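(* Let $a_1,a_0,a_{-1},b_1,b_2,c$ be real-valued $C^\infty$ functions on $\mathbb{T}^2=\mathbb{R}^2/2\pi\mathbb{Z}^2$, let $p(\xi)=\xi_1\xi_2(\xi_1+\xi_2)$ for $\xi=(\xi_1,\xi_2)\in\mathbb{R}^2$, and let $$L=\partial_t+p(\partial)+a_1(x)\partial_1^2+2a_0(x)\partial_1\partial_2+a_{-1}(x)\partial_2^2+b_1(x)\partial_1+b_2(x)\partial_2+c(x).$$ The following conditions are mutually equivalent. I. The initial value problem $Lu=f(t,x)$ in $\mathbb{R}\times\mathbb{T}^2$, $u(0,x)=u_0(x)$ in $\mathbb{T}^2$, is $L^2$-well-posed. II. For any $x\in\mathbb{T}^2$ and for any $\xi\in\Lambda$, $$\int_0^{2\pi}\Big\{a_1(x+tp'(\xi))\,\xi_1^2+2a_0(x+tp'(\xi))\,\xi_1\xi_2+a_{-1}(x+tp'(\xi))\,\xi_2^2\Big\}\,dt=0,$$ where $p'(\xi)=\nabla_\xi p(\xi)=(\xi_2(2\xi_1+\xi_2),\,\xi_1(2\xi_2+\xi_1))$ and $\Lambda=\{\xi\in\mathbb{R}^2 : p'(\xi)\in\mathbb{Z}^2\}$. III. $a_0(x)=a_1(x)+a_{-1}(x)$ on $\mathbb{T}^2$, and there exists $\phi\in C^\infty(\mathbb{T}^2)$ such that $\nabla\phi(x)=(a_{-1}(x),a_1(x))$.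
   Context: Here $\partial_t=\partial/\partial t$, $\partial_j=\partial/\partial x_j$, $\partial=\nabla=(\partial_1,\partial_2)$, and $p(\partial)=\partial_1\partial_2(\partial_1+\partial_2)$. The unknown $u(t,x)$ and the data $u_0(x)$, $f(t,x)$ are real-valued, with $(t,x)\in\mathbb{R}\times\mathbb{T}^2$. $L^2(\mathbb{T}^2)$ is the space of square-integrable functions with norm $\|g\|=\left(\int_{\mathbb{T}^2}|g(x)|^2dx\right)^{1/2}$; $C(\mathbb{R};L^2(\mathbb{T}^2))$ is the set of $L^2(\mathbb{T}^2)$-valued continuous functions on $\mathbb{R}$, and $L^1_{\mathrm{loc}}(\mathbb{R};L^2(\mathbb{T}^2))$ is the set of $L^2(\mathbb{T}^2)$-valued locally integrable functions on $\mathbb{R}$. Definition ($L^2$-well-posedness): the initial value problem $Lu=f$, $u(0,\cdot)=u_0$ is said to be $L^2$-well-posed if for any $u_0\in L^2(\mathbb{T}^2)$ and any $f\in L^1_{\mathrm{loc}}(\mathbb{R};L^2(\mathbb{T}^2))$ it possesses a unique solution $u\in C(\mathbb{R};L^2(\mathbb{T}^2))$. The equation $Lu=f$ is understood in the sense of distributions on $\mathbb{R}\times\mathbb{T}^2$. *)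

theory Defs
  imports "HOL-Analysis.Analysis"
begin

text \<open>Functions on the torus \<open>\<real>\<^sup>2 / 2\<pi>\<int>\<^sup>2\<close> are functions on the plane that are
  \<open>2\<pi>\<close>-periodic in both variables.\<close>

type_synonym plane = "real \<times> real"

definition periodic2 :: "(plane \<Rightarrow> 'b) \<Rightarrow> bool" where
  "periodic2 g \<longleftrightarrow> (\<forall>x. g (x + (2 * pi, 0)) = g x \<and> g (x + (0, 2 * pi)) = g x)"

definition dir_deriv :: "'a::euclidean_space \<Rightarrow> ('a \<Rightarrow> real) \<Rightarrow> 'a \<Rightarrow> real" where
  "dir_deriv v f = (\<lambda>x. frechet_derivative f (at x) v)"

primrec Ck :: "nat \<Rightarrow> ('a::euclidean_space \<Rightarrow> real) \<Rightarrow> bool" where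
  "Ck 0 f \<longleftrightarrow> continuous_on UNIV f"
| "Ck (Suc k) f \<longleftrightarrow> (\<forall>x. f differentiable (at x)) \<and> (\<forall>v. Ck k (dir_deriv v f))"

definition smooth :: "('a::euclidean_space \<Rightarrow> real) \<Rightarrow> bool" where
  "smooth f \<longleftrightarrow> (\<forall>k. Ck k f)"

definition smooth_torus :: "(plane \<Rightarrow> real) \<Rightarrow> bool" where
  "smooth_torus g \<longleftrightarrow> smooth g \<and> periodic2 g"

definition grad :: "(plane \<Rightarrow> real) \<Rightarrow> plane \<Rightarrow> plane" where
  "grad f x = (dir_deriv (1, 0) f x, dir_deriv (0, 1) f x)"


text \<open>Elements of \<open>L\<^sup>2\<close> of the torus are represented by functions; two representatives are the
  same element when they agree almost everywhere.\<close>

definition torus_measure :: "plane measure" where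
  "torus_measure = lebesgue_on (cbox (0, 0) (2 * pi, 2 * pi))"

definition L2 :: "(plane \<Rightarrow> real) set" where
  "L2 = {g. periodic2 g \<and> g \<in> borel_measurable torus_measure
          \<and> integrable torus_measure (\<lambda>x. (g x)\<^sup>2)}"

definition L2_eq :: "(plane \<Rightarrow> real) \<Rightarrow> (plane \<Rightarrow> real) \<Rightarrow> bool" where
  "L2_eq g h \<longleftrightarrow> (AE x in torus_measure. g x = h x)"

definition L2_norm :: "(plane \<Rightarrow> real) \<Rightarrow> real" where
  "L2_norm g = sqrt (LINT x|torus_measure. (g x)\<^sup>2)"

definition C_L2 :: "(real \<Rightarrow> plane \<Rightarrow> real) set" where
  "C_L2 = {u. (\<forall>t. u t \<in> L2) \<and>
              (\<forall>s. ((\<lambda>t. L2_norm (\<lambda>x. u t x - u s x)) \<longlongrightarrow> 0) (at s))}"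

text \<open>Strong (Bochner) measurability: almost everywhere the limit, in \<open>L\<^sup>2\<close> norm, of a sequence
  of \<open>L\<^sup>2\<close>-valued simple functions.\<close>

definition strongly_measurable_L2 :: "(real \<Rightarrow> plane \<Rightarrow> real) \<Rightarrow> bool" where
  "strongly_measurable_L2 f \<longleftrightarrow>
     (\<exists>s. (\<forall>n. simple_function lebesgue (s n) \<and> (\<forall>t. s n t \<in> L2)) \<and>
          (AE t in lebesgue. (\<lambda>n. L2_norm (\<lambda>x. s n t x - f t x)) \<longlonglongrightarrow> 0))"

definition L1loc_L2 :: "(real \<Rightarrow> plane \<Rightarrow> real) set" where
  "L1loc_L2 = {f. (\<forall>t. f t \<in> L2) \<and> strongly_measurable_L2 f \<and>
                  (\<forall>a b. set_integrable lebesgue {a..b} (\<lambda>t. L2_norm (f t)))}"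


text \<open>Distributions on \<open>\<real> \<times> \<real>\<^sup>2 / 2\<pi>\<int>\<^sup>2\<close> act on smooth functions of \<open>(t, x)\<close> that are periodic
  in \<open>x\<close> and vanish for large \<open>\<bar>t\<bar>\<close>.  The operations below are the usual ones obtained by
  transposition.\<close>

type_synonym functional = "(real \<times> plane \<Rightarrow> real) \<Rightarrow> real"

definition test_fun :: "(real \<times> plane \<Rightarrow> real) set" where
  "test_fun = {\<psi>. smooth \<psi> \<and> (\<forall>t. periodic2 (\<lambda>x. \<psi> (t, x))) \<and>
                  (\<exists>R. \<forall>t x. \<bar>t\<bar> > R \<longrightarrow> \<psi> (t, x) = 0)}"

definition dist_of :: "(real \<Rightarrow> plane \<Rightarrow> real) \<Rightarrow> functional" where
  "dist_of v \<psi> = (LINT t|lebesgue. LINT x|torus_measure. v t x * \<psi> (t, x))"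

definition dist_deriv :: "real \<times> plane \<Rightarrow> functional \<Rightarrow> functional" where
  "dist_deriv e T \<psi> = - T (dir_deriv e \<psi>)"

definition dist_mult :: "(plane \<Rightarrow> real) \<Rightarrow> functional \<Rightarrow> functional" where
  "dist_mult a T \<psi> = T (\<lambda>(t, x). a x * \<psi> (t, x))"

abbreviation "Dt \<equiv> dist_deriv (1, (0, 0))"
abbreviation "D1 \<equiv> dist_deriv (0, (1, 0))"
abbreviation "D2 \<equiv> dist_deriv (0, (0, 1))"

definition p_op :: "functional \<Rightarrow> functional" where
  "p_op T = D1 (D2 (\<lambda>\<psi>. D1 T \<psi> + D2 T \<psi>))"

text \<open>The coefficient \<open>am1\<close> is \<open>a\<^sub>-\<^sub>1\<close>.\<close>

definition L_op ::
  "(plane \<Rightarrow> real) \<Rightarrow> (plane \<Rightarrow> real) \<Rightarrow> (plane \<Rightarrow> real) \<Rightarrow> (plane \<Rightarrow> real) \<Rightarrow>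
   (plane \<Rightarrow> real) \<Rightarrow> (plane \<Rightarrow> real) \<Rightarrow> functional \<Rightarrow> functional" where
  "L_op a1 a0 am1 b1 b2 c T \<psi> =
     Dt T \<psi> + p_op T \<psi>
     + dist_mult a1 (D1 (D1 T)) \<psi>
     + 2 * dist_mult a0 (D1 (D2 T)) \<psi>
     + dist_mult am1 (D2 (D2 T)) \<psi>
     + dist_mult b1 (D1 T) \<psi>
     + dist_mult b2 (D2 T) \<psi>
     + dist_mult c T \<psi>"

definition is_solution :: "(functional \<Rightarrow> functional) \<Rightarrow>
    (real \<Rightarrow> plane \<Rightarrow> real) \<Rightarrow> (plane \<Rightarrow> real) \<Rightarrow> (real \<Rightarrow> plane \<Rightarrow> real) \<Rightarrow> bool" where
  "is_solution L f u0 u \<longleftrightarrow>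
     u \<in> C_L2 \<and> (\<forall>\<psi>\<in>test_fun. L (dist_of u) \<psi> = dist_of f \<psi>) \<and> L2_eq (u 0) u0"

definition L2_well_posed :: "(functional \<Rightarrow> functional) \<Rightarrow> bool" where
  "L2_well_posed L \<longleftrightarrow>
     (\<forall>u0\<in>L2. \<forall>f\<in>L1loc_L2.
        (\<exists>u. is_solution L f u0 u) \<and>
        (\<forall>u v. is_solution L f u0 u \<and> is_solution L f u0 v \<longrightarrow> (\<forall>t. L2_eq (u t) (v t))))"


definition p :: "plane \<Rightarrow> real" where
  "p \<xi> = fst \<xi> * snd \<xi> * (fst \<xi> + snd \<xi>)"

lemma grad_p:
  "grad p \<xi> = (snd \<xi> * (2 * fst \<xi> + snd \<xi>), fst \<xi> * (2 * snd \<xi> + fst \<xi>))"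
proof -
  have "(p has_derivative (\<lambda>h. fst h * (snd \<xi> * (2 * fst \<xi> + snd \<xi>))
           + snd h * (fst \<xi> * (2 * snd \<xi> + fst \<xi>)))) (at \<xi>)"
    unfolding p_def [abs_def]
    by (auto intro!: derivative_eq_intros simp: algebra_simps fun_eq_iff)
  then have "frechet_derivative p (at \<xi>) = (\<lambda>h. fst h * (snd \<xi> * (2 * fst \<xi> + snd \<xi>))
           + snd h * (fst \<xi> * (2 * snd \<xi> + fst \<xi>)))"
    by (rule frechet_derivative_at [symmetric])
  then show ?thesis
    by (simp add: grad_def dir_deriv_def)
qed

definition Lambda :: "plane set" where
  "Lambda = {\<xi>. fst (grad p \<xi>) \<in> \<int> \<and> snd (grad p \<xi>) \<in> \<int>}"

end

theory Submission
  imports Defs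
begin

text \<open>
  The three conditions are linked by a cycle, I to II to III to I.

  III implies I.  If \<open>\<nabla>\<phi> = (a\<^sub>-\<^sub>1, a\<^sub>1)\<close> and \<open>a\<^sub>0 = a\<^sub>1 + a\<^sub>-\<^sub>1\<close>, then conjugation with the multiplication by
  \<open>e\<^sup>\<phi>\<close> cancels the second order part of the operator, because the symbol of that part is \<open>\<nabla>\<phi> \<cdot> p'(\<xi>)\<close>, the
  first commutator of \<open>p(\<partial>)\<close> with \<open>\<phi>\<close> (\<open>gauge_adj\<close>).  What is left is \<open>p(\<partial>)\<close> plus a real vector field
  plus a function.  On Fourier coefficients this is the diagonal matrix \<open>i p(k)\<close> plus a matrix whose entries decay
  away from the diagonal and whose Hermitian part is bounded, since a real vector field is
  skew up to order zero.  Energy estimates in \<open>l\<^sup>2\<close> and in a weighted \<open>l\<^sup>2\<close> show that the flows of the finite truncations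
  converge (locale \<open>lattice_system\<close>), Duhamel's formula adds the forcing term, and an energy
  estimate with a Lipschitz frequency cutoff gives uniqueness (\<open>first_order_well_posed\<close>, \<open>gauged_well_posed\<close>).

  I implies II.  By a Baire category argument, existence and uniqueness alone force the homogeneous
  flow to be bounded on \<open>L\<^sup>2\<close> for \<open>\<bar>t\<bar> \<le> 1\<close> (\<open>hsol_bound\<close>); by duality every approximate solution of the
  transposed equation grows at most by that factor plus its accumulated residual (\<open>growth_bound\<close>).  For \<open>\<xi> \<in> \<Lambda>\<close>
  consider waves \<open>B cos (K \<cdot> x + p(K) t)\<close> with integer \<open>K\<close> close to \<open>n \<xi>\<close>, at times of size \<open>1 / n\<^sup>2\<close>.  At leading
  order the amplitude is transported with velocity \<open>p'(\<xi>)\<close> and multiplied by the exponential of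
  the integral of the second order symbol along the way, while the residual has size \<open>n\<close> and is
  integrated over a time \<open>1 / n\<^sup>2\<close>.  Hence the amplitudes are bounded uniformly in the rescaled time (\<open>wkb_bound\<close>), in
  both time directions; going \<open>N\<close> times around the closed orbit turns a
  nonzero average \<open>I\<close> into factors \<open>e\<^sup>N\<^sup>I\<close> and \<open>e\<^sup>-\<^sup>N\<^sup>I\<close>, which cannot both stay bounded (\<open>well_posed_imp_averages\<close>).

  II implies III.  Averaging along an integer velocity \<open>\<eta>\<close> keeps exactly the frequencies orthogonal to \<open>\<eta>\<close>.
  So for every frequency \<open>k\<close> and every \<open>\<xi>\<close> with \<open>p'(\<xi>) = \<plusminus>\<eta>\<close>, \<open>\<eta>\<close> orthogonal to \<open>k\<close>, the \<open>k\<close>-th coefficient of the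
  symbol at \<open>\<xi>\<close> vanishes.  The two signs give two independent linear equations
  (\<open>covector_with_velocity\<close>, \<open>averages_imp_fc\<close>), which say that \<open>a\<^sub>0 = a\<^sub>1 + a\<^sub>-\<^sub>1\<close> and that \<open>(a\<^sub>-\<^sub>1, a\<^sub>1)\<close> is
  closed with mean zero, hence a gradient (\<open>torus_potential\<close>).
\<close>

section \<open>Smooth functions on Euclidean spaces\<close>

lemma smooth_differentiable: "smooth f ==> f differentiable (at x)"
 unfolding smooth_def by (metis Ck.simps(2))

lemma smooth_dir_deriv: "smooth f ==> smooth (dir_deriv v f)"
 unfolding smooth_def by (metis Ck.simps(2))

lemma smooth_continuous: "smooth f ==> continuous_on A f"
 unfolding smooth_def by (metis Ck.simps(1) continuous_on_subset subset_UNIV)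

text \<open>\<open>smooth\<close> is a limit of finite orders, so closure properties are awkward by induction on the order: differentiating a product of \<open>C\<^sup>k\<close> functions yields sums of products. It is enough to exhibit a class of differentiable functions that is closed under directional derivatives.\<close>

lemma smooth_coinduct:
 assumes "f \<in> C"
  and step: "!!f. f \<in> C ==> (\<forall>x. f differentiable (at x)) \<and> (\<forall>v. dir_deriv v f \<in> C)"
 shows "smooth f"
proof -
 have "\<forall>f\<in>C. Ck k f" for k
 proof (induction k)
  case 0
  show ?case
   using step by (auto intro!: continuous_at_imp_continuous_on differentiable_imp_continuous_within)
 next
  case (Suc k)
  then show ?case using step by auto
 qed
 then show ?thesis using assms(1) unfolding smooth_def by blast
qed

lemma smooth_has_derivative:
 "smooth f ==> (f has_derivative (\<lambda>v. dir_deriv v f x)) (at x)"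
 unfolding dir_deriv_def using smooth_differentiable frechet_derivative_works by blast

lemma dir_deriv_eqI: "(f has_derivative f') (at x) ==> dir_deriv v f x = f' v"
 unfolding dir_deriv_def by (metis frechet_derivative_at)

lemma dir_deriv_eqI':
 "(!!x. (f has_derivative f' x) (at x)) ==> dir_deriv v f = (\<lambda>x. f' x v)"
 by (rule ext) (rule dir_deriv_eqI)

lemma smoothI_deriv:
 assumes "!!x. (f has_derivative (\<lambda>v. f' v x)) (at x)" "!!v. smooth (f' v)"
 shows "smooth f"
proof (rule smooth_coinduct[where C="{f. \<exists>f'. (\<forall>x. (f has_derivative (\<lambda>v. f' v x)) (at x)) \<and> (\<forall>v. smooth (f' v))}"])
 show "f \<in> {f. \<exists>f'. (\<forall>x. (f has_derivative (\<lambda>v. f' v x)) (at x)) \<and> (\<forall>v. smooth (f' v))}"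
  using assms by blast
next
 fix f :: "'a => real"
 assume "f \<in> {f. \<exists>f'. (\<forall>x. (f has_derivative (\<lambda>v. f' v x)) (at x)) \<and> (\<forall>v. smooth (f' v))}"
 then obtain f' where f': "!!x. (f has_derivative (\<lambda>v. f' v x)) (at x)" "!!v. smooth (f' v)" by blast
 have "dir_deriv v f = f' v" for v
  using dir_deriv_eqI'[OF f'(1)] by auto
 moreover have "(f' v has_derivative (\<lambda>w. dir_deriv w (f' v) x)) (at x)" for v x
  by (rule smooth_has_derivative[OF f'(2)])
 ultimately show "(\<forall>x. f differentiable (at x)) \<and> (\<forall>v. dir_deriv v f \<in> {f. \<exists>f'. (\<forall>x. (f has_derivative (\<lambda>v. f' v x)) (at x)) \<and> (\<forall>v. smooth (f' v))})"
  using f' smooth_dir_deriv[OF f'(2)] unfolding differentiable_def by fastforce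
qed

lemma dir_deriv_const [simp]: "dir_deriv v (\<lambda>x. c) = (\<lambda>x. 0)"
 by (rule dir_deriv_eqI') (rule has_derivative_const)

lemma smooth_const [simp, intro]: "smooth (\<lambda>x. c)"
 by (rule smooth_coinduct[where C="range (\<lambda>c x. c)"]) auto

lemma dir_deriv_add:
 assumes "smooth f" "smooth g"
 shows "dir_deriv v (\<lambda>x. f x + g x) = (\<lambda>x. dir_deriv v f x + dir_deriv v g x)"
 by (rule dir_deriv_eqI'[where f'="\<lambda>x v. dir_deriv v f x + dir_deriv v g x"])
   (intro derivative_intros smooth_has_derivative assms)

lemma smooth_add [intro]:
 assumes "smooth f" "smooth g" shows "smooth (\<lambda>x. f x + g x)"
proof (rule smooth_coinduct[where C="{\<lambda>x. f x + g x | f g. smooth f \<and> smooth g}"])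
 fix h :: "'a => real" assume "h \<in> {\<lambda>x. f x + g x | f g. smooth f \<and> smooth g}"
 then obtain f g where h: "h = (\<lambda>x. f x + g x)" "smooth f" "smooth g" by blast
 show "(\<forall>x. h differentiable (at x)) \<and> (\<forall>v. dir_deriv v h \<in> {\<lambda>x. f x + g x | f g. smooth f \<and> smooth g})"
  unfolding h(1) dir_deriv_add[OF h(2,3)]
  using h smooth_differentiable smooth_dir_deriv by (auto intro!: differentiable_add) blast
qed (use assms in blast)

lemma dir_deriv_mult:
 assumes "smooth f" "smooth g"
 shows "dir_deriv v (\<lambda>x. f x * g x) = (\<lambda>x. f x * dir_deriv v g x + dir_deriv v f x * g x)"
 by (rule dir_deriv_eqI'[where f'="\<lambda>x v. f x * dir_deriv v g x + dir_deriv v f x * g x"])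
   (intro derivative_intros smooth_has_derivative assms)

text \<open>Derivatives of a product are sums of products; this closure is the invariant class used for the product rule.\<close>

inductive_set sum_prod :: "('a::euclidean_space => real) set" where
 prod: "smooth f ==> smooth g ==> (\<lambda>x. f x * g x) \<in> sum_prod"
| add: "f \<in> sum_prod ==> g \<in> sum_prod ==> (\<lambda>x. f x + g x) \<in> sum_prod"

lemma smooth_mult [intro]:
 assumes "smooth f" "smooth g" shows "smooth (\<lambda>x. f x * g x)"
proof (rule smooth_coinduct[where C=sum_prod])
 show "(\<lambda>x. f x * g x) \<in> sum_prod" using assms by (rule sum_prod.prod)
 fix h :: "'a => real" assume "h \<in> sum_prod"
 then show "(\<forall>x. h differentiable (at x)) \<and> (\<forall>v. dir_deriv v h \<in> sum_prod)"
 proof induction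
  case (prod f g)
  then show ?case
   by (auto simp: dir_deriv_mult smooth_differentiable smooth_dir_deriv
     intro!: differentiable_mult sum_prod.intros)
 next
  case (add f g)
  have "dir_deriv v (\<lambda>x. f x + g x) = (\<lambda>x. dir_deriv v f x + dir_deriv v g x)" for v
   apply (rule dir_deriv_eqI'[where f'="\<lambda>x v. dir_deriv v f x + dir_deriv v g x"])
   using add.IH unfolding dir_deriv_def frechet_derivative_works
   by (intro derivative_intros) auto
  then show ?case using add by (auto intro!: sum_prod.add differentiable_add)
 qed
qed

lemma smooth_cmult [intro]: "smooth f ==> smooth (\<lambda>x. c * f x)"
 by (rule smooth_mult) auto

lemma dir_deriv_cmult: "smooth f ==> dir_deriv v (\<lambda>x. c * f x) = (\<lambda>x. c * dir_deriv v f x)"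
 by (subst dir_deriv_mult) auto

lemma smooth_minus [intro]: "smooth f ==> smooth (\<lambda>x. - f x)"
 using smooth_cmult[of f "-1"] by simp

lemma smooth_diff [intro]: "smooth f ==> smooth g ==> smooth (\<lambda>x. f x - g x)"
 using smooth_add[of f "\<lambda>x. - g x"] by auto

lemma dir_deriv_minus: "smooth f ==> dir_deriv v (\<lambda>x. - f x) = (\<lambda>x. - dir_deriv v f x)"
 using dir_deriv_cmult[of f v "-1"] by simp

lemma dir_deriv_diff: "smooth f ==> smooth g ==>
 dir_deriv v (\<lambda>x. f x - g x) = (\<lambda>x. dir_deriv v f x - dir_deriv v g x)"
 using dir_deriv_add[of f "\<lambda>x. - g x"] by (auto simp: dir_deriv_minus)

lemma dir_deriv_affine:
 assumes "smooth f" "bounded_linear A"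
 shows "dir_deriv v (\<lambda>x. f (A x + c)) = (\<lambda>x. dir_deriv (A v) f (A x + c))"
proof (rule dir_deriv_eqI'[where f'="\<lambda>x v. dir_deriv (A v) f (A x + c)"])
 fix x
 have "((\<lambda>x. A x + c) has_derivative (\<lambda>v. A v)) (at x)"
  by (auto intro!: derivative_eq_intros bounded_linear_imp_has_derivative assms)
 from has_derivative_compose[OF this smooth_has_derivative[OF assms(1)]]
 show "((\<lambda>x. f (A x + c)) has_derivative (\<lambda>v. dir_deriv (A v) f (A x + c))) (at x)" .
qed

lemma smooth_affine:
 assumes "smooth f" "bounded_linear A"
 shows "smooth (\<lambda>x. f (A x + c))"
proof (rule smooth_coinduct[where C="{\<lambda>x. f (A x + c) | f. smooth f}"])
 fix h assume "h \<in> {\<lambda>x. f (A x + c) | f. smooth f}"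
 then obtain f where h: "h = (\<lambda>x. f (A x + c))" "smooth f" by blast
 have "h differentiable (at x)" for x
 proof -
  have "((\<lambda>x. A x + c) has_derivative (\<lambda>v. A v)) (at x)"
   by (auto intro!: derivative_eq_intros bounded_linear_imp_has_derivative assms)
  from has_derivative_compose[OF this smooth_has_derivative[OF h(2)]]
  show ?thesis unfolding h differentiable_def by blast
 qed
 then show "(\<forall>x. h differentiable (at x)) \<and> (\<forall>v. dir_deriv v h \<in> {\<lambda>x. f (A x + c) | f. smooth f})"
  using dir_deriv_affine[OF h(2) assms(2)] smooth_dir_deriv[OF h(2)] h by blast
qed (use assms in blast)

text \<open>The class of sums of products \<open>h \<cdot> (g \<circ> f)\<close> is closed under derivatives by the chain rule.\<close>

inductive_set comp_class :: "('a::euclidean_space => real) => ('a => real) set" for f where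
 base: "smooth g ==> smooth h ==> (\<lambda>x. g (f x) * h x) \<in> comp_class f"
| add: "a \<in> comp_class f ==> b \<in> comp_class f ==> (\<lambda>x. a x + b x) \<in> comp_class f"

lemma dir_deriv_real: "smooth g ==> dir_deriv v g x = v * dir_deriv 1 g x" for v x :: real
 using linear_cmul[OF has_derivative_linear[OF smooth_has_derivative[of g x]], of v 1] by simp

lemma has_derivative_smooth_comp:
 assumes "smooth g" "smooth f"
 shows "((\<lambda>x. g (f x)) has_derivative (\<lambda>v. dir_deriv 1 g (f x) * dir_deriv v f x)) (at x)"
 using has_derivative_compose[OF smooth_has_derivative[OF assms(2), of x] smooth_has_derivative[OF assms(1), of "f x"]]
 by (subst (asm) dir_deriv_real[OF assms(1)]) (simp add: mult.commute)

lemma dir_deriv_comp: assumes "smooth g" "smooth f"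
 shows "dir_deriv v (\<lambda>x. g (f x)) = (\<lambda>x. dir_deriv 1 g (f x) * dir_deriv v f x)"
 by (rule dir_deriv_eqI') (rule has_derivative_smooth_comp[OF assms])

lemma smooth_comp:
 assumes "smooth g" "smooth f"
 shows "smooth (\<lambda>x. g (f x))"
proof (rule smooth_coinduct[where C="comp_class f"])
 show "(\<lambda>x. g (f x)) \<in> comp_class f"
  using comp_class.base[OF assms(1) smooth_const[of 1], of f] by simp
 fix k assume "k \<in> comp_class f"
 then show "(\<forall>x. k differentiable (at x)) \<and> (\<forall>v. dir_deriv v k \<in> comp_class f)"
 proof induction
  case (base g h)
  have d: "((\<lambda>x. g (f x) * h x) has_derivative
    (\<lambda>v. g (f x) * dir_deriv v h x + dir_deriv 1 g (f x) * dir_deriv v f x * h x)) (at x)" for x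
   by (intro has_derivative_mult has_derivative_smooth_comp smooth_has_derivative base assms)
  have "dir_deriv v (\<lambda>x. g (f x) * h x)
    = (\<lambda>x. g (f x) * dir_deriv v h x + dir_deriv 1 g (f x) * (dir_deriv v f x * h x))" for v
   using dir_deriv_eqI'[OF d] by (auto simp: mult.assoc)
  then show ?case using d base assms unfolding differentiable_def
   by (auto intro!: comp_class.intros smooth_dir_deriv smooth_mult)
 next
  case (add f' g)
  have "dir_deriv v (\<lambda>x. f' x + g x) = (\<lambda>x. dir_deriv v f' x + dir_deriv v g x)" for v
   apply (rule dir_deriv_eqI'[where f'="\<lambda>x v. dir_deriv v f' x + dir_deriv v g x"])
   using add.IH unfolding dir_deriv_def frechet_derivative_works
   by (intro derivative_intros) auto
  then show ?case using add by (auto intro!: comp_class.add differentiable_add)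
 qed
qed

lemma smooth_real_has_real_derivative:
 assumes "smooth g" shows "(g has_real_derivative dir_deriv 1 g s) (at s)"
proof -
 have "(\<lambda>v. dir_deriv v g s) = (*) (dir_deriv 1 g s)"
  by (rule ext) (subst dir_deriv_real[OF assms], rule mult.commute)
 then show ?thesis
  using smooth_has_derivative[OF assms, of s] by (simp add: has_field_derivative_def)
qed

lemma dir_deriv_real_eqI: "(!!x. (f has_real_derivative f' x) (at x)) ==> dir_deriv v f = (\<lambda>x. v * f' x)"
 by (rule dir_deriv_eqI'[where f'="\<lambda>x v. v * f' x", simplified])
   (auto simp: has_field_derivative_def mult.commute[of _ "f' _"])

lemma smooth_real_derivI:
 assumes "!!x. (f has_real_derivative f' x) (at x)" "smooth f'"
 shows "smooth f"
 by (rule smoothI_deriv[where f'="\<lambda>v x. v * f' x"])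
   (use assms in \<open>auto simp: has_field_derivative_def mult.commute[of _ "f' _"]\<close>)

lemma smooth_id_real [simp, intro]: "smooth (\<lambda>x::real. x)"
 by (rule smooth_real_derivI[where f'="\<lambda>x. 1"]) (auto intro!: derivative_eq_intros)

lemma smooth_exp_real [simp, intro]: "smooth (exp :: real => real)"
proof (rule smooth_coinduct[where C="range (\<lambda>c x. c * exp x :: real)"])
 fix f :: "real => real" assume "f \<in> range (\<lambda>c x. c * exp x)"
 then obtain c where f: "f = (\<lambda>x. c * exp x)" by blast
 have d: "(f has_real_derivative c * exp x) (at x)" for x
  unfolding f by (auto intro!: derivative_eq_intros)
 from dir_deriv_real_eqI[OF this] show "(\<forall>x. f differentiable at x) \<and> (\<forall>v. dir_deriv v f \<in> range (\<lambda>c x. c * exp x :: real))"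
  using d by (auto simp: has_field_derivative_def differentiable_def simp flip: mult.assoc)
qed (auto intro: image_eqI[where x=1])

lemma smooth_cos_sin: "smooth (\<lambda>x::real. a * cos x + b * sin x)"
proof (rule smooth_coinduct[where C="range (\<lambda>(a,b) x. a * cos x + b * sin x :: real)"])
 fix f :: "real => real" assume "f \<in> range (\<lambda>(a,b) x. a * cos x + b * sin x)"
 then obtain a b where f: "f = (\<lambda>x. a * cos x + b * sin x)" by auto
 have d: "(f has_real_derivative b * cos x - a * sin x) (at x)" for x
  unfolding f by (auto intro!: derivative_eq_intros)
 have "dir_deriv v f = (\<lambda>(a,b) x. a * cos x + b * sin x) (v * b, - v * a)" for v
  using dir_deriv_real_eqI[OF d] by (auto simp: algebra_simps)
 then show "(\<forall>x. f differentiable at x) \<and> (\<forall>v. dir_deriv v f \<in> range (\<lambda>(a,b) x. a * cos x + b * sin x :: real))"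
  using d unfolding has_field_derivative_def differentiable_def by blast
qed auto

lemma smooth_cos [simp, intro]: "smooth (cos :: real => real)"
 using smooth_cos_sin[of 1 0] by simp

lemma smooth_sin [simp, intro]: "smooth (sin :: real => real)"
 using smooth_cos_sin[of 0 1] by simp

lemma dir_deriv_exp [simp]: "dir_deriv v (exp :: real => real) = (\<lambda>x. v * exp x)"
 by (rule dir_deriv_real_eqI) (auto intro!: derivative_eq_intros)

lemma dir_deriv_cos [simp]: "dir_deriv v (cos :: real => real) = (\<lambda>x. v * - sin x)"
 by (rule dir_deriv_real_eqI) (auto intro!: derivative_eq_intros)

lemma dir_deriv_sin [simp]: "dir_deriv v (sin :: real => real) = (\<lambda>x. v * cos x)"
 by (rule dir_deriv_real_eqI) (auto intro!: derivative_eq_intros)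

lemma smooth_linear [intro]: assumes "bounded_linear A" shows "smooth (\<lambda>x. A x + c :: real)"
 using smooth_affine[OF smooth_id_real assms, of c] by simp

lemma dir_deriv_linear: assumes "bounded_linear A"
 shows "dir_deriv v (\<lambda>x. A x + c :: real) = (\<lambda>x. A v)"
 using dir_deriv_affine[OF smooth_id_real assms, of v c]
 by (simp add: dir_deriv_real_eqI[where f'="\<lambda>x. 1"])

subsection \<open>Bump functions\<close>

text \<open>The functions \<open>x\<^sup>-\<^sup>n e\<^sup>-\<^sup>1\<^sup>/\<^sup>x\<close>, extended by zero to \<open>x \<le> 0\<close>: the derivatives of the standard flat function are combinations of them.\<close>

definition flat :: "nat => real => real" where
 "flat n x = (if x <= 0 then 0 else exp (- inverse x) * inverse x ^ n)"

lemma flat_tendsto: "((\<lambda>x. flat n x) \<longlongrightarrow> 0) (at 0)"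
proof -
 have "((\<lambda>y. y ^ n / exp y) \<longlongrightarrow> (0::real)) at_top" by (rule tendsto_power_div_exp_0)
 then have "((\<lambda>x. inverse x ^ n / exp (inverse x)) \<longlongrightarrow> (0::real)) (at_right 0)"
  by (rule filterlim_compose) (rule filterlim_inverse_at_top_right)
 then have "(flat n \<longlongrightarrow> 0) (at_right 0)"
  by (rule Lim_transform_eventually) (auto simp: eventually_at_filter flat_def exp_minus field_simps)
 moreover have "(flat n \<longlongrightarrow> 0) (at_left 0)"
  by (rule tendsto_eventually) (auto simp: eventually_at_filter flat_def)
 ultimately show ?thesis by (simp add: filterlim_at_split)
qed

lemma flat_deriv:
 "(flat n has_real_derivative flat (n + 2) x - real n * flat (n + 1) x) (at x)"
proof (cases x "0::real" rule: linorder_cases)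
 case less
 have "((\<lambda>x. 0) has_real_derivative 0) (at x)" by simp
 then have "(flat n has_real_derivative 0) (at x)"
  by (rule has_field_derivative_transform_within_open[where S="{..<0}"]) (use less in \<open>auto simp: flat_def\<close>)
 then show ?thesis using less by (simp add: flat_def)
next
 case equal
 have "(\<lambda>h. (flat n (0 + h) - flat n 0) / h) = (\<lambda>h. flat (n+1) h)"
  by (auto simp: flat_def fun_eq_iff field_simps)
 then have "(flat n has_real_derivative 0) (at 0)"
  unfolding DERIV_def using flat_tendsto[of "n+1"] by simp
 then show ?thesis using equal by (simp add: flat_def)
next
 case greater
 have "((\<lambda>x. exp (- inverse x) * inverse x ^ n) has_real_derivative
   exp (- inverse x) * inverse x ^ (n+2) - n * (exp (- inverse x) * inverse x ^ (n+1))) (at x)"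
  apply (cases n)
  subgoal using greater by (auto intro!: derivative_eq_intros simp: field_simps power2_eq_square)
  subgoal for m
   apply (rule DERIV_cong)
    apply (use greater in \<open>(auto intro!: derivative_eq_intros)\<close>)[1]
   using greater by (cases m) (auto simp: field_simps power2_eq_square)
  done
 then have "(flat n has_real_derivative
   exp (- inverse x) * inverse x ^ (n+2) - n * (exp (- inverse x) * inverse x ^ (n+1))) (at x)"
  by (rule has_field_derivative_transform_within_open[where S="{0<..}"]) (use greater in \<open>auto simp: flat_def\<close>)
 then show ?thesis using greater by (simp add: flat_def)
qed

inductive_set flat_span :: "(real => real) set" where
 base: "(\<lambda>x. c * flat n x) \<in> flat_span"
| add: "f \<in> flat_span ==> g \<in> flat_span ==> (\<lambda>x. f x + g x) \<in> flat_span"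

lemma smooth_flat: "smooth (flat n)"
proof (rule smooth_coinduct[where C=flat_span])
 show "flat n \<in> flat_span" using flat_span.base[of 1 n] by simp
 fix f assume "f \<in> flat_span"
 then have "\<exists>f'. (\<forall>x. (f has_real_derivative f' x) (at x)) \<and> (\<forall>v. (\<lambda>x. v * f' x) \<in> flat_span)"
 proof induction
  case (base c n)
  have "((\<lambda>x. c * flat n x) has_real_derivative c * (flat (n + 2) x - real n * flat (n + 1) x)) (at x)" for x
   by (rule DERIV_cmult) (rule flat_deriv)
  moreover have "(\<lambda>x. v * (c * (flat (n + 2) x - real n * flat (n + 1) x))) \<in> flat_span" for v
   using flat_span.add[OF flat_span.base[of "v * c" "n+2"] flat_span.base[of "- v * c * n" "n+1"]]
   by (simp add: algebra_simps)
  ultimately show ?case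
   by (intro exI[of _ "\<lambda>x. c * (flat (n + 2) x - real n * flat (n + 1) x)"]) simp
 next
  case (add f g)
  then obtain f' g' where "\<forall>x. (f has_real_derivative f' x) (at x)" "\<forall>v. (\<lambda>x. v * f' x) \<in> flat_span"
   "\<forall>x. (g has_real_derivative g' x) (at x)" "\<forall>v. (\<lambda>x. v * g' x) \<in> flat_span" by blast
  then have "(\<forall>x. ((\<lambda>x. f x + g x) has_real_derivative (f' x + g' x)) (at x)) \<and> (\<forall>v. (\<lambda>x. v * (f' x + g' x)) \<in> flat_span)"
   by (auto intro: DERIV_add flat_span.add simp: distrib_left)
  then show ?case by (intro exI[of _ "\<lambda>x. f' x + g' x"])
 qed
 then obtain f' where f': "!!x. (f has_real_derivative f' x) (at x)" "!!v. (\<lambda>x. v * f' x) \<in> flat_span" by blast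
 then show "(\<forall>x. f differentiable at x) \<and> (\<forall>v. dir_deriv v f \<in> flat_span)"
  using dir_deriv_real_eqI[OF f'(1)] by (auto simp: has_field_derivative_def differentiable_def)
qed

definition bump :: "real => real" where
 "bump x = flat 0 (1 + x) * flat 0 (1 - x)"

lemma smooth_bump: "smooth bump"
proof -
 have "smooth (\<lambda>x. flat 0 (x + 1))"
  by (rule smooth_affine[OF smooth_flat, where A="\<lambda>x. x"]) (rule bounded_linear_ident)
 moreover have "smooth (\<lambda>x. flat 0 (- x + 1))"
  by (rule smooth_affine[OF smooth_flat, where A="\<lambda>x. - x"]) (intro bounded_linear_minus bounded_linear_ident)
 ultimately have "smooth (\<lambda>x. flat 0 (x + 1) * flat 0 (- x + 1))" by (rule smooth_mult)
 moreover have "bump = (\<lambda>x. flat 0 (x + 1) * flat 0 (- x + 1))"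
  by (simp add: bump_def fun_eq_iff add.commute)
 ultimately show ?thesis by (simp only:)
qed

lemma bump_nonneg: "bump x >= 0"
 by (simp add: bump_def flat_def)

lemma bump_0: "bump 0 > 0"
 by (simp add: bump_def flat_def)

lemma bump_zero: "\<bar>x\<bar> >= 1 ==> bump x = 0"
 by (auto simp: bump_def flat_def abs_if split: if_splits)

lemma smooth_scaled_bump: "smooth (\<lambda>s. bump ((s - a) / e))"
proof -
 have "smooth (\<lambda>s. bump (inverse e * s + - a / e))"
  by (rule smooth_affine[OF smooth_bump]) (auto intro!: bounded_linear_intros)
 then show ?thesis by (simp add: divide_inverse algebra_simps)
qed

subsection \<open>The lemma of du Bois-Reymond\<close>

definition test1 :: "(real => real) set" where
 "test1 = {\<theta>. smooth \<theta> \<and> (\<exists>R. \<forall>t. \<bar>t\<bar> > R --> \<theta> t = 0)}"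

lemma LINT_compact_support:
 fixes f :: "real => real"
 assumes "continuous_on UNIV f" "!!s. s \<notin> {a..b} ==> f s = 0"
 shows "integrable lebesgue f" "(LINT s|lebesgue. f s) = integral {a..b} f"
proof -
 have "f absolutely_integrable_on {a..b}"
  using assms(1) by (intro absolutely_integrable_continuous_real) (auto intro: continuous_on_subset)
 moreover have eq: "(\<lambda>x. indicator {a..b} x *\<^sub>R f x) = f"
  using assms(2) by (auto simp: indicator_def fun_eq_iff)
 ultimately show "integrable lebesgue f" by (simp add: set_integrable_def)
 show "(LINT s|lebesgue. f s) = integral {a..b} f"
  using set_lebesgue_integral_eq_integral(2)[OF \<open>f absolutely_integrable_on {a..b}\<close>]
  unfolding set_lebesgue_integral_def eq .
qed

lemma continuous_primitive:
 fixes g :: "real => real"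
 assumes cont0: "continuous_on UNIV g"
 obtains G where "!!t. (G has_real_derivative g t) (at t)"
  "!!t. c <= t ==> G t = integral {c..t} g" "!!t. t <= c ==> G t = - integral {t..c} g"
proof -
 have cont: "continuous_on A g" for A using cont0 by (rule continuous_on_subset) simp
 define G where "G t = (if c <= t then integral {c..t} g else - integral {t..c} g)" for t
 have comb: "G t = integral {a..t} g - integral {a..c} g" if "a <= c" "a <= t" for a t
 proof (cases "c <= t")
  case True
  then have "integral {a..c} g + integral {c..t} g = integral {a..t} g"
   by (intro Henstock_Kurzweil_Integration.integral_combine that integrable_continuous_real cont)
  then show ?thesis using True by (simp add: G_def)
 next
  case False
  then have "integral {a..t} g + integral {t..c} g = integral {a..c} g"
   by (intro Henstock_Kurzweil_Integration.integral_combine that integrable_continuous_real cont) simp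
  then show ?thesis using False by (simp add: G_def)
 qed
 have d: "(G has_real_derivative g t) (at t)" for t
 proof -
  define a b where "a = min c t - 1" and "b = t + 1"
  have "((\<lambda>u. integral {a..u} g) has_real_derivative g t) (at t within {a..b})"
   by (rule integral_has_real_derivative[OF cont]) (auto simp: a_def b_def)
  then have "((\<lambda>u. integral {a..u} g) has_real_derivative g t) (at t)"
   by (subst (asm) at_within_Icc_at) (auto simp: a_def b_def)
  then have "((\<lambda>u. integral {a..u} g - integral {a..c} g) has_real_derivative g t) (at t)"
   by (auto intro!: derivative_eq_intros)
  then show ?thesis
   by (rule has_field_derivative_transform_within_open[where S="{a<..}"])
     (auto simp: a_def intro!: comb[symmetric])
 qed
 have "G t = integral {c..t} g" if "c <= t" for t using that by (simp add: G_def)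
 moreover have "G t = - integral {t..c} g" if "t <= c" for t
  using that by (cases "t = c") (auto simp: G_def)
 ultimately show ?thesis using that d by blast
qed

lemma weakly_constant_imp_le:
 fixes Z :: "real => real"
 assumes Z: "continuous_on UNIV Z"
  and orth: "!!\<theta>. \<theta> \<in> test1 ==> (LINT s|lebesgue. dir_deriv 1 \<theta> s * Z s) = 0"
 shows "Z a <= Z b"
proof (rule ccontr)
 assume "\<not> Z a <= Z b"
 then have lt: "Z b < Z a" by simp
 define d where "d = (Z a - Z b) / 3"
 have "d > 0" using lt by (simp add: d_def)
 obtain e1 where e1: "e1 > 0" "!!s. \<bar>s - a\<bar> < e1 ==> \<bar>Z s - Z a\<bar> < d"
  using Z \<open>d > 0\<close> unfolding continuous_on_iff dist_real_def by (metis UNIV_I)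
 obtain e2 where e2: "e2 > 0" "!!s. \<bar>s - b\<bar> < e2 ==> \<bar>Z s - Z b\<bar> < d"
  using Z \<open>d > 0\<close> unfolding continuous_on_iff dist_real_def by (metis UNIV_I)
 define e where "e = min e1 e2"
 have "e > 0" using e1 e2 by (simp add: e_def)
 define \<eta> where "\<eta> c s = bump ((s - c) / e)" for c s
 have sm: "smooth (\<eta> c)" for c unfolding \<eta>_def by (rule smooth_scaled_bump)
 have co: "continuous_on A (\<eta> c)" for A c by (rule smooth_continuous[OF sm])
 have out: "\<eta> c s = 0" if "\<bar>s - c\<bar> >= e" for c s
  unfolding \<eta>_def using that \<open>e > 0\<close> by (intro bump_zero) (simp add: abs_divide)
 have nn: "\<eta> c s >= 0" for c s by (simp add: \<eta>_def bump_nonneg)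
 have int: "integrable lebesgue (\<lambda>s. \<eta> c s * f s)" if "continuous_on UNIV f" for c f
  by (rule LINT_compact_support[of _ "c - e" "c + e"])
    (use that co out in \<open>auto intro!: continuous_intros simp: abs_le_iff not_le\<close>)
 define M where "M = (LINT s|lebesgue. \<eta> 0 s)"
 have M: "(LINT s|lebesgue. \<eta> c s) = M" for c
 proof -
  have "(LINT s|lebesgue. \<eta> c s) = (LINT s|lborel. \<eta> c s)"
   using co[of UNIV c] by (intro integral_completion) (auto intro: borel_measurable_continuous_onI)
  also have "\<dots> = \<bar>1\<bar> *\<^sub>R (LINT s|lborel. \<eta> c (c + 1 * s))"
   by (rule lborel_integral_real_affine) simp
  also have "\<dots> = (LINT s|lborel. \<eta> 0 s)" by (simp add: \<eta>_def)
  also have "\<dots> = M" unfolding M_def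
   using co[of UNIV 0] by (intro integral_completion[symmetric]) (auto intro: borel_measurable_continuous_onI)
  finally show ?thesis .
 qed
 have "M > 0"
 proof -
  have "M = integral {-e..e} (\<eta> 0)" unfolding M_def
   by (rule LINT_compact_support) (use co out in \<open>auto simp: abs_le_iff not_le\<close>)
  moreover have "integral {-e..e} (\<eta> 0) ~= 0"
  proof
   assume "integral {-e..e} (\<eta> 0) = 0"
   then have "(\<eta> 0 has_integral 0) (cbox (-e) e)"
    using integrable_integral[OF integrable_continuous_real[OF co[of "{-e..e}" 0]]] by simp
   then have "\<eta> 0 0 = 0"
    by (rule has_integral_0_cbox_imp_0[OF co nn]) (use \<open>e > 0\<close> in auto)
   then show False using bump_0 by (simp add: \<eta>_def)
  qed
  moreover have "integral {-e..e} (\<eta> 0) >= 0"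
   by (intro integral_nonneg integrable_continuous_real co nn)
  ultimately show ?thesis by simp
 qed
 \<comment> \<open>the antiderivative of the difference of two bumps is a test function\<close>
 have key: "(LINT s|lebesgue. \<eta> a s * Z s) = (LINT s|lebesgue. \<eta> b s * Z s)"
 proof -
  define c where "c = min a b - e"
  have smd: "smooth (\<lambda>s. \<eta> a s - \<eta> b s)" using sm by auto
  obtain G where G: "!!t. (G has_real_derivative \<eta> a t - \<eta> b t) (at t)"
   "!!t. c <= t ==> G t = integral {c..t} (\<lambda>s. \<eta> a s - \<eta> b s)"
   "!!t. t <= c ==> G t = - integral {t..c} (\<lambda>s. \<eta> a s - \<eta> b s)"
   using continuous_primitive[OF smooth_continuous[OF smd], of c] by blast
  have "G t = 0" if "t <= c" for t
  proof -
   have "integral {t..c} (\<lambda>s. \<eta> a s - \<eta> b s) = integral {t..c} (\<lambda>s. 0)"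
    by (rule integral_cong) (auto simp: c_def out)
   then show ?thesis using G(3)[OF that] by simp
  qed
  moreover have "G t = 0" if "t >= max a b + e" for t
  proof -
   have ct: "c <= t" using that \<open>e > 0\<close> by (auto simp: c_def)
   have "G t = integral {c..t} (\<lambda>s. \<eta> a s - \<eta> b s)" by (rule G(2)[OF ct])
   also have "\<dots> = (LINT s|lebesgue. \<eta> a s - \<eta> b s)"
    by (rule LINT_compact_support(2)[symmetric])
      (use that co out in \<open>auto intro!: continuous_intros simp: c_def not_le out\<close>)
   also have "\<dots> = 0"
    using int[of "\<lambda>_. 1"] by (subst Bochner_Integration.integral_diff) (auto simp: M)
   finally show ?thesis .
  qed
  ultimately have "\<bar>t\<bar> > \<bar>c\<bar> + \<bar>max a b + e\<bar> --> G t = 0" for t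
   by (cases "t <= c") auto
  then have "G \<in> test1" using smooth_real_derivI[OF G(1) smd] unfolding test1_def by blast
  from orth[OF this] have "(LINT s|lebesgue. (\<eta> a s - \<eta> b s) * Z s) = 0"
   using dir_deriv_real_eqI[OF G(1)] by simp
  moreover have "(LINT s|lebesgue. (\<eta> a s - \<eta> b s) * Z s)
    = (LINT s|lebesgue. \<eta> a s * Z s) - (LINT s|lebesgue. \<eta> b s * Z s)"
   unfolding left_diff_distrib by (rule Bochner_Integration.integral_diff) (intro int Z)+
  ultimately show ?thesis by simp
 qed
 have "(LINT s|lebesgue. \<eta> a s * Z s) >= (LINT s|lebesgue. \<eta> a s * (Z a - d))"
 proof (rule integral_mono)
  show "\<eta> a s * (Z a - d) <= \<eta> a s * Z s" for s
  proof (cases "\<bar>s - a\<bar> < e")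
   case True
   then have "Z a - d <= Z s" using e1(2)[of s] by (auto simp: e_def abs_if split: if_splits)
   then show ?thesis using nn by (intro mult_left_mono)
  next
   case False then show ?thesis using out[of s a] by simp
  qed
 qed (intro int Z continuous_intros)+
 moreover have "(LINT s|lebesgue. \<eta> b s * Z s) <= (LINT s|lebesgue. \<eta> b s * (Z b + d))"
 proof (rule integral_mono)
  show "\<eta> b s * Z s <= \<eta> b s * (Z b + d)" for s
  proof (cases "\<bar>s - b\<bar> < e")
   case True
   then have "Z s <= Z b + d" using e2(2)[of s] by (auto simp: e_def abs_if split: if_splits)
   then show ?thesis using nn by (intro mult_left_mono)
  next
   case False then show ?thesis using out[of s b] by simp
  qed
 qed (intro int Z continuous_intros)+
 ultimately have "M * (Z a - d) <= M * (Z b + d)" using key by (simp add: M)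
 then have "Z a - d <= Z b + d" using \<open>M > 0\<close> by simp
 then show False using \<open>d > 0\<close> by (simp add: d_def field_simps)
qed

text \<open>Subtracting a primitive of \<open>h\<close>, one has to see that a continuous function with zero distributional derivative is constant. Testing it against the primitive of the difference of two translated, concentrated bumps compares its values at two points.\<close>

lemma du_Bois_Reymond:
 fixes z h :: "real => real"
 assumes z: "continuous_on UNIV z" and h: "continuous_on UNIV h"
  and weak: "!!\<theta>. \<theta> \<in> test1 ==> (LINT s|lebesgue. dir_deriv 1 \<theta> s * z s) = - (LINT s|lebesgue. \<theta> s * h s)"
 shows "(z has_real_derivative h t) (at t)"
proof -
 obtain H where dH: "!!t. (H has_real_derivative h t) (at t)"
  using continuous_primitive[OF h, of 0] by metis
 have cH: "continuous_on UNIV H"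
  using dH DERIV_isCont by (intro continuous_at_imp_continuous_on ballI) blast
 have orth: "(LINT s|lebesgue. dir_deriv 1 \<theta> s * (z s - H s)) = 0" if \<theta>: "\<theta> \<in> test1" for \<theta>
 proof -
  obtain R0 where sm: "smooth \<theta>" and R0: "!!t. \<bar>t\<bar> > R0 ==> \<theta> t = 0" using \<theta> unfolding test1_def by blast
  define R where "R = \<bar>R0\<bar> + 1"
  have R: "\<theta> t = 0" if "\<bar>t\<bar> >= R" for t using R0[of t] that by (simp add: R_def)
  have R1: "!!t. t \<notin> {-R..R} ==> \<theta> t = 0" using R by (auto simp: abs_if)
  have d\<theta>: "(\<theta> has_real_derivative dir_deriv 1 \<theta> s) (at s)" for s
   by (rule smooth_real_has_real_derivative[OF sm])
  have d0: "dir_deriv 1 \<theta> s = 0" if "s \<notin> {-R..R}" for s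
  proof -
   have "(\<theta> has_real_derivative 0) (at s)"
    by (rule has_field_derivative_transform_within_open[where S="- {-R..R}" and f="\<lambda>_. 0"])
      (use that R1 in auto)
   then show ?thesis using d\<theta> DERIV_unique by blast
  qed
  have c': "continuous_on UNIV (dir_deriv 1 \<theta>)" by (intro smooth_continuous smooth_dir_deriv sm)
  have c0: "continuous_on A \<theta>" for A by (intro smooth_continuous sm)
  have int: "integrable lebesgue (\<lambda>s. dir_deriv 1 \<theta> s * f s)"
    "integrable lebesgue (\<lambda>s. \<theta> s * f s)"
    "(LINT s|lebesgue. dir_deriv 1 \<theta> s * f s) = integral {-R..R} (\<lambda>s. dir_deriv 1 \<theta> s * f s)"
    "(LINT s|lebesgue. \<theta> s * f s) = integral {-R..R} (\<lambda>s. \<theta> s * f s)"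
   if "continuous_on UNIV f" for f
   by (rule LINT_compact_support, use that c' c0 d0 R1 in \<open>auto intro!: continuous_intros\<close>)+
  have "integral {-R..R} (\<lambda>s. dir_deriv 1 \<theta> s * H s + \<theta> s * h s) = \<theta> R * H R - \<theta> (-R) * H (-R)"
   by (intro integral_unique fundamental_theorem_of_calculus)
     (auto simp: R_def simp flip: has_real_derivative_iff_has_vector_derivative
      intro!: derivative_eq_intros has_field_derivative_at_within[OF d\<theta>] has_field_derivative_at_within[OF dH])
  also have "\<dots> = 0" using R by (simp add: R_def)
  also have "integral {-R..R} (\<lambda>s. dir_deriv 1 \<theta> s * H s + \<theta> s * h s)
    = integral {-R..R} (\<lambda>s. dir_deriv 1 \<theta> s * H s) + integral {-R..R} (\<lambda>s. \<theta> s * h s)"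
   by (intro Henstock_Kurzweil_Integration.integral_add integrable_continuous_real continuous_intros
      continuous_on_subset[OF c'] continuous_on_subset[OF cH] continuous_on_subset[OF h] c0) auto
  finally have "(LINT s|lebesgue. dir_deriv 1 \<theta> s * H s) = - (LINT s|lebesgue. \<theta> s * h s)"
   by (simp add: int[OF cH] int[OF h])
  then show ?thesis unfolding right_diff_distrib
   by (subst Bochner_Integration.integral_diff[OF int(1)[OF z] int(1)[OF cH]])
     (use weak[OF \<theta>] in simp)
 qed
 have "z s - H s = z t - H t" for s
  using weakly_constant_imp_le[of "\<lambda>s. z s - H s" s t] weakly_constant_imp_le[of "\<lambda>s. z s - H s" t s] orth
  by (auto intro!: continuous_intros z cH antisym)
 then have "z = (\<lambda>s. H s + (z t - H t))" by (auto simp: fun_eq_iff) (metis diff_add_cancel add.commute)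
 moreover have "((\<lambda>s. H s + (z t - H t)) has_real_derivative h t) (at t)"
  by (auto intro!: derivative_eq_intros dH)
 ultimately show ?thesis by simp
qed

section \<open>Square summable families on the frequency lattice\<close>

type_synonym freq = "int \<times> int"

definition sqsum :: "(freq => complex) set" where
 "sqsum = {x. (\<lambda>k. (cmod (x k))^2) summable_on UNIV}"

lemma sqsumI_bound:
 assumes "!!F. finite F ==> (\<Sum>k\<in>F. (cmod (x k))^2) <= B"
 shows "x \<in> sqsum"
 unfolding sqsum_def mem_Collect_eq
 by (rule nonneg_bdd_above_summable_on) (use assms in \<open>auto intro!: bdd_aboveI2\<close>)

lemma sqsum_dom:
 assumes "x \<in> sqsum" "y \<in> sqsum" "!!k. 0 <= f k" "!!k. f k <= C * ((cmod (x k))^2 + (cmod (y k))^2)"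
 shows "f summable_on (UNIV :: freq set)"
proof (rule summable_on_comparison_test)
 show "(\<lambda>k. C * ((cmod (x k))^2 + (cmod (y k))^2)) summable_on UNIV"
  using assms(1,2) by (auto simp: sqsum_def intro!: summable_on_cmult_right summable_on_add)
qed (use assms in auto)

lemma sqsum_add: assumes "x \<in> sqsum" "y \<in> sqsum" shows "(\<lambda>k. x k + y k) \<in> sqsum"
 unfolding sqsum_def mem_Collect_eq
proof (rule sqsum_dom[OF assms, where C=2])
 fix k
 have "(cmod (x k + y k))^2 <= (cmod (x k) + cmod (y k))^2"
  by (intro power_mono norm_triangle_ineq) auto
 also have "\<dots> <= 2 * ((cmod (x k))^2 + (cmod (y k))^2)"
  using sum_squares_bound[of "cmod (x k)" "cmod (y k)"] by (simp add: power2_sum)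
 finally show "(cmod (x k + y k))^2 <= 2 * ((cmod (x k))^2 + (cmod (y k))^2)" .
qed auto

lemma sqsum_cmult: assumes "x \<in> sqsum" shows "(\<lambda>k. c * x k) \<in> sqsum"
 unfolding sqsum_def mem_Collect_eq
 by (rule sqsum_dom[OF assms assms, where C="(cmod c)^2"]) (auto simp: norm_mult power_mult_distrib intro!: mult_left_mono)

lemma sqsum_zero: "(\<lambda>k. 0) \<in> sqsum" by (simp add: sqsum_def)

text \<open>The sequence space \<open>l\<^sup>2(\<int>\<^sup>2)\<close> is made a type so that the Banach space library (bounded linear maps, Bochner integrals, uniform limits, Baire category) applies to the Fourier side; square integrable functions are identified only almost everywhere and do not form such a type.\<close>

typedef l2 = sqsum morphisms coef Abs_l2
 using sqsum_zero by blast

setup_lifting type_definition_l2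

lemma coef_sqsum [simp]: "coef x \<in> sqsum" using coef by blast

lemma l2_eqI: "(!!k. coef x k = coef y k) ==> x = y"
 using coef_inject by blast

lemma sq_summable: "(\<lambda>k. (cmod (coef x k))^2) summable_on A"
 using coef_sqsum[of x] summable_on_subset_banach[of _ UNIV A] by (auto simp: sqsum_def)

lemma cmod_mult_summable: "(\<lambda>k. cmod (coef x k) * cmod (coef y k)) summable_on UNIV"
proof (rule sqsum_dom[OF coef_sqsum coef_sqsum, where C=1])
 fix k show "cmod (coef x k) * cmod (coef y k) <= 1 * ((cmod (coef x k))^2 + (cmod (coef y k))^2)"
 proof -
  have "2 * (cmod (coef x k) * cmod (coef y k)) <= (cmod (coef x k))^2 + (cmod (coef y k))^2"
   using sum_squares_bound[of "cmod (coef x k)" "cmod (coef y k)"] by (simp only: mult.assoc)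
  moreover have "0 <= cmod (coef x k) * cmod (coef y k)" by simp
  ultimately show ?thesis unfolding mult_1 by linarith
 qed
qed auto

lemma cmod_mult_abs_summable: "(\<lambda>k. norm (coef x k * coef y k)) summable_on UNIV"
 using cmod_mult_summable by (simp add: norm_mult)

lemma inner_summable: "(\<lambda>k. coef x k \<bullet> coef y k) summable_on UNIV"
proof -
 have "(\<lambda>k. norm (coef x k \<bullet> coef y k)) summable_on UNIV"
  by (rule Infinite_Sum.abs_summable_on_comparison_test[OF cmod_mult_abs_summable[of x y]])
    (simp add: norm_mult Cauchy_Schwarz_ineq2)
 then show ?thesis by (rule abs_summable_summable)
qed

instantiation l2 :: real_vector
begin
lift_definition zero_l2 :: l2 is "\<lambda>k. 0" by (rule sqsum_zero)
lift_definition plus_l2 :: "l2 => l2 => l2" is "\<lambda>x y k. x k + y k" by (rule sqsum_add)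
lift_definition uminus_l2 :: "l2 => l2" is "\<lambda>x k. - x k" using sqsum_cmult[of _ "-1"] by simp
lift_definition minus_l2 :: "l2 => l2 => l2" is "\<lambda>x y k. x k - y k"
 using sqsum_add sqsum_cmult[of _ "-1"] by fastforce
lift_definition scaleR_l2 :: "real => l2 => l2" is "\<lambda>c x k. c *\<^sub>R x k"
 using sqsum_cmult by (simp add: scaleR_conv_of_real)
instance
 by standard (transfer; auto simp: algebra_simps)+
end

lemmas coef_simps [simp] = zero_l2.rep_eq plus_l2.rep_eq uminus_l2.rep_eq minus_l2.rep_eq scaleR_l2.rep_eq

lift_definition unit_l2 :: "freq => complex => l2" is "\<lambda>k c j. if j = k then c else 0"
proof -
 fix k :: freq and c :: complex
 show "(\<lambda>j. if j = k then c else 0) \<in> sqsum"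
  unfolding sqsum_def mem_Collect_eq
  by (rule finite_nonzero_values_imp_summable_on) (rule finite_subset[of _ "{k}"], auto)
qed

lift_definition trunc :: "freq set => l2 => l2" is "\<lambda>F x j. if j \<in> F then x j else 0"
 unfolding sqsum_def mem_Collect_eq by (rule sqsum_dom[where C=1]) (auto simp: sqsum_def)

lemmas coef_unit [simp] = unit_l2.rep_eq
lemmas coef_trunc [simp] = trunc.rep_eq

instantiation l2 :: real_inner
begin
definition inner_l2 :: "l2 => l2 => real" where
 "inner_l2 x y = (\<Sum>\<^sub>\<infinity>k. coef x k \<bullet> coef y k)"
definition norm_l2 :: "l2 => real" where "norm_l2 x = sqrt (x \<bullet> x)"
definition dist_l2 :: "l2 => l2 => real" where "dist_l2 x y = norm (x - y)"
definition sgn_l2 :: "l2 => l2" where "sgn_l2 x = x /\<^sub>R norm x"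
definition uniformity_l2 :: "(l2 \<times> l2) filter" where
 "uniformity_l2 = (INF e\<in>{0 <..}. principal {(x, y). dist x y < e})"
definition open_l2 :: "l2 set => bool" where
 "open_l2 U \<longleftrightarrow> (\<forall>x\<in>U. \<forall>\<^sub>F (x', y) in uniformity. x' = x --> y \<in> U)"
instance
proof
 fix x y z :: l2 and r :: real
 show "x \<bullet> y = y \<bullet> x" by (simp add: inner_l2_def inner_commute)
 show "(x + y) \<bullet> z = x \<bullet> z + y \<bullet> z"
  by (simp add: inner_l2_def inner_add_left infsum_add inner_summable)
 show "(r *\<^sub>R x) \<bullet> y = r * (x \<bullet> y)"
  by (simp add: inner_l2_def infsum_cmult_right inner_summable)
 show "0 <= x \<bullet> x" by (simp add: inner_l2_def infsum_nonneg)
 show "(x \<bullet> x = 0) = (x = 0)"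
 proof
  assume "x \<bullet> x = 0"
  then have "coef x k \<bullet> coef x k = 0" for k
   unfolding inner_l2_def
   by (intro nonneg_infsum_le_0D[OF _ inner_summable]) auto
  then show "x = 0" by (intro l2_eqI) auto
 qed (simp add: inner_l2_def)
qed (rule dist_l2_def sgn_l2_def uniformity_l2_def open_l2_def norm_l2_def)+
end

lemma norm_l2_sq: "(norm x)^2 = (\<Sum>\<^sub>\<infinity>k. (cmod (coef x k))^2)" for x :: l2
 by (simp add: power2_norm_eq_inner inner_l2_def)

lemma sum_sq_le_norm: "finite F ==> (\<Sum>k\<in>F. (cmod (coef x k))^2) <= (norm x)^2"
 unfolding norm_l2_sq by (rule finite_sum_le_infsum[OF sq_summable]) auto

lemma cmod_coef_le: "cmod (coef x k) <= norm x"
 using sum_sq_le_norm[of "{k}" x] by (auto intro: power2_le_imp_le)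

lemma norm_l2_le: assumes "0 <= B" "!!F. finite F ==> (\<Sum>k\<in>F. (cmod (coef x k))^2) <= B^2"
 shows "norm x <= B"
 by (rule power2_le_imp_le[OF _ assms(1)], unfold norm_l2_sq, rule infsum_le_finite_sums[OF sq_summable])
   (use assms(2) in auto)

lemma coef_bounded_linear: "bounded_linear (\<lambda>x. coef x k)"
 by (rule bounded_linear_intro[where K=1]) (auto simp: cmod_coef_le)

lemma coef_sum: "coef (\<Sum>i\<in>A. f i) k = (\<Sum>i\<in>A. coef (f i) k)"
 by (rule linear_sum[OF bounded_linear.linear[OF coef_bounded_linear]])

lemma trunc_sum: "finite F ==> trunc F x = (\<Sum>k\<in>F. unit_l2 k (coef x k))"
 by (rule l2_eqI) (auto simp: coef_sum)

lemma norm_finite_support: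
 assumes "finite F" "!!k. k \<notin> F ==> coef x k = 0"
 shows "(norm x)^2 = (\<Sum>k\<in>F. (cmod (coef x k))^2)"
proof -
 have "(\<Sum>\<^sub>\<infinity>k. (cmod (coef x k))^2) = (\<Sum>\<^sub>\<infinity>k\<in>F. (cmod (coef x k))^2)"
  by (rule infsum_cong_neutral) (use assms in auto)
 then show ?thesis using assms(1) by (simp add: norm_l2_sq)
qed

lemma inner_finite_support:
 assumes "finite F" "!!k. k \<notin> F ==> coef x k = 0"
 shows "x \<bullet> y = (\<Sum>k\<in>F. coef x k \<bullet> coef y k)"
proof -
 have "(\<Sum>\<^sub>\<infinity>k. coef x k \<bullet> coef y k) = (\<Sum>\<^sub>\<infinity>k\<in>F. coef x k \<bullet> coef y k)"
  by (rule infsum_cong_neutral) (use assms in auto)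
 then show ?thesis using assms(1) by (simp add: inner_l2_def)
qed

lemma norm_unit [simp]: "norm (unit_l2 k c) = cmod c"
 using norm_finite_support[of "{k}" "unit_l2 k c"] by simp

lemma norm_trunc_le: "norm (trunc F x) <= norm x"
proof (rule norm_l2_le)
 fix G :: "freq set" assume G: "finite G"
 have "(\<Sum>k\<in>G. (cmod (coef (trunc F x) k))^2) <= (\<Sum>k\<in>G. (cmod (coef x k))^2)"
  by (rule sum_mono) auto
 also have "\<dots> <= (norm x)^2" using G by (rule sum_sq_le_norm)
 finally show "(\<Sum>k\<in>G. (cmod (coef (trunc F x) k))^2) <= (norm x)^2" .
qed simp

lemma norm_trunc_Compl:
 assumes "finite F" shows "(norm (x - trunc F x))^2 = (norm x)^2 - (\<Sum>k\<in>F. (cmod (coef x k))^2)"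
proof -
 have "(norm (x - trunc F x))^2 = (\<Sum>\<^sub>\<infinity>k\<in>UNIV - F. (cmod (coef x k))^2)"
  unfolding norm_l2_sq by (rule infsum_cong_neutral) auto
 also have "\<dots> = (norm x)^2 - (\<Sum>\<^sub>\<infinity>k\<in>F. (cmod (coef x k))^2)"
  unfolding norm_l2_sq by (rule infsum_Diff) (auto simp: sq_summable)
 finally show ?thesis using assms by simp
qed

lemma trunc_tendsto: "((\<lambda>F. trunc F x) \<longlongrightarrow> x) (finite_subsets_at_top UNIV)"
proof -
 have "((\<lambda>F. \<Sum>k\<in>F. (cmod (coef x k))^2) \<longlongrightarrow> (norm x)^2) (finite_subsets_at_top UNIV)"
  unfolding norm_l2_sq by (rule infsum_tendsto[OF sq_summable])
 then have "((\<lambda>F. sqrt ((norm x)^2 - (\<Sum>k\<in>F. (cmod (coef x k))^2))) \<longlongrightarrow> sqrt ((norm x)^2 - (norm x)^2)) (finite_subsets_at_top UNIV)"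
  by (intro tendsto_intros)
 moreover have "\<forall>\<^sub>F F in finite_subsets_at_top UNIV. sqrt ((norm x)^2 - (\<Sum>k\<in>F. (cmod (coef x k))^2)) = norm (x - trunc F x)"
 proof (rule eventually_finite_subsets_at_top_weakI)
  fix F :: "freq set" assume "finite F"
  then show "sqrt ((norm x)^2 - (\<Sum>k\<in>F. (cmod (coef x k))^2)) = norm (x - trunc F x)"
   by (subst norm_trunc_Compl[symmetric]) auto
 qed
 ultimately have "((\<lambda>F. norm (x - trunc F x)) \<longlongrightarrow> 0) (finite_subsets_at_top UNIV)"
  using Lim_transform_eventually by fastforce
 then show ?thesis by (simp add: tendsto_iff dist_norm norm_minus_commute)
qed

instance l2 :: complete_space
proof
 fix X :: "nat => l2" assume C: "Cauchy X"
 have "Cauchy (\<lambda>n. coef (X n) k)" for k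
  by (rule bounded_linear.Cauchy[OF coef_bounded_linear C])
 then have conv: "convergent (\<lambda>n. coef (X n) k)" for k by (rule Cauchy_convergent)
 define f where "f k = lim (\<lambda>n. coef (X n) k)" for k
 have f: "(\<lambda>n. coef (X n) k) \<longlonglongrightarrow> f k" for k
  using conv[of k] unfolding f_def convergent_LIMSEQ_iff .
 have tail: "\<exists>N. \<forall>n\<ge>N. \<forall>F. finite F --> (\<Sum>k\<in>F. (cmod (f k - coef (X n) k))^2) <= e^2" if "e > 0" for e
 proof -
  obtain N where N: "!!m n. m >= N ==> n >= N ==> dist (X m) (X n) < e"
   using C \<open>e > 0\<close> unfolding Cauchy_def by blast
  have "(\<Sum>k\<in>F. (cmod (f k - coef (X n) k))^2) <= e^2" if "n >= N" "finite F" for n F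
  proof (rule tendsto_upperbound)
   show "(\<lambda>m. \<Sum>k\<in>F. (cmod (coef (X m) k - coef (X n) k))^2) \<longlonglongrightarrow> (\<Sum>k\<in>F. (cmod (f k - coef (X n) k))^2)"
    by (intro tendsto_intros f)
   show "\<forall>\<^sub>F m in sequentially. (\<Sum>k\<in>F. (cmod (coef (X m) k - coef (X n) k))^2) <= e^2"
    unfolding eventually_sequentially
   proof (intro exI allI impI)
    fix m assume "N <= m"
    have "(\<Sum>k\<in>F. (cmod (coef (X m) k - coef (X n) k))^2) <= (norm (X m - X n))^2"
     using sum_sq_le_norm[OF \<open>finite F\<close>, of "X m - X n"] by simp
    also have "\<dots> <= e^2" using N[OF \<open>N <= m\<close> \<open>n >= N\<close>] by (intro power_mono) (auto simp: dist_norm)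
    finally show "(\<Sum>k\<in>F. (cmod (coef (X m) k - coef (X n) k))^2) <= e^2" .
   qed
  qed auto
  then show ?thesis by blast
 qed
 obtain N where N: "!!F. finite F ==> (\<Sum>k\<in>F. (cmod (f k - coef (X N) k))^2) <= 1^2"
  using tail[of 1] by force
 have "(\<lambda>k. f k - coef (X N) k) \<in> sqsum" using N by (rule sqsumI_bound)
 then have "(\<lambda>k. (f k - coef (X N) k) + coef (X N) k) \<in> sqsum" by (rule sqsum_add) simp
 then have "f \<in> sqsum" by simp
 then have c: "coef (Abs_l2 f) = f" by (rule Abs_l2_inverse)
 have "X \<longlonglongrightarrow> Abs_l2 f"
 proof (rule metric_LIMSEQ_I)
  fix e :: real assume "e > 0"
  obtain N where N: "!!n F. n >= N ==> finite F ==> (\<Sum>k\<in>F. (cmod (f k - coef (X n) k))^2) <= (e/2)^2"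
   using tail[of "e/2"] \<open>e > 0\<close> by auto
  have "norm (Abs_l2 f - X n) <= e/2" if "n >= N" for n
   by (rule norm_l2_le) (use N that \<open>e > 0\<close> in \<open>auto simp: c\<close>)
  then show "\<exists>N. \<forall>n\<ge>N. dist (X n) (Abs_l2 f) < e"
   using \<open>e > 0\<close> by (intro exI[of _ N]) (force simp: dist_norm norm_minus_commute)
 qed
 then show "convergent X" by (auto simp: convergent_def)
qed

instance l2 :: banach ..

instance l2 :: second_countable_topology
proof
 define S where "S = range (\<lambda>l. \<Sum>(k, a, b)\<leftarrow>l. unit_l2 k (Complex (of_rat a) (of_rat b)))"
 have cS: "countable S" unfolding S_def by simp
 have addS: "x + y \<in> S" if "x \<in> S" "y \<in> S" for x y
 proof -
  obtain l m where "x = (\<Sum>(k, a, b)\<leftarrow>l. unit_l2 k (Complex (of_rat a) (of_rat b)))"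
   "y = (\<Sum>(k, a, b)\<leftarrow>m. unit_l2 k (Complex (of_rat a) (of_rat b)))" using \<open>x \<in> S\<close> \<open>y \<in> S\<close> unfolding S_def by blast
  then have "x + y = (\<Sum>(k, a, b)\<leftarrow>l @ m. unit_l2 k (Complex (of_rat a) (of_rat b)))" by simp
  then show ?thesis unfolding S_def by blast
 qed
 have z: "0 \<in> S" unfolding S_def by (rule image_eqI[of _ _ "[]"]) auto
 have unit: "unit_l2 k c \<in> closure S" for k c
 proof (unfold closure_approachable, intro allI impI)
  fix e :: real assume "e > 0"
  obtain a where a: "a \<in> \<rat>" "\<bar>a - Re c\<bar> < e/2"
   using Rats_dense_in_real[of "Re c - e/2" "Re c + e/2"] \<open>e > 0\<close> by (auto simp: abs_less_iff) (smt (verit) field_sum_of_halves)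
  obtain b where b: "b \<in> \<rat>" "\<bar>b - Im c\<bar> < e/2"
   using Rats_dense_in_real[of "Im c - e/2" "Im c + e/2"] \<open>e > 0\<close> by (auto simp: abs_less_iff) (smt (verit) field_sum_of_halves)
  obtain a' b' where ab: "a = of_rat a'" "b = of_rat b'" using a b by (auto elim!: Rats_cases)
  have "unit_l2 k (Complex a b) - unit_l2 k c = unit_l2 k (Complex a b - c)"
   by (rule l2_eqI) auto
  then have "dist (unit_l2 k (Complex a b)) (unit_l2 k c) = cmod (Complex a b - c)" by (simp add: dist_norm)
  also have "\<dots> < e" using cmod_le[of "Complex a b - c"] a b by simp
  finally show "\<exists>y\<in>S. dist y (unit_l2 k c) < e"
   unfolding S_def ab by (intro bexI[of _ "unit_l2 k (Complex (of_rat a') (of_rat b'))"] image_eqI[of _ _ "[(k,a',b')]"]) auto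
 qed
 have addcl: "x + y \<in> closure S" if x: "x \<in> closure S" and y: "y \<in> closure S" for x y
 proof -
  obtain f g where "\<forall>n. f n \<in> S" "f \<longlonglongrightarrow> x" "\<forall>n. g n \<in> S" "g \<longlonglongrightarrow> y"
   using x y unfolding closure_sequential by blast
  then have "\<forall>n. f n + g n \<in> S" "(\<lambda>n. f n + g n) \<longlonglongrightarrow> x + y" by (auto intro: addS tendsto_add)
  then show ?thesis unfolding closure_sequential by (intro exI[of _ "\<lambda>n. f n + g n"] conjI)
 qed
 have sum: "(\<Sum>k\<in>F. unit_l2 k (f k)) \<in> closure S" if "finite F" for F f
  using that by (induction F rule: finite_induct) (auto intro: addcl unit closure_subset[THEN subsetD] z)
 have dense: "x \<in> closure S" for x
  by (rule Lim_in_closed_set[OF closed_closure _ _ trunc_tendsto[of x]])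
    (auto intro!: eventually_finite_subsets_at_top_weakI simp: trunc_sum sum)
 define B where "B = (\<lambda>(d, n). ball d (inverse (real (Suc n)))) ` (S \<times> UNIV)"
 have "topological_basis B"
 proof (rule topological_basisI)
  show "open b" if "b \<in> B" for b using that by (auto simp: B_def)
  fix U :: "l2 set" and x assume "open U" "x \<in> U"
  then obtain e where e: "e > 0" "ball x e \<subseteq> U" by (meson openE)
  obtain n where n: "inverse (real (Suc n)) < e / 2" using reals_Archimedean[of "e/2"] e by auto
  obtain d where d: "d \<in> S" "dist d x < inverse (real (Suc n))"
   using dense[of x] unfolding closure_approachable by (metis inverse_positive_iff_positive of_nat_0_less_iff zero_less_Suc)
  have "ball d (inverse (real (Suc n))) \<subseteq> ball x e"
  proof
   fix y assume "y \<in> ball d (inverse (real (Suc n)))"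
   then show "y \<in> ball x e" using d n dist_triangle[of x y d] by (simp add: dist_commute)
  qed
  then show "\<exists>b\<in>B. x \<in> b \<and> b \<subseteq> U"
   using d e by (intro bexI[of _ "ball d (inverse (real (Suc n)))"]) (auto simp: B_def)
 qed
 moreover have "countable B" unfolding B_def using cS by auto
 ultimately show "\<exists>B::l2 set set. countable B \<and> open = generate_topology B"
  using topological_basis_imp_subbasis by blast
qed

text \<open>The bilinear (not sesquilinear) pairing: a coordinate of a matrix times a vector is the pairing with a row.\<close>

definition dot :: "l2 => l2 => complex" where
 "dot m x = (\<Sum>\<^sub>\<infinity>k. coef m k * coef x k)"

lemma dot_summable: "(\<lambda>k. coef m k * coef x k) summable_on UNIV"
 by (rule abs_summable_summable[OF cmod_mult_abs_summable])

lemma dot_has_sum: "((\<lambda>k. coef m k * coef x k) has_sum dot m x) UNIV"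
 unfolding dot_def using dot_summable by simp

lemma norm_dot_le: "cmod (dot m x) <= norm m * norm x"
proof -
 have "cmod (dot m x) <= (\<Sum>\<^sub>\<infinity>k. cmod (coef m k * coef x k))"
  unfolding dot_def by (rule norm_infsum_bound[OF cmod_mult_abs_summable])
 also have "\<dots> <= norm m * norm x"
 proof (rule infsum_le_finite_sums[OF cmod_mult_abs_summable])
  fix F :: "freq set" assume F: "finite F"
  have "(\<Sum>k\<in>F. cmod (coef m k * coef x k)) <= L2_set (\<lambda>k. cmod (coef m k)) F * L2_set (\<lambda>k. cmod (coef x k)) F"
   using L2_set_mult_ineq[of "\<lambda>k. cmod (coef m k)" "\<lambda>k. cmod (coef x k)" F] by (simp add: norm_mult)
  also have "\<dots> <= norm m * norm x"
   using sum_sq_le_norm[OF F] by (intro mult_mono) (auto simp: L2_set_def intro!: real_le_lsqrt sum_nonneg)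
  finally show "(\<Sum>k\<in>F. cmod (coef m k * coef x k)) <= norm m * norm x" .
 qed
 finally show ?thesis .
qed

lemma dot_bounded_linear: "bounded_linear (dot m)"
proof (rule bounded_linear_intro[where K="norm m"])
 fix x y :: l2 and r :: real
 show "dot m (x + y) = dot m x + dot m y"
  unfolding dot_def by (simp add: distrib_left infsum_add dot_summable)
 show "dot m (r *\<^sub>R x) = r *\<^sub>R dot m x"
  unfolding dot_def by (simp add: infsum_scaleR_right)
 show "cmod (dot m x) <= norm x * norm m" using norm_dot_le[of m x] by (simp add: mult.commute)
qed

section \<open>Functions on the torus\<close>

abbreviation "TM \<equiv> torus_measure"
definition cell :: "plane set" where "cell = cbox (0, 0) (2 * pi, 2 * pi)"

lemma TM_def: "TM = lebesgue_on cell" by (simp add: torus_measure_def cell_def)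
lemma cell_lebesgue [simp]: "cell \<in> sets lebesgue" by (simp add: cell_def)
lemma cell_lmeasurable [simp]: "cell \<in> lmeasurable" by (simp add: cell_def)
lemma space_TM [simp]: "space TM = cell" by (simp add: TM_def)
lemma compact_cell [simp]: "compact cell" by (simp add: cell_def)

lemma mem_cell: "x \<in> cell \<longleftrightarrow> 0 <= fst x \<and> fst x <= 2 * pi \<and> 0 <= snd x \<and> snd x <= 2 * pi"
 by (cases x) (simp add: cell_def cbox_Pair_eq)

interpretation TM: finite_measure TM
 unfolding TM_def by (rule finite_measure_lebesgue_on) simp

lemma TM_integrable_continuous:
 fixes f :: "plane => 'a::euclidean_space"
 assumes "continuous_on UNIV f" shows "integrable TM f"
 unfolding torus_measure_def by (rule continuous_imp_integrable) (rule continuous_on_subset[OF assms subset_UNIV])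

lemma TM_integral_continuous:
 fixes f :: "plane => 'a::euclidean_space"
 assumes "continuous_on UNIV f" shows "(LINT x|TM. f x) = integral cell f"
 using lebesgue_integral_eq_integral[of cell f] TM_integrable_continuous[OF assms] by (simp add: TM_def)

lemma TM_measurable_continuous:
 fixes f :: "plane => 'a::euclidean_space"
 assumes "continuous_on UNIV f" shows "f \<in> borel_measurable TM"
 using TM_integrable_continuous[OF assms] by (rule borel_measurable_integrable)

subsection \<open>Periodic functions\<close>

lemma periodic2_nat:
 assumes "periodic2 g" shows "g (x + (2 * pi * real m, 0)) = g x" "g (x + (0, 2 * pi * real m)) = g x"
proof -
 show "g (x + (2 * pi * real m, 0)) = g x"
 proof (induction m)
  case (Suc m)
  have "x + (2 * pi * real (Suc m), 0) = (x + (2 * pi * real m, 0)) + (2 * pi, 0)"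
   by (simp add: algebra_simps)
  then show ?case using Suc assms unfolding periodic2_def by metis
 qed (simp flip: zero_prod_def)
 show "g (x + (0, 2 * pi * real m)) = g x"
 proof (induction m)
  case (Suc m)
  have "x + (0, 2 * pi * real (Suc m)) = (x + (0, 2 * pi * real m)) + (0, 2 * pi)"
   by (simp add: algebra_simps)
  then show ?case using Suc assms unfolding periodic2_def by metis
 qed (simp flip: zero_prod_def)
qed

lemma periodic2_int:
 assumes "periodic2 g" shows "g (x + (2 * pi * of_int m, 2 * pi * of_int n)) = g x"
proof -
 have a: "g (y + (2 * pi * of_int m, 0)) = g y" for y
 proof (cases m rule: int_cases2)
  case (nonneg k) then show ?thesis using periodic2_nat(1)[OF assms, of y k] by simp
 next
  case (nonpos k) then show ?thesis using periodic2_nat(1)[OF assms, of "y + (2 * pi * of_int m, 0)" k] by (simp add: add.assoc flip: zero_prod_def)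
 qed
 have b: "g (y + (0, 2 * pi * of_int n)) = g y" for y
 proof (cases n rule: int_cases2)
  case (nonneg k) then show ?thesis using periodic2_nat(2)[OF assms, of y k] by simp
 next
  case (nonpos k) then show ?thesis using periodic2_nat(2)[OF assms, of "y + (0, 2 * pi * of_int n)" k] by (simp add: add.assoc flip: zero_prod_def)
 qed
 have "x + (2 * pi * of_int m, 2 * pi * of_int n) = (x + (2 * pi * of_int m, 0)) + (0, 2 * pi * of_int n)"
  by (simp add: add.assoc)
 then show ?thesis by (metis a b)
qed

lemma periodic2_cell:
 assumes "periodic2 g" obtains y where "y \<in> cell" "g y = g x"
proof -
 define m n where "m = \<lfloor>fst x / (2 * pi)\<rfloor>" and "n = \<lfloor>snd x / (2 * pi)\<rfloor>"
 have red: "0 <= a - 2 * pi * of_int \<lfloor>a / (2 * pi)\<rfloor>" "a - 2 * pi * of_int \<lfloor>a / (2 * pi)\<rfloor> <= 2 * pi" for a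
 proof -
  have f: "of_int \<lfloor>a / (2 * pi)\<rfloor> <= a / (2 * pi)" "a / (2 * pi) <= of_int \<lfloor>a / (2 * pi)\<rfloor> + 1" by linarith+
  have "2 * pi * of_int \<lfloor>a / (2 * pi)\<rfloor> <= 2 * pi * (a / (2 * pi))"
   "2 * pi * (a / (2 * pi)) <= 2 * pi * (of_int \<lfloor>a / (2 * pi)\<rfloor> + 1)"
   by (intro mult_left_mono f; simp)+
  moreover have "2 * pi * (a / (2 * pi)) = a" by simp
  ultimately show "0 <= a - 2 * pi * of_int \<lfloor>a / (2 * pi)\<rfloor>" "a - 2 * pi * of_int \<lfloor>a / (2 * pi)\<rfloor> <= 2 * pi"
   by (simp_all only: distrib_left)
 qed
 have "g (x + (2 * pi * of_int (- m), 2 * pi * of_int (- n))) = g x" by (rule periodic2_int[OF assms])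
 moreover have "x + (2 * pi * of_int (- m), 2 * pi * of_int (- n)) \<in> cell"
  using red[of "fst x"] red[of "snd x"] by (simp add: mem_cell m_def n_def)
 ultimately show ?thesis using that by blast
qed

lemma periodic2_bounded:
 fixes g :: "plane => real"
 assumes "periodic2 g" "continuous_on UNIV g"
 obtains B where "B >= 0" "!!x. \<bar>g x\<bar> <= B"
proof -
 have "bounded (g ` cell)"
  by (intro compact_imp_bounded compact_continuous_image continuous_on_subset[OF assms(2)]) auto
 then obtain B where B: "!!x. x \<in> cell ==> \<bar>g x\<bar> <= B" unfolding bounded_iff by auto
 have "\<bar>g x\<bar> <= B" for x by (rule periodic2_cell[OF assms(1), of x]) (use B in metis)
 then show ?thesis using that[of "\<bar>B\<bar>"] by (meson abs_ge_zero abs_ge_self order_trans)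
qed

lemma smooth_torusD: "smooth_torus g ==> smooth g" "smooth_torus g ==> periodic2 g"
 by (simp_all add: smooth_torus_def)

lemma smooth_torus_cont: "smooth_torus g ==> continuous_on A g"
 by (simp add: smooth_torus_def smooth_continuous)

lemma smooth_torus_const [simp, intro]: "smooth_torus (\<lambda>x. c)"
 by (auto simp: smooth_torus_def periodic2_def)

lemma smooth_torus_add [intro]: "smooth_torus f ==> smooth_torus g ==> smooth_torus (\<lambda>x. f x + g x)"
 by (auto simp: smooth_torus_def periodic2_def)

lemma smooth_torus_mult [intro]: "smooth_torus f ==> smooth_torus g ==> smooth_torus (\<lambda>x. f x * g x)"
 by (auto simp: smooth_torus_def periodic2_def)

lemma smooth_torus_cmult [intro]: "smooth_torus g ==> smooth_torus (\<lambda>x. c * g x)"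
 by (auto simp: smooth_torus_def periodic2_def)

lemma smooth_torus_diff [intro]: "smooth_torus f ==> smooth_torus g ==> smooth_torus (\<lambda>x. f x - g x)"
 by (auto simp: smooth_torus_def periodic2_def)

lemma smooth_torus_minus [intro]: "smooth_torus g ==> smooth_torus (\<lambda>x. - g x)"
 by (auto simp: smooth_torus_def periodic2_def)

lemma smooth_torus_comp: "smooth h ==> smooth_torus g ==> smooth_torus (\<lambda>x. h (g x))" for h :: "real => real"
 by (auto simp: smooth_torus_def periodic2_def smooth_comp)

lemma smooth_torus_shift: assumes "smooth_torus g" shows "smooth_torus (\<lambda>x. g (x + c))"
proof -
 have eq: "x + d + c = (x + c) + d" for x d :: plane by (simp add: algebra_simps)
 have "smooth (\<lambda>x. g (x + c))"
  using smooth_affine[OF _ bounded_linear_ident, of g c] assms by (simp add: smooth_torus_def)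
 moreover have "periodic2 (\<lambda>x. g (x + c))"
  using assms unfolding smooth_torus_def periodic2_def eq by blast
 ultimately show ?thesis by (simp add: smooth_torus_def)
qed

lemma dir_deriv_shift: "smooth g ==> dir_deriv v (\<lambda>x. g (x + c)) = (\<lambda>x. dir_deriv v g (x + c))"
 using dir_deriv_affine[OF _ bounded_linear_ident, of g v c] by simp

lemma smooth_torus_dir_deriv [intro]: assumes "smooth_torus g" shows "smooth_torus (dir_deriv v g)"
proof -
 have "(\<lambda>x. g (x + c)) = g ==> dir_deriv v g (x + c) = dir_deriv v g x" for c x
  using fun_cong[OF dir_deriv_shift[of g v c], of x] assms by (simp add: smooth_torus_def)
 moreover have "(\<lambda>x. g (x + (2 * pi, 0))) = g" "(\<lambda>x. g (x + (0, 2 * pi))) = g"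
  using assms by (auto simp: smooth_torus_def periodic2_def)
 ultimately show ?thesis using assms by (auto simp: smooth_torus_def periodic2_def smooth_dir_deriv)
qed

text \<open>Integrate first in the direction of differentiation; by periodicity the inner integral vanishes.\<close>

lemma integral_dir_deriv_zero:
 assumes "smooth_torus g"
 shows "integral cell (dir_deriv (1, 0) g) = 0" "integral cell (dir_deriv (0, 1) g) = 0"
proof -
 have c: "continuous_on A (dir_deriv v g)" for A v using assms by (auto intro: smooth_torus_cont)
 have "g ((0, y) + (2 * pi, 0)) = g (0, y)" "g ((y, 0) + (0, 2 * pi)) = g (y, 0)" for y
  using assms unfolding smooth_torus_def periodic2_def by blast+
 then have per: "g (2 * pi, y) = g (0, y)" "g (y, 2 * pi) = g (y, 0)" for y by simp_all
 have d1: "((\<lambda>x. g (x, y)) has_vector_derivative dir_deriv (1,0) g (x, y)) (at x within S)" for x y S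
 proof -
  have e: "dir_deriv (h, 0) g (x, y) = h *\<^sub>R dir_deriv (1, 0) g (x, y)" for h
   using linear_cmul[OF has_derivative_linear[OF smooth_has_derivative[OF smooth_torusD(1)[OF assms]]], of h "(1, 0)"] by simp
  have "((\<lambda>x. (x, y)) has_derivative (\<lambda>h. (h, 0))) (at x within S)"
   by (auto intro!: derivative_eq_intros)
  then have "((\<lambda>x. g (x, y)) has_derivative (\<lambda>h. dir_deriv (h, 0) g (x, y))) (at x within S)"
   by (rule has_derivative_compose) (use assms smooth_has_derivative smooth_torusD in blast)
  moreover have "(\<lambda>h. dir_deriv (h, 0) g (x, y)) = (\<lambda>h. h *\<^sub>R dir_deriv (1, 0) g (x, y))"
   by (rule ext) (rule e)
  ultimately show ?thesis by (simp only: has_vector_derivative_def)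
 qed
 have d2: "((\<lambda>y. g (x, y)) has_vector_derivative dir_deriv (0,1) g (x, y)) (at y within S)" for x y S
 proof -
  have e: "dir_deriv (0, h) g (x, y) = h *\<^sub>R dir_deriv (0, 1) g (x, y)" for h
   using linear_cmul[OF has_derivative_linear[OF smooth_has_derivative[OF smooth_torusD(1)[OF assms]]], of h "(0, 1)"] by simp
  have "((\<lambda>y. (x, y)) has_derivative (\<lambda>h. (0, h))) (at y within S)"
   by (auto intro!: derivative_eq_intros)
  then have "((\<lambda>y. g (x, y)) has_derivative (\<lambda>h. dir_deriv (0, h) g (x, y))) (at y within S)"
   by (rule has_derivative_compose) (use assms smooth_has_derivative smooth_torusD in blast)
  moreover have "(\<lambda>h. dir_deriv (0, h) g (x, y)) = (\<lambda>h. h *\<^sub>R dir_deriv (0, 1) g (x, y))"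
   by (rule ext) (rule e)
  ultimately show ?thesis by (simp only: has_vector_derivative_def)
 qed
 have i1: "integral (cbox 0 (2 * pi)) (\<lambda>x. dir_deriv (1, 0) g (x, y)) = 0" for y
  using fundamental_theorem_of_calculus[of 0 "2*pi" "\<lambda>x. g (x, y)", OF _ d1] per
  by (auto simp: integral_unique)
 have i2: "integral (cbox 0 (2 * pi)) (\<lambda>y. dir_deriv (0, 1) g (x, y)) = 0" for x
  using fundamental_theorem_of_calculus[of 0 "2*pi" "\<lambda>y. g (x, y)", OF _ d2] per
  by (auto simp: integral_unique)
 show "integral cell (dir_deriv (0, 1) g) = 0"
  unfolding cell_def using i2 by (subst integral_prod_continuous[OF c]) simp
 have "integral cell (dir_deriv (1, 0) g) =
   integral (cbox 0 (2*pi)) (\<lambda>x. integral (cbox 0 (2*pi)) (\<lambda>y. dir_deriv (1, 0) g (x, y)))"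
  unfolding cell_def by (rule integral_prod_continuous[OF c])
 also have "\<dots> = integral (cbox 0 (2*pi)) (\<lambda>y. integral (cbox 0 (2*pi)) (\<lambda>x. dir_deriv (1, 0) g (x, y)))"
  by (rule integral_swap_continuous) (simp add: c)
 finally show "integral cell (dir_deriv (1, 0) g) = 0" using i1 by simp
qed

subsection \<open>Square integrable functions\<close>

definition ip :: "(plane => real) => (plane => real) => real" where
 "ip g h = (LINT x|TM. g x * h x)"

lemma L2D: assumes "g \<in> L2" shows "g \<in> borel_measurable TM" "integrable TM (\<lambda>x. (g x)^2)" "periodic2 g"
 using assms by (auto simp: L2_def)

lemma L2_prod_integrable: assumes "g \<in> L2" "h \<in> L2" shows "integrable TM (\<lambda>x. g x * h x)"
proof (rule Bochner_Integration.integrable_bound)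
 show "integrable TM (\<lambda>x. (g x)^2 + (h x)^2)" using assms L2D by auto
 show "(\<lambda>x. g x * h x) \<in> borel_measurable TM" using assms L2D by measurable
 have "norm (a * b) <= norm (a^2 + b^2)" for a b :: real
 proof -
  have "2 * \<bar>a * b\<bar> <= a^2 + b^2" using sum_squares_bound[of "\<bar>a\<bar>" "\<bar>b\<bar>"] by (simp add: abs_mult)
  then show ?thesis by simp
 qed
 then show "AE x in TM. norm (g x * h x) <= norm ((g x)^2 + (h x)^2)" by blast
qed

lemma L2_continuous: assumes "periodic2 g" "continuous_on UNIV g" shows "g \<in> L2"
 unfolding L2_def using assms
 by (auto intro!: TM_integrable_continuous TM_measurable_continuous continuous_intros)

lemma smooth_torus_L2: "smooth_torus g ==> g \<in> L2"
 by (intro L2_continuous smooth_torusD smooth_torus_cont)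

lemma L2_integrable: "g \<in> L2 ==> integrable TM g"
 using L2_prod_integrable[of g "\<lambda>x. 1"] smooth_torus_L2[of "\<lambda>x. 1"] by simp

lemma L2_add: assumes "g \<in> L2" "h \<in> L2" shows "(\<lambda>x. g x + h x) \<in> L2"
proof -
 have "integrable TM (\<lambda>x. (g x)^2 + 2 * (g x * h x) + (h x)^2)"
  using L2_prod_integrable[OF assms] L2D[OF assms(1)] L2D[OF assms(2)] by simp
 then have "integrable TM (\<lambda>x. (g x + h x)^2)" by (simp add: power2_sum algebra_simps)
 then show ?thesis using assms by (auto simp: L2_def periodic2_def)
qed

lemma L2_cmult: assumes "g \<in> L2" shows "(\<lambda>x. c * g x) \<in> L2"
 using assms by (auto simp: L2_def periodic2_def power_mult_distrib)

lemma L2_minus: "g \<in> L2 ==> (\<lambda>x. - g x) \<in> L2" using L2_cmult[of g "-1"] by simp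

lemma L2_diff: assumes "g \<in> L2" "h \<in> L2" shows "(\<lambda>x. g x - h x) \<in> L2"
 using L2_add[OF assms(1) L2_minus[OF assms(2)]] by simp

lemma L2_sum: "finite A ==> (!!i. i \<in> A ==> f i \<in> L2) ==> (\<lambda>x. \<Sum>i\<in>A. f i x) \<in> L2"
 by (induction A rule: finite_induct) (auto intro: L2_add smooth_torus_L2)

lemma L2_bounded_mult:
 assumes "periodic2 a" "continuous_on UNIV a" "g \<in> L2" shows "(\<lambda>x. a x * g x) \<in> L2"
proof -
 obtain B where B: "B >= 0" "!!x. \<bar>a x\<bar> <= B" using periodic2_bounded[OF assms(1,2)] by metis
 note m [measurable] = TM_measurable_continuous[OF assms(2)] L2D(1)[OF assms(3)]
 have "integrable TM (\<lambda>x. (a x * g x)^2)"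
 proof (rule Bochner_Integration.integrable_bound)
  show "integrable TM (\<lambda>x. B^2 * (g x)^2)" using L2D[OF assms(3)] by simp
  have "(a x * g x)^2 <= B^2 * (g x)^2" for x
   using power_mono[OF B(2)[of x], of 2] by (auto simp: power_mult_distrib intro!: mult_right_mono)
  then show "AE x in TM. norm ((a x * g x)^2) <= norm (B^2 * (g x)^2)" by auto
 qed measurable
 then show ?thesis using assms by (auto simp: L2_def periodic2_def)
qed

lemma L2_smooth_mult: "smooth_torus a ==> g \<in> L2 ==> (\<lambda>x. a x * g x) \<in> L2"
 by (intro L2_bounded_mult smooth_torusD smooth_torus_cont)

lemma ip_commute: "ip g h = ip h g" by (simp add: ip_def mult.commute)
lemma ip_add_left: "g \<in> L2 ==> g' \<in> L2 ==> h \<in> L2 ==> ip (\<lambda>x. g x + g' x) h = ip g h + ip g' h"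
 by (simp add: ip_def distrib_right L2_prod_integrable)
lemma ip_diff_left: "g \<in> L2 ==> g' \<in> L2 ==> h \<in> L2 ==> ip (\<lambda>x. g x - g' x) h = ip g h - ip g' h"
 by (simp add: ip_def left_diff_distrib L2_prod_integrable)
lemma ip_cmult_left: "ip (\<lambda>x. c * g x) h = c * ip g h"
 by (simp add: ip_def mult.assoc)
lemma ip_add_right: "g \<in> L2 ==> g' \<in> L2 ==> h \<in> L2 ==> ip h (\<lambda>x. g x + g' x) = ip h g + ip h g'"
 using ip_add_left[of g g' h] by (simp add: ip_commute)
lemma ip_diff_right: "g \<in> L2 ==> g' \<in> L2 ==> h \<in> L2 ==> ip h (\<lambda>x. g x - g' x) = ip h g - ip h g'"
 using ip_diff_left[of g g' h] by (simp add: ip_commute)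
lemma ip_cmult_right: "ip h (\<lambda>x. c * g x) = c * ip h g"
 using ip_cmult_left[of c g h] by (simp add: ip_commute)
lemma ip_minus_right: "ip h (\<lambda>x. - g x) = - ip h g"
 using ip_cmult_right[of h "-1" g] by simp
lemma ip_self_nonneg: "ip g g >= 0" by (simp add: ip_def)
lemma L2_norm_ip: "L2_norm g = sqrt (ip g g)" by (simp add: L2_norm_def ip_def power2_eq_square)
lemma L2_norm_sq: "(L2_norm g)^2 = ip g g" by (simp add: L2_norm_ip ip_self_nonneg)
lemma L2_norm_nonneg [simp]: "L2_norm g >= 0" by (simp add: L2_norm_ip ip_self_nonneg)

lemma ip_Cauchy_Schwarz: assumes "g \<in> L2" "h \<in> L2" shows "\<bar>ip g h\<bar> <= L2_norm g * L2_norm h"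
proof -
 have q: "0 <= ip g g + 2 * r * ip g h + r^2 * ip h h" for r
 proof -
  have "0 <= ip (\<lambda>x. g x + r * h x) (\<lambda>x. g x + r * h x)" by (rule ip_self_nonneg)
  also have "\<dots> = ip g g + 2 * r * ip g h + r^2 * ip h h"
   using assms by (simp add: ip_add_left ip_add_right L2_add L2_cmult ip_cmult_left ip_cmult_right
     ip_commute[of h g] power2_eq_square algebra_simps)
  finally show ?thesis .
 qed
 have "(ip g h)^2 <= ip g g * ip h h"
 proof (cases "ip h h = 0")
  case True
  have "ip g h = 0"
  proof (rule ccontr)
   assume "ip g h ~= 0"
   then show False using q[of "- (ip g g + 1) / (2 * ip g h)"] True by (simp add: field_simps)
  qed
  then show ?thesis using True by simp
 next
  case False
  then have "ip h h > 0" using ip_self_nonneg[of h] by simp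
  then show ?thesis using q[of "- ip g h / ip h h"] by (simp add: field_simps power2_eq_square)
 qed
 then have "sqrt ((ip g h)^2) <= sqrt (ip g g * ip h h)" by (rule real_sqrt_le_mono)
 then show ?thesis by (simp add: L2_norm_ip real_sqrt_mult)
qed

lemma L2_norm_zero_AE: assumes "g \<in> L2" "L2_norm g = 0" shows "AE x in TM. g x = 0"
proof -
 have "(LINT x|TM. (g x)^2) = 0" using assms(2) by (simp add: L2_norm_def)
 then have "AE x in TM. (g x)^2 = 0"
  by (subst (asm) integral_nonneg_eq_0_iff_AE) (use L2D[OF assms(1)] in auto)
 then show ?thesis by simp
qed

lemma L2_norm_cong_AE: assumes "AE x in TM. g x = h x" "g \<in> borel_measurable TM" "h \<in> borel_measurable TM"
 shows "L2_norm g = L2_norm h"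
 unfolding L2_norm_def
 by (rule arg_cong[where f=sqrt], rule integral_cong_AE) (use assms in auto)

lemma ip_cong_AE: assumes "AE x in TM. g x = g' x" "g \<in> L2" "g' \<in> L2" "h \<in> L2"
 shows "ip g h = ip g' h"
 unfolding ip_def using assms L2D(1) by (intro integral_cong_AE) auto

subsection \<open>Characters\<close>

definition phase :: "freq => plane => real" where
 "phase k x = of_int (fst k) * fst x + of_int (snd k) * snd x"

definition ech :: "freq => plane => complex" where
 "ech k x = cis (phase k x)"

lemma phase_add_freq: "phase (k + j) x = phase k x + phase j x"
 by (simp add: phase_def algebra_simps)
lemma phase_minus_freq: "phase (- k) x = - phase k x"
 by (simp add: phase_def)
lemma ech_add: "ech (k + j) x = ech k x * ech j x"
 by (simp add: ech_def phase_add_freq cis_mult)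
lemma ech_minus: "ech (- k) x = cnj (ech k x)"
 by (simp add: ech_def phase_minus_freq cis_cnj)
lemma ech_diff: "ech (k - j) x = ech k x * cnj (ech j x)"
 using ech_add[of k "- j" x] by (simp add: ech_minus)
lemma cmod_ech [simp]: "cmod (ech k x) = 1" by (simp add: ech_def)
lemma ech_0 [simp]: "ech 0 x = 1" by (simp add: ech_def phase_def)

lemma phase_linear: "bounded_linear (phase k)"
 unfolding phase_def[abs_def]
 by (intro bounded_linear_add bounded_linear_const_mult bounded_linear_fst bounded_linear_snd)

lemma cont_phase [continuous_intros]: "continuous_on A (phase k)"
 by (rule linear_continuous_on[OF phase_linear])

lemma cont_ech: "continuous_on A (ech k)"
 unfolding ech_def[abs_def] by (intro continuous_intros)

lemma ech_periodic: "periodic2 (ech k)"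
proof -
 have c: "cis (a + 2 * pi * of_int n) = cis a" for a and n :: int
 proof -
  have "cis (2 * pi * of_int n) = 1" by (rule cis_multiple_2pi) simp
  then show ?thesis using cis_mult[of a "2 * pi * of_int n"] by simp
 qed
 have "phase k (x + (2 * pi, 0)) = phase k x + 2 * pi * of_int (fst k)"
  "phase k (x + (0, 2 * pi)) = phase k x + 2 * pi * of_int (snd k)" for x
  by (simp_all add: phase_def algebra_simps)
 then show ?thesis by (simp add: periodic2_def ech_def c)
qed

definition cosk :: "freq => plane => real" where "cosk k x = cos (phase k x)"
definition sink :: "freq => plane => real" where "sink k x = sin (phase k x)"

lemma ech_Re_Im: "Re (ech k x) = cosk k x" "Im (ech k x) = sink k x"
 by (simp_all add: ech_def cosk_def sink_def)

lemma smooth_phase: "smooth (phase k)"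
 using smooth_linear[OF phase_linear, of k 0] by simp

lemma smooth_torus_cosk: "smooth_torus (cosk k)" and smooth_torus_sink: "smooth_torus (sink k)"
proof -
 have "smooth (cosk k)" "smooth (sink k)" unfolding cosk_def[abs_def] sink_def[abs_def]
  by (rule smooth_comp[OF smooth_cos smooth_phase] smooth_comp[OF smooth_sin smooth_phase])+
 moreover have "periodic2 (cosk k)" "periodic2 (sink k)"
  using ech_periodic[of k] unfolding periodic2_def ech_Re_Im[symmetric] by auto
 ultimately show "smooth_torus (cosk k)" "smooth_torus (sink k)" by (auto simp: smooth_torus_def)
qed

lemma dir_deriv_cosk: "dir_deriv v (cosk k) = (\<lambda>x. - phase k v * sink k x)"
 and dir_deriv_sink: "dir_deriv v (sink k) = (\<lambda>x. phase k v * cosk k x)"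
 using dir_deriv_comp[OF smooth_cos smooth_phase[of k], of v] dir_deriv_comp[OF smooth_sin smooth_phase[of k], of v]
  dir_deriv_linear[OF phase_linear[of k], of v 0]
 by (auto simp: cosk_def[abs_def] sink_def[abs_def])

lemma integral_cis: assumes "l ~= 0"
 shows "integral {0..2 * pi} (\<lambda>x. cis (of_int l * x)) = 0"
proof -
 have d: "((\<lambda>x. exp (\<i> * of_int l * of_real x) / (\<i> * of_int l)) has_vector_derivative exp (\<i> * of_int l * of_real x)) (at x within S)" for x S
  by (rule has_vector_derivative_real_field) (use assms in \<open>auto intro!: derivative_eq_intros\<close>)
 have e: "cis (of_int l * x) = exp (\<i> * of_int l * of_real x)" for x
  by (simp add: cis_conv_exp mult.assoc)
 have "((\<lambda>x. cis (of_int l * x)) has_integral (exp (\<i> * of_int l * of_real (2 * pi)) / (\<i> * of_int l) - exp (\<i> * of_int l * of_real 0) / (\<i> * of_int l))) {0..2*pi}"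
  unfolding e by (rule fundamental_theorem_of_calculus) (use d in auto)
 moreover have "exp (\<i> * of_int l * of_real (2 * pi)) = 1"
 proof -
  have "cis (2 * pi * of_int l) = 1" by (rule cis_multiple_2pi) simp
  then show ?thesis using e[of "2 * pi"] by (simp add: mult.commute)
 qed
 ultimately show ?thesis by (simp add: integral_unique)
qed

lemma integral_ech: "integral cell (ech k) = (if k = 0 then 4 * pi^2 else 0)"
proof (cases "k = 0")
 case True
 then show ?thesis by (simp add: ech_def[abs_def] phase_def cell_def content_Pair power2_eq_square scaleR_conv_of_real)
next
 case False
 have e: "ech k (x, y) = cis (of_int (fst k) * x) * cis (of_int (snd k) * y)" for x y
  by (simp add: ech_def phase_def cis_mult)
 have "integral cell (ech k) = integral (cbox 0 (2*pi)) (\<lambda>x. integral (cbox 0 (2*pi)) (\<lambda>y. cis (of_int (fst k) * x) * cis (of_int (snd k) * y)))"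
  unfolding cell_def by (subst integral_prod_continuous[OF cont_ech]) (simp add: e)
 also have "\<dots> = integral {0..2*pi} (\<lambda>x. cis (of_int (fst k) * x)) * integral {0..2*pi} (\<lambda>y. cis (of_int (snd k) * y))"
  by simp
 also have "\<dots> = 0" using False integral_cis[of "fst k"] integral_cis[of "snd k"] by (auto simp: prod_eq_iff)
 finally show ?thesis using False by simp
qed

section \<open>Fourier coefficients\<close>

text \<open>The normalization makes Parseval an isometry: the characters have norm \<open>2\<pi>\<close>.\<close>

definition fc :: "(plane => real) => freq => complex" where
 "fc g k = Complex (ip g (cosk k)) (- ip g (sink k)) / (2 * pi)"

lemma cosk_minus: "cosk (- k) = cosk k" and sink_minus: "sink (- k) = (\<lambda>x. - sink k x)"
 by (auto simp: cosk_def[abs_def] sink_def[abs_def] phase_minus_freq)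

lemma cosk_L2 [simp]: "cosk k \<in> L2" and sink_L2 [simp]: "sink k \<in> L2"
 by (auto intro: smooth_torus_L2 smooth_torus_cosk smooth_torus_sink)

lemma fc_hermitian: "fc g (- k) = cnj (fc g k)"
 by (simp add: fc_def cosk_minus sink_minus ip_minus_right complex_eq_iff)

lemma fc_add: "g \<in> L2 ==> h \<in> L2 ==> fc (\<lambda>x. g x + h x) k = fc g k + fc h k"
 by (simp add: fc_def ip_add_left complex_eq_iff add_divide_distrib diff_divide_distrib)

lemma fc_cmult: "fc (\<lambda>x. c * g x) k = c * fc g k"
 by (simp add: fc_def ip_cmult_left complex_eq_iff)

lemma fc_diff: "g \<in> L2 ==> h \<in> L2 ==> fc (\<lambda>x. g x - h x) k = fc g k - fc h k"
 by (simp add: fc_def ip_diff_left complex_eq_iff diff_divide_distrib)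

lemma fc_sum: "finite A ==> (!!i. i \<in> A ==> f i \<in> L2) ==> fc (\<lambda>x. \<Sum>i\<in>A. f i x) k = (\<Sum>i\<in>A. fc (f i) k)"
proof (induction A rule: finite_induct)
 case empty then show ?case by (simp add: fc_def ip_def complex_eq_iff)
next
 case (insert a A)
 then show ?case using fc_add[OF _ L2_sum[of A f], of "f a" k] by simp
qed

lemma integral_Re_Im:
 assumes "continuous_on UNIV (f :: plane => complex)"
 shows "Re (integral cell f) = integral cell (\<lambda>x. Re (f x))" "Im (integral cell f) = integral cell (\<lambda>x. Im (f x))"
proof -
 have "f integrable_on cell" unfolding cell_def by (rule integrable_continuous[OF continuous_on_subset[OF assms subset_UNIV]])
 from integral_linear[OF this bounded_linear_Re] integral_linear[OF this bounded_linear_Im]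
 show "Re (integral cell f) = integral cell (\<lambda>x. Re (f x))" "Im (integral cell f) = integral cell (\<lambda>x. Im (f x))"
  by (simp_all add: o_def)
qed

lemma ip_continuous: "continuous_on UNIV g ==> continuous_on UNIV h ==> ip g h = integral cell (\<lambda>x. g x * h x)"
 unfolding ip_def by (rule TM_integral_continuous) (intro continuous_intros)

lemma fc_continuous: assumes "continuous_on UNIV g"
 shows "fc g j = integral cell (\<lambda>x. of_real (g x) * cnj (ech j x)) / (2 * pi)"
proof -
 have c: "continuous_on UNIV (\<lambda>x. of_real (g x) * cnj (ech j x))"
  using assms cont_ech[of UNIV j] by (intro continuous_intros)
 have "Complex (ip g (cosk j)) (- ip g (sink j)) = integral cell (\<lambda>x. of_real (g x) * cnj (ech j x))"
  using integral_Re_Im[OF c] assms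
  by (simp add: complex_eq_iff ech_Re_Im ip_continuous smooth_torus_cont smooth_torus_cosk smooth_torus_sink)
 then show ?thesis by (simp add: fc_def)
qed

text \<open>A real function with spectrum in \<open>{k, -k}\<close>. Sums over symmetric sets of frequencies with Hermitian coefficients give the real trigonometric polynomials.\<close>

definition wave :: "complex => freq => plane => real" where
 "wave c k x = Re (c * ech k x) / (2 * pi)"

lemma wave_alt: "wave c k = (\<lambda>x. (Re c / (2 * pi)) * cosk k x + (- Im c / (2 * pi)) * sink k x)"
 by (auto simp: wave_def ech_Re_Im fun_eq_iff field_simps)

lemma smooth_torus_wave: "smooth_torus (wave c k)"
 unfolding wave_alt by (intro smooth_torus_add smooth_torus_cmult smooth_torus_cosk smooth_torus_sink)

lemma wave_L2 [simp]: "wave c k \<in> L2" by (rule smooth_torus_L2[OF smooth_torus_wave])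

lemma ip_wave: assumes "g \<in> L2" shows "ip g (wave c k) = Re (c * cnj (fc g k))"
proof -
 have "ip g (wave c k) = Re c / (2 * pi) * ip g (cosk k) + (- Im c / (2 * pi)) * ip g (sink k)"
  unfolding wave_alt
  by (simp only: ip_add_right[OF L2_cmult[OF cosk_L2] L2_cmult[OF sink_L2] assms] ip_cmult_right)
 then show ?thesis by (simp add: fc_def field_simps)
qed

lemma fc_wave: "fc (wave c k) j = (if j = k then c / 2 else 0) + (if j = - k then cnj c / 2 else 0)"
proof -
 have cont: "continuous_on UNIV (wave c k)" by (rule smooth_torus_cont[OF smooth_torus_wave])
 have "of_real (wave c k x) * cnj (ech j x) = c / (4 * pi) * ech (k - j) x + cnj c / (4 * pi) * ech (- k - j) x" for x
 proof -
  have "of_real (Re z / (2 * pi)) = (z + cnj z) / (4 * pi)" for z :: complex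
   unfolding complex_add_cnj by (simp add: field_simps)
  then have "of_real (wave c k x) = (c * ech k x + cnj (c * ech k x)) / (4 * pi)"
   unfolding wave_def .
  then show ?thesis by (simp add: ech_diff ech_minus field_simps)
 qed
 then have "integral cell (\<lambda>x. of_real (wave c k x) * cnj (ech j x))
   = integral cell (\<lambda>x. c / (4 * pi) * ech (k - j) x + cnj c / (4 * pi) * ech (- k - j) x)" by simp
 also have "\<dots> = integral cell (\<lambda>x. c / (4 * pi) * ech (k - j) x) + integral cell (\<lambda>x. cnj c / (4 * pi) * ech (- k - j) x)"
  by (rule Henstock_Kurzweil_Integration.integral_add)
    (auto simp: cell_def intro!: integrable_continuous continuous_intros cont_ech)
 also have "\<dots> = c / (4 * pi) * integral cell (ech (k - j)) + cnj c / (4 * pi) * integral cell (ech (- k - j))"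
  by simp
 also have "\<dots> = c * pi * (if j = k then 1 else 0) + cnj c * pi * (if j = - k then 1 else 0)"
  by (auto simp: integral_ech power2_eq_square field_simps eq_commute[of 0] minus_equation_iff[of k j])
 finally show ?thesis unfolding fc_continuous[OF cont] by (auto simp: field_simps)
qed

definition trig :: "(freq => complex) => freq set => plane => real" where
 "trig c F x = (\<Sum>k\<in>F. wave (c k) k x)"

lemma smooth_torus_sum: "finite A ==> (!!i. i \<in> A ==> smooth_torus (f i)) ==> smooth_torus (\<lambda>x. \<Sum>i\<in>A. f i x)"
 by (induction A rule: finite_induct) auto

lemma smooth_torus_trig: "finite F ==> smooth_torus (trig c F)"
 unfolding trig_def[abs_def] by (intro smooth_torus_sum smooth_torus_wave)

lemma trig_L2: "finite F ==> trig c F \<in> L2" by (rule smooth_torus_L2[OF smooth_torus_trig])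

lemma ip_sum_right: "finite A ==> g \<in> L2 ==> (!!i. i \<in> A ==> f i \<in> L2) ==> ip g (\<lambda>x. \<Sum>i\<in>A. f i x) = (\<Sum>i\<in>A. ip g (f i))"
proof (induction A rule: finite_induct)
 case empty then show ?case by (simp add: ip_def)
next
 case (insert a A)
 then show ?case using ip_add_right[OF _ L2_sum[of A f], of "f a" g] by simp
qed

lemma ip_trig: assumes "g \<in> L2" "finite F"
 shows "ip g (trig c F) = (\<Sum>k\<in>F. Re (c k * cnj (fc g k)))"
 unfolding trig_def[abs_def] using assms by (simp add: ip_sum_right ip_wave)

definition symset :: "freq set => bool" where "symset F \<longleftrightarrow> finite F \<and> (\<forall>k\<in>F. - k \<in> F)"
definition herm :: "(freq => complex) => bool" where "herm c \<longleftrightarrow> (\<forall>k. c (- k) = cnj (c k))"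

lemma fc_trig: assumes "symset F" "herm c" shows "fc (trig c F) j = (if j \<in> F then c j else 0)"
proof -
 have F: "finite F" "(- j \<in> F) = (j \<in> F)" using assms(1) by (auto simp: symset_def dest: bspec[where x="- j"])
 have "fc (trig c F) j = (\<Sum>k\<in>F. (if j = k then c k / 2 else 0) + (if k = - j then cnj (c k) / 2 else 0))"
 proof -
  have w: "fc (wave c k) j = (if j = k then c / 2 else 0) + (if k = - j then cnj c / 2 else 0)" for c k
   by (subst fc_wave) (simp only: equation_minus_iff[of j])
  show ?thesis unfolding trig_def[abs_def] using F by (subst fc_sum) (simp_all add: w)
 qed
 also have "\<dots> = (if j \<in> F then c j / 2 else 0) + (if - j \<in> F then cnj (c (- j)) / 2 else 0)"
  using F by (simp add: sum.distrib)
 also have "\<dots> = (if j \<in> F then c j else 0)"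
  using F spec[OF assms(2)[unfolded herm_def], of j] by simp
 finally show ?thesis .
qed

lemma ip_trig_trig: assumes "symset F" "herm c"
 shows "ip (trig c F) (trig c F) = (\<Sum>k\<in>F. (cmod (c k))^2)"
proof -
 have "finite F" using assms by (simp add: symset_def)
 then show ?thesis using ip_trig[OF trig_L2, of F F c c] fc_trig[OF assms] by (simp flip: complex_norm_square)
qed

lemma herm_fc [simp]: "herm (fc g)" by (simp add: herm_def fc_hermitian)

lemma Bessel_sym: assumes "g \<in> L2" "symset F"
 shows "ip (\<lambda>x. g x - trig (fc g) F x) (\<lambda>x. g x - trig (fc g) F x) = ip g g - (\<Sum>k\<in>F. (cmod (fc g k))^2)"
proof -
 have F: "finite F" using assms by (simp add: symset_def)
 have "ip g (trig (fc g) F) = (\<Sum>k\<in>F. (cmod (fc g k))^2)"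
  using ip_trig[OF assms(1) F, of "fc g"] by (simp flip: complex_norm_square)
 moreover have "ip (trig (fc g) F) g = ip g (trig (fc g) F)" by (rule ip_commute)
 ultimately show ?thesis using assms(1) trig_L2[OF F] ip_trig_trig[OF assms(2) herm_fc[of g]]
  by (simp add: ip_diff_left ip_diff_right L2_diff)
qed

text \<open>Enlarge the set to a symmetric one, where the partial Fourier sum is real and the defect is the squared norm of the remainder.\<close>

lemma Bessel: assumes "g \<in> L2" "finite F" shows "(\<Sum>k\<in>F. (cmod (fc g k))^2) <= ip g g"
proof -
 have s: "symset (F \<union> uminus ` F)" using assms(2) by (auto simp: symset_def)
 have "(\<Sum>k\<in>F. (cmod (fc g k))^2) <= (\<Sum>k\<in>F \<union> uminus ` F. (cmod (fc g k))^2)"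
  using assms(2) by (intro sum_mono2) auto
 also have "\<dots> <= ip g g"
  using Bessel_sym[OF assms(1) s] ip_self_nonneg[of "\<lambda>x. g x - trig (fc g) (F \<union> uminus ` F) x"] by simp
 finally show ?thesis .
qed

definition ft :: "(plane => real) => l2" where "ft g = Abs_l2 (fc g)"

lemma coef_ft: assumes "g \<in> L2" shows "coef (ft g) = fc g"
 unfolding ft_def by (rule Abs_l2_inverse) (rule sqsumI_bound[OF Bessel[OF assms]])

lemma norm_ft_le: assumes "g \<in> L2" shows "norm (ft g) <= L2_norm g"
 by (rule norm_l2_le) (use Bessel[OF assms] in \<open>auto simp: coef_ft[OF assms] L2_norm_sq\<close>)

lemma cmod_fc_le: "g \<in> L2 ==> cmod (fc g k) <= L2_norm g"
 using cmod_coef_le[of "ft g" k] norm_ft_le[of g] by (simp add: coef_ft)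

subsection \<open>Riesz-Fischer\<close>

definition fbox :: "nat => freq set" where "fbox n = {- int n..int n} \<times> {- int n..int n}"

lemma symset_fbox: "symset (fbox n)" by (auto simp: symset_def fbox_def)
lemma finite_fbox [simp]: "finite (fbox n)" by (simp add: fbox_def)
lemma fbox_mono: "m <= n ==> fbox m \<subseteq> fbox n" by (auto simp: fbox_def)

lemma mem_fbox: "k \<in> fbox n \<longleftrightarrow> \<bar>fst k\<bar> <= int n \<and> \<bar>snd k\<bar> <= int n"
 by (cases k) (auto simp: fbox_def)

lemma fbox_exhausts: "finite F ==> \<exists>n. F \<subseteq> fbox n"
proof (induction F rule: finite_induct)
 case (insert k F)
 then obtain n where "F \<subseteq> fbox n" by blast
 then have "insert k F \<subseteq> fbox (n + nat \<bar>fst k\<bar> + nat \<bar>snd k\<bar>)"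
  using fbox_mono[of n "n + nat \<bar>fst k\<bar> + nat \<bar>snd k\<bar>"] by (auto simp: mem_fbox)
 then show ?case by blast
qed auto

lemma fbox_filterlim: "filterlim fbox (finite_subsets_at_top UNIV) sequentially"
 unfolding filterlim_iff eventually_finite_subsets_at_top
proof (intro allI impI)
 fix P :: "freq set => bool" assume "\<exists>X. finite X \<and> X \<subseteq> UNIV \<and> (\<forall>Y. finite Y \<and> X \<subseteq> Y \<and> Y \<subseteq> UNIV --> P Y)"
 then obtain X where X: "finite X" "!!Y. finite Y ==> X \<subseteq> Y ==> P Y" by auto
 obtain n where "X \<subseteq> fbox n" using fbox_exhausts[OF X(1)] by blast
 then show "\<forall>\<^sub>F n in sequentially. P (fbox n)"
  unfolding eventually_sequentially using X(2) fbox_mono finite_fbox by (meson order_trans)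
qed

lemma trunc_fbox_tendsto: "(\<lambda>n. trunc (fbox n) x) \<longlonglongrightarrow> x"
 by (rule filterlim_compose[OF trunc_tendsto fbox_filterlim])

lemma sum_fbox_tendsto: "(\<lambda>n. \<Sum>k\<in>fbox n. (cmod (coef x k))^2) \<longlonglongrightarrow> (norm x)^2"
 unfolding norm_l2_sq by (rule filterlim_compose[OF infsum_tendsto[OF sq_summable] fbox_filterlim])

lemma Re_Im_sq: "Re z * Re z + Im z * Im z = (cmod z)^2"
 unfolding cmod_power2 by (simp add: power2_eq_square)

lemma trig_diff_norm:
 assumes "herm c" "n <= m"
 shows "ip (\<lambda>x. trig c (fbox m) x - trig c (fbox n) x) (\<lambda>x. trig c (fbox m) x - trig c (fbox n) x)
  = (\<Sum>k\<in>fbox m. (cmod (c k))^2) - (\<Sum>k\<in>fbox n. (cmod (c k))^2)"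
proof -
 have "ip (trig c (fbox m)) (trig c (fbox n)) = (\<Sum>k\<in>fbox n. Re (c k * cnj (fc (trig c (fbox m)) k)))"
  by (rule ip_trig) (auto intro: trig_L2)
 also have "\<dots> = (\<Sum>k\<in>fbox n. (cmod (c k))^2)"
  using fbox_mono[OF assms(2)] by (intro sum.cong) (auto simp: fc_trig[OF symset_fbox assms(1)] Re_Im_sq)
 finally have "ip (trig c (fbox m)) (trig c (fbox n)) = (\<Sum>k\<in>fbox n. (cmod (c k))^2)" .
 then show ?thesis
  using ip_commute[of "trig c (fbox n)" "trig c (fbox m)"]
  by (simp add: ip_diff_left ip_diff_right L2_diff trig_L2 ip_trig_trig[OF symset_fbox assms(1)])
qed

lemma L1_le_L2: assumes "g \<in> L2" shows "(LINT x|TM. \<bar>g x\<bar>) <= 2 * pi * L2_norm g"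
proof -
 have a: "(\<lambda>x. \<bar>g x\<bar>) \<in> L2" using assms by (auto simp: L2_def periodic2_def)
 have "ip (\<lambda>x. 1) (\<lambda>x. 1) = (2 * pi)^2"
  by (subst ip_continuous) (auto simp: cell_def content_Pair power2_eq_square)
 then have "L2_norm (\<lambda>x. 1) = 2 * pi" by (simp add: L2_norm_ip power_mult_distrib real_sqrt_mult)
 moreover have "L2_norm (\<lambda>x. \<bar>g x\<bar>) = L2_norm g" by (simp add: L2_norm_def)
 moreover have "ip (\<lambda>x. \<bar>g x\<bar>) (\<lambda>x. 1) = (LINT x|TM. \<bar>g x\<bar>)" by (simp add: ip_def)
 ultimately show ?thesis
  using ip_Cauchy_Schwarz[OF a smooth_torus_L2[OF smooth_torus_const[of 1]]] by (simp add: mult.commute)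
qed

text \<open>The partial sums are Cauchy in \<open>L\<^sup>1\<close>, so a subsequence converges almost everywhere; its limit is a concrete periodic representative, which the description of \<open>L\<^sup>2\<close> by functions requires.\<close>

lemma Riesz_Fischer:
 assumes h: "herm (coef x)"
 obtains g where "g \<in> L2" "!!k. fc g k = coef x k" "ip g g <= (norm x)^2"
proof -
 define T where "T n = trig (coef x) (fbox n)" for n
 define p where "p n = (\<Sum>k\<in>fbox n. (cmod (coef x k))^2)" for n
 have T: "T n \<in> L2" for n unfolding T_def by (rule trig_L2) simp
 note [measurable] = L2D(1)[OF T]
 have d: "ip (\<lambda>x. T m x - T n x) (\<lambda>x. T m x - T n x) = p m - p n" if "n <= m" for m n
  unfolding T_def p_def by (rule trig_diff_norm[OF h that])
 have dn: "L2_norm (\<lambda>x. T m x - T n x) = sqrt \<bar>p m - p n\<bar>" for m n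
 proof (cases "n <= m")
  case True
  then show ?thesis using d[OF True] ip_self_nonneg[of "\<lambda>x. T m x - T n x"] by (simp add: L2_norm_ip)
 next
  case False
  then have le: "m <= n" by simp
  have "L2_norm (\<lambda>x. T m x - T n x) = L2_norm (\<lambda>x. T n x - T m x)" by (simp add: L2_norm_def power2_commute)
  then show ?thesis using d[OF le] ip_self_nonneg[of "\<lambda>x. T n x - T m x"] by (simp add: L2_norm_ip abs_minus_commute)
 qed
 have plim: "p \<longlonglongrightarrow> (norm x)^2" unfolding p_def by (rule sum_fbox_tendsto)
 have ple: "p n <= (norm x)^2" for n unfolding p_def by (rule sum_sq_le_norm) simp
 have "Cauchy p" using plim by (rule LIMSEQ_imp_Cauchy)
 have L1C: "\<exists>N. \<forall>i\<ge>N. \<forall>j\<ge>N. LINT x|TM. norm (T i x - T j x) < e" if "e > 0" for e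
 proof -
  have "(e / (2 * pi))^2 > 0" using that by simp
  then obtain N where N: "!!i j. i >= N ==> j >= N ==> \<bar>p i - p j\<bar> < (e / (2 * pi))^2"
   using \<open>Cauchy p\<close> unfolding Cauchy_def dist_real_def by blast
  have "(LINT x|TM. norm (T i x - T j x)) < e" if "i >= N" "j >= N" for i j
  proof -
   have "(LINT x|TM. norm (T i x - T j x)) <= 2 * pi * sqrt \<bar>p i - p j\<bar>"
    using L1_le_L2[OF L2_diff[OF T T], of i j] by (simp add: dn)
   also have "\<dots> < 2 * pi * sqrt ((e / (2 * pi))^2)"
    using N[OF that] by (intro mult_strict_left_mono real_sqrt_less_mono) auto
   also have "\<dots> = e" using \<open>e > 0\<close> by simp
   finally show ?thesis .
  qed
  then show ?thesis by blast
 qed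
 obtain r where r: "strict_mono r" "AE x in TM. Cauchy (\<lambda>i. T (r i) x)"
  using cauchy_L1_AE_cauchy_subseq[of TM T, OF L2_integrable[OF T] L1C] by blast
 define g where "g y = lim (\<lambda>i. T (r i) y)" for y
 have [measurable]: "g \<in> borel_measurable TM" unfolding g_def by measurable
 have gl: "AE y in TM. (\<lambda>i. T (r i) y) \<longlonglongrightarrow> g y"
  using r(2) by eventually_elim (simp add: g_def Cauchy_convergent_iff convergent_LIMSEQ_iff)
 have gp: "periodic2 g" using L2D(3)[OF T] unfolding g_def periodic2_def by simp
 have rge: "r i >= i" for i by (rule seq_suble[OF r(1)])
 have est: "(\<integral>\<^sup>+ y. ennreal ((g y - T n y)^2) \<partial>TM) <= ennreal ((norm x)^2 - p n)" for n
 proof -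
  have "(\<integral>\<^sup>+ y. ennreal ((g y - T n y)^2) \<partial>TM) = (\<integral>\<^sup>+ y. liminf (\<lambda>i. ennreal ((T (r i) y - T n y)^2)) \<partial>TM)"
  proof (rule nn_integral_cong_AE, use gl in eventually_elim)
   case (elim y)
   have "(\<lambda>i. ennreal ((T (r i) y - T n y)^2)) \<longlonglongrightarrow> ennreal ((g y - T n y)^2)"
    by (intro tendsto_ennrealI tendsto_intros elim)
   from lim_imp_Liminf[OF trivial_limit_sequentially this] show ?case by (rule sym)
  qed
  also have "\<dots> <= liminf (\<lambda>i. \<integral>\<^sup>+ y. ennreal ((T (r i) y - T n y)^2) \<partial>TM)"
   by (rule nn_integral_liminf) measurable
  also have "\<dots> <= limsup (\<lambda>i. \<integral>\<^sup>+ y. ennreal ((T (r i) y - T n y)^2) \<partial>TM)"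
   by (rule Liminf_le_Limsup) simp
  also have "\<dots> <= ennreal ((norm x)^2 - p n)"
  proof (rule Limsup_bounded, unfold eventually_sequentially, intro exI allI impI)
   fix i assume "n <= i"
   then have "n <= r i" using rge[of i] by simp
   have "(\<integral>\<^sup>+ y. ennreal ((T (r i) y - T n y)^2) \<partial>TM) = ennreal (LINT y|TM. (T (r i) y - T n y)^2)"
    by (rule nn_integral_eq_integral) (use L2D(2)[OF L2_diff[OF T T]] in auto)
   also have "\<dots> = ennreal (p (r i) - p n)"
    using d[OF \<open>n <= r i\<close>] by (simp add: ip_def power2_eq_square)
   also have "\<dots> <= ennreal ((norm x)^2 - p n)" using ple[of "r i"] by (intro ennreal_leI) simp
   finally show "(\<integral>\<^sup>+ y. ennreal ((T (r i) y - T n y)^2) \<partial>TM) <= ennreal ((norm x)^2 - p n)" .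
  qed
  finally show ?thesis .
 qed
 have gTi: "integrable TM (\<lambda>y. (g y - T n y)^2)" for n
 proof (rule integrableI_bounded)
  have "(\<integral>\<^sup>+ y. ennreal (norm ((g y - T n y)^2)) \<partial>TM) <= ennreal ((norm x)^2 - p n)" using est[of n] by simp
  also have "\<dots> < \<infinity>" by simp
  finally show "(\<integral>\<^sup>+ y. ennreal (norm ((g y - T n y)^2)) \<partial>TM) < \<infinity>" .
 qed measurable
 have gT: "(\<lambda>y. g y - T n y) \<in> L2" for n
  using gTi gp L2D(3)[OF T] unfolding L2_def by (auto simp: periodic2_def)
 have g: "g \<in> L2" using L2_add[OF gT[of 0] T[of 0]] by simp
 have gTn: "ip (\<lambda>y. g y - T n y) (\<lambda>y. g y - T n y) <= (norm x)^2 - p n" for n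
 proof -
  have "ennreal (LINT y|TM. (g y - T n y)^2) <= ennreal ((norm x)^2 - p n)"
   using est[of n] by (subst (asm) nn_integral_eq_integral[OF gTi]) auto
  then show ?thesis using ple[of n] by (subst (asm) ennreal_le_iff) (auto simp: ip_def power2_eq_square)
 qed
 have fcT: "fc (T n) k = coef x k" if "k \<in> fbox n" for n k
  unfolding T_def using fc_trig[OF symset_fbox h] that by simp
 have fcg: "fc g k = coef x k" for k
 proof -
  obtain n0 where n0: "k \<in> fbox n0" using fbox_exhausts[of "{k}"] by auto
  have "(\<lambda>n. (norm x)^2 - p n) \<longlonglongrightarrow> (norm x)^2 - (norm x)^2" by (intro tendsto_intros plim)
  then have "(\<lambda>n. sqrt ((norm x)^2 - p n)) \<longlonglongrightarrow> sqrt 0" by (intro tendsto_intros) simp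
  moreover have "\<forall>\<^sub>F n in sequentially. cmod (fc g k - coef x k) <= sqrt ((norm x)^2 - p n)"
   unfolding eventually_sequentially
  proof (intro exI allI impI)
   fix n assume "n0 <= n"
   then have "fc g k - coef x k = fc (\<lambda>y. g y - T n y) k"
    using fcT[of k n] n0 fbox_mono[OF \<open>n0 <= n\<close>] by (subst fc_diff[OF g T]) (auto dest: subsetD)
   then have "cmod (fc g k - coef x k) <= L2_norm (\<lambda>y. g y - T n y)" using cmod_fc_le[OF gT] by simp
   also have "\<dots> <= sqrt ((norm x)^2 - p n)" unfolding L2_norm_ip using gTn by (rule real_sqrt_le_mono)
   finally show "cmod (fc g k - coef x k) <= sqrt ((norm x)^2 - p n)" .
  qed
  ultimately have "cmod (fc g k - coef x k) <= sqrt 0"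
   by (intro tendsto_lowerbound) auto
  then show ?thesis by simp
 qed
 have "ip g g <= (norm x)^2"
 proof -
  have "trig (fc g) (fbox 0) = T 0" by (simp add: T_def trig_def[abs_def] fcg)
  then show ?thesis using Bessel_sym[OF g symset_fbox[of 0]] gTn[of 0] by (simp add: p_def fcg)
 qed
 then show ?thesis using that g fcg by blast
qed

subsection \<open>Completeness of the trigonometric system\<close>

inductive_set trigpoly :: "(plane => real) set" where
 base: "(\<lambda>x. a * cosk k x + b * sink k x) \<in> trigpoly"
| add: "f \<in> trigpoly ==> g \<in> trigpoly ==> (\<lambda>x. f x + g x) \<in> trigpoly"

lemma trigpoly_mult_base:
 "(\<lambda>x. (a * cosk k x + b * sink k x) * (a' * cosk j x + b' * sink j x)) \<in> trigpoly"
proof -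
 have pd: "phase (k - j) x = phase k x - phase j x" for x by (simp add: phase_def algebra_simps)
 have e: "(a * cosk k x + b * sink k x) * (a' * cosk j x + b' * sink j x)
  = (((a * a' + b * b') / 2) * cosk (k - j) x + ((b * a' - a * b') / 2) * sink (k - j) x)
   + (((a * a' - b * b') / 2) * cosk (k + j) x + ((b * a' + a * b') / 2) * sink (k + j) x)" for x
  unfolding cosk_def sink_def
  by (simp add: pd phase_add_freq cos_add cos_diff sin_add sin_diff field_simps)
 show ?thesis unfolding e by (intro trigpoly.intros)
qed

lemma trigpoly_mult: assumes "f \<in> trigpoly" "g \<in> trigpoly" shows "(\<lambda>x. f x * g x) \<in> trigpoly"
 using assms
proof (induction arbitrary: g rule: trigpoly.induct)
 case (base a k b)
 from base show ?case
 proof (induction rule: trigpoly.induct)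
  case (base a' j b') show ?case by (rule trigpoly_mult_base)
 next
  case (add f g) show ?case unfolding distrib_left by (rule trigpoly.add[OF add.IH])
 qed
next
 case (add f f') show ?case unfolding distrib_right by (rule trigpoly.add[OF add.IH(1)[OF add.prems] add.IH(2)[OF add.prems]])
qed

lemma trigpoly_smooth: "f \<in> trigpoly ==> smooth_torus f"
 by (induction rule: trigpoly.induct) (rule smooth_torus_add smooth_torus_cmult smooth_torus_cosk smooth_torus_sink | assumption)+

definition circ :: "plane => complex \<times> complex" where "circ x = (cis (fst x), cis (snd x))"

lemma trigpoly_circ: "real_polynomial_function q ==> (\<lambda>x. q (circ x)) \<in> trigpoly"
proof (induction rule: real_polynomial_function.induct)
 case (linear f)
 have "f (circ x) = (f (1, 0) * cosk (1, 0) x + f (\<i>, 0) * sink (1, 0) x)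
   + (f (0, 1) * cosk (0, 1) x + f (0, \<i>) * sink (0, 1) x)" for x
 proof -
  have "circ x = (cos (fst x) *\<^sub>R (1, 0) + sin (fst x) *\<^sub>R (\<i>, 0)) + (cos (snd x) *\<^sub>R (0, 1) + sin (snd x) *\<^sub>R (0, \<i>))"
   by (auto simp: circ_def complex_eq_iff)
  then have "f (circ x) = (cos (fst x) *\<^sub>R f (1, 0) + sin (fst x) *\<^sub>R f (\<i>, 0)) + (cos (snd x) *\<^sub>R f (0, 1) + sin (snd x) *\<^sub>R f (0, \<i>))"
   using bounded_linear.linear[OF linear] by (simp only: linear_add linear_scale)
  then show ?thesis by (simp add: cosk_def sink_def phase_def)
 qed
 then show ?case by (auto intro!: trigpoly.intros)
next
 case (const c)
 have "(\<lambda>x. c * cosk 0 x + 0 * sink 0 x) \<in> trigpoly" by (rule trigpoly.base)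
 then show ?case by (simp add: cosk_def phase_def)
next
 case (add f g) then show ?case by (auto intro: trigpoly.add)
next
 case (mult f g) then show ?case by (auto intro: trigpoly_mult)
qed

lemma cont_circ: "continuous_on A circ"
 unfolding circ_def[abs_def] by (intro continuous_intros)

lemma fc_zero_trigpoly: assumes "g \<in> L2" "!!k. fc g k = 0" "f \<in> trigpoly" shows "ip g f = 0"
 using assms(3)
proof induction
 case (base a k b)
 have "ip g (cosk k) = 0" "ip g (sink k) = 0" using assms(2)[of k] by (simp_all add: fc_def complex_eq_iff)
 then show ?case using assms(1) by (simp add: ip_add_right L2_cmult ip_cmult_right)
next
 case (add f h)
 then show ?case using assms(1) by (simp add: ip_add_right smooth_torus_L2 trigpoly_smooth)
qed

text \<open>Through the embedding of the torus into \<open>\<complex>\<^sup>2\<close>, Stone and Weierstrass approximate a continuous function by polynomials, whose pull-backs are trigonometric polynomials.\<close>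

lemma fc_zero_continuous:
 assumes "g \<in> L2" "!!k. fc g k = 0" "continuous_on UNIV (\<phi> :: complex \<times> complex => real)"
 shows "(LINT x|TM. g x * \<phi> (circ x)) = 0"
proof -
 have cphi: "continuous_on UNIV (\<lambda>x. \<phi> (circ x))"
  by (rule continuous_on_compose2[OF assms(3) cont_circ]) simp
 have "cis (a + 2 * pi) = cis a" for a using cis_mult[of a "2 * pi"] by simp
 then have "periodic2 (\<lambda>x. \<phi> (circ x))" by (simp add: periodic2_def circ_def)
 then have pL: "(\<lambda>x. \<phi> (circ x)) \<in> L2" by (rule L2_continuous[OF _ cphi])
 have gi: "integrable TM (\<lambda>x. \<bar>g x\<bar>)" using L2_integrable[OF assms(1)] by simp
 have bound: "\<bar>ip g (\<lambda>x. \<phi> (circ x))\<bar> <= e * (LINT x|TM. \<bar>g x\<bar>)" if "e > 0" for e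
 proof -
  have "compact (circ ` cell)" by (intro compact_continuous_image cont_circ compact_cell)
  then obtain q where q1: "real_polynomial_function q" "!!p. p \<in> circ ` cell ==> \<bar>\<phi> p - q p\<bar> < e"
   using Stone_Weierstrass_real_polynomial_function[OF _ continuous_on_subset[OF assms(3) subset_UNIV] \<open>e > 0\<close>] by metis
  then have q: "real_polynomial_function q" "!!x. x \<in> cell ==> \<bar>\<phi> (circ x) - q (circ x)\<bar> < e" by blast+
  have qt: "(\<lambda>x. q (circ x)) \<in> trigpoly" by (rule trigpoly_circ[OF q(1)])
  then have qL: "(\<lambda>x. q (circ x)) \<in> L2" by (intro smooth_torus_L2 trigpoly_smooth)
  have "ip g (\<lambda>x. \<phi> (circ x)) = ip g (\<lambda>x. \<phi> (circ x) - q (circ x))"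
   using fc_zero_trigpoly[OF assms(1,2) qt] by (simp add: ip_diff_right assms(1) pL qL)
  also have "\<bar>\<dots>\<bar> <= (LINT x|TM. \<bar>g x * (\<phi> (circ x) - q (circ x))\<bar>)"
   unfolding ip_def by (rule integral_abs_bound)
  also have "\<dots> <= (LINT x|TM. e * \<bar>g x\<bar>)"
  proof (rule integral_mono)
   show "integrable TM (\<lambda>x. \<bar>g x * (\<phi> (circ x) - q (circ x))\<bar>)"
    using L2_prod_integrable[OF assms(1) L2_diff[OF pL qL]] by simp
   show "integrable TM (\<lambda>x. e * \<bar>g x\<bar>)" using gi by simp
   fix x assume "x \<in> space TM"
   then show "\<bar>g x * (\<phi> (circ x) - q (circ x))\<bar> <= e * \<bar>g x\<bar>"
    using mult_right_mono[OF less_imp_le[OF q(2)], of x "\<bar>g x\<bar>"] by (simp add: abs_mult mult.commute)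
  qed
  also have "\<dots> = e * (LINT x|TM. \<bar>g x\<bar>)" by simp
  finally show ?thesis .
 qed
 have "((\<lambda>e. e * (LINT x|TM. \<bar>g x\<bar>)) \<longlongrightarrow> 0 * (LINT x|TM. \<bar>g x\<bar>)) (at_right 0)"
  by (intro tendsto_intros)
 moreover have "\<forall>\<^sub>F e in at_right 0. \<bar>ip g (\<lambda>x. \<phi> (circ x))\<bar> <= e * (LINT x|TM. \<bar>g x\<bar>)"
  using eventually_at_right_less[of 0] by eventually_elim (rule bound)
 ultimately have "\<bar>ip g (\<lambda>x. \<phi> (circ x))\<bar> <= 0 * (LINT x|TM. \<bar>g x\<bar>)"
  by (rule tendsto_lowerbound) simp
 then show ?thesis by (simp add: ip_def)
qed

lemma cis_eq_open:
 assumes "cis a = cis b" "0 < a" "a < 2 * pi" "0 <= b" "b <= 2 * pi" shows "a = b"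
proof -
 have "cos a = cos b" "sin a = sin b" using assms(1) by (auto simp: complex_eq_iff)
 then have "cos (a - b) = 1" using sin_cos_squared_add3[of b] by (simp add: cos_diff)
 then obtain n :: int where n: "a - b = of_int n * 2 * pi" using cos_one_2pi_int by blast
 have "\<bar>a - b\<bar> < 2 * pi" using assms by auto
 then have "\<bar>of_int n * (2 * pi)\<bar> < 1 * (2 * pi)" using n by (simp add: mult.assoc)
 then have "\<bar>of_int n :: real\<bar> < 1" unfolding abs_mult by simp
 then have "n = 0" by linarith
 then show ?thesis using n by simp
qed

definition icell :: "plane set" where "icell = box (0, 0) (2 * pi, 2 * pi)"

lemma mem_icell: "x \<in> icell \<longleftrightarrow> 0 < fst x \<and> fst x < 2 * pi \<and> 0 < snd x \<and> snd x < 2 * pi"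
 by (cases x) (auto simp: icell_def mem_box Basis_prod_def)

lemma icell_subset: "icell \<subseteq> cell" by (auto simp: mem_icell mem_cell)

text \<open>Indicators of open sets are limits of continuous functions of the point on the torus.\<close>

lemma fc_zero_open:
 assumes g: "g \<in> L2" "!!k. fc g k = 0" and W: "open W" "W \<subseteq> icell"
 shows "(LINT x|TM. g x * indicator W x) = 0"
proof -
 define K where "K = circ ` (cell - W)"
 have K: "compact K" unfolding K_def
  by (intro compact_continuous_image cont_circ compact_diff compact_cell W(1))
 have "(0, 0) \<in> cell - W" using W(2) by (auto simp: mem_cell mem_icell)
 then have Kne: "K ~= {}" unfolding K_def by blast
 have iff: "circ x \<in> K \<longleftrightarrow> x \<notin> W" if "x \<in> cell" for x
 proof
  assume "circ x \<in> K"
  then obtain y where y: "y \<in> cell" "y \<notin> W" "circ x = circ y" unfolding K_def by auto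
  show "x \<notin> W"
  proof
   assume "x \<in> W"
   then have "x \<in> icell" using W(2) by blast
   then have "fst x = fst y" "snd x = snd y" using y
    by (auto simp: circ_def mem_icell mem_cell intro!: cis_eq_open)
   then show False using y \<open>x \<in> W\<close> by (metis prod_eqI)
  qed
 qed (use that in \<open>auto simp: K_def\<close>)
 define f where "f n p = min 1 (real n * infdist p K)" for n p
 have z: "(LINT x|TM. g x * f n (circ x)) = 0" for n
  by (rule fc_zero_continuous[OF g]) (auto simp: f_def intro!: continuous_intros)
 note [measurable] = L2D(1)[OF g(1)]
 have "(\<lambda>n. LINT x|TM. g x * f n (circ x)) \<longlonglongrightarrow> (LINT x|TM. g x * indicator W x)"
 proof (rule integral_dominated_convergence)
  have Wl: "W \<in> sets TM \<or> True" by simp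
  have "W \<in> sets lebesgue" "W \<subseteq> cell" using W icell_subset by auto
  then have [measurable]: "W \<in> sets TM" unfolding TM_def by (simp add: sets_restrict_space_iff)
  show "(\<lambda>x. g x * indicator W x) \<in> borel_measurable TM" by measurable
  have "continuous_on UNIV (\<lambda>x. f n (circ x))" for n unfolding f_def
   by (intro continuous_intros continuous_on_compose2[OF _ cont_circ, where t=UNIV and g="\<lambda>p. infdist p K"]) auto
  note [measurable] = TM_measurable_continuous[OF this]
  show "(\<lambda>x. g x * f n (circ x)) \<in> borel_measurable TM" for n by measurable
  show "integrable TM (\<lambda>x. \<bar>g x\<bar>)" using L2_integrable[OF g(1)] by simp
  show "AE x in TM. norm (g x * f n (circ x)) <= \<bar>g x\<bar>" for n
   by (rule AE_I2) (auto simp: f_def abs_mult infdist_nonneg intro!: mult_left_le)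
  show "AE x in TM. (\<lambda>n. g x * f n (circ x)) \<longlonglongrightarrow> g x * indicator W x"
  proof (rule AE_I2)
   fix x assume "x \<in> space TM"
   then have x: "x \<in> cell" by simp
   have "(\<lambda>n. f n (circ x)) \<longlonglongrightarrow> indicator W x"
   proof (cases "x \<in> W")
    case True
    then have "circ x \<notin> K" using iff[OF x] by simp
    then have pos: "infdist (circ x) K > 0"
    proof -
     have "infdist (circ x) K ~= 0"
      using in_closed_iff_infdist_zero[OF compact_imp_closed[OF K] Kne, of "circ x"] \<open>circ x \<notin> K\<close> by simp
     then show ?thesis using infdist_nonneg[of "circ x" K] by simp
    qed
    obtain N where N: "real N * infdist (circ x) K > 1" using reals_Archimedean3[OF pos] by blast
    have "f n (circ x) = 1" if "n >= N" for n
    proof -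
     have "real N * infdist (circ x) K <= real n * infdist (circ x) K"
      using that pos by (intro mult_right_mono) auto
     then show ?thesis using N by (simp add: f_def)
    qed
    then show ?thesis using True by (intro tendsto_eventually) (auto simp: eventually_sequentially)
   next
    case False
    then have "circ x \<in> K" using iff[OF x] by simp
    then show ?thesis using False by (simp add: f_def)
   qed
   then show "(\<lambda>n. g x * f n (circ x)) \<longlonglongrightarrow> g x * indicator W x" by (intro tendsto_intros)
  qed
 qed
 then show ?thesis using z by (simp add: LIMSEQ_const_iff)
qed

lemma icell_negligible: "negligible (cell - icell)"
 unfolding cell_def icell_def by (rule negligible_frontier_interval)

text \<open>A function whose integrals over all open sets vanish is zero almost everywhere.\<close>

lemma trig_complete:
 assumes g: "g \<in> L2" "!!k. fc g k = 0" shows "AE x in TM. g x = 0"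
proof (rule TM.density_zero[OF L2_integrable[OF g(1)]])
 fix A assume "A \<in> sets TM"
 then have A: "A \<in> sets lebesgue" "A \<subseteq> cell"
  unfolding TM_def by (auto simp: sets_restrict_space_iff)
 have "\<exists>T. open T \<and> A \<subseteq> T \<and> T - A \<in> lmeasurable \<and> emeasure lebesgue (T - A) < ennreal ((1/2) ^ n)" for n
  using sets_lebesgue_outer_open[OF A(1), of "(1/2) ^ n"] by (metis zero_less_divide_1_iff zero_less_numeral zero_less_power)
 then obtain T where T: "!!n. open (T n)" "!!n. A \<subseteq> T n" "!!n. T n - A \<in> lmeasurable"
  "!!n. emeasure lebesgue (T n - A) < ennreal ((1/2) ^ n)" by metis
 define U where "U n = icell \<inter> (\<Inter>i\<le>n. T i)" for n :: nat
 define G where "G = icell \<inter> (\<Inter>i. T i)"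
 have U: "open (U n)" for n unfolding U_def icell_def by (intro open_Int open_box open_INT) (auto simp: T)
 have z: "(LINT x|TM. g x * indicator (U n) x) = 0" for n
  by (rule fc_zero_open[OF g U]) (auto simp: U_def)
 have Ul: "U n \<in> sets TM" for n
  using U[of n] icell_subset unfolding TM_def by (auto simp: sets_restrict_space_iff U_def)
 have "G = (\<Inter>n. U n)" by (auto simp: G_def U_def)
 then have Gl: "G \<in> sets TM" using Ul by auto
 note [measurable] = L2D(1)[OF g(1)] Ul Gl \<open>A \<in> sets TM\<close>
 have "(\<lambda>n. LINT x|TM. g x * indicator (U n) x) \<longlonglongrightarrow> (LINT x|TM. g x * indicator G x)"
 proof (rule integral_dominated_convergence)
  show "integrable TM (\<lambda>x. \<bar>g x\<bar>)" using L2_integrable[OF g(1)] by simp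
  show "AE x in TM. norm (g x * indicator (U n) x) <= \<bar>g x\<bar>" for n
   by (rule AE_I2) (auto simp: indicator_def)
  show "AE x in TM. (\<lambda>n. g x * indicator (U n) x) \<longlonglongrightarrow> g x * indicator G x"
  proof (rule AE_I2)
   fix x
   have "(\<lambda>n. indicator (U n) x :: real) \<longlonglongrightarrow> indicator G x"
   proof (cases "x \<in> G")
    case True then show ?thesis by (simp add: G_def U_def)
   next
    case False
    then consider "x \<notin> icell" | i where "x \<notin> T i" by (auto simp: G_def)
    then show ?thesis
    proof cases
     case 1 then show ?thesis using False by (simp add: U_def)
    next
     case 2
     then have "\<forall>n\<ge>i. x \<notin> U n" by (auto simp: U_def)
     then show ?thesis using False
      by (intro tendsto_eventually, unfold eventually_sequentially) (auto intro!: exI[of _ i])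
    qed
   qed
   then show "(\<lambda>n. g x * indicator (U n) x) \<longlonglongrightarrow> g x * indicator G x" by (intro tendsto_intros)
  qed
 qed measurable
 then have G0: "(LINT x|TM. g x * indicator G x) = 0" using z by (simp add: LIMSEQ_const_iff)
 have null: "(\<Inter>i. T i) - A \<in> null_sets lebesgue"
 proof (rule null_setsI)
  show m: "(\<Inter>i. T i) - A \<in> sets lebesgue" using T(1) A(1) by (intro sets.Diff sets.countable_INT) auto
  have "emeasure lebesgue ((\<Inter>i. T i) - A) <= ennreal ((1/2) ^ n)" for n
  proof -
   have "emeasure lebesgue ((\<Inter>i. T i) - A) <= emeasure lebesgue (T n - A)"
    by (rule emeasure_mono) (use T(3)[of n] in auto)
   then show ?thesis using T(4)[of n] by simp
  qed
  moreover have "(\<lambda>n. ennreal ((1/2) ^ n)) \<longlonglongrightarrow> ennreal 0" by (intro tendsto_ennrealI LIMSEQ_power_zero) simp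
  ultimately have "emeasure lebesgue ((\<Inter>i. T i) - A) <= ennreal 0"
   by (intro tendsto_lowerbound[where F=sequentially]) auto
  then show "emeasure lebesgue ((\<Inter>i. T i) - A) = 0" by simp
 qed
 have "AE x in lebesgue. x \<notin> (\<Inter>i. T i) - A" using AE_not_in[OF null] .
 moreover have "AE x in lebesgue. x \<notin> cell - icell"
  using AE_not_in icell_negligible negligible_iff_null_sets by blast
 ultimately have "AE x in lebesgue. x \<in> cell --> indicator A x = (indicator G x :: real)"
  by eventually_elim (use T(2) in \<open>auto simp: G_def indicator_def\<close>)
 then have ae: "AE x in TM. indicator A x = (indicator G x :: real)"
  unfolding TM_def by (subst AE_restrict_space_iff) auto
 have "set_lebesgue_integral TM A g = (LINT x|TM. g x * indicator G x)"
  unfolding set_lebesgue_integral_def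
  by (rule integral_cong_AE) (use ae in \<open>auto simp: mult.commute\<close>)
 then show "set_lebesgue_integral TM A g = 0" using G0 by simp
qed

lemma L2_norm_ft: assumes "g \<in> L2" shows "norm (ft g) = L2_norm g"
proof (rule antisym[OF norm_ft_le[OF assms]])
 have "herm (coef (ft g))" by (simp add: coef_ft assms)
 then obtain h where h: "h \<in> L2" "!!k. fc h k = coef (ft g) k" "ip h h <= (norm (ft g))^2"
  using Riesz_Fischer by metis
 have "fc (\<lambda>x. g x - h x) k = 0" for k using h(2)[of k] by (simp add: fc_diff assms h(1) coef_ft)
 from trig_complete[OF L2_diff[OF assms h(1)] this] have "AE x in TM. g x = h x" by simp
 then have "L2_norm g = L2_norm h" by (rule L2_norm_cong_AE) (use assms h L2D in auto)
 then show "L2_norm g <= norm (ft g)" using h(3) by (simp add: L2_norm_ip real_le_lsqrt ip_self_nonneg)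
qed

lemma ft_add: "g \<in> L2 ==> h \<in> L2 ==> ft (\<lambda>x. g x + h x) = ft g + ft h"
 by (rule l2_eqI) (simp add: coef_ft L2_add fc_add)
lemma ft_diff: "g \<in> L2 ==> h \<in> L2 ==> ft (\<lambda>x. g x - h x) = ft g - ft h"
 by (rule l2_eqI) (simp add: coef_ft L2_diff fc_diff)
lemma ft_cmult: "g \<in> L2 ==> ft (\<lambda>x. c * g x) = c *\<^sub>R ft g"
 by (rule l2_eqI) (simp add: coef_ft L2_cmult fc_cmult scaleR_conv_of_real)

lemma Parseval: assumes "g \<in> L2" "h \<in> L2" shows "ip g h = ft g \<bullet> ft h"
proof -
 have "ip (\<lambda>x. g x + h x) (\<lambda>x. g x + h x) = (norm (ft g + ft h))^2"
  using L2_norm_ft[OF L2_add[OF assms]] by (simp add: L2_norm_sq ft_add assms)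
 moreover have "ip g g = (norm (ft g))^2" "ip h h = (norm (ft h))^2"
  using L2_norm_ft assms by (simp_all add: L2_norm_sq)
 ultimately show ?thesis using assms
  by (simp add: ip_add_left ip_add_right L2_add ip_commute[of h g] power2_norm_eq_inner inner_add_left inner_add_right inner_commute)
qed

lift_definition cnj_l2 :: "l2 => l2" is "\<lambda>x k. cnj (x k)" by (simp add: sqsum_def)

lemmas coef_cnj_l2 [simp] = cnj_l2.rep_eq

lemma Parseval_complex: assumes "g \<in> L2" "h \<in> L2"
 shows "dot (cnj_l2 (ft h)) (ft g) = of_real (ip g h)"
proof -
 have s: "(\<lambda>k. cnj (coef (ft h) k) * coef (ft g) k) summable_on UNIV"
  using dot_summable[of "cnj_l2 (ft h)" "ft g"] by simp
 have "Re (dot (cnj_l2 (ft h)) (ft g)) = (\<Sum>\<^sub>\<infinity>k. Re (cnj (coef (ft h) k) * coef (ft g) k))"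
  unfolding dot_def coef_cnj_l2 by (rule infsum_Re[OF s, symmetric])
 also have "\<dots> = ip g h" unfolding Parseval[OF assms] inner_l2_def
  by (rule infsum_cong) (simp add: inner_complex_def mult.commute)
 finally have re: "Re (dot (cnj_l2 (ft h)) (ft g)) = ip g h" .
 have "dot (cnj_l2 (ft h)) (ft g) = (\<Sum>\<^sub>\<infinity>k. cnj (coef (ft h) (- k)) * coef (ft g) (- k))"
  unfolding dot_def coef_cnj_l2
  by (rule infsum_reindex_bij_betw[symmetric, where g=uminus]) (rule bij_uminus)
 also have "\<dots> = (\<Sum>\<^sub>\<infinity>k. cnj (cnj (coef (ft h) k) * coef (ft g) k))"
  by (simp add: coef_ft assms fc_hermitian)
 also have "\<dots> = cnj (dot (cnj_l2 (ft h)) (ft g))" unfolding dot_def coef_cnj_l2 by (rule infsum_cnj)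
 finally have "Im (dot (cnj_l2 (ft h)) (ft g)) = 0" by (simp add: complex_eq_iff)
 with re show ?thesis by (simp add: complex_eq_iff)
qed

lemma ft_eq_imp_L2_eq: assumes "g \<in> L2" "h \<in> L2" "ft g = ft h" shows "L2_eq g h"
proof -
 have "L2_norm (\<lambda>x. g x - h x) = 0" using L2_norm_ft[OF L2_diff[OF assms(1,2)]] assms by (simp add: ft_diff)
 from L2_norm_zero_AE[OF L2_diff[OF assms(1,2)] this] show ?thesis by (simp add: L2_eq_def)
qed

lemma L2_eq_imp_ft_eq: assumes "g \<in> L2" "h \<in> L2" "L2_eq g h" shows "ft g = ft h"
proof (rule l2_eqI)
 fix k
 show "coef (ft g) k = coef (ft h) k"
  using ip_cong_AE[of g h] assms by (simp add: coef_ft fc_def L2_eq_def)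
qed

subsection \<open>Derivatives and products\<close>

lemma ip_smooth: "smooth_torus g ==> smooth_torus h ==> ip g h = integral cell (\<lambda>x. g x * h x)"
 by (intro ip_continuous smooth_torus_cont)

lemma ip_by_parts:
 assumes "smooth_torus g" "smooth_torus h" "v \<in> {(1, 0), (0, 1)}"
 shows "ip (dir_deriv v g) h = - ip g (dir_deriv v h)"
proof -
 have "0 = integral cell (dir_deriv v (\<lambda>x. g x * h x))"
  using integral_dir_deriv_zero[OF smooth_torus_mult[OF assms(1,2)]] assms(3) by auto
 also have "\<dots> = integral cell (\<lambda>x. g x * dir_deriv v h x + dir_deriv v g x * h x)"
  using assms by (simp add: dir_deriv_mult smooth_torusD)
 also have "\<dots> = integral cell (\<lambda>x. g x * dir_deriv v h x) + integral cell (\<lambda>x. dir_deriv v g x * h x)"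
  unfolding cell_def using assms
  by (intro Henstock_Kurzweil_Integration.integral_add integrable_continuous continuous_intros smooth_torus_cont smooth_torus_dir_deriv)
 finally show ?thesis using assms by (simp add: ip_smooth smooth_torus_dir_deriv)
qed

lemma fc_dir_deriv:
 assumes "smooth_torus g" "v \<in> {(1, 0), (0, 1)}"
 shows "fc (dir_deriv v g) k = \<i> * phase k v * fc g k"
 using assms by (simp add: fc_def ip_by_parts smooth_torus_cosk smooth_torus_sink dir_deriv_cosk dir_deriv_sink
   ip_minus_right ip_cmult_right complex_eq_iff)

text \<open>The Fourier series of \<open>a\<close> translated by \<open>k\<close> pairs with \<open>g\<close> by Parseval, so the product corresponds to convolution.\<close>

lemma fc_smooth_mult:
 assumes a: "smooth_torus a" and g: "g \<in> L2"
 shows "((\<lambda>j. fc a (k - j) * fc g j) has_sum (2 * pi) * fc (\<lambda>x. a x * g x) k) UNIV"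
proof -
 define A where "A = (\<lambda>x. a x * cosk k x)"
 define B where "B = (\<lambda>x. a x * sink k x)"
 have st: "smooth_torus A" "smooth_torus B" unfolding A_def B_def
  by (intro smooth_torus_mult a smooth_torus_cosk smooth_torus_sink)+
 then have L: "A \<in> L2" "B \<in> L2" by (auto intro: smooth_torus_L2)
 have m: "ip (\<lambda>x. a x * g x) (cosk k) = ip g A" "ip (\<lambda>x. a x * g x) (sink k) = ip g B"
  by (simp_all add: ip_def A_def B_def mult_ac)
 have "(2 * pi) * fc (\<lambda>x. a x * g x) k = of_real (ip g A) + (- \<i>) * of_real (ip g B)"
  by (simp add: fc_def m complex_eq_iff)
 also have "\<dots> = dot (cnj_l2 (ft A)) (ft g) + (- \<i>) * dot (cnj_l2 (ft B)) (ft g)"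
  by (simp add: Parseval_complex g L)
 finally have e: "(2 * pi) * fc (\<lambda>x. a x * g x) k = dot (cnj_l2 (ft A)) (ft g) + (- \<i>) * dot (cnj_l2 (ft B)) (ft g)" .
 have hs: "((\<lambda>j. cnj (fc A j) * fc g j + (- \<i>) * (cnj (fc B j) * fc g j)) has_sum
   (dot (cnj_l2 (ft A)) (ft g) + (- \<i>) * dot (cnj_l2 (ft B)) (ft g))) UNIV"
  using dot_has_sum[of "cnj_l2 (ft A)" "ft g"] dot_has_sum[of "cnj_l2 (ft B)" "ft g"]
  by (intro has_sum_add has_sum_cmult_right) (simp_all add: coef_ft L g)
 have "cnj (fc A j) * fc g j + (- \<i>) * (cnj (fc B j) * fc g j) = fc a (k - j) * fc g j" for j
 proof -
  have ca: "continuous_on UNIV a" "continuous_on UNIV A" "continuous_on UNIV B" using a st by (auto intro: smooth_torus_cont)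
  have cont: "continuous_on UNIV (\<lambda>x. of_real (A x) * cnj (ech j x))" "continuous_on UNIV (\<lambda>x. of_real (B x) * cnj (ech j x))"
   using ca cont_ech[of UNIV j] by (auto intro!: continuous_intros)
  have "of_real (A x) * cnj (ech j x) + \<i> * (of_real (B x) * cnj (ech j x)) = of_real (a x) * cnj (ech (j - k) x)" for x
  proof -
   have "of_real (A x) + \<i> * of_real (B x) = of_real (a x) * ech k x"
    by (simp add: A_def B_def complex_eq_iff ech_Re_Im)
   then have "of_real (A x) * cnj (ech j x) + \<i> * (of_real (B x) * cnj (ech j x)) = of_real (a x) * ech k x * cnj (ech j x)"
    by (metis (no_types, lifting) distrib_right mult.assoc)
   then show ?thesis by (simp add: ech_diff mult_ac)
  qed
  then have "integral cell (\<lambda>x. of_real (a x) * cnj (ech (j - k) x)) =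
    integral cell (\<lambda>x. of_real (A x) * cnj (ech j x) + \<i> * (of_real (B x) * cnj (ech j x)))" by simp
  also have "\<dots> = integral cell (\<lambda>x. of_real (A x) * cnj (ech j x)) + integral cell (\<lambda>x. \<i> * (of_real (B x) * cnj (ech j x)))"
  proof -
   have c2: "continuous_on UNIV (\<lambda>x. \<i> * (of_real (B x) * cnj (ech j x)))"
    by (intro continuous_on_mult continuous_on_const cont(2))
   show ?thesis unfolding cell_def
    by (intro Henstock_Kurzweil_Integration.integral_add integrable_continuous
      continuous_on_subset[OF cont(1)] continuous_on_subset[OF c2] subset_UNIV)
  qed
  also have "\<dots> = integral cell (\<lambda>x. of_real (A x) * cnj (ech j x)) + \<i> * integral cell (\<lambda>x. of_real (B x) * cnj (ech j x))"
   by simp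
  finally have "fc a (j - k) = fc A j + \<i> * fc B j" by (simp add: fc_continuous ca add_divide_distrib)
  then have "cnj (fc a (j - k)) = cnj (fc A j) - \<i> * cnj (fc B j)" by simp
  moreover have "cnj (fc a (j - k)) = fc a (k - j)" using fc_hermitian[of a "j - k"] by simp
  ultimately have E: "fc a (k - j) = cnj (fc A j) - \<i> * cnj (fc B j)" by metis
  show ?thesis unfolding E by (simp add: algebra_simps)
 qed
 then show ?thesis using hs e by simp
qed

definition wt :: "freq => real" where "wt k = 1 + \<bar>of_int (fst k)\<bar> + \<bar>of_int (snd k)\<bar>"

fun iter_deriv :: "plane => nat => (plane => real) => plane => real" where
 "iter_deriv v 0 g = g"
| "iter_deriv v (Suc n) g = dir_deriv v (iter_deriv v n g)"

lemma smooth_torus_iter: "smooth_torus g ==> smooth_torus (iter_deriv v n g)"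
 by (induction n) auto

lemma fc_iter: "smooth_torus g ==> v \<in> {(1, 0), (0, 1)} ==> fc (iter_deriv v n g) k = (\<i> * phase k v) ^ n * fc g k"
 by (induction n) (simp_all add: fc_dir_deriv smooth_torus_iter mult_ac)

text \<open>Each derivative multiplies the coefficients by a component of the frequency and keeps them bounded.\<close>

lemma fc_decay:
 assumes "smooth_torus g" obtains C where "C >= 0" "!!k. wt k ^ n * cmod (fc g k) <= C"
proof -
 define C where "C = 3 ^ n * (L2_norm g + L2_norm (iter_deriv (1, 0) n g) + L2_norm (iter_deriv (0, 1) n g))"
 have L: "g \<in> L2" "iter_deriv v n g \<in> L2" for v using assms by (auto intro: smooth_torus_L2 smooth_torus_iter)
 have i: "\<bar>of_int (fst k)\<bar> ^ n * cmod (fc g k) <= L2_norm (iter_deriv (1, 0) n g)"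
   "\<bar>of_int (snd k)\<bar> ^ n * cmod (fc g k) <= L2_norm (iter_deriv (0, 1) n g)" for k
  using cmod_fc_le[OF L(2)[of "(1, 0)"], of k] cmod_fc_le[OF L(2)[of "(0, 1)"], of k]
  by (simp_all add: fc_iter assms norm_mult norm_power phase_def)
 have "wt k ^ n * cmod (fc g k) <= C" for k
 proof -
  define m where "m = max 1 (max \<bar>of_int (fst k)\<bar> \<bar>of_int (snd k) :: real\<bar>)"
  have "wt k <= 3 * m" by (simp add: wt_def m_def)
  then have "wt k ^ n <= (3 * m) ^ n" by (intro power_mono) (simp_all add: wt_def)
  then have "wt k ^ n * cmod (fc g k) <= 3 ^ n * (m ^ n * cmod (fc g k))"
   using mult_right_mono[of "wt k ^ n" "(3 * m) ^ n" "cmod (fc g k)"] by (simp add: power_mult_distrib mult.assoc)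
  also have "m ^ n * cmod (fc g k) <= L2_norm g + L2_norm (iter_deriv (1, 0) n g) + L2_norm (iter_deriv (0, 1) n g)"
  proof -
   consider "m = 1" | "m = \<bar>of_int (fst k)\<bar>" | "m = \<bar>of_int (snd k)\<bar>" unfolding m_def by linarith
   then show ?thesis
   proof cases
    case 1
    then have "m ^ n * cmod (fc g k) = cmod (fc g k)" by simp
    then show ?thesis using cmod_fc_le[OF L(1), of k] L2_norm_nonneg[of "iter_deriv (1, 0) n g"]
     L2_norm_nonneg[of "iter_deriv (0, 1) n g"] by linarith
   next
    case 2
    then have "m ^ n * cmod (fc g k) <= L2_norm (iter_deriv (1, 0) n g)" using i(1)[of k] by (simp only:)
    then show ?thesis using L2_norm_nonneg[of g] L2_norm_nonneg[of "iter_deriv (0, 1) n g"] by linarith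
   next
    case 3
    then have "m ^ n * cmod (fc g k) <= L2_norm (iter_deriv (0, 1) n g)" using i(2)[of k] by (simp only:)
    then show ?thesis using L2_norm_nonneg[of g] L2_norm_nonneg[of "iter_deriv (1, 0) n g"] by linarith
   qed
  qed
  finally show ?thesis by (simp add: C_def)
 qed
 moreover have "C >= 0" unfolding C_def by (intro mult_nonneg_nonneg add_nonneg_nonneg) auto
 ultimately show ?thesis using that by blast
qed

lemma continuous_AE_zero:
 assumes "continuous_on UNIV g" "periodic2 g" "L2_norm g = 0" shows "g x = 0"
proof -
 have "ip g g = 0" using assms(3) by (metis L2_norm_sq zero_power2)
 then have "integral cell (\<lambda>x. (g x)^2) = 0" by (simp add: ip_continuous assms(1) power2_eq_square)
 moreover have c: "continuous_on cell (\<lambda>x. (g x)^2)" by (intro continuous_intros continuous_on_subset[OF assms(1)]) auto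
 ultimately have hi: "((\<lambda>x. (g x)^2) has_integral 0) (cbox (0, 0) (2 * pi, 2 * pi))"
  using integrable_integral[OF integrable_continuous[of "(0,0)" "(2*pi,2*pi)" "\<lambda>x. (g x)^2"]] by (simp add: cell_def)
 obtain y where y: "y \<in> cell" "g y = g x" using periodic2_cell[OF assms(2)] .
 have "(g y)^2 = 0"
 proof (rule has_integral_0_cbox_imp_0[OF _ _ hi])
  show "continuous_on (cbox (0, 0) (2 * pi, 2 * pi)) (\<lambda>x. (g x)^2)" using c by (simp add: cell_def)
  have "(pi, pi) \<in> icell" by (simp add: mem_icell)
  then show "box (0, 0) (2 * pi, 2 * pi) ~= {}" by (auto simp: icell_def)
 qed (use y in \<open>auto simp: cell_def\<close>)
 then show ?thesis using y by simp
qed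

lemma fc_eq_imp_eq:
 assumes "smooth_torus g" "smooth_torus h" "!!k. fc g k = fc h k" shows "g = h"
proof
 fix x
 have d: "smooth_torus (\<lambda>x. g x - h x)" using assms by auto
 have "ft g = ft h" by (rule l2_eqI) (simp add: coef_ft smooth_torus_L2 assms)
 then have "L2_norm (\<lambda>x. g x - h x) = 0"
  using L2_norm_ft[OF smooth_torus_L2[OF d]] assms by (simp add: ft_diff smooth_torus_L2)
 from continuous_AE_zero[OF smooth_torus_cont[OF d] smooth_torusD(2)[OF d] this, of x]
 show "g x = h x" by simp
qed

lemma dir_deriv_commute:
 assumes "smooth_torus g" "v \<in> {(1, 0), (0, 1)}" "w \<in> {(1, 0), (0, 1)}"
 shows "dir_deriv v (dir_deriv w g) = dir_deriv w (dir_deriv v g)"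
 by (rule fc_eq_imp_eq) (use assms in \<open>auto simp: fc_dir_deriv smooth_torus_dir_deriv mult_ac\<close>)

section \<open>Lattice systems with bounded Hermitian part\<close>

text \<open>Both signs of time are needed, because the problem is posed on the whole line.\<close>

lemma gronwall_abs:
 fixes Z Z' :: "real => real"
 assumes d: "!!s. \<bar>s\<bar> <= T ==> (Z has_real_derivative Z' s) (at s)"
  and b: "!!s. \<bar>s\<bar> <= T ==> \<bar>Z' s\<bar> <= K * Z s" and t: "\<bar>t\<bar> <= T"
 shows "Z t <= exp (K * \<bar>t\<bar>) * Z 0"
proof (cases "0 <= t")
 case True
 have "exp (- K * t) * Z t <= exp (- K * 0) * Z 0"
 proof (rule DERIV_nonpos_imp_nonincreasing[OF True])
  fix s assume s: "0 <= s" "s <= t"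
  have "((\<lambda>s. exp (- K * s) * Z s) has_real_derivative exp (- K * s) * (Z' s - K * Z s)) (at s)"
   using d[of s] s t by (auto intro!: derivative_eq_intros simp: algebra_simps)
  moreover have "exp (- K * s) * (Z' s - K * Z s) <= 0"
   using b[of s] s t by (intro mult_nonneg_nonpos) auto
  ultimately show "\<exists>y. ((\<lambda>s. exp (- K * s) * Z s) has_real_derivative y) (at s) \<and> y <= 0" by blast
 qed
 then have "exp (K * t) * (exp (- K * t) * Z t) <= exp (K * t) * Z 0" by simp
 then show ?thesis using True by (simp add: exp_minus flip: mult.assoc)
next
 case False
 then have t0: "t <= 0" by simp
 have "exp (K * t) * Z t <= exp (K * 0) * Z 0"
 proof (rule DERIV_nonneg_imp_nondecreasing[OF t0])
  fix s assume s: "t <= s" "s <= 0"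
  have "((\<lambda>s. exp (K * s) * Z s) has_real_derivative exp (K * s) * (Z' s + K * Z s)) (at s)"
   using d[of s] s t False by (auto intro!: derivative_eq_intros simp: algebra_simps)
  moreover have "exp (K * s) * (Z' s + K * Z s) >= 0"
   using b[of s] s t False by (intro mult_nonneg_nonneg) auto
  ultimately show "\<exists>y. ((\<lambda>s. exp (K * s) * Z s) has_real_derivative y) (at s) \<and> 0 <= y" by blast
 qed
 then have "exp (- K * t) * (exp (K * t) * Z t) <= exp (- K * t) * Z 0" by simp
 then show ?thesis using False by (simp add: exp_minus flip: mult.assoc)
qed

text \<open>The exponential series of the matrix.\<close>

lemma finite_linear_ode:
 fixes a :: "freq => freq => complex" and x0 :: "freq => complex"
 assumes F: "finite F"
 shows "\<exists>v :: real => freq => complex. v 0 = x0 \<and>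
  (\<forall>t. \<forall>k\<in>F. ((\<lambda>t. v t k) has_vector_derivative (\<Sum>j\<in>F. a k j * v t j)) (at t))"
proof -
 define X where "X n = ((\<lambda>x k. \<Sum>j\<in>F. a k j * x j) ^^ n) x0" for n :: nat
 define B where "B = (\<Sum>k\<in>F. \<Sum>j\<in>F. cmod (a k j))"
 define C where "C = (\<Sum>k\<in>F. cmod (x0 k))"
 have XS: "X (Suc n) k = (\<Sum>j\<in>F. a k j * X n j)" for n k by (simp add: X_def)
 have B0: "B >= 0" unfolding B_def by (intro sum_nonneg) auto
 have Xb: "cmod (X n k) <= C * B ^ n" if "k \<in> F" for n k
  using that
 proof (induction n arbitrary: k)
  case 0
  then show ?case unfolding C_def X_def using F by (auto intro: member_le_sum)
 next
  case (Suc n)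
  have "cmod (X (Suc n) k) <= (\<Sum>j\<in>F. cmod (a k j) * cmod (X n j))"
   unfolding XS by (rule sum_norm_le) (simp add: norm_mult)
  also have "\<dots> <= (\<Sum>j\<in>F. cmod (a k j) * (C * B ^ n))"
   by (intro sum_mono mult_left_mono Suc.IH) auto
  also have "\<dots> = (\<Sum>j\<in>F. cmod (a k j)) * (C * B ^ n)" by (simp add: sum_distrib_right)
  also have "\<dots> <= B * (C * B ^ n)"
  proof (rule mult_right_mono)
   show "(\<Sum>j\<in>F. cmod (a k j)) <= B" unfolding B_def
    using F Suc.prems by (intro member_le_sum) (auto intro: sum_nonneg)
   show "0 <= C * B ^ n" using B0 unfolding C_def by (intro mult_nonneg_nonneg sum_nonneg) auto
  qed
  finally show ?case by (simp add: mult_ac)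
 qed
 define c where "c k n = X n k / fact n" for k n
 have sm: "summable (\<lambda>n. c k n * z ^ n)" if "k \<in> F" for k z
 proof (rule summable_comparison_test')
  show "summable (\<lambda>n. C * ((B * cmod z) ^ n /\<^sub>R fact n))"
   using summable_exp_generic[of "B * cmod z"] by (intro summable_mult) (simp add: divide_inverse mult.commute)
  fix n
  have "norm (c k n * z ^ n) = cmod (X n k) * (cmod z ^ n / fact n)"
   by (simp add: c_def norm_mult norm_divide norm_power)
  also have "\<dots> <= C * B ^ n * (cmod z ^ n / fact n)"
   by (rule mult_right_mono[OF Xb[OF that, of n]]) simp
  also have "\<dots> = C * ((B * cmod z) ^ n /\<^sub>R fact n)"
   by (simp add: power_mult_distrib divide_inverse mult_ac)
  finally show "norm (c k n * z ^ n) <= C * ((B * cmod z) ^ n /\<^sub>R fact n)" .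
 qed
 define w where "w k z = (\<Sum>n. c k n * z ^ n)" for k and z :: complex
 have dc: "diffs (c k) n = (\<Sum>j\<in>F. a k j * c j n)" for k n
 proof -
  have "diffs (c k) n = X (Suc n) k / fact n"
   by (simp add: diffs_def c_def fact_Suc del: of_nat_Suc)
  then show ?thesis by (simp add: XS c_def sum_divide_distrib)
 qed
 have dw: "(w k has_field_derivative (\<Sum>j\<in>F. a k j * w j z)) (at z)" if k: "k \<in> F" for k z
 proof -
  have "(w k has_field_derivative (\<Sum>n. diffs (c k) n * z ^ n)) (at z)"
   unfolding w_def by (rule termdiffs_strong_converges_everywhere[OF sm[OF k]])
  also have "(\<Sum>n. diffs (c k) n * z ^ n) = (\<Sum>n. \<Sum>j\<in>F. a k j * (c j n * z ^ n))"
   by (simp add: dc sum_distrib_right mult.assoc)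
  also have "\<dots> = (\<Sum>j\<in>F. \<Sum>n. a k j * (c j n * z ^ n))"
   by (rule suminf_sum) (intro summable_mult sm)
  also have "\<dots> = (\<Sum>j\<in>F. a k j * w j z)"
   unfolding w_def by (intro sum.cong refl suminf_mult sm)
  finally show ?thesis .
 qed
 define v where "v t k = (if k \<in> F then w k (of_real t) else x0 k)" for t :: real and k
 have "v 0 = x0"
 proof
  fix k
  have "w k 0 = c k 0" unfolding w_def by (rule powser_zero)
  then show "v 0 k = x0 k" by (simp add: v_def c_def X_def)
 qed
 moreover have "((\<lambda>t. v t k) has_vector_derivative (\<Sum>j\<in>F. a k j * v t j)) (at t)" if "k \<in> F" for t k
  using has_vector_derivative_real_field[OF dw[OF that, of "of_real t"]] that by (simp add: v_def)
 ultimately show ?thesis by blast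
qed

subsection \<open>Weights\<close>

lemma wt_ge_1: "wt k >= 1" by (simp add: wt_def)
lemma wt_pos: "wt k > 0" by (simp add: wt_def add_pos_nonneg)
lemma wt_minus: "wt (- k) = wt k" by (simp add: wt_def)
lemma wt_diff_le: "\<bar>wt k - wt j\<bar> <= wt (k - j)" unfolding wt_def by (simp add: abs_if)
lemma wt_le_mult: "wt k <= wt j * wt (k - j)"
proof -
 have "wt k <= wt j + wt (k - j) - 1" unfolding wt_def by (simp add: abs_if)
 moreover have "0 <= (wt j - 1) * (wt (k - j) - 1)" using wt_ge_1 by (intro mult_nonneg_nonneg) auto
 ultimately show ?thesis by (simp add: algebra_simps)
qed
lemma wt_le_mult': "wt j <= wt k * wt (k - j)"
 using wt_le_mult[of j k] wt_minus[of "k - j"] by simp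
lemma wt_not_fbox: "k \<notin> fbox n ==> real n + 1 <= wt k"
 by (auto simp: mem_fbox wt_def not_le)

text \<open>Use \<open>2 a b \<le> a\<^sup>2 + b\<^sup>2\<close> and sum the convolution kernel first.\<close>

lemma Schur_bound:
 fixes H :: "freq => real"
 assumes H: "!!l. 0 <= H l" "H summable_on UNIV" and F: "finite F" "finite G"
 shows "(\<Sum>k\<in>F. \<Sum>j\<in>G. H (k - j) * a k * b j) <= infsum H UNIV / 2 * ((\<Sum>k\<in>F. (a k)^2) + (\<Sum>j\<in>G. (b j)^2))"
proof -
 define S where "S = infsum H UNIV"
 have row: "(\<Sum>j\<in>G. H (k - j)) <= S" for k
 proof -
  have "(\<Sum>j\<in>G. H (k - j)) = sum H ((\<lambda>j. k - j) ` G)"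
   by (subst sum.reindex) (auto simp: inj_on_def)
  also have "\<dots> <= S" unfolding S_def using F H by (intro finite_sum_le_infsum) auto
  finally show ?thesis .
 qed
 have col: "(\<Sum>k\<in>F. H (k - j)) <= S" for j
 proof -
  have "(\<Sum>k\<in>F. H (k - j)) = sum H ((\<lambda>k. k - j) ` F)"
   by (subst sum.reindex) (auto simp: inj_on_def)
  also have "\<dots> <= S" unfolding S_def using F H by (intro finite_sum_le_infsum) auto
  finally show ?thesis .
 qed
 have "(\<Sum>k\<in>F. \<Sum>j\<in>G. H (k - j) * a k * b j) <= (\<Sum>k\<in>F. \<Sum>j\<in>G. H (k - j) * ((a k)^2 / 2) + H (k - j) * ((b j)^2 / 2))"
 proof (intro sum_mono)
  fix k j
  have "a k * b j <= (a k)^2 / 2 + (b j)^2 / 2" using sum_squares_bound[of "a k" "b j"] by simp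
  then have "H (k - j) * (a k * b j) <= H (k - j) * ((a k)^2 / 2 + (b j)^2 / 2)"
   using H(1) by (rule mult_left_mono)
  then show "H (k - j) * a k * b j <= H (k - j) * ((a k)^2 / 2) + H (k - j) * ((b j)^2 / 2)"
   by (simp only: distrib_left mult.assoc)
 qed
 also have "\<dots> = (\<Sum>k\<in>F. (\<Sum>j\<in>G. H (k - j)) * ((a k)^2 / 2)) + (\<Sum>k\<in>F. \<Sum>j\<in>G. H (k - j) * ((b j)^2 / 2))"
  by (simp only: sum.distrib sum_distrib_right)
 also have "(\<Sum>k\<in>F. \<Sum>j\<in>G. H (k - j) * ((b j)^2 / 2)) = (\<Sum>j\<in>G. (\<Sum>k\<in>F. H (k - j)) * ((b j)^2 / 2))"
  by (subst sum.swap) (simp only: sum_distrib_right)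
 also have "(\<Sum>k\<in>F. (\<Sum>j\<in>G. H (k - j)) * ((a k)^2 / 2)) + (\<Sum>j\<in>G. (\<Sum>k\<in>F. H (k - j)) * ((b j)^2 / 2))
   <= (\<Sum>k\<in>F. S * ((a k)^2 / 2)) + (\<Sum>j\<in>G. S * ((b j)^2 / 2))"
  by (intro add_mono sum_mono mult_right_mono row col) auto
 also have "\<dots> = S / 2 * ((\<Sum>k\<in>F. (a k)^2) + (\<Sum>j\<in>G. (b j)^2))"
  by (simp add: sum_distrib_left distrib_left)
 finally show ?thesis by (simp add: S_def)
qed

text \<open>In the energy only the Hermitian part of the weighted matrix counts, so unbounded skew entries cost nothing.\<close>

lemma symmetrized_bound:
 fixes H \<mu> \<nu> :: "freq => real" and N :: "freq => freq => complex"
 assumes H: "!!l. 0 <= H l" "H summable_on UNIV" and F: "finite F"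
  and b: "!!k j. cmod (of_real (\<mu> k) * N k j + of_real (\<mu> j) * cnj (N j k)) <= \<nu> k * \<nu> j * H (k - j)"
 shows "\<bar>2 * (\<Sum>k\<in>F. \<Sum>j\<in>F. \<mu> k * (v k \<bullet> (N k j * v j)))\<bar> <= infsum H UNIV * (\<Sum>k\<in>F. (\<nu> k * cmod (v k))^2)"
proof -
 define P where "P k j = \<mu> k * (v k \<bullet> (N k j * v j))" for k j
 have e: "P k j + P j k = v k \<bullet> ((of_real (\<mu> k) * N k j + of_real (\<mu> j) * cnj (N j k)) * v j)" for k j
  by (simp add: P_def inner_complex_def algebra_simps)
 have "2 * (\<Sum>k\<in>F. \<Sum>j\<in>F. P k j) = (\<Sum>k\<in>F. \<Sum>j\<in>F. P k j) + (\<Sum>k\<in>F. \<Sum>j\<in>F. P j k)"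
  by (subst (3) sum.swap) simp
 also have "\<dots> = (\<Sum>k\<in>F. \<Sum>j\<in>F. v k \<bullet> ((of_real (\<mu> k) * N k j + of_real (\<mu> j) * cnj (N j k)) * v j))"
  by (simp add: e flip: sum.distrib)
 finally have "\<bar>2 * (\<Sum>k\<in>F. \<Sum>j\<in>F. P k j)\<bar> <= (\<Sum>k\<in>F. \<Sum>j\<in>F. \<bar>v k \<bullet> ((of_real (\<mu> k) * N k j + of_real (\<mu> j) * cnj (N j k)) * v j)\<bar>)"
  by (simp only:) (rule order_trans[OF sum_abs sum_mono[OF sum_abs]])
 also have "\<dots> <= (\<Sum>k\<in>F. \<Sum>j\<in>F. H (k - j) * (\<nu> k * cmod (v k)) * (\<nu> j * cmod (v j)))"
 proof (intro sum_mono)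
  fix k j
  have "\<bar>v k \<bullet> ((of_real (\<mu> k) * N k j + of_real (\<mu> j) * cnj (N j k)) * v j)\<bar> <= cmod (v k) * (cmod (of_real (\<mu> k) * N k j + of_real (\<mu> j) * cnj (N j k)) * cmod (v j))"
   using Cauchy_Schwarz_ineq2[of "v k" "(of_real (\<mu> k) * N k j + of_real (\<mu> j) * cnj (N j k)) * v j"]
   by (simp only: norm_mult)
  also have "\<dots> <= cmod (v k) * ((\<nu> k * \<nu> j * H (k - j)) * cmod (v j))"
   by (intro mult_left_mono mult_right_mono b) auto
  finally show "\<bar>v k \<bullet> ((of_real (\<mu> k) * N k j + of_real (\<mu> j) * cnj (N j k)) * v j)\<bar> <= H (k - j) * (\<nu> k * cmod (v k)) * (\<nu> j * cmod (v j))"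
   by (simp add: mult_ac)
 qed
 also have "\<dots> <= infsum H UNIV / 2 * ((\<Sum>k\<in>F. (\<nu> k * cmod (v k))^2) + (\<Sum>k\<in>F. (\<nu> k * cmod (v k))^2))"
  by (rule Schur_bound[OF H F F])
 finally show ?thesis by (simp add: P_def)
qed

text \<open>The equation \<open>x\<^sub>k' = i \<omega>\<^sub>k x\<^sub>k + \<Sum>\<^sub>j N\<^sub>k\<^sub>j x\<^sub>j\<close>. The entries of \<open>N\<close> grow with one power of the frequency, as for a first order operator, and decay rapidly away from the diagonal; the Hermitian part \<open>N + N\<^sup>*\<close> has no growth.\<close>

locale lattice_system =
 fixes om :: "freq => real" and N :: "freq => freq => complex" and h :: "freq => real"
 assumes h_nonneg: "0 <= h l" and h_sum: "(\<lambda>l. wt l ^ 4 * h l) summable_on UNIV"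
  and N_le1: "cmod (N k j) <= wt k * h (k - j)"
  and N_le2: "cmod (N k j) <= wt j * h (k - j)"
  and N_le3: "cmod (N j k) <= wt k * h (k - j)"
  and N_le4: "cmod (N j k) <= wt j * h (k - j)"
  and N_skew: "cmod (N k j + cnj (N j k)) <= h (k - j)"
begin

definition H :: "freq => real" where "H l = 5 * (wt l ^ 4 * h l)"
definition K :: real where "K = 1 + infsum H UNIV"

lemma H_nonneg: "0 <= H l" using h_nonneg[of l] wt_pos[of l] by (simp add: H_def)
lemma H_sum: "H summable_on UNIV" unfolding H_def[abs_def] by (intro summable_on_cmult_right h_sum)
lemma K_ge: "infsum H UNIV <= K" "1 <= K" "0 < K"
 using infsum_nonneg[of UNIV H] H_nonneg by (auto simp: K_def add_pos_nonneg)

lemma power_h_le_H: assumes "n <= 4" "0 <= c" "c <= 5" shows "c * (wt l ^ n * h l) <= H l"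
 unfolding H_def using assms h_nonneg[of l] wt_ge_1[of l]
 by (intro mult_mono mult_right_mono power_increasing) auto

lemma h_le_H: "h l <= H l" using power_h_le_H[of 0 1 l] by simp

lemma weight_one: "cmod (of_real 1 * N k j + of_real 1 * cnj (N j k)) <= 1 * 1 * H (k - j)"
 using N_skew[of k j] h_le_H[of "k - j"] by simp

lemma weight_commutator:
 "cmod (of_real m * N k j + of_real m' * cnj (N j k)) <= \<bar>m\<bar> * h (k - j) + \<bar>m' - m\<bar> * cmod (N j k)"
proof -
 have "of_real m * N k j + of_real m' * cnj (N j k) = of_real m * (N k j + cnj (N j k)) + of_real (m' - m) * cnj (N j k)"
  by (simp add: algebra_simps)
 then have "cmod (of_real m * N k j + of_real m' * cnj (N j k)) <= cmod (of_real m * (N k j + cnj (N j k))) + cmod (of_real (m' - m) * cnj (N j k))"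
  by (metis norm_triangle_ineq)
 also have "\<dots> = \<bar>m\<bar> * cmod (N k j + cnj (N j k)) + \<bar>m' - m\<bar> * cmod (N j k)"
  by (simp only: norm_mult norm_of_real complex_mod_cnj)
 also have "\<dots> <= \<bar>m\<bar> * h (k - j) + \<bar>m' - m\<bar> * cmod (N j k)"
  by (intro add_mono mult_left_mono N_skew) auto
 finally show ?thesis .
qed

text \<open>Conjugating with the weight costs a commutator that is one order lower, so the weighted energy is controlled as well.\<close>

lemma weight_four: "cmod (of_real (wt k ^ 4) * N k j + of_real (wt j ^ 4) * cnj (N j k)) <= (wt k)^2 * (wt j)^2 * H (k - j)"
proof -
 define a b L where "a = wt k" and "b = wt j" and "L = wt (k - j)"
 have p: "a > 0" "b > 0" "L >= 1" by (auto simp: a_def b_def L_def wt_pos wt_ge_1)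
 have ab: "a <= b * L" "b <= a * L" "\<bar>a - b\<bar> <= L" unfolding a_def b_def L_def
  by (rule wt_le_mult wt_le_mult' wt_diff_le)+
 have h0: "0 <= h (k - j)" by (rule h_nonneg)
 have "a ^ 4 = a^2 * a^2" by (simp flip: power_add)
 also have "\<dots> <= a^2 * (b * L)^2" using ab p by (intro mult_left_mono power_mono) auto
 finally have t1: "a ^ 4 <= a^2 * b^2 * L^2" by (simp add: power_mult_distrib mult.assoc)
 have "b ^ 4 - a ^ 4 = (b - a) * (a + b) * (a^2 + b^2)" by (simp add: algebra_simps power2_eq_square power4_eq_xxxx)
 then have "\<bar>b ^ 4 - a ^ 4\<bar> = \<bar>a - b\<bar> * (a + b) * (a^2 + b^2)" using p by (simp add: abs_mult abs_minus_commute)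
 also have "\<dots> <= L * (2 * (b * L)) * (2 * (a * b * L))"
 proof (intro mult_mono)
  have "b * 1 <= b * L" using p by (intro mult_left_mono) auto
  then show "a + b <= 2 * (b * L)" using ab by simp
  have "a * a <= a * (b * L)" "b * b <= b * (a * L)" using ab p by (auto intro!: mult_left_mono)
  then show "a^2 + b^2 <= 2 * (a * b * L)" by (simp add: power2_eq_square mult_ac)
 qed (use ab p in auto)
 finally have t2: "\<bar>b ^ 4 - a ^ 4\<bar> <= 4 * a * b^2 * L ^ 3" by (simp add: power2_eq_square power3_eq_cube mult_ac)
 have Njk: "cmod (N j k) <= a * h (k - j)" unfolding a_def by (rule N_le3)
 have "cmod (of_real (a ^ 4) * N k j + of_real (b ^ 4) * cnj (N j k)) <= \<bar>a ^ 4\<bar> * h (k - j) + \<bar>b ^ 4 - a ^ 4\<bar> * cmod (N j k)"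
  by (rule weight_commutator)
 also have "\<dots> <= (a^2 * b^2 * L^2) * h (k - j) + (4 * a * b^2 * L ^ 3) * (a * h (k - j))"
  using t1 t2 Njk h0 p by (intro add_mono mult_mono) auto
 also have "\<dots> = a^2 * b^2 * (1 * (L^2 * h (k - j)) + 4 * (L ^ 3 * h (k - j)))"
  by (simp add: power2_eq_square algebra_simps)
 also have "\<dots> <= a^2 * b^2 * H (k - j)"
 proof (rule mult_left_mono)
  have "1 * (L^2 * h (k - j)) <= 1 * (L ^ 4 * h (k - j))" "4 * (L ^ 3 * h (k - j)) <= 4 * (L ^ 4 * h (k - j))"
   using p h0 by (intro mult_left_mono mult_right_mono power_increasing; simp)+
  then show "1 * (L^2 * h (k - j)) + 4 * (L ^ 3 * h (k - j)) <= H (k - j)" by (simp add: H_def L_def)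
 qed simp
 finally show ?thesis by (simp add: a_def b_def)
qed

text \<open>A frequency cutoff with Lipschitz constant \<open>1 / R\<close>: its commutator with \<open>N\<close> is bounded uniformly in \<open>R\<close>, because the growth of \<open>N\<close> on the support is at most \<open>R\<close>.\<close>

definition cut :: "real => freq => real" where "cut R k = max 0 (1 - wt k / R)"

lemma cut_range: "R > 0 ==> 0 <= cut R k" "R > 0 ==> cut R k <= 1"
 using wt_pos[of k] by (auto simp: cut_def)

lemma weight_cut: assumes R: "R > 0"
 shows "cmod (of_real (cut R k) * N k j + of_real (cut R j) * cnj (N j k)) <= 1 * 1 * H (k - j)"
proof -
 define L where "L = wt (k - j)"
 have L: "L >= 1" by (simp add: L_def wt_ge_1)
 have h0: "0 <= h (k - j)" by (rule h_nonneg)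
 have "\<bar>cut R j - cut R k\<bar> <= \<bar>wt k / R - wt j / R\<bar>" unfolding cut_def by linarith
 also have "\<dots> = \<bar>wt k - wt j\<bar> / R" using R by (simp add: diff_divide_distrib[symmetric])
 also have "\<dots> <= L / R" using R wt_diff_le[of k j] by (simp add: L_def divide_right_mono)
 finally have d: "\<bar>cut R j - cut R k\<bar> <= L / R" .
 have "\<bar>cut R j - cut R k\<bar> * cmod (N j k) <= L * h (k - j)"
 proof (cases "wt k >= R \<and> wt j >= R")
  case True
  then have "cut R j = 0" "cut R k = 0" using R by (auto simp: cut_def)
  then show ?thesis using L h0 by simp
 next
  case False
  then have "cmod (N j k) <= R * h (k - j)"
   using N_le3[of j k] N_le4[of j k] mult_right_mono[OF _ h0, of "wt k" R] mult_right_mono[OF _ h0, of "wt j" R] by linarith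
  then have "\<bar>cut R j - cut R k\<bar> * cmod (N j k) <= L / R * (R * h (k - j))"
   using d R L by (intro mult_mono) auto
  then show ?thesis using R by simp
 qed
 moreover have "\<bar>cut R k\<bar> * h (k - j) <= 1 * h (k - j)"
  using cut_range[OF R, of k] h0 by (intro mult_right_mono) auto
 moreover have "1 * h (k - j) + L * h (k - j) <= H (k - j)"
 proof -
  have "L ^ 0 * h (k - j) <= L ^ 4 * h (k - j)" "L ^ 1 * h (k - j) <= L ^ 4 * h (k - j)"
   using L h0 by (intro mult_right_mono power_increasing; simp)+
  moreover have "0 <= L ^ 4 * h (k - j)" using L h0 by simp
  ultimately show ?thesis by (simp add: H_def L_def)
 qed
 ultimately show ?thesis using weight_commutator[of "cut R k" k j "cut R j"] by simp
qed

end

subsection \<open>Truncated flows\<close>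

context lattice_system
begin

lemma energy_deriv:
 fixes v :: "real => freq => complex" and \<mu> :: "freq => real"
 assumes F: "finite F"
  and d: "!!k. k \<in> F ==> ((\<lambda>t. v t k) has_vector_derivative (\<i> * om k * v t k + s k)) (at t)"
 shows "((\<lambda>t. \<Sum>k\<in>F. \<mu> k * (cmod (v t k))^2) has_real_derivative 2 * (\<Sum>k\<in>F. \<mu> k * (v t k \<bullet> s k))) (at t)"
proof -
 have "((\<lambda>t. (cmod (v t k))^2) has_real_derivative 2 * (v t k \<bullet> s k)) (at t)" if "k \<in> F" for k
 proof -
  have z: "v t k \<bullet> (\<i> * om k * v t k) = 0" by (simp add: inner_complex_def algebra_simps)
  have "((\<lambda>t. v t k \<bullet> v t k) has_vector_derivative
    (v t k \<bullet> (\<i> * om k * v t k + s k) + (\<i> * om k * v t k + s k) \<bullet> v t k)) (at t)"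
   by (rule bounded_bilinear.has_vector_derivative[OF bounded_bilinear_inner d[OF that] d[OF that]])
  moreover have "v t k \<bullet> (\<i> * om k * v t k + s k) + (\<i> * om k * v t k + s k) \<bullet> v t k = 2 * (v t k \<bullet> s k)"
   using z by (simp add: inner_add_right inner_add_left inner_commute)
  ultimately show ?thesis
   by (simp add: has_real_derivative_iff_has_vector_derivative power2_norm_eq_inner)
 qed
 then have "((\<lambda>t. \<Sum>k\<in>F. \<mu> k * (cmod (v t k))^2) has_real_derivative (\<Sum>k\<in>F. \<mu> k * (2 * (v t k \<bullet> s k)))) (at t)"
  by (intro DERIV_sum DERIV_cmult) auto
 also have "(\<Sum>k\<in>F. \<mu> k * (2 * (v t k \<bullet> s k))) = 2 * (\<Sum>k\<in>F. \<mu> k * (v t k \<bullet> s k))"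
  by (simp add: sum_distrib_left mult_ac)
 finally show ?thesis .
qed

definition flow_coef :: "nat => l2 => real => freq => complex" where
 "flow_coef n x = (SOME v. v 0 = coef x \<and> (\<forall>t. \<forall>k\<in>fbox n. ((\<lambda>t. v t k) has_vector_derivative
   (\<Sum>j\<in>fbox n. ((if j = k then \<i> * om k else 0) + N k j) * v t j)) (at t)))"

text \<open>The flow of the system cut off to a box. It preserves the energy estimates because cutting off rows and columns keeps the Hermitian part bounded.\<close>

definition Fl :: "nat => real => l2 => l2" where
 "Fl n t x = (\<Sum>k\<in>fbox n. unit_l2 k (flow_coef n x t k))"

lemma coef_Fl: "coef (Fl n t x) k = (if k \<in> fbox n then flow_coef n x t k else 0)"
 by (simp add: Fl_def coef_sum)

lemma flow_coef:
 "flow_coef n x 0 = coef x"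
 "k \<in> fbox n ==> ((\<lambda>t. flow_coef n x t k) has_vector_derivative
   (\<Sum>j\<in>fbox n. ((if j = k then \<i> * om k else 0) + N k j) * flow_coef n x t j)) (at t)"
 using someI_ex[OF finite_linear_ode[of "fbox n" "coef x" "\<lambda>k j. (if j = k then \<i> * om k else 0) + N k j"]]
 unfolding flow_coef_def by auto

lemma Fl_0: "Fl n 0 x = trunc (fbox n) x"
 by (rule l2_eqI) (simp add: coef_Fl flow_coef)

lemma Fl_deriv: assumes "k \<in> fbox n"
 shows "((\<lambda>t. coef (Fl n t x) k) has_vector_derivative
  (\<i> * om k * coef (Fl n t x) k + (\<Sum>j\<in>fbox n. N k j * coef (Fl n t x) j))) (at t)"
proof -
 have "(\<Sum>j\<in>fbox n. ((if j = k then \<i> * om k else 0) + N k j) * flow_coef n x t j)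
  = (\<Sum>j\<in>fbox n. (if j = k then \<i> * om k * flow_coef n x t j else 0)) + (\<Sum>j\<in>fbox n. N k j * flow_coef n x t j)"
  unfolding sum.distrib[symmetric] by (rule sum.cong) (auto simp: distrib_right)
 also have "\<dots> = \<i> * om k * coef (Fl n t x) k + (\<Sum>j\<in>fbox n. N k j * coef (Fl n t x) j)"
  using assms by (simp add: coef_Fl)
 finally show ?thesis using flow_coef(2)[OF assms, of x t] assms by (simp add: coef_Fl)
qed

lemma norm_Fl_sq:
 "(norm (Fl n t x - Fl n t y))^2 = (\<Sum>k\<in>fbox n. (cmod (coef (Fl n t x) k - coef (Fl n t y) k))^2)"
 by (subst norm_finite_support[of "fbox n"]) (auto simp: coef_Fl)

lemma Fl_diff_le: "(norm (Fl n t x - Fl n t y))^2 <= exp (K * \<bar>t\<bar>) * (norm (x - y))^2"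
proof -
 define v where "v t k = coef (Fl n t x) k - coef (Fl n t y) k" for t k
 define Y where "Y t = (\<Sum>k\<in>fbox n. 1 * (cmod (v t k))^2)" for t
 have dv: "((\<lambda>t. v t k) has_vector_derivative (\<i> * om k * v t k + (\<Sum>j\<in>fbox n. N k j * v t j))) (at t)"
  if "k \<in> fbox n" for k t
  using has_vector_derivative_diff[OF Fl_deriv[OF that, of x t] Fl_deriv[OF that, of y t]]
  by (simp add: v_def algebra_simps sum_subtractf)
 have "Y t <= exp (K * \<bar>t\<bar>) * Y 0"
 proof (rule gronwall_abs[where T="\<bar>t\<bar>"])
  fix s
  show "(Y has_real_derivative 2 * (\<Sum>k\<in>fbox n. 1 * (v s k \<bullet> (\<Sum>j\<in>fbox n. N k j * v s j)))) (at s)"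
   unfolding Y_def by (rule energy_deriv[OF finite_fbox dv])
  have "\<bar>2 * (\<Sum>k\<in>fbox n. 1 * (v s k \<bullet> (\<Sum>j\<in>fbox n. N k j * v s j)))\<bar> <= infsum H UNIV * (\<Sum>k\<in>fbox n. (1 * cmod (v s k))^2)"
   using symmetrized_bound[OF H_nonneg H_sum finite_fbox[of n] weight_one, of "v s"]
   by (simp add: inner_sum_right)
  also have "\<dots> <= K * Y s" unfolding Y_def using K_ge by (simp add: mult_right_mono sum_nonneg)
  finally show "\<bar>2 * (\<Sum>k\<in>fbox n. 1 * (v s k \<bullet> (\<Sum>j\<in>fbox n. N k j * v s j)))\<bar> <= K * Y s" .
 qed simp
 moreover have "Y t = (norm (Fl n t x - Fl n t y))^2" by (simp add: norm_Fl_sq Y_def v_def)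
 moreover have "Y 0 <= (norm (x - y))^2"
 proof -
  have "Y 0 = (norm (trunc (fbox n) (x - y)))^2"
   by (subst norm_finite_support[of "fbox n"]) (auto simp: Y_def v_def Fl_0)
  then show ?thesis using norm_trunc_le[of "fbox n" "x - y"] by (simp add: power_mono)
 qed
 moreover from this have "exp (K * \<bar>t\<bar>) * Y 0 <= exp (K * \<bar>t\<bar>) * (norm (x - y))^2"
  by (rule mult_left_mono) simp
 ultimately show ?thesis by linarith
qed

lemma Fl_zero: "Fl n t 0 = 0"
proof -
 have "(norm (Fl n t 0 - Fl n t 0))^2 = 0" by simp
 define Y where "Y t = (\<Sum>k\<in>fbox n. 1 * (cmod (coef (Fl n t 0) k))^2)" for t
 have "Y t <= exp (K * \<bar>t\<bar>) * Y 0"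
 proof (rule gronwall_abs[where T="\<bar>t\<bar>"])
  fix s
  show "(Y has_real_derivative 2 * (\<Sum>k\<in>fbox n. 1 * (coef (Fl n s 0) k \<bullet> (\<Sum>j\<in>fbox n. N k j * coef (Fl n s 0) j)))) (at s)"
   unfolding Y_def by (rule energy_deriv[OF finite_fbox Fl_deriv])
  have "\<bar>2 * (\<Sum>k\<in>fbox n. 1 * (coef (Fl n s 0) k \<bullet> (\<Sum>j\<in>fbox n. N k j * coef (Fl n s 0) j)))\<bar> <= infsum H UNIV * (\<Sum>k\<in>fbox n. (1 * cmod (coef (Fl n s 0) k))^2)"
   using symmetrized_bound[OF H_nonneg H_sum finite_fbox[of n] weight_one, of "coef (Fl n s 0)"]
   by (simp add: inner_sum_right)
  also have "\<dots> <= K * Y s" unfolding Y_def using K_ge by (simp add: mult_right_mono sum_nonneg)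
  finally show "\<bar>2 * (\<Sum>k\<in>fbox n. 1 * (coef (Fl n s 0) k \<bullet> (\<Sum>j\<in>fbox n. N k j * coef (Fl n s 0) j)))\<bar> <= K * Y s" .
 qed simp
 moreover have "Y 0 = 0" by (simp add: Y_def Fl_0)
 ultimately have "(\<Sum>k\<in>fbox n. (cmod (coef (Fl n t 0) k))^2) <= 0" by (simp add: Y_def)
 moreover have "(norm (Fl n t 0))^2 = (\<Sum>k\<in>fbox n. (cmod (coef (Fl n t 0) k))^2)"
  by (rule norm_finite_support) (auto simp: coef_Fl)
 ultimately have "(norm (Fl n t 0))^2 <= 0" by linarith
 then show ?thesis by simp
qed

text \<open>Data with finitely many frequencies stay concentrated on low frequencies, uniformly in the size of the box.\<close>

lemma Fl_weight:
 "(\<Sum>k\<in>fbox n. wt k ^ 4 * (cmod (coef (Fl n t x) k))^2)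
  <= exp (K * \<bar>t\<bar>) * (\<Sum>k\<in>fbox n. wt k ^ 4 * (cmod (coef x k))^2)"
proof -
 define Y where "Y t = (\<Sum>k\<in>fbox n. wt k ^ 4 * (cmod (coef (Fl n t x) k))^2)" for t
 have "Y t <= exp (K * \<bar>t\<bar>) * Y 0"
 proof (rule gronwall_abs[where T="\<bar>t\<bar>"])
  fix s
  show "(Y has_real_derivative 2 * (\<Sum>k\<in>fbox n. wt k ^ 4 * (coef (Fl n s x) k \<bullet> (\<Sum>j\<in>fbox n. N k j * coef (Fl n s x) j)))) (at s)"
   unfolding Y_def by (rule energy_deriv[OF finite_fbox Fl_deriv])
  have "\<bar>2 * (\<Sum>k\<in>fbox n. wt k ^ 4 * (coef (Fl n s x) k \<bullet> (\<Sum>j\<in>fbox n. N k j * coef (Fl n s x) j)))\<bar>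
    <= infsum H UNIV * (\<Sum>k\<in>fbox n. ((wt k)^2 * cmod (coef (Fl n s x) k))^2)"
   using symmetrized_bound[OF H_nonneg H_sum finite_fbox[of n] weight_four, of "coef (Fl n s x)"]
   by (simp add: inner_sum_right sum_distrib_left)
  also have "(\<Sum>k\<in>fbox n. ((wt k)^2 * cmod (coef (Fl n s x) k))^2) = Y s"
   by (simp add: Y_def power_mult_distrib flip: power_mult)
  also have "infsum H UNIV * Y s <= K * Y s"
   unfolding Y_def using K_ge wt_pos by (intro mult_right_mono sum_nonneg mult_nonneg_nonneg) (auto intro: less_imp_le)
  finally show "\<bar>2 * (\<Sum>k\<in>fbox n. wt k ^ 4 * (coef (Fl n s x) k \<bullet> (\<Sum>j\<in>fbox n. N k j * coef (Fl n s x) j)))\<bar> <= K * Y s" .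
 qed simp
 then show ?thesis by (simp add: Y_def Fl_0)
qed

text \<open>The difference of two truncated flows solves the larger system with a source supported outside the smaller box, where the weighted estimate makes it small.\<close>

lemma Fl_cauchy_finite:
 assumes x: "!!k. k \<notin> fbox n0 ==> coef x k = 0" and mn: "n0 <= n" "n <= m" and t: "\<bar>t\<bar> <= T"
 defines "W \<equiv> exp (K * T) * (\<Sum>k\<in>fbox n0. wt k ^ 4 * (cmod (coef x k))^2)"
 shows "(norm (Fl m t x - Fl n t x))^2 <= exp (2 * K * T) * (W / (real n + 1))"
proof -
 have T: "T >= 0" using t by simp
 have sub: "fbox n \<subseteq> fbox m" "fbox n0 \<subseteq> fbox n" using fbox_mono[OF mn(2)] fbox_mono[OF mn(1)] by blast+
 define u where "u s k = coef (Fl n s x) k" for s k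
 define v where "v s k = coef (Fl m s x) k - u s k" for s k
 define r where "r s k = (if k \<in> fbox n then 0 else (\<Sum>j\<in>fbox n. N k j * u s j))" for s k
 define Y where "Y s = (\<Sum>k\<in>fbox m. 1 * (cmod (v s k))^2)" for s
 have u0: "u s k = 0" if "k \<notin> fbox n" for s k using that by (simp add: u_def coef_Fl)
 have dv: "((\<lambda>s. v s k) has_vector_derivative (\<i> * om k * v s k + ((\<Sum>j\<in>fbox m. N k j * v s j) + r s k))) (at s)"
  if k: "k \<in> fbox m" for k s
 proof -
  have su: "(\<Sum>j\<in>fbox m. N k j * u s j) = (\<Sum>j\<in>fbox n. N k j * u s j)"
   by (rule sum.mono_neutral_right) (use sub u0 in auto)
  have "((\<lambda>s. u s k) has_vector_derivative (\<i> * om k * u s k + ((\<Sum>j\<in>fbox n. N k j * u s j) - r s k))) (at s)"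
  proof (cases "k \<in> fbox n")
   case True
   then show ?thesis using Fl_deriv[OF True, of x s] by (simp add: u_def r_def)
  next
   case False
   then show ?thesis using u0 by (simp add: r_def)
  qed
  from has_vector_derivative_diff[OF Fl_deriv[OF k, of x s] this]
  show ?thesis by (simp add: v_def su[symmetric] algebra_simps sum_subtractf)
 qed
 have wn: "(\<Sum>k\<in>fbox n. wt k ^ 4 * (cmod (u s k))^2) <= W" if "\<bar>s\<bar> <= T" for s
 proof -
  have e: "(\<Sum>k\<in>fbox n. wt k ^ 4 * (cmod (coef x k))^2) = (\<Sum>k\<in>fbox n0. wt k ^ 4 * (cmod (coef x k))^2)"
   by (rule sum.mono_neutral_right) (use sub x in auto)
  have "(\<Sum>k\<in>fbox n. wt k ^ 4 * (cmod (u s k))^2) <= exp (K * \<bar>s\<bar>) * (\<Sum>k\<in>fbox n0. wt k ^ 4 * (cmod (coef x k))^2)"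
   using Fl_weight[of n s x] unfolding e u_def .
  also have "\<dots> <= W" unfolding W_def using that K_ge wt_pos
   by (intro mult_right_mono sum_nonneg mult_nonneg_nonneg) (auto intro: less_imp_le)
  finally show ?thesis .
 qed
 have W0: "W >= 0" unfolding W_def using wt_pos
  by (intro mult_nonneg_nonneg sum_nonneg) (auto intro: less_imp_le)
 define c where "c = W / (real n + 1)"
 have c0: "c >= 0" using W0 by (simp add: c_def)
 have rb: "\<bar>2 * (\<Sum>k\<in>fbox m. v s k \<bullet> r s k)\<bar> <= infsum H UNIV * (Y s + c)" if s: "\<bar>s\<bar> <= T" for s
 proof -
  have "\<bar>\<Sum>k\<in>fbox m. v s k \<bullet> r s k\<bar> <= (\<Sum>k\<in>fbox m. \<bar>v s k \<bullet> r s k\<bar>)" by (rule sum_abs)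
  also have "\<dots> <= (\<Sum>k\<in>fbox m. \<Sum>j\<in>fbox n. H (k - j) * cmod (v s k) * ((wt j)^2 * cmod (u s j) / (real n + 1)))"
  proof (rule sum_mono)
   fix k assume k: "k \<in> fbox m"
   show "\<bar>v s k \<bullet> r s k\<bar> <= (\<Sum>j\<in>fbox n. H (k - j) * cmod (v s k) * ((wt j)^2 * cmod (u s j) / (real n + 1)))"
   proof (cases "k \<in> fbox n")
    case True
    have "0 <= (\<Sum>j\<in>fbox n. H (k - j) * cmod (v s k) * ((wt j)^2 * cmod (u s j) / (real n + 1)))"
      by (intro sum_nonneg mult_nonneg_nonneg divide_nonneg_nonneg H_nonneg) simp_all
     then show ?thesis using True by (simp add: r_def)
   next
    case False
    have "\<bar>v s k \<bullet> r s k\<bar> <= cmod (v s k) * cmod (\<Sum>j\<in>fbox n. N k j * u s j)"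
     using Cauchy_Schwarz_ineq2[of "v s k" "r s k"] False by (simp add: r_def)
    also have "\<dots> <= cmod (v s k) * (\<Sum>j\<in>fbox n. H (k - j) * ((wt j)^2 * cmod (u s j) / (real n + 1)))"
    proof (intro mult_left_mono sum_norm_le)
     fix j
     have "cmod (N k j) <= wt j * h (k - j)" by (rule N_le2)
     also have "\<dots> <= H (k - j) * ((wt j)^2 / (real n + 1))"
     proof -
      have "(real n + 1) * (wt j * h (k - j)) <= (wt j * wt (k - j)) * (wt j * h (k - j))"
       using wt_not_fbox[OF False] wt_le_mult[of k j] h_nonneg wt_pos[of j] by (intro mult_right_mono) auto
      also have "\<dots> = (wt j)^2 * (1 * (wt (k - j) ^ 1 * h (k - j)))" by (simp add: power2_eq_square)
      also have "\<dots> <= (wt j)^2 * H (k - j)" by (intro mult_left_mono power_h_le_H) auto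
      finally show ?thesis by (simp add: field_simps)
     qed
     finally have "cmod (N k j) * cmod (u s j) <= H (k - j) * ((wt j)^2 / (real n + 1)) * cmod (u s j)"
      by (rule mult_right_mono) simp
     then show "cmod (N k j * u s j) <= H (k - j) * ((wt j)^2 * cmod (u s j) / (real n + 1))"
      by (simp add: norm_mult)
    qed simp
    also have "\<dots> = (\<Sum>j\<in>fbox n. H (k - j) * cmod (v s k) * ((wt j)^2 * cmod (u s j) / (real n + 1)))"
     by (simp only: sum_distrib_left mult_ac)
    finally show ?thesis .
   qed
  qed
  also have "\<dots> <= infsum H UNIV / 2 * ((\<Sum>k\<in>fbox m. (cmod (v s k))^2) + (\<Sum>j\<in>fbox n. ((wt j)^2 * cmod (u s j) / (real n + 1))^2))"
   by (rule Schur_bound[OF H_nonneg H_sum finite_fbox finite_fbox])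
  also have "\<dots> <= infsum H UNIV / 2 * (Y s + c)"
  proof (rule mult_left_mono[OF add_mono])
   have "(\<Sum>j\<in>fbox n. ((wt j)^2 * cmod (u s j) / (real n + 1))^2) <= (\<Sum>j\<in>fbox n. wt j ^ 4 * (cmod (u s j))^2 / (real n + 1))"
   proof (rule sum_mono)
    fix j
    have "((wt j)^2 * cmod (u s j) / (real n + 1))^2 = wt j ^ 4 * (cmod (u s j))^2 / (real n + 1) / (real n + 1)"
     by (simp add: power_mult_distrib power_divide power2_eq_square power4_eq_xxxx)
    also have "\<dots> <= wt j ^ 4 * (cmod (u s j))^2 / (real n + 1) / 1"
     by (rule divide_left_mono) (use wt_pos[of j] in auto)
    finally show "((wt j)^2 * cmod (u s j) / (real n + 1))^2 <= wt j ^ 4 * (cmod (u s j))^2 / (real n + 1)" by simp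
   qed
   also have "\<dots> = (\<Sum>j\<in>fbox n. wt j ^ 4 * (cmod (u s j))^2) / (real n + 1)" by (simp add: sum_divide_distrib)
   also have "\<dots> <= c" unfolding c_def using wn[OF s] by (intro divide_right_mono) auto
   finally show "(\<Sum>j\<in>fbox n. ((wt j)^2 * cmod (u s j) / (real n + 1))^2) <= c" .
  qed (use infsum_nonneg[of UNIV H] H_nonneg in \<open>auto simp: Y_def\<close>)
  finally show ?thesis by (simp add: abs_mult)
 qed
 have "Y t + c <= exp (2 * K * \<bar>t\<bar>) * (Y 0 + c)"
 proof (rule gronwall_abs[where T=T])
  fix s assume s: "\<bar>s\<bar> <= T"
  have "(Y has_real_derivative 2 * (\<Sum>k\<in>fbox m. 1 * (v s k \<bullet> ((\<Sum>j\<in>fbox m. N k j * v s j) + r s k)))) (at s)"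
   unfolding Y_def by (rule energy_deriv[OF finite_fbox dv])
  then show "((\<lambda>s. Y s + c) has_real_derivative 2 * (\<Sum>k\<in>fbox m. 1 * (v s k \<bullet> ((\<Sum>j\<in>fbox m. N k j * v s j) + r s k)))) (at s)"
   by (auto intro!: derivative_eq_intros)
  have "2 * (\<Sum>k\<in>fbox m. 1 * (v s k \<bullet> ((\<Sum>j\<in>fbox m. N k j * v s j) + r s k)))
    = 2 * (\<Sum>k\<in>fbox m. \<Sum>j\<in>fbox m. 1 * (v s k \<bullet> (N k j * v s j))) + 2 * (\<Sum>k\<in>fbox m. v s k \<bullet> r s k)"
   by (simp add: inner_add_right inner_sum_right sum.distrib)
  also have "\<bar>\<dots>\<bar> <= infsum H UNIV * (\<Sum>k\<in>fbox m. (1 * cmod (v s k))^2) + infsum H UNIV * (Y s + c)"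
   by (intro order_trans[OF abs_triangle_ineq] add_mono rb[OF s]
     symmetrized_bound[OF H_nonneg H_sum finite_fbox[of m] weight_one, of "v s"])
  also have "\<dots> = infsum H UNIV * (Y s + (Y s + c))" by (simp add: Y_def distrib_left)
  also have "\<dots> <= K * (Y s + (Y s + c))"
   using K_ge c0 by (intro mult_right_mono) (auto simp: Y_def sum_nonneg)
  also have "\<dots> <= 2 * K * (Y s + c)" using K_ge c0 by (simp add: algebra_simps)
  finally show "\<bar>2 * (\<Sum>k\<in>fbox m. 1 * (v s k \<bullet> ((\<Sum>j\<in>fbox m. N k j * v s j) + r s k)))\<bar> <= 2 * K * (Y s + c)" .
 qed (rule t)
 moreover have "Y 0 = 0"
  unfolding Y_def v_def u_def using x sub by (intro sum.neutral) (auto simp: Fl_0)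
 moreover have "exp (2 * K * \<bar>t\<bar>) * c <= exp (2 * K * T) * c" using t K_ge c0 by (intro mult_right_mono) auto
 moreover have "(norm (Fl m t x - Fl n t x))^2 = Y t"
  by (subst norm_finite_support[of "fbox m"]) (use sub in \<open>auto simp: Y_def v_def u_def coef_Fl\<close>)
 ultimately show ?thesis using c0 by (simp add: c_def)
qed

end

subsection \<open>The limit flow\<close>

context lattice_system
begin

text \<open>Approximate the data by finitely many frequencies and use that all truncated flows are uniformly Lipschitz.\<close>

lemma Fl_cauchy:
 assumes "T >= 0" "e > 0"
 shows "\<exists>M. \<forall>m\<ge>M. \<forall>n\<ge>M. \<forall>t\<in>{-T..T}. dist (Fl m t x) (Fl n t x) < e"
proof -
 define E where "E = exp (K * T)"
 have E: "E > 0" by (simp add: E_def)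
 have "\<forall>\<^sub>F q in sequentially. dist (trunc (fbox q) x) x < e / (3 * sqrt E)"
  using trunc_fbox_tendsto[of x] assms E by (intro tendstoD) auto
 then obtain q where q: "norm (x - trunc (fbox q) x) < e / (3 * sqrt E)"
  unfolding eventually_sequentially dist_norm norm_minus_commute[of "trunc _ x"] by blast
 define y where "y = trunc (fbox q) x"
 define W where "W = exp (K * T) * (\<Sum>k\<in>fbox q. wt k ^ 4 * (cmod (coef y k))^2)"
 have near: "norm (Fl n t x - Fl n t y) < e / 3" if t: "\<bar>t\<bar> <= T" for n t
 proof -
  have "(norm (Fl n t x - Fl n t y))^2 <= exp (K * \<bar>t\<bar>) * (norm (x - y))^2" by (rule Fl_diff_le)
  also have "\<dots> <= E * (norm (x - y))^2" unfolding E_def using t K_ge by (intro mult_right_mono) auto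
  also have "\<dots> = (sqrt E * norm (x - y))^2" using E by (simp add: power_mult_distrib)
  finally have "norm (Fl n t x - Fl n t y) <= sqrt E * norm (x - y)"
   by (rule power2_le_imp_le) (use E in simp)
  also have "\<dots> < sqrt E * (e / (3 * sqrt E))"
   using q E unfolding y_def by (intro mult_strict_left_mono) auto
  also have "\<dots> = e / 3" using E by simp
  finally show ?thesis .
 qed
 have "(\<lambda>n. exp (2 * K * T) * (W * inverse (real (Suc n)))) \<longlonglongrightarrow> exp (2 * K * T) * (W * 0)"
  by (intro tendsto_intros LIMSEQ_inverse_real_of_nat)
 then have "(\<lambda>n. exp (2 * K * T) * (W / (real n + 1))) \<longlonglongrightarrow> 0" by (simp add: divide_inverse add.commute)
 then have "\<forall>\<^sub>F n in sequentially. exp (2 * K * T) * (W / (real n + 1)) < (e / 3)^2"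
  using assms by (intro order_tendstoD(2)[where y=0]) auto
 then obtain n1 where n1: "!!n. n >= n1 ==> exp (2 * K * T) * (W / (real n + 1)) < (e / 3)^2"
  unfolding eventually_sequentially by blast
 have mid: "norm (Fl m t y - Fl n t y) < e / 3" if "n >= max q n1" "m >= n" "\<bar>t\<bar> <= T" for m n t
 proof -
  have "(norm (Fl m t y - Fl n t y))^2 <= exp (2 * K * T) * (W / (real n + 1))"
   unfolding W_def by (rule Fl_cauchy_finite) (use that in \<open>auto simp: y_def\<close>)
  also have "\<dots> < (e / 3)^2" using n1[of n] that by simp
  finally show ?thesis by (rule power_less_imp_less_base) (use assms in simp)
 qed
 have "dist (Fl m t x) (Fl n t x) < e" if mn: "m >= max q n1" "n >= max q n1" and t: "t \<in> {-T..T}" for m n t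
 proof -
  have t': "\<bar>t\<bar> <= T" using t by auto
  have "norm (Fl m t y - Fl n t y) < e / 3"
  proof (cases "n <= m")
   case True then show ?thesis using mid mn t' by blast
  next
   case False
   then show ?thesis using mid[of m n t] mn t' by (simp add: norm_minus_commute)
  qed
  moreover have "Fl m t x - Fl n t x = (Fl m t x - Fl m t y) + (Fl m t y - Fl n t y) - (Fl n t x - Fl n t y)"
   by simp
  ultimately show ?thesis
   using near[OF t', of m] near[OF t', of n] unfolding dist_norm
   using norm_triangle_ineq[of "Fl m t x - Fl m t y" "Fl m t y - Fl n t y"]
    norm_triangle_ineq4[of "(Fl m t x - Fl m t y) + (Fl m t y - Fl n t y)" "Fl n t x - Fl n t y"] by simp
 qed
 then show ?thesis by blast
qed

definition S :: "real => l2 => l2" where "S t x = lim (\<lambda>n. Fl n t x)"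

lemma Fl_tendsto: "(\<lambda>n. Fl n t x) \<longlonglongrightarrow> S t x"
proof -
 have "Cauchy (\<lambda>n. Fl n t x)"
  unfolding Cauchy_def using Fl_cauchy[of "\<bar>t\<bar>" _ x] by (auto simp: abs_le_iff) (meson abs_ge_minus_self abs_ge_self abs_ge_zero atLeastAtMost_iff minus_le_iff)
 then show ?thesis unfolding S_def by (simp add: Cauchy_convergent_iff convergent_LIMSEQ_iff)
qed

lemma S_uniform: assumes "T >= 0" shows "uniform_limit {-T..T} (\<lambda>n t. Fl n t x) (\<lambda>t. S t x) sequentially"
 unfolding uniform_limit_sequentially_iff
proof (intro allI impI)
 fix e :: real assume "e > 0"
 then have "e / 2 > 0" by simp
 then obtain M where M: "!!m n t. m >= M ==> n >= M ==> t \<in> {-T..T} ==> dist (Fl m t x) (Fl n t x) < e / 2"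
  using Fl_cauchy[OF assms, of "e / 2" x] by meson
 have "dist (Fl n t x) (S t x) <= e / 2" if "n >= M" "t \<in> {-T..T}" for n t
 proof (rule tendsto_upperbound)
  show "(\<lambda>m. dist (Fl n t x) (Fl m t x)) \<longlonglongrightarrow> dist (Fl n t x) (S t x)" by (intro tendsto_intros Fl_tendsto)
  show "\<forall>\<^sub>F m in sequentially. dist (Fl n t x) (Fl m t x) <= e / 2"
   unfolding eventually_sequentially using M that by (meson less_imp_le)
 qed simp
 then show "\<exists>N. \<forall>n\<ge>N. \<forall>t\<in>{-T..T}. dist (Fl n t x) (S t x) < e"
  using \<open>e > 0\<close> by (intro exI[of _ M]) force
qed

lemma S_0: "S 0 x = x"
 using LIMSEQ_unique[OF Fl_tendsto[of 0 x]] trunc_fbox_tendsto[of x] by (simp add: Fl_0)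

lemma S_zero: "S t 0 = 0"
 using LIMSEQ_unique[OF Fl_tendsto[of t 0], of 0] by (simp add: Fl_zero)

lemma S_diff_le: "norm (S t x - S t y) <= exp (K * \<bar>t\<bar>) * norm (x - y)"
proof (rule tendsto_upperbound)
 show "(\<lambda>n. norm (Fl n t x - Fl n t y)) \<longlonglongrightarrow> norm (S t x - S t y)" by (intro tendsto_intros Fl_tendsto)
 have "norm (Fl n t x - Fl n t y) <= exp (K * \<bar>t\<bar>) * norm (x - y)" for n
 proof (rule power2_le_imp_le)
  have "exp (K * \<bar>t\<bar>) <= (exp (K * \<bar>t\<bar>))^2"
   using K_ge by (intro self_le_power) auto
  then show "(norm (Fl n t x - Fl n t y))^2 <= (exp (K * \<bar>t\<bar>) * norm (x - y))^2"
   using Fl_diff_le[of n t x y] mult_right_mono[of "exp (K * \<bar>t\<bar>)" "(exp (K * \<bar>t\<bar>))^2" "(norm (x - y))^2"]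
   by (simp add: power_mult_distrib)
 qed simp
 then show "\<forall>\<^sub>F n in sequentially. norm (Fl n t x - Fl n t y) <= exp (K * \<bar>t\<bar>) * norm (x - y)" by simp
qed simp

lemma S_norm_le: "norm (S t x) <= exp (K * \<bar>t\<bar>) * norm x"
 using S_diff_le[of t x 0] by (simp add: S_zero)

lemma Fl_continuous: "continuous_on A (\<lambda>t. Fl n t x)"
proof -
 have fc: "continuous_on A (\<lambda>t. flow_coef n x t k)" if "k \<in> fbox n" for k
  using flow_coef(2)[OF that, of x] has_vector_derivative_continuous
  by (intro continuous_at_imp_continuous_on ballI) blast
 have bl: "bounded_linear (unit_l2 k)" for k
  by (rule bounded_linear_intro[where K=1]) (auto intro!: l2_eqI)
 show ?thesis unfolding Fl_def
  by (rule continuous_on_sum) (rule bounded_linear.continuous_on[OF bl fc])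
qed

lemma S_continuous: "continuous_on UNIV (\<lambda>t. S t x)"
proof (rule continuous_at_imp_continuous_on, intro ballI)
 fix t
 have "continuous_on {-(\<bar>t\<bar> + 1)..\<bar>t\<bar> + 1} (\<lambda>t. S t x)"
  by (rule uniform_limit_theorem[OF _ S_uniform]) (auto simp: Fl_continuous)
 moreover have "t \<in> interior {-(\<bar>t\<bar> + 1)..\<bar>t\<bar> + 1}" by (simp add: abs_if)
 ultimately show "isCont (\<lambda>t. S t x) t" using continuous_on_interior by blast
qed

lemma S_jointly_continuous: "continuous_on UNIV (\<lambda>(t, x). S t x)"
 unfolding continuous_on_def
proof (intro ballI)
 fix z :: "real \<times> l2"
 obtain t x where z: "z = (t, x)" by (cases z)
 have a: "((\<lambda>p. S (fst p) x) \<longlongrightarrow> S t x) (at z)"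
 proof -
  have "isCont (\<lambda>t. S t x) t" using S_continuous[of x] by (simp add: continuous_on_eq_continuous_at)
  moreover have "(fst \<longlongrightarrow> t) (at z)" unfolding z using tendsto_fst[OF tendsto_ident_at[of "(t, x)" UNIV]] by simp
  ultimately show ?thesis by (rule isCont_tendsto_compose)
 qed
 have b: "((\<lambda>p. S (fst p) (snd p) - S (fst p) x) \<longlongrightarrow> 0) (at z)"
 proof (rule Lim_null_comparison)
  show "\<forall>\<^sub>F p in at z. norm (S (fst p) (snd p) - S (fst p) x) <= exp (K * \<bar>fst p\<bar>) * norm (snd p - x)"
   by (simp add: S_diff_le)
  have "((\<lambda>p. exp (K * \<bar>fst p\<bar>) * norm (snd p - x)) \<longlongrightarrow> exp (K * \<bar>fst z\<bar>) * norm (snd z - x)) (at z)"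
   by (intro tendsto_intros)
  then show "((\<lambda>p. exp (K * \<bar>fst p\<bar>) * norm (snd p - x)) \<longlongrightarrow> 0) (at z)" by (simp add: z)
 qed
 have "((\<lambda>p. S (fst p) x + (S (fst p) (snd p) - S (fst p) x)) \<longlongrightarrow> S t x + 0) (at z)"
  by (rule tendsto_add[OF a b])
 then show "((\<lambda>(t, x). S t x) \<longlongrightarrow> (\<lambda>(t, x). S t x) z) (at z)" by (simp add: z case_prod_beta')
qed

lemma row_sq: "(\<Sum>j\<in>F. (cmod (N k j))^2) <= (wt k * K)^2" if F: "finite F" for F
proof -
 have hH: "(\<Sum>j\<in>F. h (k - j)) <= K"
 proof -
  have "(\<Sum>j\<in>F. h (k - j)) = sum h ((\<lambda>j. k - j) ` F)" by (subst sum.reindex) (auto simp: inj_on_def)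
  also have "\<dots> <= sum H ((\<lambda>j. k - j) ` F)" by (intro sum_mono h_le_H)
  also have "\<dots> <= infsum H UNIV" using F H_nonneg H_sum by (intro finite_sum_le_infsum) auto
  finally show ?thesis using K_ge by simp
 qed
 have "(\<Sum>j\<in>F. (cmod (N k j))^2) <= (\<Sum>j\<in>F. (wt k * h (k - j)) * (wt k * K))"
 proof (rule sum_mono)
  fix j assume j: "j \<in> F"
  have "h (k - j) <= K" using member_le_sum[OF j, of "\<lambda>j. h (k - j)"] h_nonneg F hH by auto
  then have "cmod (N k j) <= wt k * K" using order_trans[OF N_le1 mult_left_mono[of "h (k - j)" K "wt k"]] wt_pos[of k] by auto
  then show "(cmod (N k j))^2 <= (wt k * h (k - j)) * (wt k * K)"
   unfolding power2_eq_square using N_le1[of k j] h_nonneg wt_pos[of k] by (intro mult_mono) auto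
 qed
 also have "\<dots> = wt k * (\<Sum>j\<in>F. h (k - j)) * (wt k * K)" by (simp add: sum_distrib_left sum_distrib_right)
 also have "\<dots> <= wt k * K * (wt k * K)" using hH K_ge wt_pos[of k] by (intro mult_right_mono mult_left_mono) auto
 finally show ?thesis by (simp add: power2_eq_square)
qed

definition row :: "freq => l2" where "row k = Abs_l2 (N k)"

lemma coef_row: "coef (row k) = N k"
 unfolding row_def by (rule Abs_l2_inverse) (rule sqsumI_bound[OF row_sq])

definition gen :: "freq => l2 => complex" where "gen k x = \<i> * om k * coef x k + dot (row k) x"

lemma gen_bounded_linear: "bounded_linear (gen k)"
 unfolding gen_def[abs_def]
 by (intro bounded_linear_add dot_bounded_linear bounded_linear_compose[OF bounded_linear_mult_right coef_bounded_linear])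

lemma gen_finite: assumes "finite F" "!!j. j \<notin> F ==> coef x j = 0"
 shows "gen k x = \<i> * om k * coef x k + (\<Sum>j\<in>F. N k j * coef x j)"
proof -
 have "dot (row k) x = (\<Sum>\<^sub>\<infinity>j\<in>F. N k j * coef x j)"
  unfolding dot_def coef_row by (rule infsum_cong_neutral) (use assms in auto)
 then show ?thesis using assms by (simp add: gen_def)
qed

lemma S_deriv: "((\<lambda>t. coef (S t x) k) has_vector_derivative gen k (S t x)) (at t)"
proof -
 define T where "T = \<bar>t\<bar> + 1"
 obtain n0 where n0: "k \<in> fbox n0" using fbox_exhausts[of "{k}"] by auto
 obtain C where C: "C > 0" "!!y. cmod (gen k y) <= norm y * C"
  using bounded_linear.pos_bounded[OF gen_bounded_linear[of k]] by blast
 have "\<exists>g. \<forall>s\<in>{-T<..<T}. (\<lambda>n. coef (Fl (n + n0) s x) k) \<longlonglongrightarrow> g s \<and> (g has_derivative (\<lambda>h. h *\<^sub>R gen k (S s x))) (at s within {-T<..<T})"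
 proof (rule has_derivative_sequence[where f'="\<lambda>n s h. h *\<^sub>R gen k (Fl (n + n0) s x)"])
  fix n s
  have "k \<in> fbox (n + n0)" using n0 fbox_mono[of n0 "n + n0"] by auto
  from Fl_deriv[OF this, of x s]
  have "((\<lambda>s. coef (Fl (n + n0) s x) k) has_vector_derivative gen k (Fl (n + n0) s x)) (at s)"
   by (subst gen_finite[of "fbox (n + n0)"]) (auto simp: coef_Fl)
  then show "((\<lambda>s. coef (Fl (n + n0) s x) k) has_derivative (\<lambda>h. h *\<^sub>R gen k (Fl (n + n0) s x))) (at s within {-T<..<T})"
   using has_derivative_at_withinI unfolding has_vector_derivative_def by blast
 next
  fix e :: real assume e: "e > 0"
  have "\<forall>\<^sub>F n in sequentially. \<forall>s\<in>{-T..T}. dist (Fl n s x) (S s x) < e / C"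
   using S_uniform[of T x] e C unfolding uniform_limit_iff by (simp add: T_def)
  then have "\<forall>\<^sub>F n in sequentially. \<forall>s\<in>{-T..T}. dist (Fl (n + n0) s x) (S s x) < e / C"
   by (rule eventually_all_ge_at_top[THEN eventually_mono]) auto
  then show "\<forall>\<^sub>F n in sequentially. \<forall>s\<in>{-T<..<T}. \<forall>h. norm (h *\<^sub>R gen k (Fl (n + n0) s x) - h *\<^sub>R gen k (S s x)) <= e * norm h"
  proof eventually_elim
   case (elim n)
   show ?case
   proof (intro ballI allI)
    fix s h assume "s \<in> {-T<..<T}"
    then have "s \<in> {-T..T}" by simp
    from bspec[OF elim this] have "norm (Fl (n + n0) s x - S s x) <= e / C" by (simp add: dist_norm)
    then have "norm (Fl (n + n0) s x - S s x) * C <= e" using C by (simp add: pos_le_divide_eq)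
    moreover have "gen k (Fl (n + n0) s x) - gen k (S s x) = gen k (Fl (n + n0) s x - S s x)"
     using linear_diff[OF bounded_linear.linear[OF gen_bounded_linear]] by metis
    ultimately have "cmod (gen k (Fl (n + n0) s x) - gen k (S s x)) <= e"
     using C(2)[of "Fl (n + n0) s x - S s x"] by simp
    then have "\<bar>h\<bar> * cmod (gen k (Fl (n + n0) s x) - gen k (S s x)) <= \<bar>h\<bar> * e" by (rule mult_left_mono) simp
    then show "norm (h *\<^sub>R gen k (Fl (n + n0) s x) - h *\<^sub>R gen k (S s x)) <= e * norm h"
     by (simp add: mult.commute flip: scaleR_diff_right)
   qed
  qed
 next
  show "t \<in> {-T<..<T}" by (auto simp: T_def)
  show "(\<lambda>n. coef (Fl (n + n0) t x) k) \<longlonglongrightarrow> coef (S t x) k"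
   by (rule LIMSEQ_ignore_initial_segment[OF bounded_linear.tendsto[OF coef_bounded_linear Fl_tendsto]])
 qed auto
 then obtain g where g: "!!s. s \<in> {-T<..<T} ==> (\<lambda>n. coef (Fl (n + n0) s x) k) \<longlonglongrightarrow> g s"
  "!!s. s \<in> {-T<..<T} ==> (g has_derivative (\<lambda>h. h *\<^sub>R gen k (S s x))) (at s within {-T<..<T})" by blast
 have t: "t \<in> {-T<..<T}" by (auto simp: T_def)
 have gS: "g s = coef (S s x) k" if "s \<in> {-T<..<T}" for s
  by (rule LIMSEQ_unique[OF g(1)[OF that]])
    (rule LIMSEQ_ignore_initial_segment[OF bounded_linear.tendsto[OF coef_bounded_linear Fl_tendsto]])
 have "(g has_vector_derivative gen k (S t x)) (at t)"
  using g(2)[OF t] t unfolding has_vector_derivative_def by (subst (asm) at_within_open) auto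
 then show ?thesis
  by (rule has_vector_derivative_transform_within_open[OF _ open_greaterThanLessThan t gS])
qed

lemma energy_growth:
 fixes v :: "real => l2"
 assumes d: "!!k t. ((\<lambda>t. coef (v t) k) has_vector_derivative gen k (v t)) (at t)"
  and R: "R > 0" and n: "real n + 1 >= R"
 obtains D where "!!t. ((\<lambda>t. \<Sum>k\<in>fbox n. cut R k * (cmod (coef (v t) k))^2) has_real_derivative D t) (at t)"
  "!!t. \<bar>D t\<bar> <= K * (norm (v t))^2"
proof -
 define D where "D t = 2 * (\<Sum>k\<in>fbox n. cut R k * (coef (v t) k \<bullet> dot (row k) (v t)))" for t
 have 1: "((\<lambda>t. \<Sum>k\<in>fbox n. cut R k * (cmod (coef (v t) k))^2) has_real_derivative D t) (at t)" for t
  unfolding D_def by (rule energy_deriv[OF finite_fbox]) (use d in \<open>simp add: gen_def\<close>)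
 have 2: "\<bar>D t\<bar> <= K * (norm (v t))^2" for t
 proof (rule tendsto_upperbound)
  have "(\<lambda>m. dot (row k) (trunc (fbox m) (v t))) \<longlonglongrightarrow> dot (row k) (v t)" for k
   by (rule bounded_linear.tendsto[OF dot_bounded_linear trunc_fbox_tendsto])
  then show "(\<lambda>m. \<bar>2 * (\<Sum>k\<in>fbox n. cut R k * (coef (v t) k \<bullet> dot (row k) (trunc (fbox m) (v t))))\<bar>) \<longlonglongrightarrow> \<bar>D t\<bar>"
   unfolding D_def by (intro tendsto_intros)
  show "\<forall>\<^sub>F m in sequentially. \<bar>2 * (\<Sum>k\<in>fbox n. cut R k * (coef (v t) k \<bullet> dot (row k) (trunc (fbox m) (v t))))\<bar> <= K * (norm (v t))^2"
   unfolding eventually_sequentially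
  proof (intro exI allI impI)
   fix m assume nm: "n <= m"
   have dt: "dot (row k) (trunc (fbox m) (v t)) = (\<Sum>j\<in>fbox m. N k j * coef (v t) j)" for k
   proof -
    have "dot (row k) (trunc (fbox m) (v t)) = (\<Sum>\<^sub>\<infinity>j\<in>fbox m. N k j * coef (v t) j)"
     unfolding dot_def coef_row by (rule infsum_cong_neutral) auto
    then show ?thesis by simp
   qed
   have cz: "cut R k = 0" if "k \<notin> fbox n" for k
    using wt_not_fbox[OF that] n R by (simp add: cut_def)
   have "(\<Sum>k\<in>fbox n. cut R k * (coef (v t) k \<bullet> dot (row k) (trunc (fbox m) (v t))))
     = (\<Sum>k\<in>fbox m. cut R k * (coef (v t) k \<bullet> dot (row k) (trunc (fbox m) (v t))))"
    by (rule sum.mono_neutral_left) (use fbox_mono[OF nm] cz in auto)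
   also have "\<dots> = (\<Sum>k\<in>fbox m. \<Sum>j\<in>fbox m. cut R k * (coef (v t) k \<bullet> (N k j * coef (v t) j)))"
    by (simp add: dt inner_sum_right sum_distrib_left)
   finally have "\<bar>2 * (\<Sum>k\<in>fbox n. cut R k * (coef (v t) k \<bullet> dot (row k) (trunc (fbox m) (v t))))\<bar>
     <= infsum H UNIV * (\<Sum>k\<in>fbox m. (1 * cmod (coef (v t) k))^2)"
    using symmetrized_bound[OF H_nonneg H_sum finite_fbox[of m] weight_cut[OF R], of "coef (v t)"] by (simp only:)
   also have "\<dots> <= K * (norm (v t))^2"
    using K_ge sum_sq_le_norm[OF finite_fbox, of "v t" m] by (intro mult_mono) (auto simp: sum_nonneg)
   finally show "\<bar>2 * (\<Sum>k\<in>fbox n. cut R k * (coef (v t) k \<bullet> dot (row k) (trunc (fbox m) (v t))))\<bar> <= K * (norm (v t))^2" .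
  qed
 qed simp
 show ?thesis by (rule that[OF 1 2])
qed

text \<open>The cutoff energy of the solution starts at zero and its derivative is bounded by \<open>K\<close> times the squared norm. Removing the cutoff bounds the maximum of the squared norm on a short interval by half of itself.\<close>

lemma local_uniqueness:
 fixes v :: "real => l2"
 assumes d: "!!k t. ((\<lambda>t. coef (v t) k) has_vector_derivative gen k (v t)) (at t)"
  and c: "continuous_on UNIV v" and z: "v t0 = 0" and t: "\<bar>t - t0\<bar> <= 1 / (2 * K)"
 shows "v t = 0"
proof -
 define J where "J = {t0 - 1 / (2 * K)..t0 + 1 / (2 * K)}"
 have "compact J" "J ~= {}" using K_ge by (auto simp: J_def)
 moreover have "continuous_on J (\<lambda>s. (norm (v s))^2)" by (intro continuous_intros continuous_on_subset[OF c]) auto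
 ultimately have "\<exists>s0\<in>J. \<forall>s\<in>J. (norm (v s))^2 <= (norm (v s0))^2"
  by (rule continuous_attains_sup)
 then obtain s0 where s0: "s0 \<in> J" "!!s. s \<in> J ==> (norm (v s))^2 <= (norm (v s0))^2"
  by (elim bexE) simp
 define B where "B = (norm (v s0))^2"
 have t0J: "t0 \<in> J" using K_ge by (simp add: J_def)
 have est: "(\<Sum>k\<in>fbox n. cut R k * (cmod (coef (v s0) k))^2) <= B / 2" if R: "R > 0" "real n + 1 >= R" for R n
 proof (rule energy_growth[OF d R])
  fix D
  assume D: "!!t. ((\<lambda>t. \<Sum>k\<in>fbox n. cut R k * (cmod (coef (v t) k))^2) has_real_derivative D t) (at t)"
   "!!t. \<bar>D t\<bar> <= K * (norm (v t))^2"
  have "norm ((\<Sum>k\<in>fbox n. cut R k * (cmod (coef (v s0) k))^2) - (\<Sum>k\<in>fbox n. cut R k * (cmod (coef (v t0) k))^2)) <= (K * B) * norm (s0 - t0)"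
  proof (rule field_differentiable_bound[where S=J])
   show "convex J" by (simp add: J_def)
   show "((\<lambda>t. \<Sum>k\<in>fbox n. cut R k * (cmod (coef (v t) k))^2) has_field_derivative D s) (at s within J)" for s
    by (rule has_field_derivative_at_within[OF D(1)])
   show "norm (D s) <= K * B" if "s \<in> J" for s
    using order_trans[OF D(2)[of s] mult_left_mono[OF s0(2)[OF that]]] K_ge by (simp add: B_def)
  qed (use s0 t0J in auto)
  also have "\<dots> <= (K * B) * (1 / (2 * K))"
   using s0(1) K_ge by (intro mult_left_mono) (auto simp: J_def abs_le_iff B_def)
  also have "\<dots> = B / 2" using K_ge by simp
  finally show ?thesis by (simp add: z)
 qed
 have "B <= B / 2"
  unfolding B_def norm_l2_sq
 proof (rule infsum_le_finite_sums[OF sq_summable], fold norm_l2_sq B_def)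
  fix F :: "freq set" assume F: "finite F"
  have "(\<lambda>R. \<Sum>k\<in>F. cut (real R) k * (cmod (coef (v s0) k))^2) \<longlonglongrightarrow> (\<Sum>k\<in>F. 1 * (cmod (coef (v s0) k))^2)"
  proof (intro tendsto_intros)
   fix k
   have "(\<lambda>R. max 0 (1 - wt k / real R)) \<longlonglongrightarrow> max 0 (1 - 0)" by (intro tendsto_intros lim_const_over_n)
   then show "(\<lambda>R. cut (real R) k) \<longlonglongrightarrow> 1" by (simp add: cut_def)
  qed
  then have "(\<Sum>k\<in>F. 1 * (cmod (coef (v s0) k))^2) <= B / 2"
  proof (rule tendsto_upperbound)
   obtain n0 where n0: "F \<subseteq> fbox n0" using fbox_exhausts[OF F] by blast
   show "\<forall>\<^sub>F R in sequentially. (\<Sum>k\<in>F. cut (real R) k * (cmod (coef (v s0) k))^2) <= B / 2"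
    unfolding eventually_sequentially
   proof (intro exI allI impI)
    fix R :: nat assume R: "max 1 n0 <= R"
    have "(\<Sum>k\<in>F. cut (real R) k * (cmod (coef (v s0) k))^2) <= (\<Sum>k\<in>fbox R. cut (real R) k * (cmod (coef (v s0) k))^2)"
     using n0 fbox_mono[of n0 R] R by (intro sum_mono2) (auto simp: cut_def)
    also have "\<dots> <= B / 2" using R by (intro est) auto
    finally show "(\<Sum>k\<in>F. cut (real R) k * (cmod (coef (v s0) k))^2) <= B / 2" .
   qed
  qed simp
  then show "(\<Sum>k\<in>F. (cmod (coef (v s0) k))^2) <= B / 2" by simp
 qed
 then have "B = 0" unfolding B_def by simp
 moreover have "t \<in> J" using t by (auto simp: J_def abs_le_iff)
 ultimately show ?thesis using s0(2)[of t] by (simp add: B_def)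
qed

text \<open>The set of zeros is closed by continuity and open by local uniqueness, and the time axis is connected.\<close>

lemma uniqueness:
 fixes v :: "real => l2"
 assumes d: "!!k t. ((\<lambda>t. coef (v t) k) has_vector_derivative gen k (v t)) (at t)"
  and c: "continuous_on UNIV v" and z: "v 0 = 0"
 shows "v t = 0"
proof -
 define Z where "Z = {t. v t = 0}"
 have "closed Z" unfolding Z_def using continuous_closed_preimage[OF c closed_UNIV closed_singleton[of 0]] by (simp add: vimage_def)
 moreover have "open Z"
  unfolding open_dist
 proof (intro ballI)
  fix s assume "s \<in> Z"
  then show "\<exists>e>0. \<forall>y. dist y s < e --> y \<in> Z"
   using local_uniqueness[OF d c, of s] K_ge
   by (intro exI[of _ "1 / (2 * K)"]) (auto simp: Z_def dist_real_def)
 qed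
 ultimately have "Z = {} \<or> Z = UNIV" using connected_UNIV connected_clopen[of UNIV] clopen by blast
 then show ?thesis using z by (auto simp: Z_def)
qed

end

section \<open>Weak solutions\<close>

abbreviation "d1 \<equiv> dir_deriv ((1, 0) :: plane)"
abbreviation "d2 \<equiv> dir_deriv ((0, 1) :: plane)"

definition slice :: "(real \<times> plane => real) => real => plane => real" where
 "slice \<psi> t x = \<psi> (t, x)"

lemma test_funD: assumes "\<psi> \<in> test_fun"
 shows "smooth \<psi>" "periodic2 (slice \<psi> t)"
 using assms by (auto simp: test_fun_def slice_def[abs_def])

lemma test_fun_support: assumes "\<psi> \<in> test_fun"
 obtains R where "R >= 0" "!!t x. \<bar>t\<bar> > R ==> \<psi> (t, x) = 0"
proof -
 obtain R where "\<forall>t x. \<bar>t\<bar> > R --> \<psi> (t, x) = 0" using assms by (auto simp: test_fun_def)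
 then show ?thesis using that[of "\<bar>R\<bar>"] by (meson abs_ge_self abs_ge_zero le_less_trans)
qed

lemma slice_embed: "bounded_linear (\<lambda>x :: plane. (0 :: real, x))"
 by (intro bounded_linear_Pair bounded_linear_zero bounded_linear_ident)

lemma smooth_slice: assumes "smooth \<psi>" shows "smooth (slice \<psi> t)"
 using smooth_affine[OF assms slice_embed, of "(t, 0)"] by (simp add: slice_def[abs_def])

lemma dir_deriv_slice: assumes "smooth \<psi>" shows "dir_deriv v (slice \<psi> t) = slice (dir_deriv (0, v) \<psi>) t"
 using dir_deriv_affine[OF assms slice_embed, of v "(t, 0)"] by (simp add: slice_def[abs_def])

lemma smooth_torus_slice: "\<psi> \<in> test_fun ==> smooth_torus (slice \<psi> t)"
 by (simp add: smooth_torus_def smooth_slice test_funD)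

lemma slice_time_deriv: assumes "smooth \<psi>"
 shows "((\<lambda>t. slice \<psi> t x) has_real_derivative slice (dir_deriv (1, 0) \<psi>) t x) (at t)"
proof -
 have e: "dir_deriv (h, 0) \<psi> (t, x) = h * dir_deriv (1, 0) \<psi> (t, x)" for h
  using linear_cmul[OF has_derivative_linear[OF smooth_has_derivative[OF assms]], of h "(1, 0)"] by simp
 have "((\<lambda>t. (t, x)) has_derivative (\<lambda>h. (h, 0))) (at t)" by (auto intro!: derivative_eq_intros)
 from has_derivative_compose[OF this smooth_has_derivative[OF assms]]
 have "((\<lambda>t. slice \<psi> t x) has_derivative (\<lambda>h. dir_deriv (h, 0) \<psi> (t, x))) (at t)" by (simp add: slice_def)
 also have "(\<lambda>h. dir_deriv (h, 0) \<psi> (t, x)) = (*) (dir_deriv (1, 0) \<psi> (t, x))"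
  by (rule ext) (subst e, rule mult.commute)
 finally show ?thesis by (simp add: has_field_derivative_def slice_def)
qed

lemma has_derivative_zero_open:
 assumes "(f has_derivative f') (at x)" "open U" "x \<in> U" "!!y. y \<in> U ==> f y = (0::real)"
 shows "f' v = 0"
proof -
 have "((\<lambda>y. 0) has_derivative (\<lambda>v. 0)) (at x)" by simp
 then have "(f has_derivative (\<lambda>v. 0)) (at x)"
  by (rule has_derivative_transform_within_open[OF _ assms(2,3)]) (simp add: assms(4))
 then have "f' = (\<lambda>v. 0)" using assms(1) has_derivative_unique by blast
 then show ?thesis by simp
qed

lemma test_fun_dir_deriv: assumes "\<psi> \<in> test_fun" shows "dir_deriv e \<psi> \<in> test_fun"
proof -
 have sm: "smooth \<psi>" by (rule test_funD[OF assms])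
 obtain R where R: "R >= 0" "!!t x. \<bar>t\<bar> > R ==> \<psi> (t, x) = 0" using test_fun_support[OF assms] by metis
 have "dir_deriv e \<psi> (t, x) = 0" if "\<bar>t\<bar> > R" for t x
 proof (rule has_derivative_zero_open[OF smooth_has_derivative[OF sm]])
  show "open ({t. \<bar>t\<bar> > R} \<times> (UNIV :: plane set))"
   by (intro open_Times open_UNIV open_Collect_less continuous_intros)
 qed (use that R in auto)
 moreover have "periodic2 (\<lambda>x. dir_deriv e \<psi> (t, x))" for t
 proof -
  have key: "dir_deriv e \<psi> (t, x + c) = dir_deriv e \<psi> (t, x)" if c: "!!t x. \<psi> (t, x + c) = \<psi> (t, x)" for c x
  proof -
   have "(\<lambda>z. \<psi> (z + (0, c))) = \<psi>" using c by (auto simp: fun_eq_iff)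
   then have "dir_deriv e \<psi> (t, x) = dir_deriv e (\<lambda>z. \<psi> (z + (0, c))) (t, x)" by simp
   also have "\<dots> = dir_deriv e \<psi> ((t, x) + (0, c))"
    using fun_cong[OF dir_deriv_affine[OF sm bounded_linear_ident, of e "(0, c)"]] by simp
   finally show ?thesis by simp
  qed
  have "\<psi> (t, x + (2 * pi, 0)) = \<psi> (t, x)" "\<psi> (t, x + (0, 2 * pi)) = \<psi> (t, x)" for t x
   using assms unfolding periodic2_def test_fun_def by blast+
  then show ?thesis unfolding periodic2_def using key by blast
 qed
 ultimately show ?thesis using sm smooth_dir_deriv by (auto simp: test_fun_def)
qed

lemma test_fun_add: assumes "\<psi> \<in> test_fun" "\<phi> \<in> test_fun" shows "(\<lambda>z. \<psi> z + \<phi> z) \<in> test_fun"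
proof -
 obtain R Q where "!!t x. \<bar>t\<bar> > R ==> \<psi> (t, x) = 0" "!!t x. \<bar>t\<bar> > Q ==> \<phi> (t, x) = 0"
  using test_fun_support[OF assms(1)] test_fun_support[OF assms(2)] by metis
 then have "\<forall>t x. \<bar>t\<bar> > max R Q --> \<psi> (t, x) + \<phi> (t, x) = 0" by auto
 then show ?thesis using assms unfolding test_fun_def periodic2_def mem_Collect_eq
  by (intro conjI smooth_add exI[of _ "max R Q"]) simp_all
qed

lemma smooth_snd: assumes "smooth a" shows "smooth (\<lambda>z :: real \<times> plane. a (snd z))"
 using smooth_affine[OF assms bounded_linear_snd, of 0] by simp

lemma smooth_fst: assumes "smooth a" shows "smooth (\<lambda>z :: real \<times> plane. a (fst z))"
 using smooth_affine[OF assms bounded_linear_fst, of 0] by simp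

lemma test_fun_mult: assumes "smooth_torus a" "\<psi> \<in> test_fun" shows "(\<lambda>z. a (snd z) * \<psi> z) \<in> test_fun"
proof -
 have "smooth (\<lambda>z. a (snd z) * \<psi> z)" using assms by (intro smooth_mult smooth_snd smooth_torusD test_funD)
 moreover obtain R where "!!t x. \<bar>t\<bar> > R ==> \<psi> (t, x) = 0" using test_fun_support[OF assms(2)] by metis
 ultimately show ?thesis using assms unfolding test_fun_def smooth_torus_def periodic2_def mem_Collect_eq
  by (intro conjI exI[of _ R]) simp_all
qed

lemma test_fun_cmult: "\<psi> \<in> test_fun ==> (\<lambda>z. c * \<psi> z) \<in> test_fun"
 using test_fun_mult[of "\<lambda>x. c"] by simp

lemma test_fun_tensor: assumes "\<theta> \<in> test1" "smooth_torus \<phi>" shows "(\<lambda>z. \<theta> (fst z) * \<phi> (snd z)) \<in> test_fun"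
proof -
 have "smooth (\<lambda>z :: real \<times> plane. \<theta> (fst z) * \<phi> (snd z))"
  using assms by (intro smooth_mult smooth_snd smooth_fst) (auto simp: test1_def smooth_torus_def)
 moreover obtain R where "\<forall>t. \<bar>t\<bar> > R --> \<theta> t = 0" using assms by (auto simp: test1_def)
 ultimately show ?thesis using assms(2) by (auto simp: test_fun_def smooth_torus_def periodic2_def)
qed

subsection \<open>Continuity in time\<close>

lemma L2_norm_diff_ft: "g \<in> L2 ==> h \<in> L2 ==> L2_norm (\<lambda>x. g x - h x) = dist (ft g) (ft h)"
 by (simp add: dist_norm ft_diff[symmetric] L2_norm_ft L2_diff)

text \<open>Continuity with values in \<open>L\<^sup>2\<close> is continuity in the Hilbert space of coefficients; the pointwise representatives may jump on null sets.\<close>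

lemma C_L2_iff: "u \<in> C_L2 \<longleftrightarrow> (\<forall>t. u t \<in> L2) \<and> continuous_on UNIV (\<lambda>t. ft (u t))"
proof -
 have "((\<lambda>t. L2_norm (\<lambda>x. u t x - u s x)) \<longlongrightarrow> 0) (at s) \<longleftrightarrow> ((\<lambda>t. ft (u t)) \<longlongrightarrow> ft (u s)) (at s)"
  if "\<forall>t. u t \<in> L2" for s
  using that by (subst (2) tendsto_dist_iff) (simp add: L2_norm_diff_ft)
 then show ?thesis unfolding C_L2_def by (auto simp: continuous_on_def)
qed

lemma L2_norm_bound: assumes "g \<in> L2" "!!x. x \<in> cell ==> \<bar>g x\<bar> <= B" "B >= 0" shows "L2_norm g <= 2 * pi * B"
proof -
 have "(LINT x|TM. (g x)^2) <= (LINT x|TM. B^2)"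
 proof (rule integral_mono)
  fix x assume "x \<in> space TM"
  then show "(g x)^2 <= B^2" using assms(2)[of x] power_mono[of "\<bar>g x\<bar>" B 2] by simp
 qed (use L2D(2)[OF assms(1)] in auto)
 also have "(LINT x|TM. B^2) = B^2 * (2 * pi)^2"
  by (subst TM_integral_continuous) (auto simp: cell_def content_Pair power2_eq_square)
 finally have "sqrt (LINT x|TM. (g x)^2) <= sqrt ((2 * pi * B)^2)"
  by (intro real_sqrt_le_mono) (simp add: power_mult_distrib mult_ac)
 then show ?thesis using assms(3) by (simp add: L2_norm_def real_sqrt_abs)
qed

lemma continuous_family_ft:
 fixes w :: "real => plane => real"
 assumes c: "continuous_on UNIV (\<lambda>z. w (fst z) (snd z))" and w: "!!t. w t \<in> L2"
 shows "continuous_on UNIV (\<lambda>t. ft (w t))"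
proof (rule continuous_at_imp_continuous_on, intro ballI)
 fix s :: real
 show "isCont (\<lambda>t. ft (w t)) s"
  unfolding continuous_at_eps_delta
 proof (intro allI impI)
  fix e :: real assume e: "e > 0"
  define d where "d = e / (4 * pi)"
  have d: "d > 0" using e by (simp add: d_def)
  have "uniformly_continuous_on ({s - 1..s + 1} \<times> cell) (\<lambda>z. w (fst z) (snd z))"
   by (intro compact_uniformly_continuous continuous_on_subset[OF c] compact_Times) auto
  then obtain r where r: "r > 0" "!!z z'. z \<in> {s - 1..s + 1} \<times> cell ==> z' \<in> {s - 1..s + 1} \<times> cell ==> dist z' z < r
     ==> dist (w (fst z') (snd z')) (w (fst z) (snd z)) < d"
   using d unfolding uniformly_continuous_on_def by metis
  have "dist (ft (w t)) (ft (w s)) < e" if t: "dist t s < min r 1" for t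
  proof -
   have "\<bar>w t x - w s x\<bar> <= d" if x: "x \<in> cell" for x
    using r(2)[of "(s, x)" "(t, x)"] x t by (auto simp: dist_real_def dist_Pair_Pair abs_less_iff)
   then have "L2_norm (\<lambda>x. w t x - w s x) <= 2 * pi * d"
    using d by (intro L2_norm_bound L2_diff w) auto
   also have "\<dots> < e" using e by (simp add: d_def)
   finally show ?thesis by (simp add: L2_norm_diff_ft w)
  qed
  then show "\<exists>da>0. \<forall>t. dist t s < da --> dist (ft (w t)) (ft (w s)) < e"
   using r(1) by (intro exI[of _ "min r 1"]) auto
 qed
qed

lemma slice_L2: "\<psi> \<in> test_fun ==> slice \<psi> t \<in> L2"
 by (rule smooth_torus_L2[OF smooth_torus_slice])

lemma slice_ft_continuous: assumes "\<psi> \<in> test_fun" shows "continuous_on UNIV (\<lambda>t. ft (slice \<psi> t))"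
 by (rule continuous_family_ft) (use assms in \<open>auto simp: slice_def slice_L2 intro!: smooth_continuous test_funD\<close>)

lemma ft_zero: "ft (\<lambda>x. 0) = 0"
 using ft_cmult[of "\<lambda>x. 0" 0] smooth_torus_L2[OF smooth_torus_const, of 0] by simp

lemma slice_support: assumes "\<psi> \<in> test_fun"
 obtains R where "R >= 0" "!!t. t \<notin> {-R..R} ==> slice \<psi> t = (\<lambda>x. 0)" "!!t. t \<notin> {-R..R} ==> ft (slice \<psi> t) = 0"
proof -
 obtain R where R: "R >= 0" "!!t x. \<bar>t\<bar> > R ==> \<psi> (t, x) = 0" using test_fun_support[OF assms] by metis
 have "slice \<psi> t = (\<lambda>x. 0)" if "t \<notin> {-R..R}" for t
  using R(2)[of t] that by (auto simp: slice_def[abs_def])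
 then show ?thesis using that[of R] R(1) ft_zero by metis
qed

lemma dist_of_slice: "dist_of u \<psi> = (LINT t|lebesgue. ip (u t) (slice \<psi> t))"
 by (simp add: dist_of_def ip_def slice_def)

lemma dist_integrable: assumes "u \<in> C_L2" "\<psi> \<in> test_fun" shows "integrable lebesgue (\<lambda>t. ip (u t) (slice \<psi> t))"
proof -
 obtain R where R: "R >= 0" "!!t. t \<notin> {-R..R} ==> slice \<psi> t = (\<lambda>x. 0)" "!!t. t \<notin> {-R..R} ==> ft (slice \<psi> t) = 0"
  using slice_support[OF assms(2)] by metis
 have u: "u t \<in> L2" for t using assms(1) by (simp add: C_L2_iff)
 have eq: "(\<lambda>t. ip (u t) (slice \<psi> t)) = (\<lambda>t. ft (u t) \<bullet> ft (slice \<psi> t))"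
  using assms u by (simp add: Parseval slice_L2)
 have "continuous_on UNIV (\<lambda>t. ft (u t) \<bullet> ft (slice \<psi> t))"
  using assms by (intro continuous_intros slice_ft_continuous) (simp add: C_L2_iff)
 then show ?thesis unfolding eq by (rule LINT_compact_support(1)[of _ "-R" R]) (simp add: R(3))
qed

lemma dist_of_add: assumes "u \<in> C_L2" "\<psi> \<in> test_fun" "\<phi> \<in> test_fun"
 shows "dist_of u (\<lambda>z. \<psi> z + \<phi> z) = dist_of u \<psi> + dist_of u \<phi>"
proof -
 have u: "u t \<in> L2" for t using assms(1) by (simp add: C_L2_iff)
 have "ip (u t) (slice (\<lambda>z. \<psi> z + \<phi> z) t) = ip (u t) (slice \<psi> t) + ip (u t) (slice \<phi> t)" for t
  using ip_add_right[OF slice_L2[OF assms(2)] slice_L2[OF assms(3)] u, of t t t] by (simp add: slice_def[abs_def])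
 then show ?thesis unfolding dist_of_slice using assms by (simp add: dist_integrable)
qed

lemma dist_of_cmult: "dist_of u (\<lambda>z. c * \<psi> z) = c * dist_of u \<psi>"
 by (simp add: dist_of_def mult.left_commute)

subsection \<open>The transposed operator\<close>

text \<open>The transpose of the spatial part of the operator, acting on test functions.\<close>

definition adj :: "(plane => real) => (plane => real) => (plane => real) => (plane => real) => (plane => real) => (plane => real)
  => (plane => real) => plane => real" where
 "adj a1 a0 am1 b1 b2 c \<phi> x = - d1 (d2 (d1 \<phi>)) x - d2 (d2 (d1 \<phi>)) x
   + d1 (d1 (\<lambda>x. a1 x * \<phi> x)) x + 2 * d2 (d1 (\<lambda>x. a0 x * \<phi> x)) x + d2 (d2 (\<lambda>x. am1 x * \<phi> x)) x
   - d1 (\<lambda>x. b1 x * \<phi> x) x - d2 (\<lambda>x. b2 x * \<phi> x) x + c x * \<phi> x"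

locale coefficients =
 fixes a1 a0 am1 b1 b2 c :: "plane => real"
 assumes smooth_coeffs: "smooth_torus a1" "smooth_torus a0" "smooth_torus am1"
  "smooth_torus b1" "smooth_torus b2" "smooth_torus c"
begin

abbreviation "A \<equiv> adj a1 a0 am1 b1 b2 c"

lemma smooth_torus_adj: assumes "smooth_torus \<phi>" shows "smooth_torus (A \<phi>)"
 unfolding adj_def[abs_def] using assms smooth_coeffs
 by (intro smooth_torus_add smooth_torus_diff smooth_torus_minus smooth_torus_cmult smooth_torus_dir_deriv smooth_torus_mult)

abbreviation "e1 \<equiv> dir_deriv ((0, (1, 0)) :: real \<times> plane)"
abbreviation "e2 \<equiv> dir_deriv ((0, (0, 1)) :: real \<times> plane)"
abbreviation "et \<equiv> dir_deriv ((1, (0, 0)) :: real \<times> plane)"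

text \<open>The transpose of the whole operator. The shape of the sum is the one produced by the linearity of \<open>dist_of\<close>.\<close>

definition Theta :: "(real \<times> plane => real) => real \<times> plane => real" where
 "Theta \<psi> z = - 1 * et \<psi> z + (- 1 * e1 (e2 (e1 \<psi>)) z + (- 1 * e2 (e2 (e1 \<psi>)) z
   + (e1 (e1 (\<lambda>z. a1 (snd z) * \<psi> z)) z + (2 * e2 (e1 (\<lambda>z. a0 (snd z) * \<psi> z)) z + (e2 (e2 (\<lambda>z. am1 (snd z) * \<psi> z)) z
   + (- 1 * e1 (\<lambda>z. b1 (snd z) * \<psi> z) z + (- 1 * e2 (\<lambda>z. b2 (snd z) * \<psi> z) z + c (snd z) * \<psi> z)))))))"

lemma Theta_test_fun: assumes "\<psi> \<in> test_fun" shows "Theta \<psi> \<in> test_fun"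
 unfolding Theta_def[abs_def]
 by (intro test_fun_add test_fun_cmult test_fun_dir_deriv test_fun_mult smooth_coeffs assms)

lemma L_op_Theta: assumes u: "u \<in> C_L2" and \<psi>: "\<psi> \<in> test_fun"
 shows "L_op a1 a0 am1 b1 b2 c (dist_of u) \<psi> = dist_of u (Theta \<psi>)"
proof -
 note tf = test_fun_add test_fun_cmult test_fun_dir_deriv test_fun_mult smooth_coeffs \<psi>
 have "dist_of u (Theta \<psi>) = - 1 * dist_of u (et \<psi>) + (- 1 * dist_of u (e1 (e2 (e1 \<psi>))) + (- 1 * dist_of u (e2 (e2 (e1 \<psi>)))
   + (dist_of u (e1 (e1 (\<lambda>z. a1 (snd z) * \<psi> z))) + (2 * dist_of u (e2 (e1 (\<lambda>z. a0 (snd z) * \<psi> z))) + (dist_of u (e2 (e2 (\<lambda>z. am1 (snd z) * \<psi> z)))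
   + (- 1 * dist_of u (e1 (\<lambda>z. b1 (snd z) * \<psi> z)) + (- 1 * dist_of u (e2 (\<lambda>z. b2 (snd z) * \<psi> z)) + dist_of u (\<lambda>z. c (snd z) * \<psi> z))))))))"
  unfolding Theta_def[abs_def]
  by (simp only: dist_of_add[OF u] dist_of_cmult tf)
 then show ?thesis
  by (simp add: L_op_def p_op_def dist_deriv_def dist_mult_def case_prod_beta')
qed

lemma slice_Theta: assumes \<psi>: "\<psi> \<in> test_fun"
 shows "slice (Theta \<psi>) t x = - slice (et \<psi>) t x + A (slice \<psi> t) x"
proof -
 have sl: "dir_deriv (0, v) \<psi> (t, x) = dir_deriv v (slice \<psi> t) x" if "smooth \<psi>" for \<psi> v t x
  using fun_cong[OF dir_deriv_slice[OF that, of v t], of x] by (simp add: slice_def)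
 have sl2: "slice (dir_deriv (0, v) \<psi>) t = dir_deriv v (slice \<psi> t)" if "smooth \<psi>" for \<psi> v t
  using dir_deriv_slice[OF that, of v t] by simp
 have m: "smooth (\<lambda>z. a (snd z) * \<psi> z)" "slice (\<lambda>z. a (snd z) * \<psi> z) t = (\<lambda>x. a x * slice \<psi> t x)" if "smooth_torus a" for a t
  using that test_funD(1)[OF \<psi>] by (auto intro!: smooth_mult smooth_snd smooth_torusD simp: slice_def[abs_def])
 note sm = test_funD(1)[OF \<psi>]
 have et: "slice (et \<psi>) t x = et \<psi> (t, x)" "\<psi> (t, x) = slice \<psi> t x" by (simp_all add: slice_def)
 have "slice (Theta \<psi>) t x = Theta \<psi> (t, x)" by (simp add: slice_def)
 then show ?thesis unfolding Theta_def adj_def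
  by (simp add: sl sl2 sm smooth_dir_deriv m smooth_coeffs et)
qed

text \<open>Test with products of a function of \<open>t\<close> and a function of \<open>x\<close> and apply du Bois-Reymond in time.\<close>

lemma homogeneous_weak_deriv:
 assumes u: "u \<in> C_L2" and eq: "!!\<psi>. \<psi> \<in> test_fun ==> L_op a1 a0 am1 b1 b2 c (dist_of u) \<psi> = 0"
  and \<phi>: "smooth_torus \<phi>"
 shows "((\<lambda>t. ip (u t) \<phi>) has_real_derivative - ip (u t) (A \<phi>)) (at t)"
proof (rule du_Bois_Reymond)
 have uL: "u t \<in> L2" for t using u by (simp add: C_L2_iff)
 have cu: "continuous_on UNIV (\<lambda>t. ip (u t) \<phi>)" if "smooth_torus \<phi>" for \<phi>
  using u that by (simp add: Parseval uL smooth_torus_L2) (auto simp: C_L2_iff intro!: continuous_intros)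
 show "continuous_on UNIV (\<lambda>t. ip (u t) \<phi>)" by (rule cu[OF \<phi>])
 show "continuous_on UNIV (\<lambda>t. - ip (u t) (A \<phi>))" by (intro continuous_intros cu smooth_torus_adj \<phi>)
 fix \<theta> :: "real => real" assume \<theta>: "\<theta> \<in> test1"
 then have sm: "smooth \<theta>" by (simp add: test1_def)
 define \<psi> where "\<psi> = (\<lambda>z :: real \<times> plane. \<theta> (fst z) * \<phi> (snd z))"
 have \<psi>: "\<psi> \<in> test_fun" unfolding \<psi>_def by (rule test_fun_tensor[OF \<theta> \<phi>])
 have sl: "slice \<psi> t = (\<lambda>x. \<theta> t * \<phi> x)" for t by (simp add: \<psi>_def slice_def[abs_def])
 have et: "slice (et \<psi>) t x = dir_deriv 1 \<theta> t * \<phi> x" for t x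
 proof (rule DERIV_unique)
  show "((\<lambda>t. slice \<psi> t x) has_real_derivative slice (et \<psi>) t x) (at t)"
   using slice_time_deriv[OF test_funD(1)[OF \<psi>], of x t] by (simp add: zero_prod_def)
  show "((\<lambda>t. slice \<psi> t x) has_real_derivative dir_deriv 1 \<theta> t * \<phi> x) (at t)"
   unfolding sl by (rule DERIV_cmult_right[OF smooth_real_has_real_derivative[OF sm]])
 qed
 have Asl: "A (slice \<psi> t) x = \<theta> t * A \<phi> x" for t x
 proof -
  have e: "(\<lambda>x. a x * (\<theta> t * \<phi> x)) = (\<lambda>x. \<theta> t * (a x * \<phi> x))" for a :: "plane => real" by (auto simp: mult_ac)
  have dc: "dir_deriv v (\<lambda>x. \<theta> t * g x) = (\<lambda>x. \<theta> t * dir_deriv v g x)" if "smooth g" for g and v :: plane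
   by (rule dir_deriv_cmult[OF that])
  have sms: "smooth \<phi>" "smooth (\<lambda>x. a1 x * \<phi> x)" "smooth (\<lambda>x. a0 x * \<phi> x)" "smooth (\<lambda>x. am1 x * \<phi> x)"
   "smooth (\<lambda>x. b1 x * \<phi> x)" "smooth (\<lambda>x. b2 x * \<phi> x)"
   using \<phi> smooth_coeffs by (auto intro!: smooth_mult smooth_torusD)
  show ?thesis unfolding sl adj_def e
   by (simp only: dc sms smooth_dir_deriv) (simp add: algebra_simps)
 qed
 have int: "integrable lebesgue (\<lambda>t. ip (u t) (slice (\<lambda>z. f (fst z) * g (snd z)) t))" if "f \<in> test1" "smooth_torus g" for f g
  by (rule dist_integrable[OF u test_fun_tensor[OF that]])
 have \<theta>': "dir_deriv 1 \<theta> \<in> test1"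
 proof -
  obtain R where R: "!!t. \<bar>t\<bar> > R ==> \<theta> t = 0" using \<theta> by (auto simp: test1_def)
  have "dir_deriv 1 \<theta> t = 0" if "\<bar>t\<bar> > R" for t
  proof (rule has_derivative_zero_open[OF smooth_has_derivative[OF sm]])
   show "open {t. \<bar>t\<bar> > R}" by (intro open_Collect_less continuous_intros)
  qed (use that R in auto)
  then show ?thesis using smooth_dir_deriv[OF sm] by (auto simp: test1_def)
 qed
 have i1: "integrable lebesgue (\<lambda>t. dir_deriv 1 \<theta> t * ip (u t) \<phi>)"
  using int[OF \<theta>' \<phi>] by (simp add: slice_def[abs_def] ip_cmult_right)
 have i2: "integrable lebesgue (\<lambda>t. \<theta> t * ip (u t) (A \<phi>))"
  using int[OF \<theta> smooth_torus_adj[OF \<phi>]] by (simp add: slice_def[abs_def] ip_cmult_right)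
 have "0 = dist_of u (Theta \<psi>)" using eq[OF \<psi>] L_op_Theta[OF u \<psi>] by simp
 also have "\<dots> = (LINT t|lebesgue. - (dir_deriv 1 \<theta> t * ip (u t) \<phi>) + \<theta> t * ip (u t) (A \<phi>))"
  unfolding dist_of_slice
 proof (rule Bochner_Integration.integral_cong[OF refl])
  fix t
  have "slice (Theta \<psi>) t = (\<lambda>x. (- dir_deriv 1 \<theta> t) * \<phi> x + \<theta> t * A \<phi> x)"
   using slice_Theta[OF \<psi>] by (auto simp: et Asl fun_eq_iff)
  then show "ip (u t) (slice (Theta \<psi>) t) = - (dir_deriv 1 \<theta> t * ip (u t) \<phi>) + \<theta> t * ip (u t) (A \<phi>)"
   using \<phi> smooth_torus_adj[OF \<phi>] uL
   by (simp only: ip_add_right L2_cmult smooth_torus_L2 ip_cmult_right)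
 qed
 also have "\<dots> = - (LINT t|lebesgue. dir_deriv 1 \<theta> t * ip (u t) \<phi>) + (LINT t|lebesgue. \<theta> t * ip (u t) (A \<phi>))"
  using i1 i2 by simp
 finally show "(LINT t|lebesgue. dir_deriv 1 \<theta> t * ip (u t) \<phi>) = - (LINT t|lebesgue. \<theta> t * - ip (u t) (A \<phi>))"
  by simp
qed

end

section \<open>The Duhamel formula\<close>

lemma sigma_finite_lebesgue: "sigma_finite_measure (lebesgue :: 'a::euclidean_space measure)"
proof
 obtain A :: "'a set set" where A: "countable A" "A \<subseteq> sets lborel" "\<Union>A = space lborel" "\<forall>a\<in>A. emeasure lborel a ~= \<infinity>"
  using lborel.sigma_finite_countable by blast
 then show "\<exists>A::'a set set. countable A \<and> A \<subseteq> sets lebesgue \<and> \<Union>A = space lebesgue \<and> (\<forall>a\<in>A. emeasure lebesgue a ~= \<infinity>)"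
  by (intro exI[of _ A]) (auto simp: emeasure_completion subset_eq)
qed

interpretation leb: sigma_finite_measure "lebesgue :: real measure" by (rule sigma_finite_lebesgue)
interpretation leb_pair: pair_sigma_finite "lebesgue :: real measure" "lebesgue :: real measure" ..

lemma lebesgue_to_borel: "f \<in> borel_measurable borel ==> f \<in> borel_measurable lebesgue"
 by (simp add: measurable_completion)

text \<open>The kernel of the integral from \<open>0\<close> to \<open>t\<close> for either sign of \<open>t\<close>.\<close>

definition sg :: "real => real => real" where
 "sg t r = (if 0 < r \<and> r <= t then 1 else if t < r \<and> r <= 0 then - 1 else 0)"

lemma sg_bound: "\<bar>sg t r\<bar> <= 1" "sg t r ~= 0 ==> \<bar>r\<bar> <= \<bar>t\<bar>"
 by (auto simp: sg_def split: if_splits)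

definition loc_int :: "(real => l2) => bool" where
 "loc_int g \<longleftrightarrow> g \<in> borel_measurable lebesgue \<and> (\<forall>R. set_integrable lebesgue {-R..R} (\<lambda>r. norm (g r)))"

lemma loc_intD: assumes "loc_int g"
 shows "g \<in> borel_measurable lebesgue" "integrable lebesgue (\<lambda>r. indicator {-R..R} r * norm (g r))"
 using assms by (auto simp: loc_int_def set_integrable_def)

lemma pair_fst_snd_borel:
 "(\<lambda>p. fst p) \<in> borel_measurable (lebesgue \<Otimes>\<^sub>M lebesgue :: (real \<times> real) measure)"
 "(\<lambda>p. snd p) \<in> borel_measurable (lebesgue \<Otimes>\<^sub>M lebesgue :: (real \<times> real) measure)"
 using measurable_compose[OF measurable_fst lebesgue_to_borel[OF measurable_ident[of borel, unfolded id_def]]]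
  measurable_compose[OF measurable_snd lebesgue_to_borel[OF measurable_ident[of borel, unfolded id_def]]]
 by (auto simp: id_def)

lemma sg_measurable: "(\<lambda>p. sg (fst p) (snd p)) \<in> borel_measurable (lebesgue \<Otimes>\<^sub>M lebesgue)"
proof -
 note [measurable] = pair_fst_snd_borel
 show ?thesis unfolding sg_def by measurable
qed

context lattice_system
begin

lemma S_measurable:
 assumes "g \<in> borel_measurable lebesgue"
 shows "(\<lambda>p. S (fst p - snd p) (g (snd p))) \<in> borel_measurable (lebesgue \<Otimes>\<^sub>M lebesgue)"
proof -
 note [measurable] = pair_fst_snd_borel
 have [measurable]: "(\<lambda>p. g (snd p)) \<in> borel_measurable (lebesgue \<Otimes>\<^sub>M lebesgue)"
  by (rule measurable_compose[OF measurable_snd assms])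
 have "(\<lambda>p. (fst p - snd p, g (snd p))) \<in> borel_measurable (lebesgue \<Otimes>\<^sub>M lebesgue)"
  by measurable
 from measurable_compose[OF this borel_measurable_continuous_onI[OF S_jointly_continuous]]
 show ?thesis by simp
qed

lemma S_measurable1:
 assumes "g \<in> borel_measurable lebesgue"
 shows "(\<lambda>r. sg t r *\<^sub>R S (t - r) (g r)) \<in> borel_measurable lebesgue"
proof -
 have "(\<lambda>r. (t, r)) \<in> lebesgue \<rightarrow>\<^sub>M (lebesgue \<Otimes>\<^sub>M lebesgue :: (real \<times> real) measure)" by measurable
 from measurable_compose[OF this borel_measurable_scaleR[OF sg_measurable S_measurable[OF assms]]]
 show ?thesis by simp
qed

lemma duhamel_bound:
 assumes "\<bar>t\<bar> <= R"
 shows "norm (sg t r *\<^sub>R S (t - r) (g r)) <= exp (K * (2 * R)) * (indicator {-R..R} r * norm (g r))"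
proof (cases "sg t r = 0")
 case True
 then show ?thesis by simp
next
 case False
 then have r: "\<bar>r\<bar> <= \<bar>t\<bar>" by (rule sg_bound)
 have "norm (sg t r *\<^sub>R S (t - r) (g r)) <= 1 * norm (S (t - r) (g r))"
  using sg_bound(1)[of t r] by (simp add: mult_left_le_one_le)
 also have "\<dots> <= exp (K * \<bar>t - r\<bar>) * norm (g r)" using S_norm_le by simp
 also have "\<dots> <= exp (K * (2 * R)) * norm (g r)"
  using r assms K_ge by (intro mult_right_mono) auto
 also have "norm (g r) = indicator {-R..R} r * norm (g r)"
 proof -
  have "- R <= r \<and> r <= R" using r assms by linarith
  then show ?thesis by simp
 qed
 finally show ?thesis .
qed

lemma duhamel_integrable: assumes "loc_int g" shows "integrable lebesgue (\<lambda>r. sg t r *\<^sub>R S (t - r) (g r))"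
proof (rule Bochner_Integration.integrable_bound)
 show "integrable lebesgue (\<lambda>r. exp (K * (2 * \<bar>t\<bar>)) * (indicator {-\<bar>t\<bar>..\<bar>t\<bar>} r * norm (g r)))"
  using loc_intD(2)[OF assms] by simp
 show "(\<lambda>r. sg t r *\<^sub>R S (t - r) (g r)) \<in> borel_measurable lebesgue"
  by (rule S_measurable1[OF loc_intD(1)[OF assms]])
 show "AE r in lebesgue. norm (sg t r *\<^sub>R S (t - r) (g r)) <= norm (exp (K * (2 * \<bar>t\<bar>)) * (indicator {-\<bar>t\<bar>..\<bar>t\<bar>} r * norm (g r)))"
  using duhamel_bound[of t "\<bar>t\<bar>" _ g] by (intro AE_I2) (simp add: abs_mult)
qed

definition duhamel :: "l2 => (real => l2) => real => l2" where
 "duhamel x g t = S t x + (LINT r|lebesgue. sg t r *\<^sub>R S (t - r) (g r))"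

lemma duhamel_0: "duhamel x g 0 = x"
proof -
 have "sg 0 r = 0" for r by (auto simp: sg_def)
 then show ?thesis unfolding duhamel_def by (simp add: S_0)
qed

lemma duhamel_continuous: assumes g: "loc_int g" shows "continuous_on UNIV (duhamel x g)"
proof -
 have "continuous_on UNIV (\<lambda>t. LINT r|lebesgue. sg t r *\<^sub>R S (t - r) (g r))"
  unfolding continuous_on_sequentially o_def
 proof (intro ballI allI impI)
  fix t :: real and X assume X: "(\<forall>n. X n \<in> UNIV) \<and> X \<longlonglongrightarrow> t"
  then have lim: "X \<longlonglongrightarrow> t" by blast
  then have "Bseq X" by (intro convergent_imp_Bseq) (auto simp: convergent_def)
  then obtain R0 where R0: "!!n. \<bar>X n\<bar> <= R0" unfolding Bseq_def by auto
  define R where "R = max R0 \<bar>t\<bar>"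
  have R: "\<bar>X n\<bar> <= R" "\<bar>t\<bar> <= R" for n using R0[of n] by (auto simp: R_def)
  show "(\<lambda>n. LINT r|lebesgue. sg (X n) r *\<^sub>R S (X n - r) (g r)) \<longlonglongrightarrow> (LINT r|lebesgue. sg t r *\<^sub>R S (t - r) (g r))"
  proof (rule integral_dominated_convergence)
   show "integrable lebesgue (\<lambda>r. exp (K * (2 * R)) * (indicator {-R..R} r * norm (g r)))"
    using loc_intD(2)[OF g] by simp
   show "AE r in lebesgue. norm (sg (X n) r *\<^sub>R S (X n - r) (g r)) <= exp (K * (2 * R)) * (indicator {-R..R} r * norm (g r))" for n
    by (intro AE_I2 duhamel_bound R)
   have "AE r in lebesgue. r ~= t" by (rule AE_completion) (rule AE_lborel_singleton)
   then show "AE r in lebesgue. (\<lambda>n. sg (X n) r *\<^sub>R S (X n - r) (g r)) \<longlonglongrightarrow> sg t r *\<^sub>R S (t - r) (g r)"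
   proof eventually_elim
    case (elim r)
    have "\<forall>\<^sub>F n in sequentially. sg (X n) r = sg t r"
    proof (cases "r < t")
     case True
     then have "\<forall>\<^sub>F n in sequentially. r < X n" using lim by (rule order_tendstoD(1)[rotated])
     then show ?thesis by eventually_elim (use True in \<open>auto simp: sg_def\<close>)
    next
     case False
     then have "t < r" using elim by simp
     then have "\<forall>\<^sub>F n in sequentially. X n < r" using lim by (rule order_tendstoD(2)[rotated])
     then show ?thesis by eventually_elim (use \<open>t < r\<close> in \<open>auto simp: sg_def\<close>)
    qed
    then have "(\<lambda>n. sg (X n) r) \<longlonglongrightarrow> sg t r" by (rule tendsto_eventually)
    moreover have "(\<lambda>n. S (X n - r) (g r)) \<longlonglongrightarrow> S (t - r) (g r)"
    proof (rule isCont_tendsto_compose[of _ "\<lambda>t. S t (g r)"])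
     show "isCont (\<lambda>t. S t (g r)) (t - r)" using S_continuous by (simp add: continuous_on_eq_continuous_at)
    qed (intro tendsto_intros lim)
    ultimately show ?case by (rule tendsto_scaleR)
   qed
  qed (rule S_measurable1[OF loc_intD(1)[OF g]])+
 qed
 then show ?thesis unfolding duhamel_def[abs_def] by (intro continuous_intros S_continuous)
qed

text \<open>Integration by parts in \<open>t\<close> along the flow started at time \<open>r\<close>; the kernel leaves one boundary term at \<open>t = r\<close>.\<close>

lemma kernel_by_parts:
 fixes \<theta> \<theta>' :: "real => complex"
 assumes \<theta>: "!!t. (\<theta> has_vector_derivative \<theta>' t) (at t)" "continuous_on UNIV \<theta>'"
  and supp: "!!t. t \<notin> {-R..R} ==> \<theta> t = 0" "!!t. t \<notin> {-R..R} ==> \<theta>' t = 0"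
 shows "(LINT t|lebesgue. sg t r *\<^sub>R (\<theta>' t * coef (S (t - r) y) k + \<theta> t * gen k (S (t - r) y))) = - \<theta> r * coef y k"
  "(LINT t|lebesgue. \<theta>' t * coef (S t y) k + \<theta> t * gen k (S t y)) = 0"
proof -
 define F where "F r t = \<theta> t * coef (S (t - r) y) k" for r t
 define f where "f r t = \<theta>' t * coef (S (t - r) y) k + \<theta> t * gen k (S (t - r) y)" for r t
 have dS: "((\<lambda>t. coef (S (t - r) y) k) has_vector_derivative gen k (S (t - r) y)) (at t)" for r t
 proof -
  have "((\<lambda>t. t - r) has_vector_derivative 1) (at t)"
   by (auto intro!: derivative_eq_intros simp: has_vector_derivative_def)
  from vector_diff_chain_at[OF this, of "\<lambda>t. coef (S t y) k" "gen k (S (t - r) y)"] S_deriv[where t="t - r"]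
  show ?thesis by (simp add: o_def)
 qed
 have dF: "(F r has_vector_derivative f r t) (at t)" for r t
  unfolding F_def f_def using has_vector_derivative_mult[OF \<theta>(1)[of t] dS[of r t]] by (simp add: add.commute)
 have ct: "continuous_on UNIV \<theta>" using \<theta>(1) has_vector_derivative_continuous
  by (intro continuous_at_imp_continuous_on ballI) blast
 have cS: "continuous_on UNIV (\<lambda>t. S (t - r) y)" for r
  by (rule continuous_on_compose2[OF S_continuous]) (auto intro!: continuous_intros)
 have cf: "continuous_on A (f r)" for A r
  by (rule continuous_on_subset[of UNIV]) (auto simp: f_def[abs_def] intro!: continuous_intros ct \<theta>(2)
     bounded_linear.continuous_on[OF gen_bounded_linear cS] bounded_linear.continuous_on[OF coef_bounded_linear cS])
 define Q where "Q = \<bar>R\<bar> + \<bar>r\<bar> + 1"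
 have Q: "Q > 0" "\<bar>r\<bar> < Q" by (auto simp: Q_def)
 have QR: "\<theta> Q = 0" "\<theta> (- Q) = 0"
 proof -
  have "Q \<notin> {-R..R}" "- Q \<notin> {-R..R}" unfolding Q_def atLeastAtMost_iff by linarith+
  then show "\<theta> Q = 0" "\<theta> (- Q) = 0" by (auto intro: supp(1))
 qed
 note Q = Q QR
 have f0: "f r t = 0" if "t \<notin> {-Q..Q}" for r t
 proof -
  have "t \<notin> {-R..R}" using that by (auto simp: Q_def)
  then show ?thesis using supp by (simp add: f_def)
 qed
 have ftc: "(LINT t|lebesgue. indicator {a..b} t *\<^sub>R f r t) = F r b - F r a" if "a <= b" for a b r
 proof -
  have "f r absolutely_integrable_on {a..b}" by (rule absolutely_integrable_continuous_real[OF cf])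
  then have "(LINT t:{a..b}|lebesgue. f r t) = integral {a..b} (f r)" by (rule set_lebesgue_integral_eq_integral(2))
  also have "\<dots> = F r b - F r a"
   by (rule integral_unique[OF fundamental_theorem_of_calculus[OF that]])
     (rule has_vector_derivative_at_within[OF dF])
  finally show ?thesis by (simp add: set_lebesgue_integral_def)
 qed
 have "(LINT t|lebesgue. f 0 t) = (LINT t|lebesgue. indicator {-Q..Q} t *\<^sub>R f 0 t)"
  by (rule Bochner_Integration.integral_cong) (auto simp: indicator_def f0)
 also have "\<dots> = 0" using Q by (subst ftc) (auto simp: F_def)
 finally show "(LINT t|lebesgue. \<theta>' t * coef (S t y) k + \<theta> t * gen k (S t y)) = 0" by (simp add: f_def)
 show "(LINT t|lebesgue. sg t r *\<^sub>R (\<theta>' t * coef (S (t - r) y) k + \<theta> t * gen k (S (t - r) y))) = - \<theta> r * coef y k"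
 proof (cases "0 < r")
  case True
  have "(LINT t|lebesgue. sg t r *\<^sub>R f r t) = (LINT t|lebesgue. indicator {r..Q} t *\<^sub>R f r t)"
   by (rule Bochner_Integration.integral_cong) (use True Q in \<open>auto simp: indicator_def sg_def intro!: f0\<close>)
  also have "\<dots> = F r Q - F r r" using Q by (intro ftc) auto
  finally show ?thesis using Q by (simp add: F_def f_def S_0)
 next
  case False
  have "AE t in lebesgue. t ~= r" by (rule AE_completion) (rule AE_lborel_singleton)
  then have ae: "AE t in lebesgue. sg t r *\<^sub>R f r t = - (indicator {-Q..r} t *\<^sub>R f r t)"
   by eventually_elim (use False Q in \<open>auto simp: indicator_def sg_def intro!: f0\<close>)
  have "(LINT t|lebesgue. sg t r *\<^sub>R f r t) = (LINT t|lebesgue. - (indicator {-Q..r} t *\<^sub>R f r t))"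
  proof (rule integral_cong_AE[OF _ _ ae])
   have fm: "f r \<in> borel_measurable lebesgue"
    by (intro lebesgue_to_borel borel_measurable_continuous_onI cf)
   have "(\<lambda>t. sg t r) \<in> borel_measurable borel" unfolding sg_def by measurable
   from lebesgue_to_borel[OF this] show "(\<lambda>t. sg t r *\<^sub>R f r t) \<in> borel_measurable lebesgue"
    by (rule borel_measurable_scaleR[OF _ fm])
   show "(\<lambda>t. - (indicator {-Q..r} t *\<^sub>R f r t)) \<in> borel_measurable lebesgue"
    by (intro borel_measurable_uminus borel_measurable_scaleR borel_measurable_indicator fm) simp
  qed
  also have "\<dots> = - (F r r - F r (- Q))" using Q by (simp add: ftc)
  finally show ?thesis using Q by (simp add: F_def f_def S_0)
 qed
qed

text \<open>Fubini reduces the claim to \<open>kernel_by_parts\<close> for each starting time.\<close>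

lemma duhamel_weak:
 fixes \<theta> \<theta>' :: "real => complex"
 assumes g: "loc_int g"
  and \<theta>: "!!t. (\<theta> has_vector_derivative \<theta>' t) (at t)" "continuous_on UNIV \<theta>'"
  and supp: "!!t. t \<notin> {-R..R} ==> \<theta> t = 0" "!!t. t \<notin> {-R..R} ==> \<theta>' t = 0"
 shows "(LINT t|lebesgue. \<theta>' t * coef (duhamel x g t) k + \<theta> t * gen k (duhamel x g t)) = - (LINT t|lebesgue. \<theta> t * coef (g t) k)"
proof -
 define D where "D t = (LINT r|lebesgue. sg t r *\<^sub>R S (t - r) (g r))" for t
 define P where "P t y = \<theta>' t * coef y k + \<theta> t * gen k y" for t y
 have ct: "continuous_on UNIV \<theta>" using \<theta>(1) has_vector_derivative_continuous
  by (intro continuous_at_imp_continuous_on ballI) blast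
 have Pbl: "bounded_linear (P t)" for t unfolding P_def[abs_def]
  by (intro bounded_linear_add bounded_linear_compose[OF bounded_linear_mult_right coef_bounded_linear]
    bounded_linear_compose[OF bounded_linear_mult_right gen_bounded_linear])
 have PD: "P t (D t) = (LINT r|lebesgue. sg t r *\<^sub>R P t (S (t - r) (g r)))" for t
  unfolding D_def
  by (subst integral_bounded_linear[OF Pbl duhamel_integrable[OF g], symmetric])
    (simp add: linear_cmul[OF bounded_linear.linear[OF Pbl]])
 obtain C1 where C1: "C1 > 0" "!!y. cmod (gen k y) <= norm y * C1"
  using bounded_linear.pos_bounded[OF gen_bounded_linear[of k]] by blast
 define RR where "RR = \<bar>R\<bar>"
 have supp': "\<theta> t = 0" "\<theta>' t = 0" if "\<not> \<bar>t\<bar> <= RR" for t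
 proof -
  have "t \<notin> {-R..R}" using that unfolding RR_def atLeastAtMost_iff by linarith
  then show "\<theta> t = 0" "\<theta>' t = 0" by (rule supp)+
 qed
 have "bounded (\<theta> ` {-RR..RR})" "bounded (\<theta>' ` {-RR..RR})"
  by (intro compact_imp_bounded compact_continuous_image continuous_on_subset[OF ct] continuous_on_subset[OF \<theta>(2)] compact_Icc subset_UNIV)+
 then obtain B B' where "\<forall>y\<in>\<theta> ` {-RR..RR}. cmod y <= B" "\<forall>y\<in>\<theta>' ` {-RR..RR}. cmod y <= B'"
  unfolding bounded_iff by blast
 then have B: "!!t. \<bar>t\<bar> <= RR ==> cmod (\<theta> t) <= B" "!!t. \<bar>t\<bar> <= RR ==> cmod (\<theta>' t) <= B'"
  by (simp_all add: abs_le_iff)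
 have Pb: "cmod (P t y) <= (B' + B * C1) * norm y" if t: "\<bar>t\<bar> <= RR" for t y
 proof -
  have "cmod (P t y) <= cmod (\<theta>' t) * cmod (coef y k) + cmod (\<theta> t) * cmod (gen k y)"
   unfolding P_def by (rule order_trans[OF norm_triangle_ineq]) (simp add: norm_mult)
  also have "\<dots> <= B' * norm y + B * (norm y * C1)"
   using B[OF t] order_trans[OF norm_ge_zero B(1)[OF t]] order_trans[OF norm_ge_zero B(2)[OF t]] C1
   by (intro add_mono mult_mono cmod_coef_le) auto
  finally show ?thesis by (simp add: algebra_simps)
 qed
 define M where "M = B' + B * C1"
 have M0: "M >= 0" using B(1)[of 0] B(2)[of 0] C1 unfolding M_def RR_def
  by (intro add_nonneg_nonneg mult_nonneg_nonneg) (auto intro: order_trans[OF norm_ge_zero])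
 define I where "I = (\<lambda>t r. sg t r *\<^sub>R P t (S (t - r) (g r)))"
 have Im: "case_prod I \<in> borel_measurable (lebesgue \<Otimes>\<^sub>M lebesgue)"
 proof -
  note [measurable] = sg_measurable S_measurable[OF loc_intD(1)[OF g]] pair_fst_snd_borel
  have [measurable]: "(\<lambda>p. \<theta> (fst p)) \<in> borel_measurable (lebesgue \<Otimes>\<^sub>M (lebesgue :: real measure))"
   "(\<lambda>p. \<theta>' (fst p)) \<in> borel_measurable (lebesgue \<Otimes>\<^sub>M (lebesgue :: real measure))"
   using measurable_compose[OF pair_fst_snd_borel(1) borel_measurable_continuous_onI[OF ct]]
    measurable_compose[OF pair_fst_snd_borel(1) borel_measurable_continuous_onI[OF \<theta>(2)]] .
  have [measurable]: "(\<lambda>p. coef (S (fst p - snd p) (g (snd p))) k) \<in> borel_measurable (lebesgue \<Otimes>\<^sub>M lebesgue)"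
   "(\<lambda>p. gen k (S (fst p - snd p) (g (snd p)))) \<in> borel_measurable (lebesgue \<Otimes>\<^sub>M lebesgue)"
   using measurable_compose[OF S_measurable[OF loc_intD(1)[OF g]] borel_measurable_continuous_onI[OF linear_continuous_on[OF coef_bounded_linear]]]
    measurable_compose[OF S_measurable[OF loc_intD(1)[OF g]] borel_measurable_continuous_onI[OF linear_continuous_on[OF gen_bounded_linear]]] .
  have "(\<lambda>p. sg (fst p) (snd p) *\<^sub>R (\<theta>' (fst p) * coef (S (fst p - snd p) (g (snd p))) k + \<theta> (fst p) * gen k (S (fst p - snd p) (g (snd p)))))
    \<in> borel_measurable (lebesgue \<Otimes>\<^sub>M lebesgue)" by measurable
  then show ?thesis by (simp add: I_def P_def case_prod_beta')
 qed
 have Ib: "norm (I t r) <= indicator {-RR..RR} t * (M * exp (K * (2 * RR)) * (indicator {-RR..RR} r * norm (g r)))" for t r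
 proof (cases "\<bar>t\<bar> <= RR")
  case True
  have "norm (I t r) = norm (P t (sg t r *\<^sub>R S (t - r) (g r)))" by (simp add: I_def linear_cmul[OF bounded_linear.linear[OF Pbl]])
  also have "\<dots> <= M * norm (sg t r *\<^sub>R S (t - r) (g r))" unfolding M_def by (rule Pb[OF True])
  also have "\<dots> <= M * (exp (K * (2 * RR)) * (indicator {-RR..RR} r * norm (g r)))"
   by (intro mult_left_mono duhamel_bound True M0)
  finally show ?thesis using True by (simp add: indicator_def abs_le_iff mult.assoc)
 next
  case False
  then show ?thesis using supp'[OF False] by (auto simp: I_def P_def indicator_def)
 qed
 have gi: "integrable lebesgue (\<lambda>r. M * exp (K * (2 * RR)) * (indicator {-RR..RR} r * norm (g r)))"
  by (intro integrable_mult_right loc_intD(2)[OF g])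
 have Ir: "integrable lebesgue (\<lambda>r. I t r)" for t
  unfolding I_def using integrable_bounded_linear[OF Pbl duhamel_integrable[OF g, of t]]
  by (simp add: linear_cmul[OF bounded_linear.linear[OF Pbl]])
 have Iint: "integrable (lebesgue \<Otimes>\<^sub>M lebesgue) (case_prod I)"
 proof (rule leb_pair.Fubini_integrable[OF Im])
  define c where "c = (LINT r|lebesgue. M * exp (K * (2 * RR)) * (indicator {-RR..RR} r * norm (g r)))"
  have i1: "integrable lebesgue (\<lambda>t. indicator {-RR..RR} t * c :: real)"
   by (intro integrable_mult_left integrable_real_indicator) (auto simp: emeasure_lborel_Icc_eq)
  show "integrable lebesgue (\<lambda>t. LINT r|lebesgue. norm (case_prod I (t, r)))"
  proof (rule Bochner_Integration.integrable_bound[OF i1])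
   show "(\<lambda>t. LINT r|lebesgue. norm (case_prod I (t, r))) \<in> borel_measurable lebesgue"
    using leb.borel_measurable_lebesgue_integral[of "\<lambda>t r. norm (case_prod I (t, r))" lebesgue] Im
    by (simp add: case_prod_beta')
   have "(LINT r|lebesgue. norm (I t r)) <= indicator {-RR..RR} t * c" for t
   proof -
    have "(LINT r|lebesgue. norm (I t r)) <= (LINT r|lebesgue. indicator {-RR..RR} t * (M * exp (K * (2 * RR)) * (indicator {-RR..RR} r * norm (g r))))"
     by (rule integral_mono) (use Ir gi Ib in auto)
    then show ?thesis by (simp add: c_def)
   qed
   moreover have "0 <= (LINT r|lebesgue. norm (I t r))" for t by simp
   ultimately have "norm (LINT r|lebesgue. norm (I t r)) <= norm (indicator {-RR..RR} t * c)" for t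
    by (metis abs_of_nonneg order_trans real_norm_def)
   then show "AE t in lebesgue. norm (LINT r|lebesgue. norm (case_prod I (t, r))) <= norm (indicator {-RR..RR} t * c)" by simp
  qed
  show "AE t in lebesgue. integrable lebesgue (\<lambda>r. case_prod I (t, r))" using Ir by simp
 qed
 have hom: "integrable lebesgue (\<lambda>t. P t (S t x))"
 proof -
  have cont: "continuous_on A (\<lambda>t. P t (S t x))" for A
   by (rule continuous_on_subset[of UNIV]) (auto simp: P_def[abs_def] intro!: continuous_intros ct \<theta>(2)
     bounded_linear.continuous_on[OF gen_bounded_linear S_continuous] bounded_linear.continuous_on[OF coef_bounded_linear S_continuous])
  have "(\<lambda>t. P t (S t x)) absolutely_integrable_on {-RR..RR}" by (rule absolutely_integrable_continuous_real[OF cont])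
  moreover have "(\<lambda>t. indicator {-RR..RR} t *\<^sub>R P t (S t x)) = (\<lambda>t. P t (S t x))"
   using supp' by (auto simp: indicator_def P_def fun_eq_iff abs_le_iff)
  ultimately show ?thesis by (simp add: set_integrable_def)
 qed
 have inh: "integrable lebesgue (\<lambda>t. P t (D t))"
  using leb_pair.integrable_fst[OF Iint] unfolding PD I_def .
 have "(LINT t|lebesgue. P t (duhamel x g t)) = (LINT t|lebesgue. P t (S t x) + P t (D t))"
  by (simp add: duhamel_def D_def bounded_linear.linear[OF Pbl] linear_add)
 also have "\<dots> = (LINT t|lebesgue. P t (S t x)) + (LINT t|lebesgue. P t (D t))"
  by (rule Bochner_Integration.integral_add[OF hom inh])
 also have "(LINT t|lebesgue. P t (S t x)) = 0"
  unfolding P_def by (rule kernel_by_parts(2)[OF \<theta> supp])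
 also have "(LINT t|lebesgue. P t (D t)) = (LINT t|lebesgue. LINT r|lebesgue. I t r)"
  unfolding PD I_def ..
 also have "\<dots> = (LINT r|lebesgue. LINT t|lebesgue. I t r)"
  by (rule leb_pair.Fubini_integral[OF Iint, symmetric])
 also have "\<dots> = (LINT r|lebesgue. - \<theta> r * coef (g r) k)"
  unfolding I_def P_def by (intro Bochner_Integration.integral_cong refl kernel_by_parts(1)[OF \<theta> supp])
 finally show ?thesis by (simp add: P_def)
qed

end

subsection \<open>Summable lattice weights\<close>

lemma sum_int_inverse_square: "(\<Sum>a\<in>{- int n..int n}. inverse ((1 + \<bar>of_int a\<bar>)^2)) <= 4 - 2 / (1 + real n)"
proof (induction n)
 case (Suc n)
 have e: "{- int (Suc n)..int (Suc n)} = insert (- int (Suc n)) (insert (int (Suc n)) {- int n..int n})" by auto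
 have "(\<Sum>a\<in>{- int (Suc n)..int (Suc n)}. inverse ((1 + \<bar>of_int a\<bar>)^2))
   = 2 * inverse ((2 + real n)^2) + (\<Sum>a\<in>{- int n..int n}. inverse ((1 + \<bar>of_int a\<bar>)^2))"
  unfolding e by (subst sum.insert, simp, simp, subst sum.insert) (simp_all add: add.commute)
 also have "\<dots> <= 2 * inverse ((2 + real n)^2) + (4 - 2 / (1 + real n))" using Suc by simp
 also have "\<dots> <= 4 - 2 / (1 + real (Suc n))"
 proof -
  have "2 * inverse ((2 + real n)^2) <= 2 / ((1 + real n) * (2 + real n))"
   unfolding power2_eq_square inverse_eq_divide times_divide_eq_right mult_1_right
   by (intro divide_left_mono mult_right_mono mult_pos_pos) auto
  also have "\<dots> = 2 / (1 + real n) - 2 / (1 + real (Suc n))" by (simp add: field_simps)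
  finally show ?thesis by simp
 qed
 finally show ?case .
qed simp

lemma wt_inverse_summable: "(\<lambda>l. inverse (wt l ^ 4)) summable_on UNIV"
proof (rule nonneg_bdd_above_summable_on)
 show "0 <= inverse (wt l ^ 4)" for l using wt_pos[of l] by simp
 show "bdd_above (sum (\<lambda>l. inverse (wt l ^ 4)) ` {F. F \<subseteq> UNIV \<and> finite F})"
 proof (rule bdd_aboveI2)
  fix F :: "freq set" assume "F \<in> {F. F \<subseteq> UNIV \<and> finite F}"
  then obtain n where n: "F \<subseteq> fbox n" using fbox_exhausts by blast
  define q where "q a = inverse ((1 + \<bar>of_int a :: real\<bar>)^2)" for a :: int
  have q0: "q a >= 0" for a by (simp add: q_def)
  have "sum (\<lambda>l. inverse (wt l ^ 4)) F <= sum (\<lambda>l. inverse (wt l ^ 4)) (fbox n)"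
   using n wt_pos by (intro sum_mono2) (auto intro: less_imp_le)
  also have "\<dots> <= (\<Sum>(a, b)\<in>fbox n. q a * q b)"
  proof (rule sum_mono, clarify)
   fix a b :: int
   have "(1 + \<bar>of_int a :: real\<bar>)^2 * (1 + \<bar>of_int b\<bar>)^2 <= (wt (a, b))^2 * (wt (a, b))^2"
    by (intro mult_mono power_mono) (auto simp: wt_def)
   also have "\<dots> = wt (a, b) ^ 4" by (simp flip: power_add)
   finally have "inverse (wt (a, b) ^ 4) <= inverse ((1 + \<bar>of_int a :: real\<bar>)^2 * (1 + \<bar>of_int b\<bar>)^2)"
    by (intro le_imp_inverse_le mult_pos_pos zero_less_power) auto
   then show "inverse (wt (a, b) ^ 4) <= q a * q b" by (simp add: q_def)
  qed
  also have "\<dots> = (\<Sum>a\<in>{- int n..int n}. q a) * (\<Sum>b\<in>{- int n..int n}. q b)"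
   unfolding fbox_def by (simp add: sum_product sum.cartesian_product)
  also have "\<dots> <= 4 * 4"
  proof -
   have "(\<Sum>a\<in>{- int n..int n}. q a) <= 4 - 2 / (1 + real n)" unfolding q_def by (rule sum_int_inverse_square)
   also have "\<dots> <= 4" by simp
   finally show ?thesis by (intro mult_mono sum_nonneg q0) auto
  qed
  finally show "sum (\<lambda>l. inverse (wt l ^ 4)) F <= 4 * 4" .
 qed
qed

subsection \<open>Convergence of truncated pairings\<close>

text \<open>Weak equations are known coordinate by coordinate; summing them over boxes of frequencies and letting the boxes grow is justified by dominated convergence.\<close>

lemma truncated_pairing_integrable:
 assumes G: "loc_int G" and W: "continuous_on UNIV W" "!!t. t \<notin> {-R..R} ==> W t = 0"
 shows "integrable lebesgue (\<lambda>t. trunc F (G t) \<bullet> W t)" "integrable lebesgue (\<lambda>t. G t \<bullet> W t)"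
  and "(\<lambda>n. LINT t|lebesgue. trunc (fbox n) (G t) \<bullet> W t) \<longlonglongrightarrow> (LINT t|lebesgue. G t \<bullet> W t)"
proof -
 have "bounded (W ` {-R..R})" by (intro compact_imp_bounded compact_continuous_image continuous_on_subset[OF W(1)]) auto
 then obtain B0 where "\<forall>y\<in>W ` {-R..R}. norm y <= B0" unfolding bounded_iff by blast
 then have B0: "!!t. t \<in> {-R..R} ==> norm (W t) <= B0" by blast
 define B where "B = \<bar>B0\<bar>"
 have B: "norm (W t) <= B" "B >= 0" for t using B0[of t] W(2)[of t] by (cases "t \<in> {-R..R}"; simp add: B_def)+
 have bl: "bounded_linear (trunc F)" for F
  by (rule bounded_linear_intro[where K=1]) (auto intro!: l2_eqI simp: norm_trunc_le)
 note [measurable] = loc_intD(1)[OF G] lebesgue_to_borel[OF borel_measurable_continuous_onI[OF W(1)]]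
 have [measurable]: "(\<lambda>t. trunc F (G t)) \<in> borel_measurable lebesgue" for F
  using measurable_compose[OF loc_intD(1)[OF G] borel_measurable_continuous_onI[OF linear_continuous_on[OF bl]]] .
 have dom: "integrable lebesgue (\<lambda>t. B * (indicator {-R..R} t * norm (G t)))"
  by (intro integrable_mult_right loc_intD(2)[OF G])
 have b: "norm (y \<bullet> W t) <= B * (indicator {-R..R} t * norm (G t))" if "norm y <= norm (G t)" for y t
 proof (cases "t \<in> {-R..R}")
  case True
  have "\<bar>y \<bullet> W t\<bar> <= norm y * norm (W t)" by (rule Cauchy_Schwarz_ineq2)
  also have "\<dots> <= norm (G t) * B" using that B by (intro mult_mono) auto
  finally show ?thesis using True by (simp add: mult.commute)
 qed (use W(2) in simp)
 have bn: "norm (y \<bullet> W t) <= norm (B * (indicator {-R..R} t * norm (G t)))" if "norm y <= norm (G t)" for y t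
  using b[OF that] by simp
 show "integrable lebesgue (\<lambda>t. trunc F (G t) \<bullet> W t)"
 proof (rule Bochner_Integration.integrable_bound[OF dom])
  show "AE t in lebesgue. norm (trunc F (G t) \<bullet> W t) <= norm (B * (indicator {-R..R} t * norm (G t)))"
   by (rule AE_I2) (rule bn[OF norm_trunc_le])
 qed measurable
 show "integrable lebesgue (\<lambda>t. G t \<bullet> W t)"
 proof (rule Bochner_Integration.integrable_bound[OF dom])
  show "AE t in lebesgue. norm (G t \<bullet> W t) <= norm (B * (indicator {-R..R} t * norm (G t)))"
   by (rule AE_I2) (rule bn[OF order_refl])
 qed measurable
 show "(\<lambda>n. LINT t|lebesgue. trunc (fbox n) (G t) \<bullet> W t) \<longlonglongrightarrow> (LINT t|lebesgue. G t \<bullet> W t)"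
 proof (rule integral_dominated_convergence[OF _ _ dom])
  show "AE t in lebesgue. (\<lambda>n. trunc (fbox n) (G t) \<bullet> W t) \<longlonglongrightarrow> G t \<bullet> W t"
   by (rule AE_I2) (rule tendsto_inner[OF trunc_fbox_tendsto tendsto_const])
  show "AE t in lebesgue. norm (trunc (fbox n) (G t) \<bullet> W t) <= B * (indicator {-R..R} t * norm (G t))" for n
   by (rule AE_I2) (rule b[OF norm_trunc_le])
 qed measurable
qed

lemma loc_int_continuous: assumes "continuous_on UNIV G" shows "loc_int G"
 unfolding loc_int_def
proof (intro conjI allI)
 show "G \<in> borel_measurable lebesgue" by (rule lebesgue_to_borel[OF borel_measurable_continuous_onI[OF assms]])
 fix R show "set_integrable lebesgue {-R..R} (\<lambda>r. norm (G r))"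
  by (rule absolutely_integrable_continuous_real) (intro continuous_intros continuous_on_subset[OF assms] subset_UNIV)
qed

subsection \<open>Realizing Hermitian sequences\<close>

text \<open>Coefficients of real functions are the fixed points of this involution.\<close>

lift_definition reflect :: "l2 => l2" is "\<lambda>x k. cnj (x (- k))"
proof -
 fix x :: "freq => complex" assume "x \<in> sqsum"
 then show "(\<lambda>k. cnj (x (- k))) \<in> sqsum"
  using summable_on_reindex_bij_betw[OF bij_uminus, of "\<lambda>k. (cmod (x k))^2"] by (simp add: sqsum_def)
qed

lemmas coef_reflect [simp] = reflect.rep_eq

lemma norm_reflect: "norm (reflect x) = norm x"
proof -
 have "(norm (reflect x))^2 = (norm x)^2"
  unfolding norm_l2_sq using infsum_reindex_bij_betw[OF bij_uminus, of "\<lambda>k. (cmod (coef x k))^2"] by simp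
 then show ?thesis by simp
qed

lemma reflect_bounded_linear: "bounded_linear reflect"
 by (rule bounded_linear_intro[where K=1]) (auto intro!: l2_eqI simp: norm_reflect)

definition hpart :: "l2 => l2" where "hpart x = (1/2) *\<^sub>R (x + reflect x)"

lemma coef_hpart: "coef (hpart x) k = (coef x k + cnj (coef x (- k))) / 2"
 by (simp add: hpart_def scaleR_conv_of_real)

lemma hpart_bounded_linear: "bounded_linear hpart"
 unfolding hpart_def[abs_def] by (intro bounded_linear_intros reflect_bounded_linear)

lemma herm_hpart: "herm (coef (hpart x))" by (simp add: herm_def coef_hpart add.commute)

lemma reflect_hpart: "reflect (hpart x) = hpart x"
 by (rule l2_eqI) (simp add: coef_hpart add.commute)

lemma hpart_ft: "g \<in> L2 ==> hpart (ft g) = ft g"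
 by (rule l2_eqI) (simp add: coef_hpart coef_ft fc_hermitian)

text \<open>Strong measurability turns into Borel measurability of the coefficients. The limit of the simple functions is symmetrized so that it corresponds to a real function at every time, also on the exceptional null set.\<close>

lemma L1loc_L2_loc_int:
 assumes f: "f \<in> L1loc_L2"
 obtains g where "loc_int g" "!!t. reflect (g t) = g t" "AE t in lebesgue. g t = ft (f t)"
proof -
 have fL: "f t \<in> L2" for t using f by (simp add: L1loc_L2_def)
 obtain s where s: "!!n. simple_function lebesgue (s n)" "!!n t. s n t \<in> L2"
  "AE t in lebesgue. (\<lambda>n. L2_norm (\<lambda>x. s n t x - f t x)) \<longlonglongrightarrow> 0"
  using f unfolding L1loc_L2_def strongly_measurable_L2_def by blast
 define g where "g t = hpart (lim (\<lambda>n. ft (s n t)))" for t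
 have [measurable]: "(\<lambda>t. ft (s n t)) \<in> borel_measurable lebesgue" for n
  by (rule borel_measurable_simple_function) (rule simple_function_compose1[OF s(1)])
 have "(\<lambda>t. lim (\<lambda>n. ft (s n t))) \<in> borel_measurable lebesgue" by measurable
 from measurable_compose[OF this borel_measurable_continuous_onI[OF linear_continuous_on[OF hpart_bounded_linear]]]
 have gm: "g \<in> borel_measurable lebesgue" by (simp add: g_def[abs_def])
 have ae: "AE t in lebesgue. g t = ft (f t)"
  using s(3)
 proof eventually_elim
  case (elim t)
  then have "(\<lambda>n. ft (s n t)) \<longlonglongrightarrow> ft (f t)"
   by (subst tendsto_dist_iff) (simp add: L2_norm_diff_ft[symmetric] s(2) fL)
  then show ?case unfolding g_def by (simp add: limI hpart_ft fL)
 qed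
 have "set_integrable lebesgue {-R..R} (\<lambda>r. norm (g r))" for R
 proof -
  have i: "integrable lebesgue (\<lambda>t. indicator {-R..R} t *\<^sub>R L2_norm (f t))"
   using f unfolding L1loc_L2_def set_integrable_def by blast
  have "integrable lebesgue (\<lambda>t. indicator {-R..R} t *\<^sub>R norm (g t))"
  proof (rule Bochner_Integration.integrable_bound[OF i])
   show "(\<lambda>t. indicator {-R..R} t *\<^sub>R norm (g t)) \<in> borel_measurable lebesgue"
    by (intro borel_measurable_scaleR borel_measurable_indicator measurable_compose[OF gm borel_measurable_continuous_onI]
      continuous_intros) auto
   show "AE t in lebesgue. norm (indicator {-R..R} t *\<^sub>R norm (g t)) <= norm (indicator {-R..R} t *\<^sub>R L2_norm (f t))"
    using ae by eventually_elim (simp add: L2_norm_ft fL)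
  qed
  then show ?thesis by (simp add: set_integrable_def)
 qed
 then show ?thesis using that[of g] gm ae by (auto simp: loc_int_def g_def reflect_hpart)
qed

text \<open>A choice of representative, with the coefficients made Hermitian first.\<close>

definition realize :: "l2 => plane => real" where
 "realize x = (SOME g. g \<in> L2 \<and> ft g = hpart x)"

lemma realize: "realize x \<in> L2" "ft (realize x) = hpart x"
proof -
 obtain g where g: "g \<in> L2" "!!k. fc g k = coef (hpart x) k"
  using Riesz_Fischer[OF herm_hpart[of x]] by metis
 have "ft g = hpart x" by (rule l2_eqI) (simp add: coef_ft g)
 then have "\<exists>g. g \<in> L2 \<and> ft g = hpart x" using g by blast
 from someI_ex[OF this] show "realize x \<in> L2" "ft (realize x) = hpart x" by (auto simp: realize_def)
qed

lemma L2_norm_smooth_mult: assumes "smooth_torus a"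
 obtains B where "B >= 0" "!!g. g \<in> L2 ==> L2_norm (\<lambda>x. a x * g x) <= B * L2_norm g"
proof -
 obtain B where B: "B >= 0" "!!x. \<bar>a x\<bar> <= B"
  using periodic2_bounded[OF smooth_torusD(2)[OF assms] smooth_torus_cont[OF assms]] by metis
 have "L2_norm (\<lambda>x. a x * g x) <= B * L2_norm g" if "g \<in> L2" for g
 proof -
  have "(LINT x|TM. (a x * g x)^2) <= (LINT x|TM. B^2 * (g x)^2)"
  proof (rule integral_mono)
   show "(a x * g x)^2 <= B^2 * (g x)^2" for x
    using power_mono[OF B(2)[of x], of 2] by (auto simp: power_mult_distrib intro!: mult_right_mono)
  qed (use L2D(2)[OF L2_smooth_mult[OF assms that]] L2D(2)[OF that] in auto)
  then have "sqrt (LINT x|TM. (a x * g x)^2) <= sqrt (B^2 * (LINT x|TM. (g x)^2))"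
   by (intro real_sqrt_le_mono) simp
  then show ?thesis using B(1) by (simp add: L2_norm_def real_sqrt_mult)
 qed
 with B(1) show ?thesis by (rule that)
qed

lemma C_L2_smooth_mult: assumes "smooth_torus a" "u \<in> C_L2" shows "(\<lambda>t x. a x * u t x) \<in> C_L2"
proof -
 obtain B where "B >= 0" and le: "!!g. g \<in> L2 ==> L2_norm (\<lambda>x. a x * g x) <= B * L2_norm g"
  using L2_norm_smooth_mult[OF assms(1)] by blast
 have u: "u t \<in> L2" for t using assms(2) by (simp add: C_L2_iff)
 have "((\<lambda>t. L2_norm (\<lambda>x. a x * u t x - a x * u s x)) \<longlongrightarrow> 0) (at s)" for s
 proof (rule Lim_null_comparison)
  have "L2_norm (\<lambda>x. a x * u t x - a x * u s x) <= B * L2_norm (\<lambda>x. u t x - u s x)" for t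
   using le[OF L2_diff[OF u u], of t s] by (simp add: right_diff_distrib)
  then show "\<forall>\<^sub>F t in at s. norm (L2_norm (\<lambda>x. a x * u t x - a x * u s x)) <= B * L2_norm (\<lambda>x. u t x - u s x)" by simp
  have "((\<lambda>t. L2_norm (\<lambda>x. u t x - u s x)) \<longlongrightarrow> 0) (at s)" using assms(2) by (simp add: C_L2_def)
  from tendsto_mult[OF tendsto_const[of B] this]
  show "((\<lambda>t. B * L2_norm (\<lambda>x. u t x - u s x)) \<longlongrightarrow> 0) (at s)" by simp
 qed
 then show ?thesis using u assms(1) by (simp add: C_L2_def L2_smooth_mult)
qed

section \<open>The first order problem\<close>

subsection \<open>Differentiable families of functions\<close>

text \<open>The mean value theorem, uniformly on the compact cell, bounds the difference quotient in \<open>L\<^sup>2\<close>.\<close>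

lemma differentiable_family_ft:
 fixes w w' :: "real => plane => real"
 assumes d: "!!t x. ((\<lambda>t. w t x) has_real_derivative w' t x) (at t)"
  and c: "continuous_on UNIV (\<lambda>z. w' (fst z) (snd z))" and w: "!!t. w t \<in> L2" "!!t. w' t \<in> L2"
 shows "((\<lambda>t. ft (w t)) has_vector_derivative ft (w' s)) (at s)"
 unfolding has_vector_derivative_def has_derivative_within_alt2
proof (intro conjI allI impI)
 show "bounded_linear (\<lambda>h. h *\<^sub>R ft (w' s))" by (rule bounded_linear_scaleR_left)
 fix e :: real assume e: "e > 0"
 define d where "d = e / (2 * pi)"
 have dp: "d > 0" using e by (simp add: d_def)
 have "uniformly_continuous_on ({s - 1..s + 1} \<times> cell) (\<lambda>z. w' (fst z) (snd z))"
  by (intro compact_uniformly_continuous continuous_on_subset[OF c] compact_Times) auto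
 then obtain r where r: "r > 0" "!!z z'. z \<in> {s - 1..s + 1} \<times> cell ==> z' \<in> {s - 1..s + 1} \<times> cell ==> dist z' z < r
    ==> dist (w' (fst z') (snd z')) (w' (fst z) (snd z)) < d"
  using dp unfolding uniformly_continuous_on_def by metis
 have "norm (ft (w t) - ft (w s) - (t - s) *\<^sub>R ft (w' s)) <= e * norm (t - s)" if t: "dist t s < min r 1" for t
 proof -
  have "\<bar>w t x - w s x - (t - s) * w' s x\<bar> <= d * \<bar>t - s\<bar>" if x: "x \<in> cell" for x
  proof -
   have ts: "\<bar>t - s\<bar> < r" "\<bar>t - s\<bar> < 1" using t by (auto simp: dist_real_def)
   have "norm (w t x - t * w' s x - (w s x - s * w' s x)) <= d * norm (t - s)"
   proof (rule field_differentiable_bound[where S = "closed_segment s t" and f' = "\<lambda>\<tau>. w' \<tau> x - w' s x"])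
    show "convex (closed_segment s t)" by simp
    show "((\<lambda>\<tau>. w \<tau> x - \<tau> * w' s x) has_field_derivative w' \<tau> x - w' s x) (at \<tau> within closed_segment s t)" for \<tau>
     by (rule has_field_derivative_at_within) (auto intro!: derivative_eq_intros d)
    fix \<tau> assume "\<tau> \<in> closed_segment s t"
    then have "\<bar>\<tau> - s\<bar> <= \<bar>t - s\<bar>" by (auto simp: closed_segment_eq_real_ivl split: if_splits)
    then have "dist (w' \<tau> x) (w' s x) < d"
     using r(2)[of "(s, x)" "(\<tau>, x)"] x ts by (auto simp: dist_real_def dist_Pair_Pair abs_less_iff abs_le_iff)
    then show "norm (w' \<tau> x - w' s x) <= d" by (simp add: dist_real_def)
   qed auto
   then show ?thesis by (simp add: algebra_simps)
  qed
  then have "L2_norm (\<lambda>x. w t x - w s x - (t - s) * w' s x) <= 2 * pi * (d * \<bar>t - s\<bar>)"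
   using dp by (intro L2_norm_bound L2_diff L2_cmult w) auto
  also have "\<dots> = e * norm (t - s)" by (simp add: d_def)
  finally show ?thesis by (simp add: L2_norm_ft[symmetric] ft_diff ft_cmult w L2_diff L2_cmult)
 qed
 then show "\<forall>\<^sub>F t in at s. norm (ft (w t) - ft (w s) - (t - s) *\<^sub>R ft (w' s)) <= e * norm (t - s)"
  unfolding eventually_at using r(1) by (intro exI[of _ "min r 1"]) auto
qed

lemma slice_ft_deriv: assumes \<psi>: "\<psi> \<in> test_fun"
 shows "((\<lambda>t. ft (slice \<psi> t)) has_vector_derivative ft (slice (dir_deriv (1, 0) \<psi>) t)) (at t)"
proof (rule differentiable_family_ft)
 show "((\<lambda>t. slice \<psi> t x) has_real_derivative slice (dir_deriv (1, 0) \<psi>) t x) (at t)" for t x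
  by (rule slice_time_deriv[OF test_funD(1)[OF \<psi>]])
 have "smooth (dir_deriv (1, 0) \<psi>)" using test_funD(1)[OF test_fun_dir_deriv[OF \<psi>]] .
 then show "continuous_on UNIV (\<lambda>z. slice (dir_deriv (1, 0) \<psi>) (fst z) (snd z))"
  using smooth_continuous[of "dir_deriv (1, 0) \<psi>" UNIV] by (simp add: slice_def)
qed (use \<psi> test_fun_dir_deriv[OF \<psi>] slice_L2 in auto)

lemma is_solution_diff_zero:
 assumes sm: "smooth_torus a1" "smooth_torus a0" "smooth_torus am1" "smooth_torus b1" "smooth_torus b2" "smooth_torus c"
  and u: "is_solution (L_op a1 a0 am1 b1 b2 c) f u0 u" and v: "is_solution (L_op a1 a0 am1 b1 b2 c) f u0 v"
 defines "w \<equiv> \<lambda>t x. u t x - v t x"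
 shows "w \<in> C_L2" "!!\<psi>. \<psi> \<in> test_fun ==> L_op a1 a0 am1 b1 b2 c (dist_of w) \<psi> = 0" "ft (w 0) = 0"
proof -
 interpret coefficients a1 a0 am1 b1 b2 c by unfold_locales (use sm in auto)
 have C: "u \<in> C_L2" "v \<in> C_L2" using u v by (auto simp: is_solution_def)
 then have L: "u t \<in> L2" "v t \<in> L2" for t by (auto simp: C_L2_iff)
 show w: "w \<in> C_L2" using C unfolding C_L2_iff w_def by (auto simp: L2_diff ft_diff intro!: continuous_intros)
 show "L_op a1 a0 am1 b1 b2 c (dist_of w) \<psi> = 0" if \<psi>: "\<psi> \<in> test_fun" for \<psi>
 proof -
  have T: "Theta \<psi> \<in> test_fun" by (rule Theta_test_fun[OF \<psi>])
  have "dist_of w (Theta \<psi>) = dist_of u (Theta \<psi>) - dist_of v (Theta \<psi>)"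
   unfolding dist_of_slice w_def
   by (simp add: ip_diff_left L slice_L2[OF T] Bochner_Integration.integral_diff[OF dist_integrable[OF C(1) T] dist_integrable[OF C(2) T]])
  also have "\<dots> = 0" using u v \<psi> L_op_Theta[OF C(1) \<psi>] L_op_Theta[OF C(2) \<psi>] unfolding is_solution_def by simp
  finally show ?thesis by (simp add: L_op_Theta[OF w \<psi>])
 qed
 have "AE x in TM. u 0 x = v 0 x"
  using u v unfolding is_solution_def L2_eq_def by (auto elim: AE_mp)
 then have "ft (u 0) = ft (v 0)" by (intro L2_eq_imp_ft_eq L) (simp add: L2_eq_def)
 then show "ft (w 0) = 0" by (simp add: w_def ft_diff L)
qed

subsection \<open>First order perturbations of the principal part\<close>

locale first_order =
 fixes b1 b2 c :: "plane => real"
 assumes smooth_b: "smooth_torus b1" "smooth_torus b2" "smooth_torus c"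
begin

sublocale coefficients "\<lambda>x. 0" "\<lambda>x. 0" "\<lambda>x. 0" b1 b2 c
 by unfold_locales (use smooth_b in auto)

text \<open>The zero order term after moving the derivatives off the coefficients.\<close>

definition cc :: "plane => real" where "cc x = c x - d1 b1 x - d2 b2 x"

lemma smooth_cc: "smooth_torus cc" unfolding cc_def[abs_def]
 by (intro smooth_torus_diff smooth_torus_dir_deriv smooth_b)

definition pp :: "(plane => real) => plane => real" where
 "pp \<phi> x = d1 (d2 (d1 \<phi>)) x + d2 (d2 (d1 \<phi>)) x"

lemma smooth_pp: "smooth_torus \<phi> ==> smooth_torus (pp \<phi>)" unfolding pp_def[abs_def]
 by (intro smooth_torus_add smooth_torus_dir_deriv)

lemma adj_expand: assumes "smooth_torus \<phi>"
 shows "A \<phi> x = - pp \<phi> x - b1 x * d1 \<phi> x - b2 x * d2 \<phi> x + cc x * \<phi> x"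
 using assms smooth_b
 by (simp add: adj_def pp_def cc_def dir_deriv_mult smooth_torusD dir_deriv_const algebra_simps)

lemma ip_adj: assumes u: "u \<in> L2" and \<phi>: "smooth_torus \<phi>"
 shows "ip u (A \<phi>) = - (ip u (pp \<phi>) + ip (\<lambda>x. b1 x * u x) (d1 \<phi>) + ip (\<lambda>x. b2 x * u x) (d2 \<phi>) - ip (\<lambda>x. cc x * u x) \<phi>)"
proof -
 have m: "ip (\<lambda>x. a x * u x) g = ip u (\<lambda>x. a x * g x)" for a g by (simp add: ip_def mult_ac)
 have "A \<phi> = (\<lambda>x. - 1 * pp \<phi> x + (- 1 * (b1 x * d1 \<phi> x) + (- 1 * (b2 x * d2 \<phi> x) + cc x * \<phi> x)))"
  using adj_expand[OF \<phi>] by (auto simp: fun_eq_iff)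
 moreover have "smooth_torus (pp \<phi>)" "smooth_torus (\<lambda>x. b1 x * d1 \<phi> x)" "smooth_torus (\<lambda>x. b2 x * d2 \<phi> x)" "smooth_torus (\<lambda>x. cc x * \<phi> x)"
  by (intro smooth_pp smooth_torus_mult smooth_torus_dir_deriv smooth_b smooth_cc \<phi>)+
 ultimately show ?thesis unfolding m
  by (simp only: ip_add_right ip_cmult_right u smooth_torus_L2 L2_add L2_cmult)
qed

definition om :: "freq => real" where
 "om k = of_int (fst k) * of_int (snd k) * (of_int (fst k) + of_int (snd k))"

text \<open>The matrix of \<open>u \<mapsto> - \<partial>\<^sub>1(b\<^sub>1 u) - \<partial>\<^sub>2(b\<^sub>2 u) - \<gamma> u\<close> in the characters.\<close>

definition N :: "freq => freq => complex" where
 "N k j = (- \<i> * of_int (fst k) * fc b1 (k - j) - \<i> * of_int (snd k) * fc b2 (k - j) - fc cc (k - j)) / (2 * pi)"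

definition M :: "freq => real" where "M l = cmod (fc b1 l) + cmod (fc b2 l) + cmod (fc cc l)"

definition h :: "freq => real" where "h l = 2 * (wt l * M l)"

lemma M_nonneg: "0 <= M l" by (simp add: M_def)

lemma M_minus: "M (k - j) = M (j - k)"
 using fc_hermitian[of _ "k - j"] by (simp add: M_def)

lemma fst_snd_wt: "\<bar>of_int (fst k)\<bar> <= wt k" "\<bar>of_int (snd k)\<bar> <= wt k" by (auto simp: wt_def)

lemma cmod_sum3: "cmod (\<i> * of_int m * a + \<i> * of_int n * b + d) <= w * (cmod a + cmod b + cmod d)"
 if "\<bar>of_int m\<bar> <= w" "\<bar>of_int n\<bar> <= w" "1 <= w" for a b d :: complex
proof -
 have "cmod (\<i> * of_int m * a + \<i> * of_int n * b + d) <= \<bar>of_int m\<bar> * cmod a + \<bar>of_int n\<bar> * cmod b + cmod d"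
  by (intro order_trans[OF norm_triangle_ineq] add_mono) (auto simp: norm_mult)
 also have "\<dots> <= w * cmod a + w * cmod b + w * cmod d" using that
  by (intro add_mono mult_right_mono mult_right_le_one_le) (auto simp: mult_le_cancel_right1 intro: mult_right_mono[of 1 w, simplified])
 finally show ?thesis by (simp add: algebra_simps)
qed

lemma div_2pi_le: "cmod (z / complex_of_real (2 * pi)) <= cmod z"
proof -
 have "cmod z / (2 * pi) <= cmod z / 1" using pi_gt3 by (intro divide_left_mono) auto
 then show ?thesis by (simp add: norm_divide norm_mult)
qed

lemma N_bound: "cmod (N k j) <= wt k * M (k - j)"
proof -
 have e: "- \<i> * of_int (fst k) * fc b1 (k - j) - \<i> * of_int (snd k) * fc b2 (k - j) - fc cc (k - j)
   = - (\<i> * of_int (fst k) * fc b1 (k - j) + \<i> * of_int (snd k) * fc b2 (k - j) + fc cc (k - j))"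
  by (simp add: algebra_simps)
 have "cmod (N k j) <= cmod (- (\<i> * of_int (fst k) * fc b1 (k - j) + \<i> * of_int (snd k) * fc b2 (k - j) + fc cc (k - j)))"
  unfolding N_def e by (rule div_2pi_le)
 also have "\<dots> <= wt k * M (k - j)"
  unfolding norm_minus_cancel M_def by (intro cmod_sum3 fst_snd_wt wt_ge_1)
 finally show ?thesis .
qed

sublocale lattice_system om N h
proof
 fix k j l :: freq
 have w: "wt l >= 1" "M l >= 0" for l by (rule wt_ge_1, rule M_nonneg)
 show "0 <= h l" using w[of l] by (simp add: h_def)
 have hM: "M l <= h l" "wt l * M l <= h l" for l
 proof -
  show "M l <= h l" "wt l * M l <= h l"
   using mult_right_mono[OF w(1)[of l] w(2)[of l]] w(2)[of l] unfolding h_def by simp_all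
 qed
 have h_sym: "h (j - k) = h (k - j)" using wt_minus[of "k - j"] M_minus[of k j] by (simp add: h_def)
 show n1: "cmod (N k j) <= wt k * h (k - j)" for k j
  using N_bound[of k j] mult_left_mono[OF hM(1)[of "k - j"], of "wt k"] wt_pos[of k] by linarith
 show n2: "cmod (N k j) <= wt j * h (k - j)" for k j
 proof -
  have "cmod (N k j) <= wt k * M (k - j)" by (rule N_bound)
  also have "\<dots> <= wt j * wt (k - j) * M (k - j)" by (intro mult_right_mono wt_le_mult M_nonneg)
  also have "\<dots> <= wt j * h (k - j)" unfolding mult.assoc using hM(2)[of "k - j"] wt_pos[of j] by (intro mult_left_mono) auto
  finally show ?thesis .
 qed
 show "cmod (N j k) <= wt k * h (k - j)" using n2[of j k] by (simp add: h_sym)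
 show "cmod (N j k) <= wt j * h (k - j)" using n1[of j k] by (simp add: h_sym)
 have cf: "cnj (fc g (j - k)) = fc g (k - j)" for g using fc_hermitian[of g "k - j"] by simp
 have "N k j + cnj (N j k) = - (\<i> * of_int (fst (k - j)) * fc b1 (k - j) + \<i> * of_int (snd (k - j)) * fc b2 (k - j) + 2 * fc cc (k - j)) / (2 * pi)"
  by (simp add: N_def cf add_divide_distrib diff_divide_distrib ring_distribs)
 also have "cmod \<dots> <= cmod (\<i> * of_int (fst (k - j)) * fc b1 (k - j) + \<i> * of_int (snd (k - j)) * fc b2 (k - j) + 2 * fc cc (k - j))"
  using div_2pi_le by (metis norm_minus_cancel)
 also have "\<dots> <= wt (k - j) * (cmod (fc b1 (k - j)) + cmod (fc b2 (k - j)) + cmod (2 * fc cc (k - j)))"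
  by (intro cmod_sum3 fst_snd_wt wt_ge_1)
 also have "\<dots> <= wt (k - j) * (2 * M (k - j))"
  using wt_pos[of "k - j"] by (intro mult_left_mono) (auto simp: M_def norm_mult)
 finally show "cmod (N k j + cnj (N j k)) <= h (k - j)" by (simp add: h_def mult_ac)
 \<comment> \<open>The exponent nine: four for the weight, one for \<open>h\<close>, four for summability.\<close>
 obtain C1 C2 C3 where C: "!!k. wt k ^ 9 * cmod (fc b1 k) <= C1" "!!k. wt k ^ 9 * cmod (fc b2 k) <= C2" "!!k. wt k ^ 9 * cmod (fc cc k) <= C3"
  using fc_decay[OF smooth_b(1), of 9] fc_decay[OF smooth_b(2), of 9] fc_decay[OF smooth_cc, of 9] by metis
 show "(\<lambda>l. wt l ^ 4 * h l) summable_on UNIV"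
 proof (rule summable_on_comparison_test[OF summable_on_cmult_right[OF wt_inverse_summable, of "2 * (C1 + C2 + C3)"]])
  fix l
  have "wt l ^ 4 * h l = 2 * (wt l ^ 9 * M l) * inverse (wt l ^ 4)"
   using wt_pos[of l] by (simp add: h_def field_simps flip: power_add power_Suc)
  also have "\<dots> <= 2 * (C1 + C2 + C3) * inverse (wt l ^ 4)"
  proof (intro mult_right_mono mult_left_mono)
   show "wt l ^ 9 * M l <= C1 + C2 + C3" using C[of l] by (simp add: M_def distrib_left)
  qed (use wt_pos[of l] in auto)
  finally show "wt l ^ 4 * h l <= 2 * (C1 + C2 + C3) * inverse (wt l ^ 4)" .
  show "0 <= wt l ^ 4 * h l" using w[of l] by (simp add: h_def)
 qed
qed

lemma gen_ft: assumes u: "u \<in> L2"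
 shows "gen k (ft u) = \<i> * om k * fc u k - \<i> * of_int (fst k) * fc (\<lambda>x. b1 x * u x) k
   - \<i> * of_int (snd k) * fc (\<lambda>x. b2 x * u x) k - fc (\<lambda>x. cc x * u x) k"
proof -
 define \<alpha> \<beta> \<delta> :: complex where "\<alpha> = - \<i> * of_int (fst k) / (2 * pi)" and "\<beta> = - \<i> * of_int (snd k) / (2 * pi)" and "\<delta> = - 1 / (2 * pi)"
 have N: "N k j = \<alpha> * fc b1 (k - j) + \<beta> * fc b2 (k - j) + \<delta> * fc cc (k - j)" for j
  by (simp add: N_def \<alpha>_def \<beta>_def \<delta>_def diff_divide_distrib)
 note h1 = has_sum_cmult_right[OF fc_smooth_mult[OF smooth_b(1) u], of \<alpha> k]
  and h2 = has_sum_cmult_right[OF fc_smooth_mult[OF smooth_b(2) u], of \<beta> k]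
  and h3 = has_sum_cmult_right[OF fc_smooth_mult[OF smooth_cc u], of \<delta> k]
 have "(\<lambda>j. \<alpha> * (fc b1 (k - j) * fc u j) + \<beta> * (fc b2 (k - j) * fc u j) + \<delta> * (fc cc (k - j) * fc u j))
   = (\<lambda>j. coef (row k) j * coef (ft u) j)"
  unfolding fun_eq_iff coef_row coef_ft[OF u] N by (simp add: distrib_right mult.assoc)
 with has_sum_add[OF has_sum_add[OF h1 h2] h3]
 have d: "dot (row k) (ft u) = \<alpha> * (complex_of_real (2 * pi) * fc (\<lambda>x. b1 x * u x) k)
   + \<beta> * (complex_of_real (2 * pi) * fc (\<lambda>x. b2 x * u x) k) + \<delta> * (complex_of_real (2 * pi) * fc (\<lambda>x. cc x * u x) k)"
  using has_sum_unique[OF dot_has_sum[of "row k" "ft u"]] by simp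
 show ?thesis unfolding gen_def d coef_ft[OF u] by (simp add: \<alpha>_def \<beta>_def \<delta>_def)
qed

end

lemma trunc_inner: "finite F ==> trunc F x \<bullet> y = (\<Sum>k\<in>F. Re (cnj (coef y k) * coef x k))"
 by (subst inner_finite_support[of F]) (auto simp: inner_complex_def mult.commute intro!: sum.cong)

lemma linear_pairing_integrable:
 fixes W :: "real => complex" and T :: "l2 => complex"
 assumes G: "loc_int G" and T: "bounded_linear T" and W: "continuous_on UNIV W" "!!t. t \<notin> {-R..R} ==> W t = 0"
 shows "integrable lebesgue (\<lambda>t. W t * T (G t))"
proof -
 have "bounded (W ` {-R..R})" by (intro compact_imp_bounded compact_continuous_image continuous_on_subset[OF W(1)]) auto
 then obtain B0 where "\<forall>y\<in>W ` {-R..R}. norm y <= B0" unfolding bounded_iff by blast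
 then have B0: "!!t. t \<in> {-R..R} ==> norm (W t) <= \<bar>B0\<bar>" by force
 obtain C where C: "C > 0" "!!y. cmod (T y) <= norm y * C" using bounded_linear.pos_bounded[OF T] by blast
 have dom: "integrable lebesgue (\<lambda>t. \<bar>B0\<bar> * C * (indicator {-R..R} t * norm (G t)))"
  by (intro integrable_mult_right loc_intD(2)[OF G])
 have "norm (W t * T (G t)) <= norm (\<bar>B0\<bar> * C * (indicator {-R..R} t * norm (G t)))" for t
 proof (cases "t \<in> {-R..R}")
  case True
  have "cmod (W t) * cmod (T (G t)) <= \<bar>B0\<bar> * (norm (G t) * C)"
   by (intro mult_mono B0[OF True] C(2)) auto
  then show ?thesis using True C(1) by (simp add: norm_mult mult_ac)
 qed (use W(2) in simp)
 moreover have "(\<lambda>t. T (G t)) \<in> borel_measurable lebesgue"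
  by (rule measurable_compose[OF loc_intD(1)[OF G] borel_measurable_continuous_onI[OF linear_continuous_on[OF T]]])
 ultimately show ?thesis
  using lebesgue_to_borel[OF borel_measurable_continuous_onI[OF W(1)]]
  by (intro Bochner_Integration.integrable_bound[OF dom] borel_measurable_times AE_I2) auto
qed

lemma slice_pairing:
 assumes G: "loc_int G" and X: "X \<in> test_fun"
 shows "integrable lebesgue (\<lambda>t. trunc F (G t) \<bullet> ft (slice X t))" "integrable lebesgue (\<lambda>t. G t \<bullet> ft (slice X t))"
  and "(\<lambda>n. LINT t|lebesgue. trunc (fbox n) (G t) \<bullet> ft (slice X t)) \<longlonglongrightarrow> (LINT t|lebesgue. G t \<bullet> ft (slice X t))"
proof -
 obtain R where "!!t. t \<notin> {-R..R} ==> ft (slice X t) = 0" using slice_support[OF X] by metis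
 note truncated_pairing_integrable[OF G slice_ft_continuous[OF X] this]
 then show "integrable lebesgue (\<lambda>t. trunc F (G t) \<bullet> ft (slice X t))" "integrable lebesgue (\<lambda>t. G t \<bullet> ft (slice X t))"
  "(\<lambda>n. LINT t|lebesgue. trunc (fbox n) (G t) \<bullet> ft (slice X t)) \<longlonglongrightarrow> (LINT t|lebesgue. G t \<bullet> ft (slice X t))" by blast+
qed

context first_order
begin

lemma N_reflect: "N (- k) (- j) = cnj (N k j)"
 using fc_hermitian[of _ "k - j"] by (simp add: N_def)

lemma gen_reflect: "gen k (reflect x) = cnj (gen (- k) x)"
proof -
 have "dot (row k) (reflect x) = (\<Sum>\<^sub>\<infinity>j. cnj (N (- k) (- j) * coef x (- j)))"
  by (simp add: dot_def coef_row N_reflect)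
 also have "\<dots> = (\<Sum>\<^sub>\<infinity>j. cnj (N (- k) j * coef x j))"
  by (rule infsum_reindex_bij_betw[OF bij_uminus, of "\<lambda>j. cnj (N (- k) j * coef x j)"])
 also have "\<dots> = cnj (dot (row (- k)) x)" unfolding infsum_cnj by (simp add: dot_def coef_row)
 finally have "dot (row k) (reflect x) = cnj (dot (row (- k)) x)" .
 moreover have "om (- k) = - om k" by (simp add: om_def algebra_simps)
 ultimately show ?thesis by (simp add: gen_def)
qed

text \<open>The flow maps real functions to real functions: both sides solve the same system, since the matrix commutes with the reflection.\<close>

lemma reflect_S: "reflect (S t x) = S t (reflect x)"
proof -
 have "reflect (S t x) - S t (reflect x) = 0"
 proof (rule uniqueness[of "\<lambda>t. reflect (S t x) - S t (reflect x)"])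
  fix k t
  have "((\<lambda>t. cnj (coef (S t x) (- k))) has_vector_derivative cnj (gen (- k) (S t x))) (at t)"
   by (rule has_vector_derivative_cnj[OF S_deriv])
  from has_vector_derivative_diff[OF this S_deriv[of "reflect x" k t]]
  show "((\<lambda>t. coef (reflect (S t x) - S t (reflect x)) k) has_vector_derivative gen k (reflect (S t x) - S t (reflect x))) (at t)"
   by (simp add: linear_diff[OF bounded_linear.linear[OF gen_bounded_linear]] gen_reflect)
  show "continuous_on UNIV (\<lambda>t. reflect (S t x) - S t (reflect x))"
   by (intro continuous_on_diff S_continuous bounded_linear.continuous_on[OF reflect_bounded_linear])
 qed (simp add: S_0)
 then show ?thesis by simp
qed

lemma reflect_duhamel: assumes g: "loc_int g" "!!t. reflect (g t) = g t" and x: "reflect x = x"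
 shows "reflect (duhamel x g t) = duhamel x g t"
proof -
 note lin = bounded_linear.linear[OF reflect_bounded_linear]
 have "reflect (LINT r|lebesgue. sg t r *\<^sub>R S (t - r) (g r)) = (LINT r|lebesgue. reflect (sg t r *\<^sub>R S (t - r) (g r)))"
  by (rule integral_bounded_linear[OF reflect_bounded_linear duhamel_integrable[OF g(1)], symmetric])
 then show ?thesis
  by (simp add: duhamel_def linear_add[OF lin] linear_cmul[OF lin] reflect_S g(2) x)
qed

text \<open>Summation over a box turns the generator, coordinate by coordinate, into pairings of truncated \<open>L\<^sup>2\<close> functions with derivatives of the test function.\<close>

lemma mode_sum: assumes u: "u \<in> L2" and \<phi>: "smooth_torus \<phi>" and F: "finite F"
 shows "(\<Sum>k\<in>F. Re (cnj (fc \<phi> k) * gen k (ft u))) = trunc F (ft u) \<bullet> ft (pp \<phi>)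
  + trunc F (ft (\<lambda>x. b1 x * u x)) \<bullet> ft (d1 \<phi>) + trunc F (ft (\<lambda>x. b2 x * u x)) \<bullet> ft (d2 \<phi>)
  - trunc F (ft (\<lambda>x. cc x * u x)) \<bullet> ft \<phi>"
proof -
 have sm: "smooth_torus (d1 \<phi>)" "smooth_torus (d2 \<phi>)" "smooth_torus (d2 (d1 \<phi>))" "smooth_torus (d1 (d2 (d1 \<phi>)))" "smooth_torus (d2 (d2 (d1 \<phi>)))"
  by (intro smooth_torus_dir_deriv \<phi>)+
 have ph: "phase k (1, 0) = of_int (fst k)" "phase k (0, 1) = of_int (snd k)" for k by (simp_all add: phase_def)
 have f1: "fc (d1 \<phi>) k = \<i> * of_int (fst k) * fc \<phi> k" and f2: "fc (d2 \<phi>) k = \<i> * of_int (snd k) * fc \<phi> k" if "smooth_torus \<phi>" for \<phi> k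
  using fc_dir_deriv[OF that, of "(1, 0)" k] fc_dir_deriv[OF that, of "(0, 1)" k] by (simp_all add: ph)
 have fp: "fc (pp \<phi>) k = - \<i> * om k * fc \<phi> k" for k
  unfolding pp_def[abs_def] by (simp add: fc_add smooth_torus_L2 sm f1 f2 \<phi> om_def algebra_simps)
 have bu: "(\<lambda>x. b1 x * u x) \<in> L2" "(\<lambda>x. b2 x * u x) \<in> L2" "(\<lambda>x. cc x * u x) \<in> L2"
  by (intro L2_smooth_mult smooth_b smooth_cc u)+
 show ?thesis
  unfolding trunc_inner[OF F] coef_ft[OF u] coef_ft[OF bu(1)] coef_ft[OF bu(2)] coef_ft[OF bu(3)]
   coef_ft[OF smooth_torus_L2[OF smooth_pp[OF \<phi>]]] coef_ft[OF smooth_torus_L2[OF sm(1)]] coef_ft[OF smooth_torus_L2[OF sm(2)]]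
   coef_ft[OF smooth_torus_L2[OF \<phi>]] fp f1[OF \<phi>] f2[OF \<phi>] gen_ft[OF u]
   sum.distrib[symmetric] sum_subtractf[symmetric]
  by (rule sum.cong[OF refl]) (simp add: algebra_simps)
qed

lemma existence:
 assumes u0: "u0 \<in> L2" and f: "f \<in> L1loc_L2"
 shows "\<exists>u. is_solution (L_op (\<lambda>x. 0) (\<lambda>x. 0) (\<lambda>x. 0) b1 b2 c) f u0 u"
proof -
 obtain g where g: "loc_int g" "!!t. reflect (g t) = g t" "AE t in lebesgue. g t = ft (f t)"
  using L1loc_L2_loc_int[OF f] by metis
 define z where "z = duhamel (ft u0) g"
 define u where "u t = realize (z t)" for t
 have zc: "continuous_on UNIV z" unfolding z_def by (rule duhamel_continuous[OF g(1)])
 have r0: "reflect (ft u0) = ft u0" using reflect_hpart[of "ft u0"] by (simp add: hpart_ft u0)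
 have rz: "reflect (z t) = z t" for t unfolding z_def by (rule reflect_duhamel[OF g(1,2) r0])
 have uL: "u t \<in> L2" for t by (simp add: u_def realize)
 have fu: "ft (u t) = z t" for t
  unfolding u_def realize(2) hpart_def rz by (simp add: scaleR_2[symmetric])
 have uC: "u \<in> C_L2" using zc by (simp add: C_L2_iff uL fu)
 have fL: "f t \<in> L2" for t using f by (simp add: L1loc_L2_def)
 have "L2_eq (u 0) u0" by (rule ft_eq_imp_L2_eq[OF uL u0]) (simp add: fu z_def duhamel_0)
 moreover have "L_op (\<lambda>x. 0) (\<lambda>x. 0) (\<lambda>x. 0) b1 b2 c (dist_of u) \<psi> = dist_of f \<psi>" if \<psi>: "\<psi> \<in> test_fun" for \<psi>
 proof -
  define B1 B2 B3 where "B1 t x = b1 x * u t x" and "B2 t x = b2 x * u t x" and "B3 t x = cc x * u t x" for t x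
  have BC: "B1 \<in> C_L2" "B2 \<in> C_L2" "B3 \<in> C_L2"
   unfolding B1_def[abs_def] B2_def[abs_def] B3_def[abs_def] by (intro C_L2_smooth_mult smooth_b smooth_cc uC)+
  have BL: "B1 t \<in> L2" "B2 t \<in> L2" "B3 t \<in> L2" for t using BC by (auto simp: C_L2_iff)
  have li: "loc_int (\<lambda>t. ft (B1 t))" "loc_int (\<lambda>t. ft (B2 t))" "loc_int (\<lambda>t. ft (B3 t))" "loc_int z"
   using BC zc by (auto simp: C_L2_iff intro: loc_int_continuous)
  define X where "X = (\<lambda>z. e1 (e2 (e1 \<psi>)) z + e2 (e2 (e1 \<psi>)) z)"
  have tf: "et \<psi> \<in> test_fun" "X \<in> test_fun" "e1 \<psi> \<in> test_fun" "e2 \<psi> \<in> test_fun"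
   unfolding X_def by (intro test_fun_add test_fun_dir_deriv \<psi>)+
  have st: "smooth_torus (slice \<psi> t)" for t by (rule smooth_torus_slice[OF \<psi>])
  have sl: "dir_deriv v (slice \<eta> t) = slice (dir_deriv (0, v) \<eta>) t" if "\<eta> \<in> test_fun" for \<eta> v t
   by (rule dir_deriv_slice[OF test_funD(1)[OF that]])
  have slX: "pp (slice \<psi> t) = slice X t" for t
  proof -
   have t2: "e1 \<psi> \<in> test_fun" "e2 (e1 \<psi>) \<in> test_fun" by (intro test_fun_dir_deriv \<psi>)+
   show ?thesis by (simp add: pp_def fun_eq_iff sl \<psi> t2 X_def slice_def)
  qed
  obtain R1 R2 where R1: "!!t. t \<notin> {-R1..R1} ==> ft (slice \<psi> t) = 0" and R2: "!!t. t \<notin> {-R2..R2} ==> ft (slice (et \<psi>) t) = 0"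
   using slice_support[OF \<psi>] slice_support[OF tf(1)] by metis
  define R where "R = max R1 R2"
  have R: "ft (slice \<psi> t) = 0" "ft (slice (et \<psi>) t) = 0" if "t \<notin> {-R..R}" for t
   using that by (intro R1 R2; auto simp: R_def)+
  define th th' where "th k t = cnj (coef (ft (slice \<psi> t)) k)" and "th' k t = cnj (coef (ft (slice (et \<psi>) t)) k)" for k t
  have d: "(th k has_vector_derivative th' k t) (at t)" for k t
   unfolding th_def[abs_def] th'_def using slice_ft_deriv[OF \<psi>, of t]
   by (intro has_vector_derivative_cnj bounded_linear.has_vector_derivative[OF coef_bounded_linear]) (simp add: zero_prod_def)
  have c: "continuous_on UNIV (th k)" "continuous_on UNIV (th' k)" for k
   unfolding th_def[abs_def] th'_def[abs_def]
   by (intro continuous_on_cnj bounded_linear.continuous_on[OF coef_bounded_linear] slice_ft_continuous \<psi> tf)+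
  have s: "th k t = 0" "th' k t = 0" if "t \<notin> {-R..R}" for k t using R[OF that] by (simp_all add: th_def th'_def)
  have i: "integrable lebesgue (\<lambda>t. th' k t * coef (z t) k)" "integrable lebesgue (\<lambda>t. th k t * gen k (z t))"
   "integrable lebesgue (\<lambda>t. th k t * coef (g t) k)" for k
   by (rule linear_pairing_integrable[OF li(4) coef_bounded_linear c(2) s(2)]
     linear_pairing_integrable[OF li(4) gen_bounded_linear c(1) s(1)]
     linear_pairing_integrable[OF g(1) coef_bounded_linear c(1) s(1)]; assumption)+
  have w: "(LINT t|lebesgue. Re (th' k t * coef (z t) k) + Re (th k t * gen k (z t))) = - (LINT t|lebesgue. Re (th k t * coef (g t) k))" for k
  proof -
   have "(LINT t|lebesgue. th' k t * coef (z t) k + th k t * gen k (z t)) = - (LINT t|lebesgue. th k t * coef (g t) k)"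
    unfolding z_def by (rule duhamel_weak[OF g(1) d c(2) s])
   then have "Re (LINT t|lebesgue. th' k t * coef (z t) k + th k t * gen k (z t)) = Re (- (LINT t|lebesgue. th k t * coef (g t) k))" by simp
   then show ?thesis
    unfolding Bochner_Integration.integral_add[OF integrable_Re[OF i(1)] integrable_Re[OF i(2)]]
     integral_Re[OF i(1)] integral_Re[OF i(2)] integral_Re[OF i(3)] Bochner_Integration.integral_add[OF i(1,2)] by simp
  qed
  define L where "L n t = trunc (fbox n) (z t) \<bullet> ft (slice (et \<psi>) t) + (trunc (fbox n) (z t) \<bullet> ft (slice X t)
    + trunc (fbox n) (ft (B1 t)) \<bullet> ft (slice (e1 \<psi>) t) + trunc (fbox n) (ft (B2 t)) \<bullet> ft (slice (e2 \<psi>) t)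
    - trunc (fbox n) (ft (B3 t)) \<bullet> ft (slice \<psi> t))" for n t
  have L: "L n t = (\<Sum>k\<in>fbox n. Re (th' k t * coef (z t) k) + Re (th k t * gen k (z t)))" for n t
   using mode_sum[OF uL[of t] st[of t] finite_fbox[of n]]
   by (simp add: L_def sum.distrib trunc_inner th_def th'_def fu slX sl \<psi> B1_def[abs_def] B2_def[abs_def] B3_def[abs_def]
      coef_ft slice_L2)
  have "(LINT t|lebesgue. L n t) = (\<Sum>k\<in>fbox n. LINT t|lebesgue. Re (th' k t * coef (z t) k) + Re (th k t * gen k (z t)))" for n
   unfolding L by (rule Bochner_Integration.integral_sum) (intro Bochner_Integration.integrable_add integrable_Re i)
  also have "(\<Sum>k\<in>fbox n. LINT t|lebesgue. Re (th' k t * coef (z t) k) + Re (th k t * gen k (z t)))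
    = - (LINT t|lebesgue. trunc (fbox n) (g t) \<bullet> ft (slice \<psi> t))" for n
  proof -
   have "(LINT t|lebesgue. trunc (fbox n) (g t) \<bullet> ft (slice \<psi> t)) = (\<Sum>k\<in>fbox n. LINT t|lebesgue. Re (th k t * coef (g t) k))"
    unfolding trunc_inner[OF finite_fbox] th_def[symmetric]
    by (rule Bochner_Integration.integral_sum) (intro integrable_Re i)
   then show ?thesis by (simp only: w sum_negf)
  qed
  finally have eq: "(LINT t|lebesgue. L n t) = - (LINT t|lebesgue. trunc (fbox n) (g t) \<bullet> ft (slice \<psi> t))" for n .
  note sp = slice_pairing[OF li(4) tf(1)] slice_pairing[OF li(4) tf(2)] slice_pairing[OF li(1) tf(3)]
   slice_pairing[OF li(2) tf(4)] slice_pairing[OF li(3) \<psi>]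
  have l1: "(\<lambda>n. LINT t|lebesgue. L n t) \<longlonglongrightarrow> (LINT t|lebesgue. z t \<bullet> ft (slice (et \<psi>) t)) + ((LINT t|lebesgue. z t \<bullet> ft (slice X t))
    + (LINT t|lebesgue. ft (B1 t) \<bullet> ft (slice (e1 \<psi>) t)) + (LINT t|lebesgue. ft (B2 t) \<bullet> ft (slice (e2 \<psi>) t))
    - (LINT t|lebesgue. ft (B3 t) \<bullet> ft (slice \<psi> t)))"
   unfolding L_def by (simp add: sp) (intro tendsto_add tendsto_diff sp)
  have l2: "(\<lambda>n. LINT t|lebesgue. L n t) \<longlonglongrightarrow> - (LINT t|lebesgue. g t \<bullet> ft (slice \<psi> t))"
   unfolding eq by (intro tendsto_minus slice_pairing(3)[OF g(1) \<psi>])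
  have "(LINT t|lebesgue. g t \<bullet> ft (slice \<psi> t)) = - ((LINT t|lebesgue. z t \<bullet> ft (slice (et \<psi>) t)) + ((LINT t|lebesgue. z t \<bullet> ft (slice X t))
    + (LINT t|lebesgue. ft (B1 t) \<bullet> ft (slice (e1 \<psi>) t)) + (LINT t|lebesgue. ft (B2 t) \<bullet> ft (slice (e2 \<psi>) t))
    - (LINT t|lebesgue. ft (B3 t) \<bullet> ft (slice \<psi> t))))"
   using LIMSEQ_unique[OF l1 l2] by linarith
  also have "\<dots> = (LINT t|lebesgue. - (z t \<bullet> ft (slice (et \<psi>) t) + (z t \<bullet> ft (slice X t)
    + ft (B1 t) \<bullet> ft (slice (e1 \<psi>) t) + ft (B2 t) \<bullet> ft (slice (e2 \<psi>) t) - ft (B3 t) \<bullet> ft (slice \<psi> t))))"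
   by (simp add: sp)
  also have "\<dots> = dist_of u (Theta \<psi>)"
   unfolding dist_of_slice
  proof (rule Bochner_Integration.integral_cong[OF refl])
   fix t
   have "slice (Theta \<psi>) t = (\<lambda>x. - 1 * slice (et \<psi>) t x + A (slice \<psi> t) x)" using slice_Theta[OF \<psi>] by (simp add: fun_eq_iff)
   then have "ip (u t) (slice (Theta \<psi>) t) = - 1 * ip (u t) (slice (et \<psi>) t) + ip (u t) (A (slice \<psi> t))"
    by (simp only: ip_add_right ip_cmult_right uL slice_L2[OF tf(1)] L2_cmult smooth_torus_L2[OF smooth_torus_adj[OF st]])
   also have "\<dots> = - (z t \<bullet> ft (slice (et \<psi>) t) + (z t \<bullet> ft (slice X t)
    + ft (B1 t) \<bullet> ft (slice (e1 \<psi>) t) + ft (B2 t) \<bullet> ft (slice (e2 \<psi>) t) - ft (B3 t) \<bullet> ft (slice \<psi> t)))"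
    unfolding ip_adj[OF uL st] B1_def[symmetric] B2_def[symmetric] B3_def[symmetric] slX sl[OF \<psi>]
    by (simp add: Parseval uL BL slice_L2 tf \<psi> fu)
   finally show "- (z t \<bullet> ft (slice (et \<psi>) t) + (z t \<bullet> ft (slice X t)
    + ft (B1 t) \<bullet> ft (slice (e1 \<psi>) t) + ft (B2 t) \<bullet> ft (slice (e2 \<psi>) t) - ft (B3 t) \<bullet> ft (slice \<psi> t))) = ip (u t) (slice (Theta \<psi>) t)" ..
  qed
  also have "(LINT t|lebesgue. g t \<bullet> ft (slice \<psi> t)) = dist_of f \<psi>"
  proof -
   have ae: "AE t in lebesgue. g t \<bullet> ft (slice \<psi> t) = ip (f t) (slice \<psi> t)"
    using g(3) by eventually_elim (simp add: Parseval fL slice_L2 \<psi>)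
   have m: "(\<lambda>t. g t \<bullet> ft (slice \<psi> t)) \<in> borel_measurable lebesgue"
    using slice_pairing(2)[OF g(1) \<psi>] by (rule borel_measurable_integrable)
   have "(\<lambda>t. ip (f t) (slice \<psi> t)) \<in> borel_measurable lebesgue"
    by (rule borel_measurable_AE[OF m ae])
   then show ?thesis unfolding dist_of_slice by (intro integral_cong_AE m ae)
  qed
  finally show ?thesis using L_op_Theta[OF uC \<psi>] by simp
 qed
 ultimately show ?thesis using uC by (auto simp: is_solution_def)
qed

text \<open>Testing against cosines and sines shows that the coefficients solve the lattice system.\<close>

lemma homogeneous_zero:
 assumes w: "w \<in> C_L2" and eq: "!!\<psi>. \<psi> \<in> test_fun ==> L_op (\<lambda>x. 0) (\<lambda>x. 0) (\<lambda>x. 0) b1 b2 c (dist_of w) \<psi> = 0"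
  and z: "ft (w 0) = 0"
 shows "ft (w t) = 0"
proof (rule uniqueness[of "\<lambda>t. ft (w t)"])
 have wL: "w t \<in> L2" for t using w by (simp add: C_L2_iff)
 show "continuous_on UNIV (\<lambda>t. ft (w t))" using w by (simp add: C_L2_iff)
 fix k t
 note hd = homogeneous_weak_deriv[OF w eq]
 have ph: "phase k (1, 0) = of_int (fst k)" "phase k (0, 1) = of_int (snd k)" by (simp_all add: phase_def)
 have dd: "dir_deriv v (\<lambda>x. r * sink k x) = (\<lambda>x. (r * phase k v) * cosk k x)" "dir_deriv v (\<lambda>x. r * cosk k x) = (\<lambda>x. (- r * phase k v) * sink k x)" for r and v :: plane
  by (simp_all add: dir_deriv_cmult smooth_torusD smooth_torus_cosk smooth_torus_sink dir_deriv_cosk dir_deriv_sink mult.assoc)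
 have pc: "pp (cosk k) = (\<lambda>x. om k * sink k x)" "pp (sink k) = (\<lambda>x. - om k * cosk k x)"
  unfolding pp_def[abs_def] dir_deriv_cosk dir_deriv_sink dd ph om_def by (simp_all add: fun_eq_iff algebra_simps)
 define Q where "Q g = ip (w t) (A g)" for g
 have Qc: "- Q (cosk k) = om k * ip (w t) (sink k) + - of_int (fst k) * ip (\<lambda>x. b1 x * w t x) (sink k)
   + - of_int (snd k) * ip (\<lambda>x. b2 x * w t x) (sink k) - ip (\<lambda>x. cc x * w t x) (cosk k)"
  unfolding Q_def ip_adj[OF wL smooth_torus_cosk] pc dir_deriv_cosk ip_cmult_right ph by simp
 have Qs: "- Q (sink k) = - om k * ip (w t) (cosk k) + of_int (fst k) * ip (\<lambda>x. b1 x * w t x) (cosk k)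
   + of_int (snd k) * ip (\<lambda>x. b2 x * w t x) (cosk k) - ip (\<lambda>x. cc x * w t x) (sink k)"
  unfolding Q_def ip_adj[OF wL smooth_torus_sink] pc dir_deriv_sink ip_cmult_right ph by simp
 define c0 c1 :: complex where "c0 = complex_of_real (1 / (2 * pi))" and "c1 = - \<i> * complex_of_real (1 / (2 * pi))"
 have dc: "((\<lambda>t. ip (w t) (cosk k)) has_vector_derivative - Q (cosk k)) (at t)"
  "((\<lambda>t. ip (w t) (sink k)) has_vector_derivative - Q (sink k)) (at t)"
  unfolding Q_def using hd[OF _ smooth_torus_cosk, of k t] hd[OF _ smooth_torus_sink, of k t]
  by (simp_all add: has_real_derivative_iff_has_vector_derivative)
 have fcc: "fc g k = ip g (cosk k) *\<^sub>R c0 + ip g (sink k) *\<^sub>R c1" for g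
  by (simp add: fc_def complex_eq_iff c0_def c1_def)
 have g: "gen k (ft (w t)) = (- Q (cosk k)) *\<^sub>R c0 + (- Q (sink k)) *\<^sub>R c1"
  unfolding gen_ft[OF wL] fcc Qc Qs
  by (simp add: complex_eq_iff c0_def c1_def diff_divide_distrib add_divide_distrib mult.assoc)
 have "((\<lambda>t. ip (w t) (cosk k) *\<^sub>R c0 + ip (w t) (sink k) *\<^sub>R c1) has_vector_derivative
   (- Q (cosk k)) *\<^sub>R c0 + (- Q (sink k)) *\<^sub>R c1) (at t)"
  by (rule has_vector_derivative_add[OF bounded_linear.has_vector_derivative[OF bounded_linear_scaleR_left dc(1)]
     bounded_linear.has_vector_derivative[OF bounded_linear_scaleR_left dc(2)]])
 then show "((\<lambda>t. coef (ft (w t)) k) has_vector_derivative gen k (ft (w t))) (at t)"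
  by (simp only: coef_ft[OF wL] fcc g)
qed (rule z)

end

theorem first_order_well_posed:
 assumes "smooth_torus b1" "smooth_torus b2" "smooth_torus c"
 shows "L2_well_posed (L_op (\<lambda>x. 0) (\<lambda>x. 0) (\<lambda>x. 0) b1 b2 c)"
proof -
 interpret first_order b1 b2 c by unfold_locales (use assms in auto)
 show ?thesis unfolding L2_well_posed_def
 proof (intro ballI conjI allI impI existence)
  fix u0 f u v t
  assume "is_solution (L_op (\<lambda>x. 0) (\<lambda>x. 0) (\<lambda>x. 0) b1 b2 c) f u0 u \<and> is_solution (L_op (\<lambda>x. 0) (\<lambda>x. 0) (\<lambda>x. 0) b1 b2 c) f u0 v"
  then have s: "is_solution (L_op (\<lambda>x. 0) (\<lambda>x. 0) (\<lambda>x. 0) b1 b2 c) f u0 u" "is_solution (L_op (\<lambda>x. 0) (\<lambda>x. 0) (\<lambda>x. 0) b1 b2 c) f u0 v" by auto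
  note d = is_solution_diff_zero[OF smooth_torus_const smooth_torus_const smooth_torus_const smooth_b s]
  have L: "u t \<in> L2" "v t \<in> L2" using s by (auto simp: is_solution_def C_L2_iff)
  have "ft (\<lambda>x. u t x - v t x) = 0" by (rule homogeneous_zero[OF d])
  then show "L2_eq (u t) (v t)" by (intro ft_eq_imp_L2_eq L) (simp add: ft_diff L)
 qed
qed

section \<open>Removing the second order part\<close>

lemma strongly_measurable_norm:
 assumes "strongly_measurable_L2 f" "!!t. f t \<in> L2"
 shows "(\<lambda>t. L2_norm (f t)) \<in> borel_measurable lebesgue"
proof -
 obtain s where s: "!!n. simple_function lebesgue (s n)" "!!n t. s n t \<in> L2"
  "AE t in lebesgue. (\<lambda>n. L2_norm (\<lambda>x. s n t x - f t x)) \<longlonglongrightarrow> 0"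
  using assms(1) unfolding strongly_measurable_L2_def by blast
 have [measurable]: "(\<lambda>t. L2_norm (s n t)) \<in> borel_measurable lebesgue" for n
  by (rule borel_measurable_simple_function) (rule simple_function_compose1[OF s(1)])
 have m: "(\<lambda>t. lim (\<lambda>n. L2_norm (s n t))) \<in> borel_measurable lebesgue" by measurable
 have "AE t in lebesgue. lim (\<lambda>n. L2_norm (s n t)) = L2_norm (f t)"
  using s(3)
 proof eventually_elim
  case (elim t)
  then have "(\<lambda>n. ft (s n t)) \<longlonglongrightarrow> ft (f t)"
   by (subst tendsto_dist_iff) (simp add: L2_norm_diff_ft[symmetric] s(2) assms(2))
  from tendsto_norm[OF this] show ?case by (intro limI) (simp add: L2_norm_ft s(2) assms(2))
 qed
 with m show ?thesis by (rule borel_measurable_AE)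
qed

lemma L1loc_L2_smooth_mult: assumes a: "smooth_torus a" and f: "f \<in> L1loc_L2"
 shows "(\<lambda>t x. a x * f t x) \<in> L1loc_L2"
proof -
 obtain B where B: "B >= 0" "!!g. g \<in> L2 ==> L2_norm (\<lambda>x. a x * g x) <= B * L2_norm g"
  using L2_norm_smooth_mult[OF a] by blast
 have fL: "f t \<in> L2" for t using f by (simp add: L1loc_L2_def)
 have afL: "(\<lambda>x. a x * f t x) \<in> L2" for t by (rule L2_smooth_mult[OF a fL])
 obtain s where s: "!!n. simple_function lebesgue (s n)" "!!n t. s n t \<in> L2"
  "AE t in lebesgue. (\<lambda>n. L2_norm (\<lambda>x. s n t x - f t x)) \<longlonglongrightarrow> 0"
  using f unfolding L1loc_L2_def strongly_measurable_L2_def by blast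
 have sm: "strongly_measurable_L2 (\<lambda>t x. a x * f t x)"
  unfolding strongly_measurable_L2_def
 proof (intro exI[of _ "\<lambda>n t x. a x * s n t x"] conjI allI)
  show "simple_function lebesgue (\<lambda>t x. a x * s n t x)" for n by (rule simple_function_compose1[OF s(1)])
  show "(\<lambda>x. a x * s n t x) \<in> L2" for n t by (rule L2_smooth_mult[OF a s(2)])
  show "AE t in lebesgue. (\<lambda>n. L2_norm (\<lambda>x. a x * s n t x - a x * f t x)) \<longlonglongrightarrow> 0"
   using s(3)
  proof eventually_elim
   case (elim t)
   have "L2_norm (\<lambda>x. a x * s n t x - a x * f t x) <= B * L2_norm (\<lambda>x. s n t x - f t x)" for n
    using B(2)[OF L2_diff[OF s(2) fL], of n t t] by (simp add: right_diff_distrib)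
   then have "\<forall>\<^sub>F n in sequentially. norm (L2_norm (\<lambda>x. a x * s n t x - a x * f t x)) <= B * L2_norm (\<lambda>x. s n t x - f t x)" by simp
   then show ?case by (rule Lim_null_comparison) (use tendsto_mult[OF tendsto_const[of B] elim] in simp)
  qed
 qed
 have "set_integrable lebesgue {p..q} (\<lambda>t. L2_norm (\<lambda>x. a x * f t x))" for p q
  unfolding set_integrable_def
 proof (rule Bochner_Integration.integrable_bound)
  show "integrable lebesgue (\<lambda>t. B * (indicator {p..q} t *\<^sub>R L2_norm (f t)))"
   using f unfolding L1loc_L2_def set_integrable_def by (intro integrable_mult_right) blast
  show "(\<lambda>t. indicator {p..q} t *\<^sub>R L2_norm (\<lambda>x. a x * f t x)) \<in> borel_measurable lebesgue"
   by (intro borel_measurable_scaleR borel_measurable_indicator strongly_measurable_norm[OF sm] afL) auto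
  show "AE t in lebesgue. norm (indicator {p..q} t *\<^sub>R L2_norm (\<lambda>x. a x * f t x)) <= norm (B * (indicator {p..q} t *\<^sub>R L2_norm (f t)))"
   using B(2)[OF fL] B(1) by (auto simp: indicator_def)
 qed
 then show ?thesis using sm afL by (simp add: L1loc_L2_def)
qed

subsection \<open>Conjugation by an exponential\<close>

locale gauge = coefficients +
 fixes \<phi> :: "plane => real"
 assumes smooth_phi: "smooth_torus \<phi>" and grad_phi: "!!x. grad \<phi> x = (am1 x, a1 x)"
  and a0_eq: "!!x. a0 x = a1 x + am1 x"
begin

definition E :: "plane => real" where "E x = exp (\<phi> x)"
definition E' :: "plane => real" where "E' x = exp (- \<phi> x)"

lemma smooth_E: "smooth_torus E" unfolding E_def[abs_def] by (rule smooth_torus_comp[OF smooth_exp_real smooth_phi])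
lemma smooth_E': "smooth_torus E'" unfolding E'_def[abs_def]
 using smooth_torus_comp[OF smooth_exp_real smooth_torus_minus[OF smooth_phi]] by simp

lemma E_E': "E x * E' x = 1" "E' x * E x = 1" by (simp_all add: E_def E'_def exp_minus)

lemma d_phi: "d1 \<phi> = am1" "d2 \<phi> = a1"
 using grad_phi by (auto simp: grad_def fun_eq_iff)

lemma d_E: "d1 E = (\<lambda>x. am1 x * E x)" "d2 E = (\<lambda>x. a1 x * E x)"
proof -
 have "dir_deriv v E x = dir_deriv v \<phi> x * E x" for v x
 proof -
  have "((\<lambda>x. exp (\<phi> x)) has_derivative (\<lambda>h. exp (\<phi> x) * frechet_derivative \<phi> (at x) h)) (at x)"
   using smooth_has_derivative[OF smooth_torusD(1)[OF smooth_phi], of x]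
   by (auto intro!: derivative_eq_intros simp: fun_eq_iff dir_deriv_def)
  from dir_deriv_eqI[OF this, of v] show ?thesis by (simp add: E_def[abs_def] dir_deriv_def[of v \<phi>])
 qed
 then show "d1 E = (\<lambda>x. am1 x * E x)" "d2 E = (\<lambda>x. a1 x * E x)" by (simp_all add: fun_eq_iff d_phi)
qed

lemma d1_a1: "d1 a1 = d2 am1"
 using dir_deriv_commute[OF smooth_phi, of "(1, 0)" "(0, 1)"] by (simp add: d_phi)

text \<open>The first order coefficients after conjugation, including the derivatives that the second order terms and the third order commutators leave behind.\<close>

definition B1 :: "plane => real" where
 "B1 x = b1 x - d2 a1 x - a1 x * a1 x - 2 * d2 am1 x - 2 * (am1 x * a1 x)"
definition B2 :: "plane => real" where
 "B2 x = b2 x - d1 am1 x - am1 x * am1 x - 2 * d2 am1 x - 2 * (am1 x * a1 x)"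
text \<open>The zero order coefficient is fixed by the value at the constant function, which avoids computing third derivatives of the exponential.\<close>

definition C :: "plane => real" where "C x = A E x * E' x + d1 B1 x + d2 B2 x"

lemma smooth_gauged: "smooth_torus B1" "smooth_torus B2" "smooth_torus C"
proof -
 show B: "smooth_torus B1" "smooth_torus B2" unfolding B1_def[abs_def] B2_def[abs_def]
  by (intro smooth_torus_diff smooth_torus_mult smooth_torus_cmult smooth_torus_dir_deriv smooth_coeffs)+
 show "smooth_torus C" unfolding C_def[abs_def]
  by (intro smooth_torus_add smooth_torus_mult smooth_torus_dir_deriv smooth_torus_adj smooth_E smooth_E' B)
qed

text \<open>Leibniz expansion. The terms with two derivatives on \<open>\<psi>\<close> have coefficients \<open>\<plusminus>(a\<^sub>0 - a\<^sub>1 - a\<^sub>-\<^sub>1)\<close>, \<open>a\<^sub>1 - a\<^sub>1\<close> and \<open>a\<^sub>-\<^sub>1 - a\<^sub>-\<^sub>1\<close>; the equality of the mixed derivatives of \<open>\<phi>\<close> matches the remaining ones.\<close>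

lemma gauge_adj: assumes "smooth_torus \<psi>"
 shows "A (\<lambda>x. E x * \<psi> x) x = E x * adj (\<lambda>x. 0) (\<lambda>x. 0) (\<lambda>x. 0) B1 B2 C \<psi> x"
proof -
 interpret F: first_order B1 B2 C by unfold_locales (rule smooth_gauged)+
 have sm: "smooth \<psi>" "smooth E" "smooth a1" "smooth am1" "smooth b1" "smooth b2"
  using assms smooth_E smooth_coeffs by (auto intro: smooth_torusD)
 have com: "d1 (d2 \<psi>) = d2 (d1 \<psi>)" by (rule dir_deriv_commute[OF assms]) auto
 have com1: "d1 (d2 (d1 \<psi>)) = d2 (d1 (d1 \<psi>))" "d1 (d2 (d2 \<psi>)) = d2 (d2 (d1 \<psi>))"
  using dir_deriv_commute[OF smooth_torus_dir_deriv[OF assms, of "(1, 0)"], of "(1, 0)" "(0, 1)"]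
   dir_deriv_commute[OF smooth_torus_dir_deriv[OF assms, of "(0, 1)"], of "(1, 0)" "(0, 1)"] com by auto
 have a0: "a0 = (\<lambda>x. a1 x + am1 x)" using a0_eq by auto
 have "A (\<lambda>x. E x * \<psi> x) x = \<psi> x * A E x + E x * (- d1 (d2 (d1 \<psi>)) x - d2 (d2 (d1 \<psi>)) x - B1 x * d1 \<psi> x - B2 x * d2 \<psi> x)"
  unfolding adj_def a0 B1_def B2_def
  by (simp add: dir_deriv_mult dir_deriv_add sm smooth_dir_deriv smooth_mult smooth_add d_E d1_a1 com com1)
    (simp add: algebra_simps)
 moreover have "F.cc x = A E x * E' x" by (simp add: F.cc_def C_def)
 ultimately show ?thesis
  using E_E'(1)[of x] by (simp add: F.adj_expand[OF assms] F.pp_def algebra_simps)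
qed

lemma test_fun_E: "\<psi> \<in> test_fun ==> (\<lambda>z. E (snd z) * \<psi> z) \<in> test_fun" by (rule test_fun_mult[OF smooth_E])

lemma gauge_L_op: assumes u: "u \<in> C_L2" and \<psi>: "\<psi> \<in> test_fun"
 shows "L_op a1 a0 am1 b1 b2 c (dist_of u) (\<lambda>z. E (snd z) * \<psi> z)
   = L_op (\<lambda>x. 0) (\<lambda>x. 0) (\<lambda>x. 0) B1 B2 C (dist_of (\<lambda>t x. E x * u t x)) \<psi>"
proof -
 interpret F: first_order B1 B2 C by unfold_locales (rule smooth_gauged)+
 note E\<psi> = test_fun_E[OF \<psi>]
 have sl: "slice (\<lambda>z. E (snd z) * \<psi> z) t = (\<lambda>x. E x * slice \<psi> t x)" for t by (simp add: slice_def fun_eq_iff)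
 have et: "slice (et (\<lambda>z. E (snd z) * \<psi> z)) t x = E x * slice (et \<psi>) t x" for t x
 proof (rule DERIV_unique)
  show "((\<lambda>t. slice (\<lambda>z. E (snd z) * \<psi> z) t x) has_real_derivative slice (et (\<lambda>z. E (snd z) * \<psi> z)) t x) (at t)"
   using slice_time_deriv[OF test_funD(1)[OF E\<psi>], of x t] by (simp add: zero_prod_def)
  show "((\<lambda>t. slice (\<lambda>z. E (snd z) * \<psi> z) t x) has_real_derivative E x * slice (et \<psi>) t x) (at t)"
   unfolding sl using DERIV_cmult[OF slice_time_deriv[OF test_funD(1)[OF \<psi>], of x t], of "E x"] by (simp add: zero_prod_def)
 qed
 have "slice (Theta (\<lambda>z. E (snd z) * \<psi> z)) t x = E x * slice (F.Theta \<psi>) t x" for t x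
  unfolding slice_Theta[OF E\<psi>] F.slice_Theta[OF \<psi>] sl et gauge_adj[OF smooth_torus_slice[OF \<psi>]]
  by (simp add: algebra_simps)
 then have "ip (u t) (slice (Theta (\<lambda>z. E (snd z) * \<psi> z)) t) = ip (\<lambda>x. E x * u t x) (slice (F.Theta \<psi>) t)" for t
  by (simp add: ip_def mult_ac)
 then show ?thesis
  unfolding L_op_Theta[OF u E\<psi>] F.L_op_Theta[OF C_L2_smooth_mult[OF smooth_E u] \<psi>] dist_of_slice by simp
qed

lemma gauge_dist: "dist_of f (\<lambda>z. E (snd z) * \<psi> z) = dist_of (\<lambda>t x. E x * f t x) \<psi>"
 by (simp add: dist_of_def mult_ac)

text \<open>Test functions correspond to each other under multiplication with \<open>e\<^sup>\<phi>\<close> and with \<open>e\<^sup>-\<^sup>\<phi>\<close>.\<close>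

lemma gauge_solution:
 assumes u: "u \<in> C_L2"
 shows "is_solution (L_op a1 a0 am1 b1 b2 c) f u0 u \<longleftrightarrow>
  is_solution (L_op (\<lambda>x. 0) (\<lambda>x. 0) (\<lambda>x. 0) B1 B2 C) (\<lambda>t x. E x * f t x) (\<lambda>x. E x * u0 x) (\<lambda>t x. E x * u t x)"
proof -
 have Eu: "(\<lambda>t x. E x * u t x) \<in> C_L2" by (rule C_L2_smooth_mult[OF smooth_E u])
 have nz: "E x ~= 0" for x by (simp add: E_def)
 have "(\<forall>\<psi>\<in>test_fun. L_op a1 a0 am1 b1 b2 c (dist_of u) \<psi> = dist_of f \<psi>) \<longleftrightarrow>
  (\<forall>\<psi>\<in>test_fun. L_op (\<lambda>x. 0) (\<lambda>x. 0) (\<lambda>x. 0) B1 B2 C (dist_of (\<lambda>t x. E x * u t x)) \<psi> = dist_of (\<lambda>t x. E x * f t x) \<psi>)" (is "?l \<longleftrightarrow> ?r")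
 proof
  assume ?l then show ?r by (simp add: gauge_L_op[OF u, symmetric] gauge_dist[symmetric] test_fun_E)
 next
  assume r: ?r
  show ?l
  proof
   fix \<psi> assume "\<psi> \<in> test_fun"
   then have t: "(\<lambda>z. E' (snd z) * \<psi> z) \<in> test_fun" by (rule test_fun_mult[OF smooth_E'])
   have e: "(\<lambda>z. E (snd z) * (E' (snd z) * \<psi> z)) = \<psi>" by (simp add: mult.assoc[symmetric] E_E')
   show "L_op a1 a0 am1 b1 b2 c (dist_of u) \<psi> = dist_of f \<psi>"
    using bspec[OF r t] gauge_L_op[OF u t] gauge_dist[of f "\<lambda>z. E' (snd z) * \<psi> z"] unfolding e by simp
  qed
 qed
 then show ?thesis using u Eu by (simp add: is_solution_def L2_eq_def nz)
qed

theorem gauged_well_posed: "L2_well_posed (L_op a1 a0 am1 b1 b2 c)"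
proof -
 let ?L = "L_op a1 a0 am1 b1 b2 c" and ?M = "L_op (\<lambda>x. 0) (\<lambda>x. 0) (\<lambda>x. 0) B1 B2 C"
 have nz: "E x ~= 0" for x by (simp add: E_def)
 have wp: "L2_well_posed ?M" by (rule first_order_well_posed[OF smooth_gauged])
 show ?thesis unfolding L2_well_posed_def
 proof (intro ballI conjI allI impI)
  fix u0 f assume u0: "u0 \<in> L2" and f: "f \<in> L1loc_L2"
  have E0: "(\<lambda>x. E x * u0 x) \<in> L2" "(\<lambda>t x. E x * f t x) \<in> L1loc_L2"
   by (rule L2_smooth_mult[OF smooth_E u0], rule L1loc_L2_smooth_mult[OF smooth_E f])
  then obtain v where v: "is_solution ?M (\<lambda>t x. E x * f t x) (\<lambda>x. E x * u0 x) v"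
   using wp unfolding L2_well_posed_def by blast
  then have "(\<lambda>t x. E' x * v t x) \<in> C_L2" by (intro C_L2_smooth_mult smooth_E') (simp add: is_solution_def)
  from gauge_solution[OF this, of f u0] v show "\<exists>u. is_solution ?L f u0 u"
   by (auto simp: mult.assoc[symmetric] E_E')
  fix u w t assume s: "is_solution ?L f u0 u \<and> is_solution ?L f u0 w"
  then have "u \<in> C_L2" "w \<in> C_L2" by (auto simp: is_solution_def)
  with s have "is_solution ?M (\<lambda>t x. E x * f t x) (\<lambda>x. E x * u0 x) (\<lambda>t x. E x * u t x)"
   "is_solution ?M (\<lambda>t x. E x * f t x) (\<lambda>x. E x * u0 x) (\<lambda>t x. E x * w t x)"
   using gauge_solution by blast+
  then have "L2_eq (\<lambda>x. E x * u t x) (\<lambda>x. E x * w t x)"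
   using wp E0 unfolding L2_well_posed_def by blast
  then show "L2_eq (u t) (w t)" by (simp add: L2_eq_def nz)
 qed
qed

end

section \<open>Averages along closed orbits\<close>

subsection \<open>Potentials\<close>

lemma dir_deriv_pair: "smooth g ==> dir_deriv (a, b) g x = a * d1 g x + b * d2 g x"
proof -
 assume g: "smooth g"
 interpret linear "\<lambda>v. dir_deriv v g x" using smooth_has_derivative[OF g] by (rule has_derivative_linear)
 have "(a, b) = a *\<^sub>R (1, 0) + b *\<^sub>R (0, 1)" by simp
 then show ?thesis using add[of "a *\<^sub>R (1, 0)" "b *\<^sub>R (0, 1)"] by (simp only: scale real_scaleR_def)
qed

lemma smooth_along_line:
 fixes h :: "'a::euclidean_space => real"
 assumes h: "smooth h"
 shows "((\<lambda>t. h (x + t *\<^sub>R v)) has_real_derivative dir_deriv v h (x + t *\<^sub>R v)) (at t)"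
proof -
 have c: "((\<lambda>t. x + t *\<^sub>R v) has_derivative (\<lambda>s. s *\<^sub>R v)) (at t)"
  by (auto intro!: derivative_eq_intros)
 have "dir_deriv (s *\<^sub>R v) h z = dir_deriv v h z * s" for s z
  using linear_cmul[OF has_derivative_linear[OF smooth_has_derivative[OF h, of z]], of s v] by simp
 then show ?thesis
  using has_derivative_compose[OF c smooth_has_derivative[OF h]] by (simp add: has_field_derivative_def)
qed

text \<open>The integral over the fixed interval covers both signs of \<open>y\<close> and can be differentiated in parameters.\<close>

lemma scaled_primitive:
 fixes g :: "real => real"
 assumes "continuous_on UNIV g"
 shows "((\<lambda>y. y * integral {0..1} (\<lambda>\<tau>. g (\<tau> * y))) has_real_derivative g y) (at y)"
proof -
 obtain G where G: "!!t. (G has_real_derivative g t) (at t)" using continuous_primitive[OF assms, of 0] by metis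
 have "y * integral {0..1} (\<lambda>\<tau>. g (\<tau> * y)) = G y - G 0" for y
 proof -
  have "((\<lambda>\<tau>. g (\<tau> * y) * y) has_integral G (1 * y) - G (0 * y)) {0..1}"
  proof (rule fundamental_theorem_of_calculus)
   fix \<tau> :: real
   have "((\<lambda>\<tau>. G (\<tau> * y)) has_real_derivative g (\<tau> * y) * y) (at \<tau>)"
    by (rule DERIV_chain2[OF G]) (auto intro!: derivative_eq_intros)
   then show "((\<lambda>\<tau>. G (\<tau> * y)) has_vector_derivative g (\<tau> * y) * y) (at \<tau> within {0..1})"
    by (simp add: has_real_derivative_iff_has_vector_derivative has_vector_derivative_at_within)
  qed simp
  from integral_unique[OF this] show ?thesis by (simp add: mult.commute[of y])
 qed
 then show ?thesis using DERIV_diff[OF G[of y] DERIV_const[of "G 0"]] by simp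
qed

definition prim2 :: "(plane => real) => plane => real" where
 "prim2 f z = snd z * integral {0..1} (\<lambda>\<tau>. f (fst z, \<tau> * snd z))"

lemma prim2_has_derivative:
 assumes f: "smooth f"
 shows "(prim2 f has_derivative (\<lambda>v. fst v * prim2 (d1 f) z + snd v * f z)) (at z)"
proof -
 obtain x y where z: "z = (x, y)" by (cases z)
 define F where "F x y = y * integral {0..1} (\<lambda>\<tau>. f (x, \<tau> * y))" for x y
 have cf: "continuous_on A (\<lambda>z. f (h z))" if "continuous_on A h" for A :: "'b::topological_space set" and h
  using continuous_on_compose2[OF smooth_continuous[OF f, of UNIV] that] by simp
 have cdf: "continuous_on A (\<lambda>z. d1 f (h z))" if "continuous_on A h" for A :: "'b::topological_space set" and h
  using continuous_on_compose2[OF smooth_continuous[OF smooth_dir_deriv[OF f], of UNIV] that] by simp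
 have Fy: "((\<lambda>y. F x y) has_real_derivative f (x, y)) (at y)" for x y
  unfolding F_def by (rule scaled_primitive) (intro cf continuous_intros)
 have Fx: "((\<lambda>x. F x y) has_real_derivative prim2 (d1 f) (x, y)) (at x)"
 proof -
  have "((\<lambda>x. integral (cbox 0 1) (\<lambda>\<tau>. f (x, \<tau> * y))) has_real_derivative integral (cbox 0 1) (\<lambda>\<tau>. d1 f (x, \<tau> * y))) (at x within UNIV)"
  proof (rule leibniz_rule_field_derivative)
   show "((\<lambda>x. f (x, t * y)) has_real_derivative d1 f (x, t * y)) (at x within UNIV)" for x t
    using smooth_along_line[OF f, of "(0, t * y)" "(1, 0)" x] by simp
   show "(\<lambda>\<tau>. f (x, \<tau> * y)) integrable_on cbox 0 1" for x by (intro integrable_continuous cf continuous_intros)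
   show "continuous_on (UNIV \<times> cbox 0 1) (\<lambda>(x, t). d1 f (x, t * y))"
    unfolding case_prod_beta' by (intro cdf continuous_intros)
  qed auto
  from DERIV_cmult[OF this, of y] show ?thesis by (simp add: F_def prim2_def)
 qed
 have "((\<lambda>(x, y). F x y) has_derivative (\<lambda>(tx, ty). prim2 (d1 f) (x, y) * tx + blinfun_apply (blinfun_mult_right (f (x, y))) ty)) (at (x, y) within UNIV \<times> UNIV)"
 proof (rule has_derivative_partialsI)
  show "((\<lambda>x. F x y) has_derivative (*) (prim2 (d1 f) (x, y))) (at x within UNIV)" using Fx by (simp add: has_field_derivative_def)
  show "((\<lambda>y. F x y) has_derivative blinfun_apply (blinfun_mult_right (f (x, y)))) (at y within UNIV)" for x y
   using Fy by (simp add: has_field_derivative_def blinfun_mult_right.rep_eq)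
  have "continuous_on UNIV (\<lambda>z. blinfun_mult_right (f z))"
   by (intro bounded_linear.continuous_on[OF bounded_linear_blinfun_mult_right] smooth_continuous f)
  then show "continuous (at (x, y) within UNIV \<times> UNIV) (\<lambda>(x, y). blinfun_mult_right (f (x, y)))"
   by (simp add: continuous_on_eq_continuous_within case_prod_beta')
 qed auto
 then show ?thesis by (simp add: z prim2_def[abs_def] F_def case_prod_beta' blinfun_mult_right.rep_eq mult.commute)
qed

lemma prim2_cmult: "r * prim2 f z = prim2 (\<lambda>z. r * f z) z"
 by (simp add: prim2_def)

lemma smooth_potential:
 assumes f: "smooth f" and g: "smooth g" and closed: "d2 f = d1 g"
 obtains \<phi> where "smooth \<phi>" "d1 \<phi> = f" "d2 \<phi> = g"
proof -
 define P where "P x = x * integral {0..1} (\<lambda>\<tau>. f (\<tau> * x, 0))" for x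
 have "continuous_on UNIV (\<lambda>x. f (x, 0))"
  by (rule continuous_on_compose2[OF smooth_continuous[OF f, of UNIV]]) (auto intro!: continuous_intros)
 from scaled_primitive[OF this] have P: "(P has_derivative (*) (f (x, 0))) (at x)" for x
  unfolding P_def[abs_def] has_field_derivative_def .
 have prim: "prim2 (d1 g) z = f z - f (fst z, 0)" for z
 proof -
  have "((\<lambda>\<tau>. dir_deriv (0, snd z) f (fst z, \<tau> * snd z)) has_integral f (fst z, 1 * snd z) - f (fst z, 0 * snd z)) {0..1}"
  proof (rule fundamental_theorem_of_calculus)
   fix \<tau> :: real
   show "((\<lambda>\<tau>. f (fst z, \<tau> * snd z)) has_vector_derivative dir_deriv (0, snd z) f (fst z, \<tau> * snd z)) (at \<tau> within {0..1})"
    using smooth_along_line[OF f, of "(fst z, 0)" "(0, snd z)" \<tau>]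
    by (simp add: has_real_derivative_iff_has_vector_derivative has_vector_derivative_at_within)
  qed simp
  moreover have "dir_deriv (0, y) f w = y * d1 g w" for y w
   using dir_deriv_pair[OF f, of 0 y w] by (simp add: closed)
  ultimately have "integral {0..1} (\<lambda>\<tau>. snd z * d1 g (fst z, \<tau> * snd z)) = f (fst z, 1 * snd z) - f (fst z, 0 * snd z)"
   by (simp only: integral_unique)
  then show ?thesis by (simp add: prim2_def)
 qed
 define \<phi> where "\<phi> z = P (fst z) + prim2 g z" for z
 have d: "(\<phi> has_derivative (\<lambda>v. fst v * f z + snd v * g z)) (at z)" for z
 proof -
  have "(\<phi> has_derivative (\<lambda>v. f (fst z, 0) * fst v + (fst v * prim2 (d1 g) z + snd v * g z))) (at z)"
   unfolding \<phi>_def[abs_def]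
   by (rule has_derivative_add[OF has_derivative_compose[OF has_derivative_fst[OF has_derivative_ident] P] prim2_has_derivative[OF g]])
  then show ?thesis by (simp add: prim algebra_simps)
 qed
 have "smooth \<phi>"
  by (rule smoothI_deriv[OF d]) (intro smooth_add smooth_cmult f g)
 moreover have "d1 \<phi> = f" "d2 \<phi> = g" using dir_deriv_eqI'[OF d] by simp_all
 ultimately show ?thesis by (rule that)
qed

lemma const_of_zero_grad:
 assumes "smooth (h :: plane => real)" "d1 h = (\<lambda>x. 0)" "d2 h = (\<lambda>x. 0)" shows "h x = h 0"
proof -
 have "(h has_derivative (\<lambda>v. 0)) (at x within UNIV)" for x
 proof -
  have "dir_deriv v h x = 0" for v using dir_deriv_pair[OF assms(1), of "fst v" "snd v" x] by (simp add: assms)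
  then show ?thesis using smooth_has_derivative[OF assms(1), of x] by simp
 qed
 from has_derivative_zero_constant[OF convex_UNIV this] show ?thesis by (metis UNIV_I)
qed

text \<open>The periods of a potential are constants; subtracting the corresponding linear function gives a periodic function, and integrating its gradient over the cell shows that the periods vanish.\<close>

lemma torus_potential:
 assumes f: "smooth_torus f" and g: "smooth_torus g" and closed: "d2 f = d1 g"
  and mean: "integral cell f = 0" "integral cell g = 0"
 obtains \<phi> where "smooth_torus \<phi>" "d1 \<phi> = f" "d2 \<phi> = g"
proof -
 obtain \<phi> where \<phi>: "smooth \<phi>" "d1 \<phi> = f" "d2 \<phi> = g" using smooth_potential[OF smooth_torusD(1)[OF f] smooth_torusD(1)[OF g] closed] .
 have shift: "\<phi> (z + w) - \<phi> z = \<phi> (0 + w) - \<phi> 0" if w: "!!z. f (z + w) = f z" "!!z. g (z + w) = g z" for z w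
 proof (rule const_of_zero_grad[of "\<lambda>z. \<phi> (z + w) - \<phi> z"])
  have s: "smooth (\<lambda>z. \<phi> (z + w))" using smooth_affine[OF \<phi>(1) bounded_linear_ident] by simp
  then show "smooth (\<lambda>z. \<phi> (z + w) - \<phi> z)" using \<phi>(1) by (rule smooth_diff)
  show "d1 (\<lambda>z. \<phi> (z + w) - \<phi> z) = (\<lambda>x. 0)" "d2 (\<lambda>z. \<phi> (z + w) - \<phi> z) = (\<lambda>x. 0)"
   by (simp_all add: dir_deriv_diff s \<phi> dir_deriv_shift w)
 qed
 have per: "f (z + (2 * pi, 0)) = f z" "g (z + (2 * pi, 0)) = g z" "f (z + (0, 2 * pi)) = f z" "g (z + (0, 2 * pi)) = g z" for z
  using smooth_torusD(2)[OF f, unfolded periodic2_def] smooth_torusD(2)[OF g, unfolded periodic2_def] by blast+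
 define K1 K2 where "K1 = (\<phi> (2 * pi, 0) - \<phi> 0) / (2 * pi)" and "K2 = (\<phi> (0, 2 * pi) - \<phi> 0) / (2 * pi)"
 have sh: "\<phi> (z + (2 * pi, 0)) = \<phi> z + K1 * (2 * pi)" "\<phi> (z + (0, 2 * pi)) = \<phi> z + K2 * (2 * pi)" for z
  using shift[of "(2 * pi, 0)" z] shift[of "(0, 2 * pi)" z] per by (simp_all add: K1_def K2_def)
 define \<gamma> where "\<gamma> z = \<phi> z - (K1 * fst z + K2 * snd z)" for z
 have bl: "bounded_linear (\<lambda>z :: plane. K1 * fst z + K2 * snd z)"
  by (intro bounded_linear_add bounded_linear_compose[OF bounded_linear_mult_right] bounded_linear_fst bounded_linear_snd)
 have sl: "smooth (\<lambda>z :: plane. K1 * fst z + K2 * snd z)" using smooth_linear[OF bl, of 0] by simp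
 have dl: "dir_deriv v (\<lambda>z :: plane. K1 * fst z + K2 * snd z) = (\<lambda>x. K1 * fst v + K2 * snd v)" for v
  by (rule dir_deriv_eqI'[OF bounded_linear_imp_has_derivative[OF bl]])
 have "periodic2 \<gamma>" unfolding periodic2_def \<gamma>_def sh by (simp add: algebra_simps)
 moreover have "smooth \<gamma>" unfolding \<gamma>_def[abs_def] by (rule smooth_diff[OF \<phi>(1) sl])
 ultimately have \<gamma>: "smooth_torus \<gamma>" by (simp add: smooth_torus_def)
 have dg: "d1 \<gamma> = (\<lambda>z. f z - K1)" "d2 \<gamma> = (\<lambda>z. g z - K2)"
  unfolding \<gamma>_def[abs_def] by (simp_all add: dir_deriv_diff \<phi> sl dl)
 have fi: "f integrable_on cell" "g integrable_on cell"
  unfolding cell_def by (intro integrable_continuous smooth_torus_cont f g)+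
 have ci: "(\<lambda>z :: plane. K :: real) integrable_on cell" for K unfolding cell_def by (rule integrable_const)
 have vol: "integral cell (\<lambda>z :: plane. K :: real) = 4 * pi^2 * K" for K
  unfolding cell_def by (simp add: content_Pair power2_eq_square)
 have "K1 = 0" "K2 = 0"
  using integral_dir_deriv_zero[OF \<gamma>] mean vol[of K1] vol[of K2]
  by (simp_all add: dg Henstock_Kurzweil_Integration.integral_diff[OF fi(1) ci] Henstock_Kurzweil_Integration.integral_diff[OF fi(2) ci])
 then have "\<gamma> = \<phi>" by (simp add: \<gamma>_def fun_eq_iff)
 then show ?thesis using that[of \<phi>] \<gamma> \<phi> by simp
qed

subsection \<open>Averages along periodic bicharacteristics\<close>

text \<open>The pairing of the translates \<open>Q(\<cdot> + t \<eta>)\<close> with the characters of frequency \<open>k\<close> does not depend on \<open>t\<close>, since these characters are constant along \<open>\<eta>\<close>. Its time average is the pairing with the averages.\<close>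

lemma fc_zero_of_averages:
 assumes Q: "smooth_torus Q" and avg: "!!x. integral {0..2 * pi} (\<lambda>t. Q (x + t *\<^sub>R \<eta>)) = 0" and k: "phase k \<eta> = 0"
 shows "fc Q k = 0"
proof -
 have "ip Q g = 0" if g: "smooth_torus g" "dir_deriv \<eta> g = (\<lambda>x. 0)" for g
 proof -
  obtain a b where \<eta>: "\<eta> = (a, b)" by (cases \<eta>)
  define w where "w t = (\<lambda>x. Q (x + t *\<^sub>R \<eta>))" for t :: real
  define w' where "w' t = (\<lambda>x. dir_deriv \<eta> Q (x + t *\<^sub>R \<eta>))" for t :: real
  have sw: "smooth_torus (w t)" for t unfolding w_def by (rule smooth_torus_shift[OF Q])
  have w'e: "w' t = dir_deriv \<eta> (w t)" for t unfolding w_def w'_def by (rule dir_deriv_shift[OF smooth_torusD(1)[OF Q], symmetric])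
  have sw': "smooth_torus (w' t)" for t unfolding w'e by (rule smooth_torus_dir_deriv[OF sw])
  have "((\<lambda>t. ft (w t)) has_vector_derivative ft (w' t)) (at t)" for t
  proof (rule differentiable_family_ft)
   show "((\<lambda>t. w t x) has_real_derivative w' t x) (at t)" for t x
    unfolding w_def w'_def by (rule smooth_along_line[OF smooth_torusD(1)[OF Q]])
   have "continuous_on UNIV (\<lambda>z. dir_deriv \<eta> Q (snd z + fst z *\<^sub>R \<eta>))"
    using continuous_on_compose2[OF smooth_torus_cont[OF smooth_torus_dir_deriv[OF Q], of UNIV \<eta>], of UNIV "\<lambda>z. snd z + fst z *\<^sub>R \<eta>"]
    by (simp add: continuous_intros)
   then show "continuous_on UNIV (\<lambda>z. w' (fst z) (snd z))" by (simp add: w'_def)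
  qed (use sw sw' smooth_torus_L2 in auto)
  from bounded_linear.has_vector_derivative[OF bounded_linear_inner_left this, of "ft g"]
  have "((\<lambda>t. ip (w t) g) has_real_derivative ip (w' t) g) (at t)" for t
   by (simp add: has_real_derivative_iff_has_vector_derivative Parseval smooth_torus_L2 sw sw' g)
  moreover have "ip (w' t) g = 0" for t
  proof -
   have "w' t = (\<lambda>x. a * d1 (w t) x + b * d2 (w t) x)"
    unfolding w'e \<eta> by (rule ext) (rule dir_deriv_pair[OF smooth_torusD(1)[OF sw]])
   then have "ip (w' t) g = a * ip (d1 (w t)) g + b * ip (d2 (w t)) g"
    by (simp add: ip_add_left ip_cmult_left L2_cmult smooth_torus_L2 smooth_torus_dir_deriv sw g)
   also have "\<dots> = - ip (w t) (\<lambda>x. a * d1 g x + b * d2 g x)"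
    by (simp add: ip_by_parts sw g ip_add_right ip_cmult_right L2_cmult smooth_torus_L2 smooth_torus_dir_deriv)
   also have "(\<lambda>x. a * d1 g x + b * d2 g x) = (\<lambda>x. 0)"
    using g(2) dir_deriv_pair[OF smooth_torusD(1)[OF g(1)], of a b] by (simp only: \<eta> fun_eq_iff) simp
   finally show ?thesis by (simp add: ip_def)
  qed
  ultimately have "\<forall>t. ((\<lambda>t. ip (w t) g) has_real_derivative 0) (at t)" by simp
  from DERIV_isconst_all[OF this] have const: "ip (w t) g = ip (w 0) g" for t by blast
  have "2 * pi * ip (w 0) g = integral {0..2 * pi} (\<lambda>t. ip (w t) g)"
  proof -
   have "(\<lambda>t. ip (w t) g) = (\<lambda>t. ip (w 0) g)" by (rule ext) (rule const)
   then show ?thesis by simp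
  qed
  also have "\<dots> = integral (cbox 0 (2 * pi)) (\<lambda>t. integral (cbox (0, 0) (2 * pi, 2 * pi)) (\<lambda>x. w t x * g x))"
   by (simp add: ip_smooth sw g cell_def)
  also have "\<dots> = integral (cbox (0, 0) (2 * pi, 2 * pi)) (\<lambda>x. integral (cbox 0 (2 * pi)) (\<lambda>t. w t x * g x))"
  proof (rule integral_swap_continuous)
   have "continuous_on A (\<lambda>z. Q (snd z + fst z *\<^sub>R \<eta>) * g (snd z))" for A
   proof -
    have c: "continuous_on A (\<lambda>z. snd z + fst z *\<^sub>R \<eta>)" "continuous_on A (snd :: real \<times> plane => plane)" by (intro continuous_intros)+
    show ?thesis
     by (rule continuous_on_mult[OF continuous_on_compose2[OF smooth_torus_cont[OF Q, of UNIV] c(1)]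
        continuous_on_compose2[OF smooth_torus_cont[OF g(1), of UNIV] c(2)]]) auto
   qed
   then show "continuous_on (cbox (0, 0, 0) (2 * pi, 2 * pi, 2 * pi)) (\<lambda>(t, x). w t x * g x)"
    by (simp add: w_def case_prod_beta')
  qed
  also have "\<dots> = 0" using avg by (simp add: w_def)
  finally show ?thesis by (simp add: w_def)
 qed
 from this[OF smooth_torus_cosk, of k] this[OF smooth_torus_sink, of k]
 show ?thesis by (simp add: fc_def dir_deriv_cosk dir_deriv_sink k complex_eq_iff)
qed

text \<open>With \<open>P = \<xi>\<^sub>1 \<xi>\<^sub>2\<close> the equations \<open>p'(\<xi>) = (a, b)\<close> read \<open>\<xi>\<^sub>2\<^sup>2 = a - 2P\<close>, \<open>\<xi>\<^sub>1\<^sup>2 = b - 2P\<close>, and consistency is the quadratic equation \<open>3P\<^sup>2 - 2(a + b)P + ab = 0\<close>. The smaller root makes both squares nonnegative; the larger root, with its sign changed, is the smaller root for the velocity \<open>(-a, -b)\<close>.\<close>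

lemma covector_with_velocity:
 fixes a b :: real
 assumes "(a, b) ~= 0"
 defines "P \<equiv> (a + b - sqrt (a^2 - a * b + b^2)) / 3"
 obtains \<xi> where "grad p \<xi> = (a, b)" "(fst \<xi>)^2 = b - 2 * P" "fst \<xi> * snd \<xi> = P" "(snd \<xi>)^2 = a - 2 * P"
proof -
 define D where "D = sqrt (a^2 - a * b + b^2)"
 have e: "a^2 - a * b + b^2 = ((a + b) / 2)^2 + 3 * ((a - b) / 2)^2" by (simp add: power2_eq_square field_simps)
 have D2: "D^2 = a^2 - a * b + b^2" unfolding D_def e by (intro real_sqrt_pow2 add_nonneg_nonneg) auto
 have D0: "D >= 0" unfolding D_def by (auto simp: e intro!: real_sqrt_ge_zero)
 have "\<bar>(a + b) / 2\<bar> <= D" unfolding D_def e by (rule real_le_rsqrt) (simp add: power_divide)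
 then have S: "(b - 2 * P) + (a - 2 * P) >= 0" using D0 unfolding P_def D_def[symmetric] by (simp add: field_simps abs_le_iff)
 have PP: "(b - 2 * P) * (a - 2 * P) = P^2"
  using D2 unfolding P_def D_def[symmetric] by (simp add: power2_eq_square field_simps)
 have XY: "b - 2 * P >= 0" "a - 2 * P >= 0"
 proof -
  have "0 <= (b - 2 * P) * (a - 2 * P)" unfolding PP by simp
  then show "b - 2 * P >= 0" "a - 2 * P >= 0" using S unfolding zero_le_mult_iff by linarith+
 qed
 define \<xi> where "\<xi> = (sqrt (b - 2 * P), (if P < 0 then -1 else 1) * sqrt (a - 2 * P))"
 have m: "sqrt (b - 2 * P) * sqrt (a - 2 * P) = \<bar>P\<bar>" by (simp add: real_sqrt_mult[symmetric] PP)
 have 1: "(fst \<xi>)^2 = b - 2 * P" "(snd \<xi>)^2 = a - 2 * P" using XY by (auto simp: \<xi>_def)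
 have 2: "fst \<xi> * snd \<xi> = P" using m by (auto simp: \<xi>_def)
 have "grad p \<xi> = (2 * (fst \<xi> * snd \<xi>) + (snd \<xi>)^2, 2 * (fst \<xi> * snd \<xi>) + (fst \<xi>)^2)"
  by (simp add: grad_p power2_eq_square algebra_simps)
 then have "grad p \<xi> = (a, b)" unfolding 1 2 by simp
 then show ?thesis using 1 2 that by blast
qed

context
 fixes a1 a0 am1 :: "plane => real"
 assumes sm: "smooth_torus a1" "smooth_torus a0" "smooth_torus am1"
begin

text \<open>The velocities \<open>(m, n)\<close> and \<open>(-m, -n)\<close> use the two roots of the quadratic equation, which differ by a multiple of the positive number \<open>D\<close>; this separates the two linear conditions.\<close>

lemma averages_imp_fc:
 assumes II: "\<forall>x. \<forall>\<xi>\<in>Lambda. integral {0..2 * pi} (\<lambda>t. a1 (x + t *\<^sub>R grad p \<xi>) * (fst \<xi>)^2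
       + 2 * a0 (x + t *\<^sub>R grad p \<xi>) * fst \<xi> * snd \<xi> + am1 (x + t *\<^sub>R grad p \<xi>) * (snd \<xi>)^2) = 0"
  and m: "(m, n) ~= (0 :: freq)" and k: "fst k * m + snd k * n = 0"
 shows "fc a0 k = fc a1 k + fc am1 k" "of_int n * fc a1 k + of_int m * fc am1 k = 0"
proof -
 define D where "D = sqrt ((of_int m)^2 - of_int m * of_int n + (of_int n)^2)"
 define B where "B = fc a0 k - fc a1 k - fc am1 k"
 have key: "s * (of_int n * fc a1 k + of_int m * fc am1 k) + 2 * of_real ((s * (of_int m + of_int n) - D) / 3) * B = 0"
  if s: "s = 1 \<or> s = -1" for s :: real
 proof -
  define a b where "a = s * of_int m" and "b = s * of_int n"
  define P where "P = (a + b - sqrt (a^2 - a * b + b^2)) / 3"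
  have ab: "(a, b) ~= 0" using s m by (auto simp: a_def b_def zero_prod_def)
  have Pe: "P = (s * (of_int m + of_int n) - D) / 3" using s by (auto simp: P_def a_def b_def D_def distrib_left)
  obtain \<xi> where \<xi>: "grad p \<xi> = (a, b)" "(fst \<xi>)^2 = b - 2 * P" "fst \<xi> * snd \<xi> = P" "(snd \<xi>)^2 = a - 2 * P"
   using covector_with_velocity[OF ab] unfolding P_def by blast
  have "\<xi> \<in> Lambda" using s by (auto simp: Lambda_def \<xi>(1) a_def b_def)
  define Q where "Q x = (b - 2 * P) * a1 x + (2 * P * a0 x + (a - 2 * P) * am1 x)" for x
  have "fc Q k = 0"
  proof (rule fc_zero_of_averages[where \<eta> = "(a, b)"])
   show "smooth_torus Q" unfolding Q_def[abs_def] by (intro smooth_torus_add smooth_torus_cmult sm)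
   show "phase k (a, b) = 0"
   proof -
    have "of_int (fst k) * of_int m + of_int (snd k) * of_int n = (0 :: real)" using k by (metis of_int_0 of_int_add of_int_mult)
    then show ?thesis using s by (auto simp: phase_def a_def b_def algebra_simps)
   qed
   fix x
   have "integral {0..2 * pi} (\<lambda>t. a1 (x + t *\<^sub>R grad p \<xi>) * (fst \<xi>)^2
       + 2 * a0 (x + t *\<^sub>R grad p \<xi>) * fst \<xi> * snd \<xi> + am1 (x + t *\<^sub>R grad p \<xi>) * (snd \<xi>)^2) = 0" using II \<open>\<xi> \<in> Lambda\<close> by blast
   then show "integral {0..2 * pi} (\<lambda>t. Q (x + t *\<^sub>R (a, b))) = 0"
    unfolding mult.assoc \<xi> by (simp add: Q_def mult_ac add_ac)
  qed
  moreover have "fc Q k = of_real (b - 2 * P) * fc a1 k + (of_real (2 * P) * fc a0 k + of_real (a - 2 * P) * fc am1 k)"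
   unfolding Q_def[abs_def] by (simp only: fc_add fc_cmult L2_cmult L2_add smooth_torus_L2 sm)
  ultimately show ?thesis unfolding Pe[symmetric] by (simp add: a_def b_def B_def algebra_simps)
 qed
 have D: "D > 0"
 proof -
  have "(of_int m)^2 - of_int m * of_int n + (of_int n)^2 = ((of_int m + of_int n) / 2)^2 + 3 * ((of_int m - of_int n) / 2 :: real)^2"
   by (simp add: power2_eq_square field_simps)
  moreover have "of_int m + of_int n ~= (0::real) \<or> of_int m - of_int n ~= (0::real)" using m by (auto simp: zero_prod_def)
  ultimately show ?thesis unfolding D_def by (auto intro: add_pos_nonneg add_nonneg_pos)
 qed
 have "complex_of_real (- (4 * D / 3)) * B = (of_real 1 * (of_int n * fc a1 k + of_int m * fc am1 k) + 2 * of_real ((1 * (of_int m + of_int n) - D) / 3) * B)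
   + (of_real (- 1) * (of_int n * fc a1 k + of_int m * fc am1 k) + 2 * of_real ((- 1 * (of_int m + of_int n) - D) / 3) * B)"
  by (simp add: field_simps)
 also have "\<dots> = 0" unfolding key[OF disjI1[OF refl]] key[OF disjI2[OF refl]] by simp
 finally have "complex_of_real (- (4 * D / 3)) * B = 0" .
 then have B: "B = 0" using D by simp
 then show "fc a0 k = fc a1 k + fc am1 k" by (simp add: B_def algebra_simps)
 show "of_int n * fc a1 k + of_int m * fc am1 k = 0" using key[of 1] B by simp
qed

lemma averages_imp_gradient:
 assumes II: "\<forall>x. \<forall>\<xi>\<in>Lambda. integral {0..2 * pi} (\<lambda>t. a1 (x + t *\<^sub>R grad p \<xi>) * (fst \<xi>)^2
       + 2 * a0 (x + t *\<^sub>R grad p \<xi>) * fst \<xi> * snd \<xi> + am1 (x + t *\<^sub>R grad p \<xi>) * (snd \<xi>)^2) = 0"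
 shows "(\<forall>x. a0 x = a1 x + am1 x) \<and> (\<exists>\<phi>. smooth_torus \<phi> \<and> (\<forall>x. grad \<phi> x = (am1 x, a1 x)))"
proof -
 note fcs = averages_imp_fc[OF II]
 have ann: "\<exists>m n. (m, n) ~= (0 :: freq) \<and> fst k * m + snd k * n = 0 \<and> (k ~= 0 --> m = - snd k \<and> n = fst k)" for k
 proof (cases "k = 0")
  case True then show ?thesis by (intro exI[of _ 1] exI[of _ 0]) (simp add: zero_prod_def)
 next
  case False
  then have "(- snd k, fst k) ~= (0 :: freq) \<and> fst k * (- snd k) + snd k * fst k = 0" by (auto simp: zero_prod_def prod_eq_iff)
  then show ?thesis by blast
 qed
 have "fc a0 k = fc (\<lambda>x. a1 x + am1 x) k" for k
  using ann[of k] fcs(1)[of _ _ k] by (auto simp: fc_add smooth_torus_L2 sm)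
 then have e: "a0 = (\<lambda>x. a1 x + am1 x)" by (intro fc_eq_imp_eq sm smooth_torus_add)
 have ph: "phase k (1, 0) = of_int (fst k)" "phase k (0, 1) = of_int (snd k)" for k by (simp_all add: phase_def)
 have "fc (d2 am1) k = fc (d1 a1) k" for k
 proof (cases "k = 0")
  case False
  then have "of_int (fst k) * fc a1 k + of_int (- snd k) * fc am1 k = 0"
   by (intro fcs(2)) (auto simp: zero_prod_def prod_eq_iff)
  then show ?thesis by (simp add: fc_dir_deriv sm ph)
 qed (simp add: fc_dir_deriv sm ph)
 then have closed: "d2 am1 = d1 a1" by (intro fc_eq_imp_eq sm smooth_torus_dir_deriv)
 have z: "fc am1 0 = 0" "fc a1 0 = 0"
  using fcs(2)[of 1 0 0] fcs(2)[of 0 1 0] by (simp_all add: zero_prod_def)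
 have "cosk 0 = (\<lambda>x. 1)" by (simp add: cosk_def phase_def fun_eq_iff)
 then have mean: "integral cell g = 0" if "smooth_torus g" "fc g 0 = 0" for g
  using that ip_smooth[OF that(1) smooth_torus_const[of 1]] by (simp add: fc_def complex_eq_iff)
 obtain \<phi> where "smooth_torus \<phi>" "d1 \<phi> = am1" "d2 \<phi> = a1"
  using torus_potential[OF sm(3,1) closed mean[OF sm(3) z(1)] mean[OF sm(1) z(2)]] .
 then show ?thesis using e by (auto simp: grad_def)
qed

end

section \<open>Growth of solutions of the well-posed problem\<close>

subsection \<open>Well-posedness bounds the homogeneous flow\<close>

lemma zero_L1loc: "(\<lambda>t x. 0) \<in> L1loc_L2"
proof -
 have z: "(\<lambda>x. 0) \<in> L2" by (rule smooth_torus_L2[OF smooth_torus_const])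
 have "strongly_measurable_L2 (\<lambda>t x. 0)"
  unfolding strongly_measurable_L2_def using z by (intro exI[of _ "\<lambda>n t x. 0"]) (auto simp: L2_norm_def)
 then show ?thesis using z by (auto simp: L1loc_L2_def L2_norm_def set_integrable_def)
qed

lemma norm_hpart_le: "norm (hpart x) <= norm x"
 using norm_triangle_ineq[of x "reflect x"] by (simp add: hpart_def norm_reflect)

lemma hpart_linear: "linear hpart" by (rule bounded_linear.linear[OF hpart_bounded_linear])

context coefficients
begin

text \<open>Homogeneous solutions in terms of coefficients. Real-valuedness is kept as a condition, so that the space is closed under linear combinations and locally uniform limits.\<close>

definition hsol :: "(real => l2) => bool" where
 "hsol v \<longleftrightarrow> continuous_on UNIV v \<and> (\<forall>t. hpart (v t) = v t) \<and>
   (\<forall>\<psi>\<in>test_fun. (LINT t|lebesgue. v t \<bullet> ft (slice (Theta \<psi>) t)) = 0)"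

lemma pairing_integrable: assumes "continuous_on UNIV v" "X \<in> test_fun"
 shows "integrable lebesgue (\<lambda>t. v t \<bullet> ft (slice X t))"
 by (rule slice_pairing(2)[OF loc_int_continuous[OF assms(1)] assms(2)])

lemma hsol_zero: "hsol (\<lambda>t. 0)"
 by (auto simp: hsol_def linear_0[OF hpart_linear])

lemma hsol_add: assumes "hsol v" "hsol w" shows "hsol (\<lambda>t. v t + w t)"
 using assms by (auto simp: hsol_def inner_add_left linear_add[OF hpart_linear] Theta_test_fun pairing_integrable intro!: continuous_intros)

lemma hsol_scale: assumes "hsol v" shows "hsol (\<lambda>t. r *\<^sub>R v t)"
 using assms by (auto simp: hsol_def linear_cmul[OF hpart_linear] intro!: continuous_intros)

lemma hsol_sum: "(!!i. i < n ==> hsol (f i)) ==> hsol (\<lambda>t. \<Sum>i<n. f i t)" for n :: nat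
 by (induction n) (auto intro: hsol_zero hsol_add)

lemma hsol_limit:
 assumes s: "!!n :: nat. hsol (s n)" and u: "!!R. uniform_limit {-R..R} s z sequentially"
 shows "hsol z"
 unfolding hsol_def
proof (intro conjI allI ballI)
 have cs: "continuous_on UNIV (s n)" for n using s by (simp add: hsol_def)
 have cR: "continuous_on {-R..R} z" for R
  by (rule uniform_limit_theorem[OF always_eventually u]) (auto intro: continuous_on_subset[OF cs])
 show cz: "continuous_on UNIV z"
 proof (rule continuous_at_imp_continuous_on, intro ballI)
  fix t :: real
  show "isCont z t"
   by (rule continuous_on_interior[OF cR[of "\<bar>t\<bar> + 1"]]) auto
 qed
 have pt: "(\<lambda>n. s n t) \<longlonglongrightarrow> z t" for t
  by (rule tendsto_uniform_limitI[OF u[of "\<bar>t\<bar>"]]) auto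
 have "(\<lambda>n. hpart (s n t)) \<longlonglongrightarrow> hpart (z t)" for t by (rule bounded_linear.tendsto[OF hpart_bounded_linear pt])
 then show "hpart (z t) = z t" for t using s pt LIMSEQ_unique by (fastforce simp: hsol_def)
 fix \<psi> assume \<psi>: "\<psi> \<in> test_fun"
 define W where "W t = ft (slice (Theta \<psi>) t)" for t
 have T: "Theta \<psi> \<in> test_fun" by (rule Theta_test_fun[OF \<psi>])
 obtain R where R: "!!t. t \<notin> {-R..R} ==> W t = 0" unfolding W_def using slice_support[OF T] by metis
 have cW: "continuous_on UNIV W" unfolding W_def[abs_def] by (rule slice_ft_continuous[OF T])
 have iW: "integrable lebesgue (\<lambda>t. norm (W t))"
  by (rule LINT_compact_support(1)[of _ "-R" R]) (auto intro!: continuous_intros cW simp: R)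
 define J where "J = (LINT t|lebesgue. norm (W t))"
 have J0: "0 <= J" by (simp add: J_def)
 have iz: "integrable lebesgue (\<lambda>t. z t \<bullet> W t)" unfolding W_def by (rule pairing_integrable[OF cz T])
 have "\<bar>LINT t|lebesgue. z t \<bullet> W t\<bar> <= e * J" if e: "e > 0" for e
 proof -
  obtain n where n: "!!t. t \<in> {-R..R} ==> dist (s n t) (z t) < e"
   using uniform_limitD[OF u e] unfolding eventually_sequentially by blast
  have isn: "integrable lebesgue (\<lambda>t. s n t \<bullet> W t)" unfolding W_def by (rule pairing_integrable[OF cs T])
  have "(LINT t|lebesgue. s n t \<bullet> W t) = 0" using s[of n] \<psi> by (simp add: hsol_def W_def)
  then have "(LINT t|lebesgue. z t \<bullet> W t) = (LINT t|lebesgue. z t \<bullet> W t - s n t \<bullet> W t)"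
   using Bochner_Integration.integral_diff[OF iz isn] by simp
  also have "\<bar>\<dots>\<bar> <= (LINT t|lebesgue. \<bar>z t \<bullet> W t - s n t \<bullet> W t\<bar>)" by (rule integral_abs_bound)
  also have "\<dots> <= (LINT t|lebesgue. e * norm (W t))"
  proof (rule integral_mono)
   show "\<bar>z t \<bullet> W t - s n t \<bullet> W t\<bar> <= e * norm (W t)" for t
   proof (cases "t \<in> {-R..R}")
    case True
    have "\<bar>(z t - s n t) \<bullet> W t\<bar> <= norm (z t - s n t) * norm (W t)" by (rule Cauchy_Schwarz_ineq2)
    also have "\<dots> <= e * norm (W t)" using n[OF True] by (intro mult_right_mono) (simp_all add: dist_norm norm_minus_commute)
    finally show ?thesis by (simp add: inner_diff_left)
   qed (simp add: R)
  qed (use iz isn iW in auto)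
  also have "\<dots> = e * J" by (simp add: J_def)
  finally show ?thesis .
 qed
 note est = this
 have "\<bar>LINT t|lebesgue. z t \<bullet> W t\<bar> <= 0 + x" if x: "x > 0" for x
 proof -
  have "\<bar>LINT t|lebesgue. z t \<bullet> W t\<bar> <= x / (J + 1) * J" using J0 x by (intro est divide_pos_pos) auto
  also have "\<dots> <= x" using J0 x by (simp add: field_simps)
  finally show ?thesis by simp
 qed
 then have "\<bar>LINT t|lebesgue. z t \<bullet> W t\<bar> <= 0" by (rule field_le_epsilon)
 then show "(LINT t|lebesgue. z t \<bullet> ft (slice (Theta \<psi>) t)) = 0" by (simp add: W_def)
qed

lemma hsol_realize: assumes v: "hsol v"
 shows "(\<lambda>t. realize (v t)) \<in> C_L2" "!!\<psi>. \<psi> \<in> test_fun ==> L_op a1 a0 am1 b1 b2 c (dist_of (\<lambda>t. realize (v t))) \<psi> = 0"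
  "ft (realize (v t)) = v t"
proof -
 show f: "ft (realize (v t)) = v t" for t using v by (simp add: realize(2) hsol_def)
 show C: "(\<lambda>t. realize (v t)) \<in> C_L2" using v by (simp add: C_L2_iff realize(1) f hsol_def)
 fix \<psi> assume \<psi>: "\<psi> \<in> test_fun"
 have "dist_of (\<lambda>t. realize (v t)) (Theta \<psi>) = (LINT t|lebesgue. v t \<bullet> ft (slice (Theta \<psi>) t))"
  unfolding dist_of_slice by (simp add: Parseval realize(1) slice_L2[OF Theta_test_fun[OF \<psi>]] f)
 then show "L_op a1 a0 am1 b1 b2 c (dist_of (\<lambda>t. realize (v t))) \<psi> = 0"
  using v \<psi> L_op_Theta[OF C \<psi>] by (simp add: hsol_def)
qed

lemma hsol_weak_deriv: assumes v: "hsol v" and \<phi>: "smooth_torus \<phi>"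
 shows "((\<lambda>t. v t \<bullet> ft \<phi>) has_real_derivative - (v t \<bullet> ft (A \<phi>))) (at t)"
 using homogeneous_weak_deriv[OF hsol_realize(1,2)[OF v] \<phi>, of t]
 by (simp add: Parseval realize(1) smooth_torus_L2 \<phi> smooth_torus_adj hsol_realize(3)[OF v])

context
 assumes wp: "L2_well_posed (L_op a1 a0 am1 b1 b2 c)"
begin

lemma hsol_exists: obtains v where "hsol v" "v 0 = hpart x"
proof -
 have "\<exists>u. is_solution (L_op a1 a0 am1 b1 b2 c) (\<lambda>t x. 0) (realize x) u"
  using wp realize(1) zero_L1loc unfolding L2_well_posed_def by blast
 then obtain u where u: "is_solution (L_op a1 a0 am1 b1 b2 c) (\<lambda>t x. 0) (realize x) u" ..
 then have C: "u \<in> C_L2" by (simp add: is_solution_def)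
 then have L: "u t \<in> L2" for t by (simp add: C_L2_iff)
 have "(LINT t|lebesgue. ft (u t) \<bullet> ft (slice (Theta \<psi>) t)) = 0" if \<psi>: "\<psi> \<in> test_fun" for \<psi>
 proof -
  have "dist_of u (Theta \<psi>) = (LINT t|lebesgue. ft (u t) \<bullet> ft (slice (Theta \<psi>) t))"
   unfolding dist_of_slice by (simp add: Parseval L slice_L2[OF Theta_test_fun[OF \<psi>]])
  moreover have "dist_of (\<lambda>t x. 0) \<psi> = 0" by (simp add: dist_of_def)
  ultimately show ?thesis using u \<psi> L_op_Theta[OF C \<psi>] by (simp add: is_solution_def)
 qed
 then have "hsol (\<lambda>t. ft (u t))" using C by (simp add: hsol_def C_L2_iff hpart_ft)
 moreover have "ft (u 0) = hpart x"
  using L2_eq_imp_ft_eq[OF L realize(1)] u by (simp add: is_solution_def realize(2))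
 ultimately show ?thesis by (rule that)
qed

lemma hsol_unique: assumes v: "hsol v" "hsol w" "v 0 = w 0" shows "v t = w t"
proof -
 have z: "dist_of (\<lambda>t x. 0) \<psi> = 0" for \<psi> by (simp add: dist_of_def)
 have "is_solution (L_op a1 a0 am1 b1 b2 c) (\<lambda>t x. 0) (realize (v 0)) (\<lambda>t. realize (v t))"
  "is_solution (L_op a1 a0 am1 b1 b2 c) (\<lambda>t x. 0) (realize (v 0)) (\<lambda>t. realize (w t))"
  using v hsol_realize(1,2) by (auto simp: is_solution_def z L2_eq_def)
 then have "L2_eq (realize (v t)) (realize (w t))"
  using wp realize(1) zero_L1loc unfolding L2_well_posed_def by blast
 from L2_eq_imp_ft_eq[OF realize(1) realize(1) this] show ?thesis
  using v by (simp add: hsol_realize(3))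
qed

text \<open>Baire category: the data whose solutions are bounded by \<open>n\<close> on \<open>[-m, m]\<close> exhaust the space, so their closure has interior for some \<open>n\<close>; taking differences recenters the ball at the origin.\<close>

lemma hsol_almost_open:
 assumes e: "e > (0::real)"
 obtains d where "d > 0" "!!x \<eta>. norm x < d ==> hpart x = x ==> \<eta> > 0 ==>
  \<exists>v. hsol v \<and> (\<forall>t. \<bar>t\<bar> <= m --> norm (v t) <= e) \<and> norm (x - v 0) < \<eta>"
proof -
 define V where "V n = {x. \<exists>v. hsol v \<and> v 0 = hpart x \<and> (\<forall>t. \<bar>t\<bar> <= m --> norm (v t) <= real n)}" for n
 have un: "(\<Union>n. closure (V n)) = UNIV"
 proof (rule sym, intro UNIV_eq_I)
  fix x
  obtain v where v: "hsol v" "v 0 = hpart x" using hsol_exists .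
  have "compact (v ` {-m..m})" using v(1) by (intro compact_continuous_image) (auto simp: hsol_def intro: continuous_on_subset)
  then obtain K where K: "\<forall>y\<in>v ` {-m..m}. norm y <= K" using compact_imp_bounded bounded_iff by metis
  obtain n where n: "K <= real n" using real_arch_simple by blast
  have "norm (v t) <= real n" if "\<bar>t\<bar> <= m" for t
  proof -
   have "t \<in> {-m..m}" using that by auto
   from bspec[OF K imageI[OF this]] show ?thesis using n by linarith
  qed
  then have "x \<in> V n" using v by (auto simp: V_def)
  then show "x \<in> (\<Union>n. closure (V n))" using closure_subset by blast
 qed
 have "\<exists>n. interior (closure (V n)) ~= {}"
 proof (rule ccontr)
  assume "\<not> (\<exists>n. interior (closure (V n)) ~= {})"
  then have I: "interior (closure (V n)) = {}" for n by blast
  have "euclidean interior_of (\<Union>(range (\<lambda>n. closure (V n)))) = {}"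
  proof (rule Baire_category_alt)
   show "completely_metrizable_space (euclidean :: l2 topology) \<or> locally_compact_space (euclidean :: l2 topology) \<and> regular_space (euclidean :: l2 topology)"
    by (rule disjI1) (rule completely_metrizable_space_euclidean)
  qed (use I in auto)
  then show False using un by simp
 qed
 then obtain n x0 r where r: "r > 0" "ball x0 r \<subseteq> closure (V n)"
  unfolding ex_in_conv[symmetric] mem_interior by blast
 define d where "d = r * e / (real n + 1)"
 have d: "d > 0" using r(1) e by (simp add: d_def)
 have "\<exists>v. hsol v \<and> (\<forall>t. \<bar>t\<bar> <= m --> norm (v t) <= e) \<and> norm (x - v 0) < \<eta>" if x: "norm x < d" "hpart x = x" and \<eta>: "\<eta> > 0" for x \<eta>
 proof -
  define s where "s = e / (real n + 1)"
  have s: "s > 0" using e by (simp add: s_def)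
  define y where "y = (1 / s) *\<^sub>R x"
  have yr: "norm y < r" using x(1) s unfolding y_def d_def s_def[symmetric]
   by (simp add: field_simps s_def)
  have "x0 + y \<in> closure (V n)" "x0 - y \<in> closure (V n)" using r(2) yr by (auto simp: dist_norm subset_iff)
  then obtain a b where ab: "a \<in> V n" "dist a (x0 + y) < \<eta> / s" "b \<in> V n" "dist b (x0 - y) < \<eta> / s"
   using \<eta> s unfolding closure_approachable by (metis divide_pos_pos)
  obtain va vb where va: "hsol va" "va 0 = hpart a" "!!t. \<bar>t\<bar> <= m ==> norm (va t) <= real n"
   and vb: "hsol vb" "vb 0 = hpart b" "!!t. \<bar>t\<bar> <= m ==> norm (vb t) <= real n"
   using ab unfolding V_def by blast
  define v where "v t = (s / 2) *\<^sub>R (va t + (- 1) *\<^sub>R vb t)" for t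
  have "hsol v" unfolding v_def[abs_def] by (intro hsol_scale hsol_add va vb)
  moreover have "norm (v t) <= e" if t: "\<bar>t\<bar> <= m" for t
  proof -
   have "norm (v t) <= s / 2 * (norm (va t) + norm (vb t))" unfolding v_def using s norm_triangle_ineq4[of "va t" "vb t"] by (simp add: mult_left_mono)
   also have "\<dots> <= s / 2 * (real n + real n)" using s va(3)[OF t] vb(3)[OF t] by (intro mult_left_mono add_mono) auto
   also have "\<dots> <= e" using e by (simp add: s_def field_simps)
   finally show ?thesis .
  qed
  moreover have "norm (x - v 0) < \<eta>"
  proof -
   have "x = hpart ((s / 2) *\<^sub>R ((x0 + y) - (x0 - y)))" using s by (simp add: y_def x(2) scaleR_2[symmetric])
   then have "x - v 0 = hpart ((s / 2) *\<^sub>R (((x0 + y) - a) - ((x0 - y) - b)))"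
    unfolding v_def va(2) vb(2) by (simp add: linear_diff[OF hpart_linear] linear_cmul[OF hpart_linear] linear_add[OF hpart_linear] algebra_simps)
   then have "norm (x - v 0) <= norm ((s / 2) *\<^sub>R (((x0 + y) - a) - ((x0 - y) - b)))" using norm_hpart_le by metis
   also have "\<dots> <= s / 2 * (norm ((x0 + y) - a) + norm ((x0 - y) - b))"
    using s norm_triangle_ineq4[of "(x0 + y) - a" "(x0 - y) - b"] by (simp add: mult_left_mono)
   also have "\<dots> < s / 2 * (\<eta> / s + \<eta> / s)" using ab s by (intro mult_strict_left_mono add_strict_mono) (simp_all add: dist_norm norm_minus_commute)
   also have "\<dots> = \<eta>" using s by simp
   finally show ?thesis .
  qed
  ultimately show ?thesis by blast
 qed
 with d show ?thesis by (rule that)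
qed

text \<open>As in the open mapping theorem, successive approximation writes small data as a series of initial values of solutions. The solutions are controlled on growing time intervals, so that the series converges to a solution on the whole line, which is the only kind to which uniqueness applies.\<close>

lemma hsol_bound: obtains C where "C > 0" "!!v t. hsol v ==> \<bar>t\<bar> <= 1 ==> norm (v t) <= C * norm (v 0)"
proof -
 have "\<forall>j::nat. \<exists>d>0. \<forall>x \<eta>. norm x < d --> hpart x = x --> \<eta> > 0 -->
  (\<exists>v. hsol v \<and> (\<forall>t. \<bar>t\<bar> <= real j + 1 --> norm (v t) <= (1/2) ^ j) \<and> norm (x - v 0) < \<eta>)"
 proof
  fix j :: nat
  have "(0::real) < (1/2) ^ j" by simp
  then obtain d where "d > 0" "!!x \<eta>. norm x < d ==> hpart x = x ==> \<eta> > 0 ==>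
   \<exists>v. hsol v \<and> (\<forall>t. \<bar>t\<bar> <= real j + 1 --> norm (v t) <= (1/2) ^ j) \<and> norm (x - v 0) < \<eta>" by (rule hsol_almost_open[where m = "real j + 1"]) blast
  then show "\<exists>d>0. \<forall>x \<eta>. norm x < d --> hpart x = x --> \<eta> > 0 -->
   (\<exists>v. hsol v \<and> (\<forall>t. \<bar>t\<bar> <= real j + 1 --> norm (v t) <= (1/2) ^ j) \<and> norm (x - v 0) < \<eta>)" by blast
 qed
 then obtain d0 where d0: "!!j. d0 j > 0" "!!j x \<eta>. norm x < d0 j ==> hpart x = x ==> \<eta> > 0 ==>
  \<exists>v. hsol v \<and> (\<forall>t. \<bar>t\<bar> <= real j + 1 --> norm (v t) <= (1/2) ^ j) \<and> norm (x - v 0) < \<eta>" by metis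
 define d where "d j = min (d0 j) ((1/2) ^ j)" for j
 have dp: "d j > 0" "d j <= d0 j" "d j <= (1/2) ^ j" for j using d0(1)[of j] by (auto simp: d_def)
 \<comment> \<open>One step of the approximation; \<open>d (Suc j)\<close> is the tolerance that the next step accepts.\<close>
 define nxt where "nxt j x = (SOME v. hsol v \<and> (\<forall>t. \<bar>t\<bar> <= real j + 1 --> norm (v t) <= (1/2) ^ j) \<and> norm (x - v 0) < d (Suc j))" for j x
 have nxt: "hsol (nxt j x)" "!!t. \<bar>t\<bar> <= real j + 1 ==> norm (nxt j x t) <= (1/2) ^ j" "norm (x - nxt j x 0) < d (Suc j)"
  if "norm x < d j" "hpart x = x" for j x
 proof -
  have "\<exists>v. hsol v \<and> (\<forall>t. \<bar>t\<bar> <= real j + 1 --> norm (v t) <= (1/2) ^ j) \<and> norm (x - v 0) < d (Suc j)"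
   using that dp[of j] dp[of "Suc j"] by (intro d0(2)) auto
  from someI_ex[OF this] show "hsol (nxt j x)" "!!t. \<bar>t\<bar> <= real j + 1 ==> norm (nxt j x t) <= (1/2) ^ j" "norm (x - nxt j x 0) < d (Suc j)"
   by (auto simp: nxt_def)
 qed
 have small: "norm (v t) <= 2" if v: "hsol v" "norm (v 0) < d 0" and t: "\<bar>t\<bar> <= 1" for v t
 proof -
  define res where "res = rec_nat (v 0) (\<lambda>j x. x - nxt j x 0)"
  have res: "res 0 = v 0" "res (Suc j) = res j - nxt j (res j) 0" for j by (simp_all add: res_def)
  have inv: "norm (res j) < d j \<and> hpart (res j) = res j" for j
  proof (induction j)
   case 0 show ?case using v by (simp add: res hsol_def)
  next
   case (Suc j)
   then have "hpart (nxt j (res j) 0) = nxt j (res j) 0" using nxt(1) by (simp add: hsol_def)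
   then show ?case using Suc nxt(3)[of "res j" j] by (simp add: res linear_diff[OF hpart_linear])
  qed
  define f where "f j = nxt j (res j)" for j
  have f: "hsol (f j)" "!!t. \<bar>t\<bar> <= real j + 1 ==> norm (f j t) <= (1/2) ^ j" for j
   using nxt(1,2)[of "res j" j] inv[of j] by (auto simp: f_def)
  define z where "z t = (\<Sum>j. f j t)" for t
  have sm: "summable (\<lambda>j. (1/2::real) ^ j)" by (rule summable_geometric) simp
  have ul: "uniform_limit {-R..R} (\<lambda>n t. \<Sum>j<n. f j t) z sequentially" for R
   unfolding z_def[abs_def]
  proof (rule Weierstrass_m_test_ev[OF _ sm])
   obtain J where J: "R <= real J" using real_arch_simple by blast
   show "\<forall>\<^sub>F n in sequentially. \<forall>t\<in>{-R..R}. norm (f n t) <= (1/2) ^ n"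
    unfolding eventually_sequentially
   proof (intro exI[of _ J] allI impI ballI)
    fix n t assume "J <= n" "t \<in> {-R..R}"
    then have "\<bar>t\<bar> <= real n + 1" using J by (auto simp: abs_le_iff)
    then show "norm (f n t) <= (1/2) ^ n" by (rule f(2))
   qed
  qed
  have hz: "hsol z" by (rule hsol_limit[OF hsol_sum ul]) (rule f(1))
  have "(\<Sum>j<n. f j 0) = v 0 - res n" for n by (induction n) (simp_all add: res f_def)
  moreover have "(\<lambda>n. \<Sum>j<n. f j 0) \<longlonglongrightarrow> z 0" by (rule tendsto_uniform_limitI[OF ul[of 0]]) simp
  moreover have "res \<longlonglongrightarrow> 0"
  proof (rule Lim_null_comparison)
   show "\<forall>\<^sub>F n in sequentially. norm (res n) <= (1/2) ^ n"
    using inv dp(3) by (intro always_eventually allI) (meson less_imp_le order_trans)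
   show "(\<lambda>n. (1/2::real) ^ n) \<longlonglongrightarrow> 0" by (rule LIMSEQ_power_zero) simp
  qed
  then have "(\<lambda>n. v 0 - res n) \<longlonglongrightarrow> v 0 - 0" by (intro tendsto_intros)
  ultimately have "z 0 = v 0" using LIMSEQ_unique by fastforce
  then have "v t = z t" using hsol_unique[OF v(1) hz] by simp
  also have "norm (z t) <= (\<Sum>j. (1/2) ^ j)"
   unfolding z_def using f(2) t by (intro norm_suminf_le sm) (metis add_increasing of_nat_0_le_iff order_trans)
  also have "\<dots> = 2" by (subst suminf_geometric) auto
  finally show ?thesis .
 qed
 show ?thesis
 proof (rule that[of "4 / d 0"])
  show "4 / d 0 > 0" using dp by simp
  fix v t assume v: "hsol v" and t: "\<bar>t\<bar> <= (1::real)"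
  show "norm (v t) <= 4 / d 0 * norm (v 0)"
  proof (cases "v 0 = 0")
   case True
   then have "v t = 0" using hsol_unique[OF v hsol_zero] by simp
   then show ?thesis by (simp add: True)
  next
   case False
   define r where "r = d 0 / (2 * norm (v 0))"
   have r: "r > 0" using dp False by (simp add: r_def)
   have "norm (r *\<^sub>R v 0) < d 0" using dp[of 0] False by (simp add: r_def)
   from small[OF hsol_scale[OF v] this t] have "r * norm (v t) <= 2" using r by simp
   then show ?thesis using dp[of 0] False by (simp add: r_def field_simps)
  qed
 qed
qed

end

text \<open>The solution is differentiable only against fixed smooth functions; its norm continuity handles the moving factor.\<close>

lemma hsol_pairing_deriv:
 assumes v: "hsol v" and w: "!!t. smooth_torus (w t)" "!!t. smooth_torus (w' t)"
  and d: "((\<lambda>t. ft (w t)) has_vector_derivative ft (w' s)) (at s)"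
 shows "((\<lambda>t. v t \<bullet> ft (w t)) has_real_derivative v s \<bullet> ft (\<lambda>x. w' s x - A (w s) x)) (at s)"
proof -
 have cv: "isCont v s" using v by (simp add: hsol_def continuous_on_eq_continuous_at)
 have "((\<lambda>t. v t \<bullet> (ft (w t) - ft (w s))) has_real_derivative v s \<bullet> ft (w' s)) (at s)"
  unfolding has_field_derivative_iff
 proof -
  have "((\<lambda>t. (1 / norm (t - s)) *\<^sub>R (ft (w t) - (ft (w s) + (t - s) *\<^sub>R ft (w' s)))) \<longlongrightarrow> 0) (at s)"
   using d unfolding has_vector_derivative_def has_derivative_within by simp
  from tendsto_norm_zero[OF this]
  have "((\<lambda>t. norm ((1 / (t - s)) *\<^sub>R (ft (w t) - ft (w s)) - ft (w' s))) \<longlongrightarrow> 0) (at s)"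
  proof (rule Lim_transform_eventually)
   show "\<forall>\<^sub>F t in at s. norm ((1 / norm (t - s)) *\<^sub>R (ft (w t) - (ft (w s) + (t - s) *\<^sub>R ft (w' s))))
     = norm ((1 / (t - s)) *\<^sub>R (ft (w t) - ft (w s)) - ft (w' s))"
    unfolding eventually_at_filter
   proof (rule always_eventually, intro allI impI)
    fix t assume t: "t ~= s"
    then have "(1 / (t - s)) *\<^sub>R (ft (w t) - ft (w s)) - ft (w' s) = (1 / (t - s)) *\<^sub>R (ft (w t) - (ft (w s) + (t - s) *\<^sub>R ft (w' s)))"
     by (simp add: scaleR_diff_right scaleR_add_right)
    then show "norm ((1 / norm (t - s)) *\<^sub>R (ft (w t) - (ft (w s) + (t - s) *\<^sub>R ft (w' s))))
     = norm ((1 / (t - s)) *\<^sub>R (ft (w t) - ft (w s)) - ft (w' s))" by simp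
   qed
  qed
  then have "((\<lambda>t. (1 / (t - s)) *\<^sub>R (ft (w t) - ft (w s))) \<longlongrightarrow> ft (w' s)) (at s)"
   by (simp only: tendsto_norm_zero_iff LIM_zero_iff)
  from tendsto_inner[OF cv[unfolded isCont_def] this]
  show "((\<lambda>t. (v t \<bullet> (ft (w t) - ft (w s)) - v s \<bullet> (ft (w s) - ft (w s))) / (t - s)) \<longlongrightarrow> v s \<bullet> ft (w' s)) (at s)"
   by (simp add: divide_inverse mult.commute)
 qed
 from DERIV_add[OF this hsol_weak_deriv[OF v w(1)[of s], of s]]
 show ?thesis
  by (simp add: inner_diff_right ft_diff smooth_torus_L2 w smooth_torus_adj)
qed

text \<open>Duality: pair the approximate solution \<open>w\<close> with the homogeneous solution whose value at the end is \<open>w\<close> itself.\<close>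

lemma growth_bound:
 assumes C: "!!v t. hsol v ==> \<bar>t\<bar> <= 1 ==> norm (v t) <= C * norm (v 0)" "C > 0"
  and ex: "!!x. \<exists>v. hsol v \<and> v 0 = hpart x"
  and w: "!!t. smooth_torus (w t)" "!!t. smooth_torus (w' t)"
  and d: "!!s. ((\<lambda>t. ft (w t)) has_vector_derivative ft (w' s)) (at s)"
  and \<tau>: "\<bar>\<tau>\<bar> <= 1" and \<rho>: "!!s. \<bar>s\<bar> <= \<bar>\<tau>\<bar> ==> L2_norm (\<lambda>x. w' s x - A (w s) x) <= \<rho>"
 shows "L2_norm (w \<tau>) <= C * (L2_norm (w 0) + \<bar>\<tau>\<bar> * \<rho>)"
proof -
 \<comment> \<open>The solution with value \<open>w \<tau>\<close> at time \<open>\<tau>\<close> is followed back to time zero.\<close>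
 obtain v where v: "hsol v" "v 0 = ft (w \<tau>)" using ex[of "ft (w \<tau>)"] by (auto simp: hpart_ft smooth_torus_L2 w)
 define n where "n = norm (ft (w \<tau>))"
 have nL: "n = L2_norm (w \<tau>)" by (simp add: n_def L2_norm_ft smooth_torus_L2 w)
 define g where "g s = v (s - \<tau>) \<bullet> ft (w s)" for s
 have "(g has_real_derivative v (s - \<tau>) \<bullet> ft (\<lambda>x. w' s x - A (w s) x)) (at s)" for s
 proof -
  have ds: "((\<lambda>t. ft (w (t + \<tau>))) has_vector_derivative ft (w' (s - \<tau> + \<tau>))) (at (s - \<tau>))"
  proof -
   have "((\<lambda>t. t + \<tau>) has_vector_derivative 1) (at (s - \<tau>))"
    by (auto intro!: derivative_eq_intros simp flip: has_real_derivative_iff_has_vector_derivative)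
   from vector_diff_chain_at[OF this d] show ?thesis by (simp add: o_def)
  qed
  have "((\<lambda>t. v t \<bullet> ft (w (t + \<tau>))) has_real_derivative v (s - \<tau>) \<bullet> ft (\<lambda>x. w' (s - \<tau> + \<tau>) x - A (w (s - \<tau> + \<tau>)) x)) (at (s - \<tau>))"
   by (rule hsol_pairing_deriv[where w = "\<lambda>t. w (t + \<tau>)" and w' = "\<lambda>t. w' (t + \<tau>)", OF v(1) w(1) w(2) ds])
  moreover have "((\<lambda>s. s - \<tau>) has_real_derivative 1) (at s)" by (auto intro!: derivative_eq_intros)
  ultimately have "((\<lambda>s. v (s - \<tau>) \<bullet> ft (w (s - \<tau> + \<tau>))) has_real_derivative v (s - \<tau>) \<bullet> ft (\<lambda>x. w' (s - \<tau> + \<tau>) x - A (w (s - \<tau> + \<tau>)) x) * 1) (at s)"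
   by (rule DERIV_chain2[where f = "\<lambda>t. v t \<bullet> ft (w (t + \<tau>))" and g = "\<lambda>s. s - \<tau>"])
  then show ?thesis by (simp add: g_def[abs_def])
 qed
 note dg = this
 have bnd: "\<bar>v (s - \<tau>) \<bullet> ft (\<lambda>x. w' s x - A (w s) x)\<bar> <= C * n * \<rho>" if s: "s \<in> closed_segment 0 \<tau>" for s
 proof -
  have s1: "\<bar>s\<bar> <= \<bar>\<tau>\<bar>" "\<bar>s - \<tau>\<bar> <= 1" using s \<tau> by (auto simp: closed_segment_eq_real_ivl split: if_splits)
  have L: "(\<lambda>x. w' s x - A (w s) x) \<in> L2" by (intro smooth_torus_L2 smooth_torus_diff w smooth_torus_adj)
  have "\<bar>v (s - \<tau>) \<bullet> ft (\<lambda>x. w' s x - A (w s) x)\<bar> <= norm (v (s - \<tau>)) * norm (ft (\<lambda>x. w' s x - A (w s) x))" by (rule Cauchy_Schwarz_ineq2)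
  also have "\<dots> <= (C * n) * \<rho>"
   using C(1)[OF v(1) s1(2)] \<rho>[OF s1(1)] C(2) by (intro mult_mono) (simp_all add: v(2) n_def L2_norm_ft L)
  finally show ?thesis .
 qed
 have "norm (g \<tau> - g 0) <= C * n * \<rho> * norm (\<tau> - 0)"
  by (rule field_differentiable_bound[where S = "closed_segment 0 \<tau>"])
    (use bnd in \<open>auto intro: has_field_derivative_at_within dg\<close>)
 then have "\<bar>g \<tau>\<bar> <= \<bar>g 0\<bar> + C * n * \<rho> * \<bar>\<tau>\<bar>" by simp
 moreover have "g \<tau> = n^2" by (simp add: g_def v(2) n_def power2_norm_eq_inner)
 moreover have "\<bar>g 0\<bar> <= (C * n) * L2_norm (w 0)"
 proof -
  have "\<bar>g 0\<bar> <= norm (v (0 - \<tau>)) * norm (ft (w 0))" unfolding g_def by (rule Cauchy_Schwarz_ineq2)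
  also have "\<dots> <= (C * n) * L2_norm (w 0)"
   using C(1)[OF v(1), of "0 - \<tau>"] C(2) \<tau> by (intro mult_mono mult_nonneg_nonneg) (auto simp: v(2) n_def L2_norm_ft smooth_torus_L2 w)
  finally show ?thesis .
 qed
 ultimately have "n * n <= n * (C * (L2_norm (w 0) + \<bar>\<tau>\<bar> * \<rho>))" by (simp add: power2_eq_square algebra_simps)
 moreover have "0 <= C * (L2_norm (w 0) + \<bar>\<tau>\<bar> * \<rho>)"
  using C(2) order_trans[OF L2_norm_nonneg \<rho>[of 0]] by (intro mult_nonneg_nonneg add_nonneg_nonneg) auto
 ultimately show ?thesis unfolding nL[symmetric] by (cases "n > 0") (auto simp: not_less)
qed

end

subsection \<open>Primitives along a direction\<close>

text \<open>Derivatives of a primitive are primitives of derivatives plus smooth functions, a class closed under differentiation.\<close>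

lemma smooth_prim2: assumes "smooth f" shows "smooth (prim2 f)"
proof (rule smooth_coinduct[where C = "{h. \<exists>f g. smooth f \<and> smooth g \<and> h = (\<lambda>z. prim2 f z + g z)}"])
 have "prim2 f = (\<lambda>z. prim2 f z + 0)" by simp
 then show "prim2 f \<in> {h. \<exists>f g. smooth f \<and> smooth g \<and> h = (\<lambda>z. prim2 f z + g z)}" using assms smooth_const by blast
next
 fix h assume "h \<in> {h. \<exists>f g. smooth f \<and> smooth g \<and> h = (\<lambda>z. prim2 f z + g z)}"
 then obtain f g where fg: "smooth f" "smooth g" "h = (\<lambda>z. prim2 f z + g z)" by blast
 have d: "(h has_derivative (\<lambda>v. (fst v * prim2 (d1 f) z + snd v * f z) + dir_deriv v g z)) (at z)" for z
  unfolding fg(3) by (rule has_derivative_add[OF prim2_has_derivative[OF fg(1)] smooth_has_derivative[OF fg(2)]])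
 have "dir_deriv v h = (\<lambda>z. prim2 (\<lambda>z. fst v * d1 f z) z + (snd v * f z + dir_deriv v g z))" for v
  using dir_deriv_eqI'[OF d] by (simp add: fun_eq_iff prim2_cmult add.assoc)
 moreover have "smooth (\<lambda>z. fst v * d1 f z)" "smooth (\<lambda>z. snd v * f z + dir_deriv v g z)" for v
  by (intro smooth_cmult smooth_add smooth_dir_deriv fg)+
 ultimately show "(\<forall>x. h differentiable at x) \<and> (\<forall>v. dir_deriv v h \<in> {h. \<exists>f g. smooth f \<and> smooth g \<and> h = (\<lambda>z. prim2 f z + g z)})"
  using d unfolding differentiable_def by blast
qed

text \<open>Rotate and scale the coordinates so that \<open>\<eta>\<close> becomes the second unit vector. The primitive lives on the plane; on the torus it need not exist, and the obstruction is the average to be studied.\<close>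

lemma directional_primitive:
 assumes Q: "smooth Q" and \<eta>: "\<eta> ~= (0 :: plane)"
 obtains \<Psi> where "smooth \<Psi>" "dir_deriv \<eta> \<Psi> = Q"
proof -
 obtain a b where ab: "\<eta> = (a, b)" by (cases \<eta>)
 define n where "n = a * a + b * b"
 have n: "n ~= 0" using \<eta> unfolding n_def ab by (simp add: zero_prod_def sum_squares_eq_zero_iff)
 define M where "M z = (- b * fst z + a * snd z, a * fst z + b * snd z)" for z :: plane
 define N where "N x = ((- b * fst x + a * snd x) / n, (a * fst x + b * snd x) / n)" for x :: plane
 have blM: "bounded_linear M"
  by (rule linear_conv_bounded_linear[THEN iffD1]) (auto intro!: linearI simp: M_def algebra_simps)
 have blN: "bounded_linear N"
  by (rule linear_conv_bounded_linear[THEN iffD1]) (auto intro!: linearI simp: N_def algebra_simps add_divide_distrib diff_divide_distrib)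
 have MN: "M (N x) = x" for x
 proof -
  have "- b * (- b * fst x + a * snd x) + a * (a * fst x + b * snd x) = n * fst x"
   "a * (- b * fst x + a * snd x) + b * (a * fst x + b * snd x) = n * snd x" by (simp_all add: n_def algebra_simps)
  then show ?thesis using n by (simp add: M_def N_def prod_eq_iff add_divide_distrib[symmetric] diff_divide_distrib[symmetric])
 qed
 have Ne: "N \<eta> = (0, 1)" using n by (simp add: N_def ab n_def)
 have sQ: "smooth (\<lambda>z. Q (M z))" using smooth_affine[OF Q blM, of 0] by simp
 have d2: "d2 (prim2 (\<lambda>z. Q (M z))) = (\<lambda>z. Q (M z))" using dir_deriv_eqI'[OF prim2_has_derivative[OF sQ], of "(0, 1)"] by simp
 show ?thesis
 proof (rule that[of "\<lambda>x. prim2 (\<lambda>z. Q (M z)) (N x)"])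
  show "smooth (\<lambda>x. prim2 (\<lambda>z. Q (M z)) (N x))" using smooth_affine[OF smooth_prim2[OF sQ] blN, of 0] by simp
  show "dir_deriv \<eta> (\<lambda>x. prim2 (\<lambda>z. Q (M z)) (N x)) = Q"
   using dir_deriv_affine[OF smooth_prim2[OF sQ] blN, of \<eta> 0] by (simp add: Ne d2 MN)
 qed
qed

subsection \<open>Smooth families\<close>

text \<open>Smooth dependence on a real parameter and the point together; closed under the operations below and bounded on compact sets, which gives all constants in the expansion at once.\<close>

definition sfam :: "(real => plane => real) => bool" where
 "sfam f \<longleftrightarrow> smooth (\<lambda>z. f (fst z) (snd z))"

lemma sfam_space: "smooth a ==> sfam (\<lambda>s x. a x)" by (simp add: sfam_def smooth_snd)
lemma sfam_add: "sfam f ==> sfam g ==> sfam (\<lambda>s x. f s x + g s x)" by (simp add: sfam_def smooth_add)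
lemma sfam_diff: "sfam f ==> sfam g ==> sfam (\<lambda>s x. f s x - g s x)" by (simp add: sfam_def smooth_diff)
lemma sfam_minus: "sfam f ==> sfam (\<lambda>s x. - f s x)" by (simp add: sfam_def smooth_minus)
lemma sfam_mult: "sfam f ==> sfam g ==> sfam (\<lambda>s x. f s x * g s x)" by (simp add: sfam_def smooth_mult)
lemma sfam_comp: "smooth h ==> sfam f ==> sfam (\<lambda>s x. h (f s x))" for h :: "real => real"
 unfolding sfam_def by (rule smooth_comp)

lemma sfam_linear: assumes "bounded_linear (\<lambda>z :: real \<times> plane. l (fst z) (snd z))" shows "sfam (\<lambda>s x. l s x + c)"
 unfolding sfam_def by (rule smooth_linear[OF assms])

lemma sfam_time: assumes "sfam f" shows "sfam (\<lambda>s x. f (r * s) x)"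
proof -
 have "bounded_linear (\<lambda>z :: real \<times> plane. (r * fst z, snd z))"
  by (intro bounded_linear_Pair bounded_linear_compose[OF bounded_linear_mult_right] bounded_linear_fst bounded_linear_snd)
 from smooth_affine[OF assms[unfolded sfam_def] this, of 0] show ?thesis by (simp add: sfam_def)
qed

lemma sfam_deriv: assumes "sfam f" shows "sfam (\<lambda>s x. dir_deriv v (f s) x)"
proof -
 have "f = slice (\<lambda>z. f (fst z) (snd z))" by (simp add: slice_def fun_eq_iff)
 then have "dir_deriv v (f s) = slice (dir_deriv (0, v) (\<lambda>z. f (fst z) (snd z))) s" for s
  using dir_deriv_slice[OF assms[unfolded sfam_def], of v s] by simp
 then have "(\<lambda>z. dir_deriv v (f (fst z)) (snd z)) = dir_deriv (0, v) (\<lambda>z. f (fst z) (snd z))"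
  by (simp add: slice_def fun_eq_iff)
 then show ?thesis using smooth_dir_deriv[OF assms[unfolded sfam_def]] by (simp add: sfam_def)
qed

lemmas sfam_intros = sfam_add sfam_diff sfam_minus sfam_mult sfam_deriv

lemma sfam_bounded: assumes "sfam f"
 shows "\<exists>M. \<forall>s x. \<bar>s\<bar> <= S --> x \<in> cell --> \<bar>f s x\<bar> <= M"
proof -
 have "compact ((\<lambda>z. f (fst z) (snd z)) ` ({-S..S} \<times> cell))"
  by (intro compact_continuous_image smooth_continuous[OF assms[unfolded sfam_def]] compact_Times) auto
 then obtain M where M: "\<forall>y\<in>(\<lambda>z. f (fst z) (snd z)) ` ({-S..S} \<times> cell). norm y <= M" using compact_imp_bounded bounded_iff by metis
 have "\<bar>f s x\<bar> <= M" if "\<bar>s\<bar> <= S" "x \<in> cell" for s x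
 proof -
  have "(s, x) \<in> {-S..S} \<times> cell" using that by (simp add: abs_le_iff)
  then show ?thesis using M by force
 qed
 then show ?thesis by blast
qed

subsection \<open>Oscillating approximate solutions\<close>

context coefficients
begin

text \<open>The symbol of the second order part, up to sign.\<close>

definition symb :: "plane => real => real => real" where
 "symb x k1 k2 = a1 x * k1^2 + 2 * a0 x * k1 * k2 + am1 x * k2^2"

text \<open>The coefficients of \<open>K\<^sub>1\<close> and \<open>K\<^sub>2\<close> in the part of the expansion of a wave that is linear in the frequency.\<close>

definition E1 :: "(plane => real) => plane => real" where
 "E1 B x = 2 * d2 (d1 B) x + d2 (d2 B) x - 2 * d1 (\<lambda>x. a1 x * B x) x - 2 * d2 (\<lambda>x. a0 x * B x) x + b1 x * B x"
definition E2 :: "(plane => real) => plane => real" where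
 "E2 B x = d1 (d1 B) x + 2 * d2 (d1 B) x - 2 * d1 (\<lambda>x. a0 x * B x) x - 2 * d2 (\<lambda>x. am1 x * B x) x + b2 x * B x"

lemma sfam_A: assumes "sfam f" shows "sfam (\<lambda>s. A (f s))" "sfam (\<lambda>s. E1 (f s))" "sfam (\<lambda>s. E2 (f s))"
proof -
 note sm = smooth_coeffs[THEN smooth_torusD(1)]
 show "sfam (\<lambda>s. A (f s))" unfolding adj_def[abs_def] by (intro sfam_intros sfam_space smooth_const sm assms)
 show "sfam (\<lambda>s. E1 (f s))" unfolding E1_def[abs_def] by (intro sfam_intros sfam_space smooth_const sm assms)
 show "sfam (\<lambda>s. E2 (f s))" unfolding E2_def[abs_def] by (intro sfam_intros sfam_space smooth_const sm assms)
qed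

lemma smooth_wave: "smooth_torus (\<lambda>x. cos (phase K x + \<theta>))" "smooth_torus (\<lambda>x. sin (phase K x + \<theta>))"
 and wave_deriv: "dir_deriv v (\<lambda>x. cos (phase K x + \<theta>)) = (\<lambda>x. - phase K v * sin (phase K x + \<theta>))"
  "dir_deriv v (\<lambda>x. sin (phase K x + \<theta>)) = (\<lambda>x. phase K v * cos (phase K x + \<theta>))"
proof -
 have e: "(\<lambda>x. cos (phase K x + \<theta>)) = (\<lambda>x. cos \<theta> * cosk K x - sin \<theta> * sink K x)"
  "(\<lambda>x. sin (phase K x + \<theta>)) = (\<lambda>x. cos \<theta> * sink K x + sin \<theta> * cosk K x)"
  by (simp_all add: cosk_def sink_def cos_add sin_add mult.commute)
 show "smooth_torus (\<lambda>x. cos (phase K x + \<theta>))" "smooth_torus (\<lambda>x. sin (phase K x + \<theta>))"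
  unfolding e by (intro smooth_torus_diff smooth_torus_add smooth_torus_cmult smooth_torus_cosk smooth_torus_sink)+
 have s: "smooth (cosk K)" "smooth (sink K)" by (simp_all add: smooth_torusD smooth_torus_cosk smooth_torus_sink)
 have d: "dir_deriv v (\<lambda>x. cos \<theta> * cosk K x - sin \<theta> * sink K x) = (\<lambda>x. cos \<theta> * dir_deriv v (cosk K) x - sin \<theta> * dir_deriv v (sink K) x)"
  "dir_deriv v (\<lambda>x. cos \<theta> * sink K x + sin \<theta> * cosk K x) = (\<lambda>x. cos \<theta> * dir_deriv v (sink K) x + sin \<theta> * dir_deriv v (cosk K) x)"
  by (simp_all add: dir_deriv_diff dir_deriv_add dir_deriv_cmult smooth_cmult s)
 show "dir_deriv v (\<lambda>x. cos (phase K x + \<theta>)) = (\<lambda>x. - phase K v * sin (phase K x + \<theta>))"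
  "dir_deriv v (\<lambda>x. sin (phase K x + \<theta>)) = (\<lambda>x. phase K v * cos (phase K x + \<theta>))"
  unfolding e(1) e(2) d dir_deriv_cosk dir_deriv_sink fun_eq_iff
  by (simp_all add: cosk_def sink_def cos_add sin_add algebra_simps)
qed

text \<open>The eikonal term cancels against the time derivative of the phase; the terms quadratic in \<open>K\<close> are the transport along \<open>p'(K)\<close> and the symbol.\<close>

lemma adj_wave:
 fixes K :: freq and \<theta> :: real
 assumes B: "smooth_torus B"
 defines "k1 \<equiv> real_of_int (fst K)" and "k2 \<equiv> real_of_int (snd K)"
 shows "A (\<lambda>x. B x * cos (phase K x + \<theta>)) x
  = cos (phase K x + \<theta>) * (A B x + k2 * (2 * k1 + k2) * d1 B x + k1 * (2 * k2 + k1) * d2 B x - symb x k1 k2 * B x)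
   + sin (phase K x + \<theta>) * (k1 * E1 B x + k2 * E2 B x - k1 * k2 * (k1 + k2) * B x)"
proof -
 define Cs Sn where "Cs = (\<lambda>x. cos (phase K x + \<theta>))" and "Sn = (\<lambda>x. sin (phase K x + \<theta>))"
 have ph: "phase K (1, 0) = k1" "phase K (0, 1) = k2" by (simp_all add: phase_def k1_def k2_def)
 have dC: "d1 Cs = (\<lambda>x. - k1 * Sn x)" "d2 Cs = (\<lambda>x. - k2 * Sn x)" "d1 Sn = (\<lambda>x. k1 * Cs x)" "d2 Sn = (\<lambda>x. k2 * Cs x)"
  unfolding Cs_def Sn_def wave_deriv ph by simp_all
 have sm: "smooth B" "smooth Cs" "smooth Sn" "smooth a1" "smooth a0" "smooth am1" "smooth b1" "smooth b2"
  using B smooth_wave[of K \<theta>] smooth_coeffs unfolding Cs_def Sn_def by (auto intro: smooth_torusD)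
 have com: "d1 (d2 B) = d2 (d1 B)" by (rule dir_deriv_commute[OF B]) auto
 have com1: "d1 (d2 (d1 B)) = d2 (d1 (d1 B))" "d1 (d2 (d2 B)) = d2 (d2 (d1 B))"
  using dir_deriv_commute[OF smooth_torus_dir_deriv[OF B, of "(1, 0)"], of "(1, 0)" "(0, 1)"]
   dir_deriv_commute[OF smooth_torus_dir_deriv[OF B, of "(0, 1)"], of "(1, 0)" "(0, 1)"] com by auto
 have "A (\<lambda>x. B x * Cs x) x = Cs x * (A B x + k2 * (2 * k1 + k2) * d1 B x + k1 * (2 * k2 + k1) * d2 B x - symb x k1 k2 * B x)
   + Sn x * (k1 * E1 B x + k2 * E2 B x - k1 * k2 * (k1 + k2) * B x)"
  unfolding adj_def E1_def E2_def symb_def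
  by (simp add: dir_deriv_mult dir_deriv_add dir_deriv_minus dir_deriv_diff sm smooth_dir_deriv smooth_mult smooth_add smooth_diff smooth_minus dC com com1)
    (simp add: algebra_simps power2_eq_square)
 then show ?thesis by (simp add: Cs_def Sn_def)
qed

end

context coefficients
begin

text \<open>Replacing \<open>n \<xi>\<close> by integers changes the quadratic terms by \<open>O(n)\<close> only.\<close>

lemma rounding_bound:
 fixes x y k l :: real
 assumes "\<bar>n * x - k\<bar> <= 1" "\<bar>n * y - l\<bar> <= 1" "\<bar>x\<bar> <= X" "\<bar>l\<bar> <= n * X" "n >= 0"
 shows "\<bar>n^2 * (x * y) - k * l\<bar> <= 2 * n * X"
proof -
 have "n^2 * (x * y) - k * l = n * x * (n * y - l) + (n * x - k) * l" by (simp add: power2_eq_square algebra_simps)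
 also have "\<bar>\<dots>\<bar> <= \<bar>n * x\<bar> * \<bar>n * y - l\<bar> + \<bar>n * x - k\<bar> * \<bar>l\<bar>" by (metis abs_mult abs_triangle_ineq)
 also have "\<dots> <= (n * X) * 1 + 1 * (n * X)"
  using assms by (intro add_mono mult_mono) (auto simp: abs_mult mult_left_mono intro!: mult_nonneg_nonneg order_trans[OF abs_ge_zero assms(3)])
 finally show ?thesis by (simp add: algebra_simps)
qed

text \<open>The amplitude solves the transport equation for \<open>\<xi>\<close>, not for the nearby integer covector, so that it does not depend on \<open>n\<close>. Over a rescaled time \<open>s\<close> the residual \<open>O(n)\<close> contributes \<open>O(\<bar>s\<bar> / n)\<close>. The phases \<open>0\<close> and \<open>- \<pi> / 2\<close> together recover the full norm of the amplitude.\<close>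

lemma wkb_bound:
 fixes \<xi> \<eta> :: plane and \<Psi> :: "plane => real"
 assumes C: "!!v t. hsol v ==> \<bar>t\<bar> <= 1 ==> norm (v t) <= C * norm (v 0)" "C > 0"
  and ex: "!!x. \<exists>v. hsol v \<and> v 0 = hpart x"
  and \<eta>: "\<eta> = grad p \<xi>"
  and \<Psi>: "smooth \<Psi>" "dir_deriv \<eta> \<Psi> = (\<lambda>x. symb x (fst \<xi>) (snd \<xi>))"
 defines "B \<equiv> \<lambda>s x. exp (\<Psi> x - \<Psi> (x + s *\<^sub>R \<eta>))"
 shows "smooth_torus (B s)" "(L2_norm (B s))^2 <= 2 * (4 * pi * C)^2"
proof -
 define x1 x2 where "x1 = fst \<xi>" and "x2 = snd \<xi>"
 define h1 h2 where "h1 = x2 * (2 * x1 + x2)" and "h2 = x1 * (2 * x2 + x1)"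
 have \<eta>h: "\<eta> = (h1, h2)" by (simp add: \<eta> grad_p h1_def h2_def x1_def x2_def)
 define Q where "Q x = symb x x1 x2" for x
 have sQ: "smooth_torus Q" unfolding Q_def[abs_def] symb_def
  using smooth_torus_add[OF smooth_torus_add[OF smooth_torus_cmult[OF smooth_coeffs(1), of "x1^2"] smooth_torus_cmult[OF smooth_coeffs(2), of "2 * x1 * x2"]]
   smooth_torus_cmult[OF smooth_coeffs(3), of "x2^2"]] by (simp add: mult_ac)
 have \<Psi>Q: "dir_deriv \<eta> \<Psi> = Q" by (simp add: \<Psi>(2) Q_def[abs_def] x1_def x2_def)
 have dt: "((\<lambda>s. \<Psi> (x + s *\<^sub>R \<eta>)) has_real_derivative Q (x + s *\<^sub>R \<eta>)) (at s)" for x s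
  using smooth_along_line[OF \<Psi>(1), of x \<eta> s] by (simp add: \<Psi>Q)
 have bl: "bounded_linear (\<lambda>z :: real \<times> plane. snd z + fst z *\<^sub>R \<eta>)"
  by (intro bounded_linear_add bounded_linear_snd bounded_linear_compose[OF bounded_linear_scaleR_left] bounded_linear_fst)
 have fB: "sfam B" unfolding B_def
  using smooth_affine[OF \<Psi>(1) bl, of 0]
  by (intro sfam_comp[OF smooth_exp_real] sfam_diff sfam_space \<Psi>(1)) (simp add: sfam_def)
 have sh: "\<Psi> (x + w) - \<Psi> (x + w + s *\<^sub>R \<eta>) = \<Psi> x - \<Psi> (x + s *\<^sub>R \<eta>)" if w: "!!x. Q (x + w) = Q x" for w x s
 proof -
  have "\<forall>s. ((\<lambda>s. \<Psi> (x + w + s *\<^sub>R \<eta>) - \<Psi> (x + s *\<^sub>R \<eta>)) has_real_derivative 0) (at s)"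
  proof
   fix s
   have "Q (x + w + s *\<^sub>R \<eta>) = Q (x + s *\<^sub>R \<eta>)" using w[of "x + s *\<^sub>R \<eta>"] by (simp add: add_ac)
   then show "((\<lambda>s. \<Psi> (x + w + s *\<^sub>R \<eta>) - \<Psi> (x + s *\<^sub>R \<eta>)) has_real_derivative 0) (at s)"
    using DERIV_diff[OF dt[of "x + w" s] dt[of x s]] by simp
  qed
  from DERIV_isconst_all[OF this, of s 0] show ?thesis by simp
 qed
 have perQ: "Q (x + (2 * pi, 0)) = Q x" "Q (x + (0, 2 * pi)) = Q x" for x
  using smooth_torusD(2)[OF sQ] unfolding periodic2_def by blast+
 have smB: "smooth (B s)" for s
  using smooth_slice[OF fB[unfolded sfam_def], of s] by (simp add: slice_def[abs_def])
 have sB: "smooth_torus (B s)" for s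
  unfolding smooth_torus_def periodic2_def using smB sh[OF perQ(1)] sh[OF perQ(2)] by (simp add: B_def)
 then show "smooth_torus (B s)" .
 \<comment> \<open>The transport equation, which gives the time derivative of the amplitude.\<close>
 define B' where "B' s x = dir_deriv \<eta> (B s) x - Q x * B s x" for s x
 have fB': "sfam B'" unfolding B'_def[abs_def] by (intro sfam_intros sfam_space fB smooth_torusD(1) sQ)
 have sB': "smooth_torus (B' s)" for s unfolding B'_def[abs_def]
  by (intro smooth_torus_diff smooth_torus_mult smooth_torus_dir_deriv sB sQ)
 have dB: "((\<lambda>s. B s x) has_real_derivative B' s x) (at s)" for s x
 proof -
  have "((\<lambda>r. B s (x + r *\<^sub>R \<eta>)) has_real_derivative dir_deriv \<eta> (B s) (x + 0 *\<^sub>R \<eta>)) (at 0)"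
   by (rule smooth_along_line[OF smB])
  moreover have "((\<lambda>r. B s (x + r *\<^sub>R \<eta>)) has_real_derivative B s (x + 0 *\<^sub>R \<eta>) * (Q (x + 0 *\<^sub>R \<eta>) - Q (x + s *\<^sub>R \<eta> + 0 *\<^sub>R \<eta>))) (at 0)"
  proof -
   have e: "(\<lambda>r. B s (x + r *\<^sub>R \<eta>)) = (\<lambda>r. exp (\<Psi> (x + r *\<^sub>R \<eta>) - \<Psi> (x + s *\<^sub>R \<eta> + r *\<^sub>R \<eta>)))" by (simp add: B_def add_ac)
   show ?thesis unfolding e
    using DERIV_fun_exp[OF DERIV_diff[OF dt[of x 0] dt[of "x + s *\<^sub>R \<eta>" 0]]] by (simp add: B_def)
  qed
  ultimately have "dir_deriv \<eta> (B s) x = B s x * (Q x - Q (x + s *\<^sub>R \<eta>))" using DERIV_unique by fastforce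
  then have "B' s x = B s x * (0 - Q (x + s *\<^sub>R \<eta>))" by (simp add: B'_def algebra_simps)
  then show ?thesis using DERIV_fun_exp[OF DERIV_diff[OF DERIV_const[of "\<Psi> x"] dt[of x s]]] by (simp add: B_def)
 qed
 define S where "S = \<bar>s\<bar>"
 note fams = fB sfam_deriv[OF fB, of "(1, 0)"] sfam_deriv[OF fB, of "(0, 1)"] sfam_A[OF fB]
  sfam_space[OF smooth_torusD(1)[OF smooth_coeffs(1)]] sfam_space[OF smooth_torusD(1)[OF smooth_coeffs(2)]] sfam_space[OF smooth_torusD(1)[OF smooth_coeffs(3)]]
 obtain M0 where m0: "!!r x. \<bar>r\<bar> <= S ==> x \<in> cell ==> \<bar>B r x\<bar> <= M0"
  using sfam_bounded[OF fams(1), of S] by blast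
 obtain M1 where m1: "!!r x. \<bar>r\<bar> <= S ==> x \<in> cell ==> \<bar>d1 (B r) x\<bar> <= M1"
  using sfam_bounded[OF fams(2), of S] by blast
 obtain M2 where m2: "!!r x. \<bar>r\<bar> <= S ==> x \<in> cell ==> \<bar>d2 (B r) x\<bar> <= M2"
  using sfam_bounded[OF fams(3), of S] by blast
 obtain M3 where m3: "!!r x. \<bar>r\<bar> <= S ==> x \<in> cell ==> \<bar>A (B r) x\<bar> <= M3"
  using sfam_bounded[OF fams(4), of S] by blast
 obtain M4 where m4: "!!r x. \<bar>r\<bar> <= S ==> x \<in> cell ==> \<bar>E1 (B r) x\<bar> <= M4"
  using sfam_bounded[OF fams(5), of S] by blast
 obtain M5 where m5: "!!r x. \<bar>r\<bar> <= S ==> x \<in> cell ==> \<bar>E2 (B r) x\<bar> <= M5"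
  using sfam_bounded[OF fams(6), of S] by blast
 obtain M6 where m6: "!!r x. \<bar>r\<bar> <= S ==> x \<in> cell ==> \<bar>a1 x\<bar> <= M6"
  using sfam_bounded[OF fams(7), of S] by blast
 obtain M7 where m7: "!!r x. \<bar>r\<bar> <= S ==> x \<in> cell ==> \<bar>a0 x\<bar> <= M7"
  using sfam_bounded[OF fams(8), of S] by blast
 obtain M8 where m8: "!!r x. \<bar>r\<bar> <= S ==> x \<in> cell ==> \<bar>am1 x\<bar> <= M8"
  using sfam_bounded[OF fams(9), of S] by blast
 define M where "M = Max {0, M0, M1, M2, M3, M4, M5, M6, M7, M8}"
 have le: "M0 <= M" "M1 <= M" "M2 <= M" "M3 <= M" "M4 <= M" "M5 <= M" "M6 <= M" "M7 <= M" "M8 <= M"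
  unfolding M_def by (rule Max_ge; simp)+
 have M: "\<bar>B r x\<bar> <= M" "\<bar>d1 (B r) x\<bar> <= M" "\<bar>d2 (B r) x\<bar> <= M" "\<bar>A (B r) x\<bar> <= M" "\<bar>E1 (B r) x\<bar> <= M" "\<bar>E2 (B r) x\<bar> <= M"
  "\<bar>a1 x\<bar> <= M" "\<bar>a0 x\<bar> <= M" "\<bar>am1 x\<bar> <= M" if "\<bar>r\<bar> <= S" "x \<in> cell" for r x
  by (rule m0[OF that, THEN order_trans, OF le(1)] m1[OF that, THEN order_trans, OF le(2)] m2[OF that, THEN order_trans, OF le(3)]
    m3[OF that, THEN order_trans, OF le(4)] m4[OF that, THEN order_trans, OF le(5)] m5[OF that, THEN order_trans, OF le(6)]
    m6[OF that, THEN order_trans, OF le(7)] m7[OF that, THEN order_trans, OF le(8)] m8[OF that, THEN order_trans, OF le(9)])+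
 have M0: "M >= 0" unfolding M_def by (rule Max_ge) simp_all
 define X where "X = \<bar>x1\<bar> + \<bar>x2\<bar> + 1"
 have X: "X >= 1" "\<bar>x1\<bar> <= X" "\<bar>x2\<bar> <= X" by (auto simp: X_def)
 define MM where "MM = X * (15 * M + 8 * (M * M))"
 have MM0: "MM >= 0" using X M0 by (simp add: MM_def)
 \<comment> \<open>Large enough for the time \<open>s / n\<^sup>2\<close> to be at most one and for the residual to contribute at most \<open>2\<pi>\<close>.\<close>
 obtain n0 where n0: "max (max 1 S) (S * MM) <= real n0" using real_arch_simple by blast
 define n where "n = real n0"
 have n: "n >= 1" "S <= n" "S * MM <= n" using n0 by (auto simp: n_def)
 define K :: freq where "K = (\<lfloor>n * x1\<rfloor>, \<lfloor>n * x2\<rfloor>)"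
 define k1 k2 where "k1 = real_of_int (fst K)" and "k2 = real_of_int (snd K)"
 have kn: "\<bar>n * x1 - k1\<bar> <= 1" "\<bar>n * x2 - k2\<bar> <= 1" unfolding k1_def k2_def K_def fst_conv snd_conv by linarith+
 have kX: "\<bar>k1\<bar> <= n * X" "\<bar>k2\<bar> <= n * X"
 proof -
  have "\<bar>k1\<bar> <= \<bar>n * x1\<bar> + 1" "\<bar>k2\<bar> <= \<bar>n * x2\<bar> + 1" using kn by linarith+
  moreover have "\<bar>n * x1\<bar> + 1 <= n * X" "\<bar>n * x2\<bar> + 1 <= n * X"
  proof -
   have "0 <= n * \<bar>x1\<bar>" "0 <= n * \<bar>x2\<bar>" using n(1) by simp_all
   moreover have "\<bar>n * x1\<bar> = n * \<bar>x1\<bar>" "\<bar>n * x2\<bar> = n * \<bar>x2\<bar>" "n * X = n * \<bar>x1\<bar> + n * \<bar>x2\<bar> + n"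
    using n(1) by (simp_all add: X_def abs_mult distrib_left)
   ultimately show "\<bar>n * x1\<bar> + 1 <= n * X" "\<bar>n * x2\<bar> + 1 <= n * X" using n(1) by linarith+
  qed
  ultimately show "\<bar>k1\<bar> <= n * X" "\<bar>k2\<bar> <= n * X" by linarith+
 qed
 define e11 e12 e22 where "e11 = n^2 * (x1 * x1) - k1 * k1" and "e12 = n^2 * (x1 * x2) - k1 * k2" and "e22 = n^2 * (x2 * x2) - k2 * k2"
 have e: "\<bar>e11\<bar> <= 2 * n * X" "\<bar>e12\<bar> <= 2 * n * X" "\<bar>e22\<bar> <= 2 * n * X"
  unfolding e11_def e12_def e22_def using n(1) by (intro rounding_bound kn kX X; simp)+
 define pK where "pK = k1 * k2 * (k1 + k2)"
 define w where "w \<theta> t x = B (n^2 * t) x * cos (phase K x + (pK * t + \<theta>))" for \<theta> t x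
 define w' where "w' \<theta> t x = n^2 * B' (n^2 * t) x * cos (phase K x + (pK * t + \<theta>)) - B (n^2 * t) x * (pK * sin (phase K x + (pK * t + \<theta>)))" for \<theta> t x
 have sw: "smooth_torus (w \<theta> t)" for \<theta> t unfolding w_def[abs_def] by (intro smooth_torus_mult sB smooth_wave)
 have sw': "smooth_torus (w' \<theta> t)" for \<theta> t unfolding w'_def[abs_def]
  by (intro smooth_torus_diff smooth_torus_mult smooth_torus_cmult sB sB' smooth_wave smooth_torus_const)
 have fw': "sfam (w' \<theta>)" for \<theta>
 proof -
  have "bounded_linear (\<lambda>z :: real \<times> plane. phase K (snd z) + pK * fst z)"
   by (intro bounded_linear_add bounded_linear_compose[OF phase_linear] bounded_linear_compose[OF bounded_linear_mult_right] bounded_linear_fst bounded_linear_snd)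
  from sfam_linear[of "\<lambda>t x. phase K x + pK * t", OF this, of \<theta>]
  have l: "sfam (\<lambda>t x. phase K x + (pK * t + \<theta>))" by (simp add: add.assoc)
  show ?thesis unfolding w'_def[abs_def]
   by (rule sfam_diff[OF sfam_mult[OF sfam_mult[OF sfam_space[OF smooth_const] sfam_time[OF fB']] sfam_comp[OF smooth_cos l]]
      sfam_mult[OF sfam_time[OF fB] sfam_mult[OF sfam_space[OF smooth_const] sfam_comp[OF smooth_sin l]]]])
 qed
 have dw: "((\<lambda>t. ft (w \<theta> t)) has_vector_derivative ft (w' \<theta> t)) (at t)" for \<theta> t
 proof (rule differentiable_family_ft)
  show "((\<lambda>t. w \<theta> t x) has_real_derivative w' \<theta> t x) (at t)" for t x
  proof -
   have "((\<lambda>t. B (n^2 * t) x) has_real_derivative B' (n^2 * t) x * n^2) (at t)"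
    by (rule DERIV_chain2[where f = "\<lambda>s. B s x" and g = "\<lambda>t. n^2 * t", OF dB]) (auto intro!: derivative_eq_intros)
   moreover have "((\<lambda>t. cos (phase K x + (pK * t + \<theta>))) has_real_derivative - sin (phase K x + (pK * t + \<theta>)) * pK) (at t)"
    by (auto intro!: derivative_eq_intros)
   ultimately show ?thesis unfolding w_def w'_def
    by (auto intro!: derivative_eq_intros simp: algebra_simps)
  qed
  show "continuous_on UNIV (\<lambda>z. w' \<theta> (fst z) (snd z))" by (rule smooth_continuous[OF fw'[unfolded sfam_def]])
 qed (use sw sw' smooth_torus_L2 in auto)
 define \<tau> where "\<tau> = s / n^2"
 have n2: "n^2 >= n" using n(1) by (simp add: power2_eq_square)
 have \<tau>: "\<bar>\<tau>\<bar> <= 1" "n^2 * \<tau> = s" "\<bar>\<tau>\<bar> * n <= S / n"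
  using n n2 order_trans[OF n(2) n2] by (auto simp: \<tau>_def S_def[symmetric] power2_eq_square field_simps)
 define \<rho> where "\<rho> = 2 * pi * (n * MM)"
 have rem: "L2_norm (\<lambda>x. w' \<theta> t x - A (w \<theta> t) x) <= \<rho>" if t: "\<bar>t\<bar> <= \<bar>\<tau>\<bar>" for \<theta> t
  unfolding \<rho>_def
 proof (rule L2_norm_bound)
  show "(\<lambda>x. w' \<theta> t x - A (w \<theta> t) x) \<in> L2" by (intro smooth_torus_L2 smooth_torus_diff sw sw' smooth_torus_adj)
  show "0 <= n * MM" using n(1) MM0 by simp
  fix x assume x: "x \<in> cell"
  define r where "r = n^2 * t"
  have r: "\<bar>r\<bar> <= S"
  proof -
   have "n^2 * \<bar>t\<bar> <= n^2 * \<bar>\<tau>\<bar>" using t by (intro mult_left_mono) auto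
   then show ?thesis using \<tau>(2) by (simp add: r_def S_def abs_mult[symmetric]) (metis abs_mult abs_power2)
  qed
  note Mr = M[OF r x]
  define Cs Sn where "Cs = cos (phase K x + (pK * t + \<theta>))" and "Sn = sin (phase K x + (pK * t + \<theta>))"
  define D1 D2 b where "D1 = d1 (B r) x" and "D2 = d2 (B r) x" and "b = B r x"
  have Aw: "A (w \<theta> t) x = Cs * (A (B r) x + k2 * (2 * k1 + k2) * D1 + k1 * (2 * k2 + k1) * D2 - symb x k1 k2 * b)
   + Sn * (k1 * E1 (B r) x + k2 * E2 (B r) x - pK * b)"
   unfolding w_def[abs_def] Cs_def Sn_def D1_def D2_def b_def pK_def
   using adj_wave[OF sB[of r], of K "pK * t + \<theta>" x] by (simp add: r_def k1_def k2_def pK_def)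
  have B'x: "B' r x = h1 * D1 + h2 * D2 - Q x * b"
   unfolding B'_def D1_def D2_def b_def \<eta>h using dir_deriv_pair[OF smB[of r], of h1 h2 x] by simp
  have wx: "w' \<theta> t x = n^2 * (h1 * D1 + h2 * D2 - Q x * b) * Cs - b * (pK * Sn)"
   unfolding w'_def r_def[symmetric] B'x Cs_def Sn_def b_def by simp
  define R1 R2 where "R1 = (2 * e12 + e22) * D1 + (2 * e12 + e11) * D2 - (a1 x * e11 + 2 * a0 x * e12 + am1 x * e22) * b - A (B r) x"
   and "R2 = k1 * E1 (B r) x + k2 * E2 (B r) x"
  have "w' \<theta> t x - A (w \<theta> t) x = Cs * R1 - Sn * R2"
   unfolding Aw wx R1_def R2_def e11_def e12_def e22_def h1_def h2_def Q_def symb_def by (simp add: algebra_simps power2_eq_square)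
  also have "\<bar>\<dots>\<bar> <= \<bar>R1\<bar> + \<bar>R2\<bar>"
  proof -
   have "\<bar>Cs * R1\<bar> <= 1 * \<bar>R1\<bar>" "\<bar>Sn * R2\<bar> <= 1 * \<bar>R2\<bar>"
    unfolding abs_mult Cs_def Sn_def by (intro mult_right_mono abs_cos_le_one abs_sin_le_one abs_ge_zero)+
   then show ?thesis by linarith
  qed
  also have "\<dots> <= n * MM"
  proof -
   have nX: "n * X >= 1" "0 <= n * X" using mult_mono[OF n(1) X(1)] n(1) by auto
   have e12': "\<bar>2 * e12 + e22\<bar> <= 6 * (n * X)" "\<bar>2 * e12 + e11\<bar> <= 6 * (n * X)" using e by (simp_all only: mult.assoc)
   have nX6: "0 <= 6 * (n * X)" and nX8: "0 <= 8 * (M * (n * X))" using nX M0 by simp_all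
   have p1: "\<bar>(2 * e12 + e22) * D1\<bar> <= (6 * (n * X)) * M" "\<bar>(2 * e12 + e11) * D2\<bar> <= (6 * (n * X)) * M"
    unfolding abs_mult D1_def D2_def
    by (rule mult_mono[OF e12'(1) Mr(2) nX6 abs_ge_zero] mult_mono[OF e12'(2) Mr(3) nX6 abs_ge_zero])+
   have c2: "2 * (M * (n * X)) = M * (2 * n * X)" by simp
   have p2: "\<bar>a1 x * e11\<bar> <= 2 * (M * (n * X))" "\<bar>a0 x * e12\<bar> <= 2 * (M * (n * X))" "\<bar>am1 x * e22\<bar> <= 2 * (M * (n * X))"
    unfolding abs_mult c2
    by (rule mult_mono[OF Mr(7) e(1) M0 abs_ge_zero] mult_mono[OF Mr(8) e(2) M0 abs_ge_zero] mult_mono[OF Mr(9) e(3) M0 abs_ge_zero])+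
   have t3: "\<bar>u + 2 * v * q + z\<bar> <= \<bar>u\<bar> + 2 * \<bar>v * q\<bar> + \<bar>z\<bar>" for u v q z :: real
    using abs_triangle_ineq[of "u + 2 * v * q" z] abs_triangle_ineq[of u "2 * v * q"] by (simp add: abs_mult)
   have "\<bar>a1 x * e11 + 2 * a0 x * e12 + am1 x * e22\<bar> <= 8 * (M * (n * X))"
    by (rule order_trans[OF t3]) (use p2 in linarith)
   then have p3: "\<bar>(a1 x * e11 + 2 * a0 x * e12 + am1 x * e22) * b\<bar> <= (8 * (M * (n * X))) * M"
    unfolding b_def abs_mult[of _ "B r x"] by (rule mult_mono[OF _ Mr(1) nX8 abs_ge_zero])
   have p4: "\<bar>A (B r) x\<bar> <= (n * X) * M" using order_trans[OF Mr(4) mult_right_mono[OF nX(1) M0, unfolded mult_1_left]] .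
   have p5: "\<bar>k1 * E1 (B r) x\<bar> <= (n * X) * M" "\<bar>k2 * E2 (B r) x\<bar> <= (n * X) * M"
    unfolding abs_mult by (rule mult_mono[OF kX(1) Mr(5) nX(2) abs_ge_zero] mult_mono[OF kX(2) Mr(6) nX(2) abs_ge_zero])+
   have t: "\<bar>u1 + u2 - u3 - u4\<bar> + \<bar>v1 + v2\<bar> <= (\<bar>u1\<bar> + \<bar>u2\<bar> + \<bar>u3\<bar> + \<bar>u4\<bar>) + (\<bar>v1\<bar> + \<bar>v2\<bar>)" for u1 u2 u3 u4 v1 v2 :: real
    using abs_triangle_ineq4[of "u1 + u2 - u3" u4] abs_triangle_ineq4[of "u1 + u2" u3] abs_triangle_ineq[of u1 u2] abs_triangle_ineq[of v1 v2] by simp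
   have "\<bar>R1\<bar> + \<bar>R2\<bar> <= (6 * (n * X) * M + 6 * (n * X) * M + 8 * (M * (n * X)) * M + (n * X) * M) + ((n * X) * M + (n * X) * M)"
    unfolding R1_def R2_def by (rule order_trans[OF t]) (intro add_mono p1 p3 p4 p5)
   also have "\<dots> = n * MM" by (simp add: MM_def algebra_simps)
   finally show ?thesis .
  qed
  finally show "\<bar>w' \<theta> t x - A (w \<theta> t) x\<bar> <= n * MM" .
 qed
 have bd: "L2_norm (w \<theta> \<tau>) <= 4 * pi * C" for \<theta>
 proof -
  have "L2_norm (w \<theta> 0) <= 2 * pi * 1"
   by (rule L2_norm_bound) (auto simp: w_def B_def smooth_torus_L2[OF sw])
  moreover have "\<bar>\<tau>\<bar> * \<rho> <= 2 * pi"
  proof -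
   have "\<bar>\<tau>\<bar> * \<rho> = (\<bar>\<tau>\<bar> * n) * (2 * pi * MM)" by (simp add: \<rho>_def)
   also have "\<dots> <= S / n * (2 * pi * MM)" using \<tau>(3) MM0 by (intro mult_right_mono) auto
   also have "\<dots> <= 2 * pi" using n by (simp add: field_simps)
   finally show ?thesis .
  qed
  ultimately have "C * (L2_norm (w \<theta> 0) + \<bar>\<tau>\<bar> * \<rho>) <= C * (4 * pi)" using C(2) by (intro mult_left_mono) auto
  moreover have "L2_norm (w \<theta> \<tau>) <= C * (L2_norm (w \<theta> 0) + \<bar>\<tau>\<bar> * \<rho>)"
   by (rule growth_bound[OF C ex sw sw' dw \<tau>(1) rem])
  ultimately show ?thesis by (simp add: mult_ac)
 qed
 define F where "F x = phase K x + pK * \<tau>" for x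
 define wc ws where "wc = w 0 \<tau>" and "ws = w (- (pi / 2)) \<tau>"
 have we: "wc x = B s x * cos (F x)" "ws x = B s x * sin (F x)" for x
 proof -
  have e: "phase K x + (pK * \<tau> + 0) = F x" "phase K x + (pK * \<tau> + - (pi / 2)) = F x - pi / 2" by (simp_all add: F_def)
  show "wc x = B s x * cos (F x)" "ws x = B s x * sin (F x)"
   unfolding wc_def ws_def w_def \<tau>(2) e by (simp_all add: cos_diff)
 qed
 have L: "(\<lambda>x. wc x * wc x) \<in> L2" "(\<lambda>x. ws x * ws x) \<in> L2" unfolding wc_def ws_def by (intro smooth_torus_L2 smooth_torus_mult sw)+
 have "(L2_norm (B s))^2 = (LINT x|TM. wc x * wc x + ws x * ws x)"
  unfolding L2_norm_sq ip_def
 proof (rule Bochner_Integration.integral_cong[OF refl])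
  fix x
  have "wc x * wc x + ws x * ws x = B s x * B s x * ((cos (F x))^2 + (sin (F x))^2)" unfolding we by algebra
  from this[unfolded sin_cos_squared_add2] show "B s x * B s x = wc x * wc x + ws x * ws x" by simp
 qed
 also have "\<dots> = (L2_norm wc)^2 + (L2_norm ws)^2"
  unfolding L2_norm_sq ip_def by (rule Bochner_Integration.integral_add[OF L2_integrable[OF L(1)] L2_integrable[OF L(2)]])
 also have "\<dots> <= (4 * pi * C)^2 + (4 * pi * C)^2"
  unfolding wc_def ws_def by (intro add_mono power_mono bd L2_norm_nonneg)
 finally show "(L2_norm (B s))^2 <= 2 * (4 * pi * C)^2" by simp
qed

text \<open>Around the closed orbit the amplitude at \<open>s = 2\<pi>N\<close> is \<open>exp (- N I)\<close>, at \<open>s = - 2\<pi>N\<close> it is \<open>exp (N I)\<close>, where \<open>I\<close> is the integral over one period. Since \<open>exp y + exp (- y) \<ge> y\<^sup>2 / 2\<close> for \<open>y = 2 N I\<close>, the bound makes \<open>N\<^sup>2\<close> times the squared norm of \<open>I\<close> bounded in \<open>N\<close>.\<close>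

theorem well_posed_imp_averages:
 assumes wp: "L2_well_posed (L_op a1 a0 am1 b1 b2 c)" and \<xi>: "\<xi> \<in> Lambda"
 shows "integral {0..2 * pi} (\<lambda>t. symb (x + t *\<^sub>R grad p \<xi>) (fst \<xi>) (snd \<xi>)) = 0"
proof -
 define \<eta> where "\<eta> = grad p \<xi>"
 define Q where "Q x = symb x (fst \<xi>) (snd \<xi>)" for x
 obtain m n where "fst \<eta> = of_int m" "snd \<eta> = of_int n" using \<xi> by (auto simp: Lambda_def \<eta>_def elim!: Ints_cases)
 then have mn: "\<eta> = (of_int m, of_int n)" by (simp add: prod_eq_iff)
 show ?thesis
 proof (cases "\<eta> = 0")
  case True
  have "fst \<xi> = 0 \<and> snd \<xi> = 0"
  proof -
   have h: "snd \<xi> * (2 * fst \<xi> + snd \<xi>) = 0" "fst \<xi> * (2 * snd \<xi> + fst \<xi>) = 0" using True by (auto simp: \<eta>_def grad_p zero_prod_def)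
   then show ?thesis by auto
  qed
  then show ?thesis by (simp add: symb_def)
 next
  case False
  obtain C where C: "C > 0" "!!v t. hsol v ==> \<bar>t\<bar> <= 1 ==> norm (v t) <= C * norm (v 0)" using hsol_bound[OF wp] by blast
  have ex: "\<exists>v. hsol v \<and> v 0 = hpart x" for x using hsol_exists[OF wp, of x] by blast
  have sQ: "smooth Q" unfolding Q_def[abs_def] symb_def
   using smooth_coeffs[THEN smooth_torusD(1)] by (intro smooth_add smooth_mult smooth_const)
  obtain \<Psi> where \<Psi>: "smooth \<Psi>" "dir_deriv \<eta> \<Psi> = Q" using directional_primitive[OF sQ False] .
  define B where "B s x = exp (\<Psi> x - \<Psi> (x + s *\<^sub>R \<eta>))" for s x
  note wk = wkb_bound[OF C(2,1) ex \<eta>_def \<Psi>[unfolded Q_def[abs_def]]]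
  have sB: "smooth_torus (B s)" and bB: "(L2_norm (B s))^2 <= 2 * (4 * pi * C)^2" for s
   using wk[of s] by (simp_all add: B_def[abs_def])
  define I where "I x = \<Psi> (x + (2 * pi) *\<^sub>R \<eta>) - \<Psi> x" for x
  have "B (2 * pi) x = exp (- I x)" for x by (simp add: B_def I_def)
  then have "I = (\<lambda>x. - ln (B (2 * pi) x))" by simp
  then have perI: "periodic2 I" using smooth_torusD(2)[OF sB[of "2 * pi"]] by (simp add: periodic2_def del: split_paired_All)
  have smI: "smooth I" unfolding I_def[abs_def] using smooth_affine[OF \<Psi>(1) bounded_linear_ident, of "(2 * pi) *\<^sub>R \<eta>"]
   by (intro smooth_diff \<Psi>(1)) simp
  have LI: "I \<in> L2" by (rule L2_continuous[OF perI smooth_continuous[OF smI]])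
  have shI: "I (x + (2 * pi * of_int j) *\<^sub>R \<eta>) = I x" for x j
   using periodic2_int[OF perI, of x "j * m" "j * n"] by (simp add: mn mult_ac)
  have pos: "\<Psi> (x + (2 * pi * real N) *\<^sub>R \<eta>) - \<Psi> x = real N * I x" for x N
  proof (induction N)
   case (Suc N)
   have e: "x + (2 * pi * real (Suc N)) *\<^sub>R \<eta> = (x + (2 * pi * of_int (int N)) *\<^sub>R \<eta>) + (2 * pi) *\<^sub>R \<eta>" by (simp add: algebra_simps scaleR_add_left)
   have "\<Psi> (x + (2 * pi * real (Suc N)) *\<^sub>R \<eta>) = I (x + (2 * pi * of_int (int N)) *\<^sub>R \<eta>) + \<Psi> (x + (2 * pi * of_int (int N)) *\<^sub>R \<eta>)" unfolding I_def e by simp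
   then show ?case using Suc unfolding shI by (simp add: algebra_simps)
  qed simp
  have neg: "\<Psi> (x + (- (2 * pi * real N)) *\<^sub>R \<eta>) - \<Psi> x = - (real N * I x)" for x N
   using pos[of "x + (- (2 * pi * real N)) *\<^sub>R \<eta>" N] shI[of x "- int N"] by simp
  have est: "2 * (real N)^2 * (L2_norm I)^2 <= 4 * (4 * pi * C)^2" for N
  proof -
   have iI: "integrable TM (\<lambda>x. I x * I x)" using L2_prod_integrable[OF LI LI] .
   have iB: "integrable TM (\<lambda>x. B s x * B s x)" for s by (intro L2_prod_integrable smooth_torus_L2 sB)
   have "2 * (real N)^2 * (L2_norm I)^2 = (LINT x|TM. 2 * (real N)^2 * (I x * I x))"
    by (simp add: L2_norm_sq ip_def)
   also have "\<dots> <= (LINT x|TM. B (2 * pi * real N) x * B (2 * pi * real N) x + B (- (2 * pi * real N)) x * B (- (2 * pi * real N)) x)"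
   proof (rule integral_mono)
    fix x
    define y where "y = 2 * (real N * I x)"
    have "B (2 * pi * real N) x = exp (- (real N * I x))" "B (- (2 * pi * real N)) x = exp (real N * I x)"
     using pos[of x N] neg[of x N] by (simp_all add: B_def minus_diff_eq[symmetric, of "\<Psi> x"] del: minus_diff_eq)
    then have "B (2 * pi * real N) x * B (2 * pi * real N) x + B (- (2 * pi * real N)) x * B (- (2 * pi * real N)) x = exp (- y) + exp y"
     by (simp add: y_def mult_exp_exp mult_ac)
    moreover have "y^2 / 2 <= exp (- y) + exp y"
    proof -
     have a: "z^2 / 2 <= exp (- z) + exp z" if "z >= 0" for z :: real
      using exp_lower_Taylor_quadratic[OF that] that exp_ge_add_one_self[of "- z"] exp_gt_zero[of "-z"] by simp
     show ?thesis using a[of y] a[of "- y"] by (cases "y >= 0") (simp_all add: add.commute)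
    qed
    ultimately show "2 * (real N)^2 * (I x * I x) <= B (2 * pi * real N) x * B (2 * pi * real N) x + B (- (2 * pi * real N)) x * B (- (2 * pi * real N)) x"
     by (simp add: y_def power2_eq_square mult_ac)
   qed (use iI iB in auto)
   also have "\<dots> = (L2_norm (B (2 * pi * real N)))^2 + (L2_norm (B (- (2 * pi * real N))))^2"
    unfolding L2_norm_sq ip_def by (rule Bochner_Integration.integral_add[OF iB iB])
   also have "\<dots> <= 4 * (4 * pi * C)^2" using bB[of "2 * pi * real N"] bB[of "- (2 * pi * real N)"] by linarith
   finally show ?thesis .
  qed
  have "L2_norm I = 0"
  proof (rule ccontr)
   assume "L2_norm I ~= 0"
   then have p: "(L2_norm I)^2 > 0" by simp
   obtain N where N: "2 * (4 * pi * C)^2 / (L2_norm I)^2 < real N" using reals_Archimedean2 by blast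
   then have "2 * (4 * pi * C)^2 < real N * (L2_norm I)^2" using p by (simp add: field_simps)
   also have "\<dots> <= (real N)^2 * (L2_norm I)^2"
   proof (rule mult_right_mono)
    have "real N <= real (N * N)" unfolding of_nat_le_iff by (rule le_square)
    then show "real N <= (real N)^2" by (simp add: power2_eq_square)
   qed simp
   finally show False using est[of N] by simp
  qed
  then have I0: "I x = 0" for x by (rule continuous_AE_zero[OF smooth_continuous[OF smI] perI])
  have "((\<lambda>t. Q (x + t *\<^sub>R \<eta>)) has_integral \<Psi> (x + (2 * pi) *\<^sub>R \<eta>) - \<Psi> (x + 0 *\<^sub>R \<eta>)) {0..2 * pi}"
  proof (rule fundamental_theorem_of_calculus)
   fix t
   show "((\<lambda>t. \<Psi> (x + t *\<^sub>R \<eta>)) has_vector_derivative Q (x + t *\<^sub>R \<eta>)) (at t within {0..2 * pi})"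
    using smooth_along_line[OF \<Psi>(1), of x \<eta> t]
    by (simp add: \<Psi>(2) has_real_derivative_iff_has_vector_derivative has_vector_derivative_at_within)
  qed simp
  from integral_unique[OF this] I0[of x] show ?thesis by (simp add: I_def Q_def \<eta>_def)
 qed
qed

end

theorem theorem1:
  fixes a1 a0 am1 b1 b2 c :: "plane \<Rightarrow> real"
  assumes "smooth_torus a1" "smooth_torus a0" "smooth_torus am1"
    and "smooth_torus b1" "smooth_torus b2" "smooth_torus c"
  defines "I \<equiv> L2_well_posed (L_op a1 a0 am1 b1 b2 c)"
    and "II \<equiv> (\<forall>x. \<forall>\<xi>\<in>Lambda.
           integral {0..2 * pi} (\<lambda>t. a1 (x + t *\<^sub>R grad p \<xi>) * (fst \<xi>)\<^sup>2
             + 2 * a0 (x + t *\<^sub>R grad p \<xi>) * fst \<xi> * snd \<xi>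
             + am1 (x + t *\<^sub>R grad p \<xi>) * (snd \<xi>)\<^sup>2) = 0)"
    and "III \<equiv> (\<forall>x. a0 x = a1 x + am1 x) \<and>
           (\<exists>\<phi>. smooth_torus \<phi> \<and> (\<forall>x. grad \<phi> x = (am1 x, a1 x)))"
  shows "(I \<longleftrightarrow> II) \<and> (II \<longleftrightarrow> III) \<and> (I \<longleftrightarrow> III)"
proof -
  interpret coefficients a1 a0 am1 b1 b2 c by unfold_locales (use assms(1-6) in auto)
  have "I ==> II"
    unfolding I_def II_def using well_posed_imp_averages by (simp add: symb_def)
  moreover have "II ==> III"
    unfolding II_def III_def by (rule averages_imp_gradient[OF assms(1-3)])
  moreover have "III ==> I"
  proof -
    assume III
    then obtain \<phi> where \<phi>: "\<forall>x. a0 x = a1 x + am1 x" "smooth_torus \<phi>" "\<forall>x. grad \<phi> x = (am1 x, a1 x)" unfolding III_def by blast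
    interpret gauge a1 a0 am1 b1 b2 c \<phi> by unfold_locales (use \<phi> in auto)
    show I unfolding I_def by (rule gauged_well_posed)
  qed
  ultimately show ?thesis by blast
qed

end
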